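(* Let $u$ be a weak solution of $-\operatorname{div}\mathcal{B}(x,u,\nabla u)+\mathcal{L}(u)=0$ in $\Omega$ such that $u\ge0$ in $B_R(x_0)\subset\Omega$. Then there exists $c=c(N,p,s,\Lambda,C_1,C_2)$ such that $$\operatorname*{ess\,sup}_{B_{r/2}(x_0)}u\le c\operatorname*{ess\,inf}_{B_r(x_0)}u+c\Big(\frac rR\Big)^{\frac p{p-1}}\mathrm{Tail}(u^-;x_0,R)$$ whenever $B_r(x_0)\subset B_{R/2}(x_0)$ and $r\in(0,1]$.
   Context: $\Omega\subset\mathbb{R}^N$ ($N\ge2$) is a bounded smooth domain, $1<p<\infty$, $0<s<1$. $\mathcal{B}:\Omega\times\mathbb{R}\times\mathbb{R}^N\to\mathbb{R}^N$ is measurable in $x$ and continuous in $(u,\zeta)$, and satisfies (H1): $\mathcal{B}(x,u,\zeta)\cdot\zeta\ge C_1|\zeta|^p$ and $|\mathcal{B}(x,u,\zeta)|\le C_2|\zeta|^{p-1}$ for a.e. $x\in\Omega$ and all $(u,\zeta)\in\mathbb{R}^{N+1}$, with constants $C_1,C_2>0$. $K$ is a measurable kernel, symmetric in $x,y$, with $\Lambda^{-1}|x-y|^{-N-ps}\le K(x,y)\le\Lambda|x-y|^{-N-ps}$ for some $\Lambda\ge1$; $d\mu=K(x,y)\,dx\,dy$. $\mathcal{L}(u)(x)=\mathrm{P.V.}\int_{\mathbb{R}^N}|u(x)-u(y)|^{p-2}(u(x)-u(y))K(x,y)\,dy$. A function $u\in L^\infty(\mathbb{R}^N)\cap W^{1,p}_{\rm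 loc}(\Omega)$ is a weak solution if for every $\Omega'\Subset\Omega$ and every $\phi\in W^{1,p}_0(\Omega')$ (extended by zero), $\int_{\Omega'}\mathcal{B}(x,u,\nabla u)\cdot\nabla\phi\,dx+\int_{\mathbb{R}^N}\int_{\mathbb{R}^N}|u(x)-u(y)|^{p-2}(u(x)-u(y))(\phi(x)-\phi(y))\,d\mu=0$. The tail is $\mathrm{Tail}(v;x_0,r)=\big(r^p\int_{\mathbb{R}^N\setminus B_r(x_0)}\frac{|v(y)|^{p-1}}{|y-x_0|^{N+ps}}dy\big)^{1/(p-1)}$. $k^-=\max\{-k,0\}$. *)

theory Defs
  imports "HOL-Analysis.Analysis" "HOL-Probability.Essential_Supremum"
begin

text \<open>C-infinity real-valued functions on an open set S: all iterated partial
  derivatives exist and are (Frechet) differentiable at every point of S.\<close>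
definition smooth_on :: "'a::euclidean_space set \<Rightarrow> ('a \<Rightarrow> real) \<Rightarrow> bool" where
  "smooth_on S f \<longleftrightarrow>
     (\<exists>F. f \<in> F \<and> (\<forall>g\<in>F. (\<forall>x\<in>S. g differentiable (at x)) \<and>
                       (\<forall>i\<in>Basis. (\<lambda>x. frechet_derivative g (at x) i) \<in> F)))"

definition grad :: "('a::euclidean_space \<Rightarrow> real) \<Rightarrow> 'a \<Rightarrow> 'a" where
  "grad f x = (\<Sum>i\<in>Basis. frechet_derivative f (at x) i *\<^sub>R i)"

definition smooth_bounded_domain :: "'a::euclidean_space set \<Rightarrow> bool" where
  "smooth_bounded_domain \<Omega> \<longleftrightarrow> open \<Omega> \<and> connected \<Omega> \<and> bounded \<Omega> \<and> \<Omega> \<noteq> {} \<and>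
     (\<forall>z\<in>frontier \<Omega>. \<exists>U \<rho>. open U \<and> z \<in> U \<and> smooth_on U \<rho> \<and>
         \<Omega> \<inter> U = {x\<in>U. \<rho> x < 0} \<and> (\<forall>x\<in>U. grad \<rho> x \<noteq> 0))"

definition test_fun :: "'a::euclidean_space set \<Rightarrow> ('a \<Rightarrow> real) \<Rightarrow> bool" where
  "test_fun U \<phi> \<longleftrightarrow> smooth_on UNIV \<phi> \<and> compact (closure {x. \<phi> x \<noteq> 0}) \<and>
                     closure {x. \<phi> x \<noteq> 0} \<subseteq> U"

definition W1p_loc :: "'a::euclidean_space set \<Rightarrow> real \<Rightarrow> ('a \<Rightarrow> real) \<Rightarrow> ('a \<Rightarrow> 'a) \<Rightarrow> bool" where
  "W1p_loc \<Omega> p u G \<longleftrightarrow> u \<in> borel_measurable lebesgue \<and> G \<in> borel_measurable lebesgue \<and>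
     (\<forall>K. compact K \<and> K \<subseteq> \<Omega> \<longrightarrow>
        set_integrable lebesgue K (\<lambda>x. \<bar>u x\<bar> powr p) \<and>
        set_integrable lebesgue K (\<lambda>x. norm (G x) powr p)) \<and>
     (\<forall>\<phi>. test_fun \<Omega> \<phi> \<longrightarrow> (\<forall>i\<in>Basis.
        (\<integral>x. u x * (grad \<phi> x \<bullet> i) \<partial>lebesgue) = - (\<integral>x. (G x \<bullet> i) * \<phi> x \<partial>lebesgue)))"

text \<open>phi (already extended by zero) belongs to W^{1,p}_0(U), with gradient Phi
  (extended by zero): limit in W^{1,p} of test functions supported in U.\<close>
definition W01p :: "'a::euclidean_space set \<Rightarrow> real \<Rightarrow> ('a \<Rightarrow> real) \<Rightarrow> ('a \<Rightarrow> 'a) \<Rightarrow> bool" where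
  "W01p U p \<phi> \<Phi> \<longleftrightarrow> \<phi> \<in> borel_measurable lebesgue \<and> \<Phi> \<in> borel_measurable lebesgue \<and>
     (\<forall>x. x \<notin> U \<longrightarrow> \<phi> x = 0 \<and> \<Phi> x = 0) \<and>
     integrable lebesgue (\<lambda>x. \<bar>\<phi> x\<bar> powr p) \<and> integrable lebesgue (\<lambda>x. norm (\<Phi> x) powr p) \<and>
     (\<exists>\<psi>::nat \<Rightarrow> 'a \<Rightarrow> real. (\<forall>k. test_fun U (\<psi> k)) \<and>
        (\<lambda>k. \<integral>x. \<bar>\<psi> k x - \<phi> x\<bar> powr p \<partial>lebesgue) \<longlonglongrightarrow> 0 \<and>
        (\<lambda>k. \<integral>x. norm (grad (\<psi> k) x - \<Phi> x) powr p \<partial>lebesgue) \<longlonglongrightarrow> 0)"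

definition cc_subset :: "'a::euclidean_space set \<Rightarrow> 'a set \<Rightarrow> bool" where
  "cc_subset \<Omega>' \<Omega> \<longleftrightarrow> open \<Omega>' \<and> bounded \<Omega>' \<and> closure \<Omega>' \<subseteq> \<Omega>"

definition weak_solution ::
  "'a::euclidean_space set \<Rightarrow> real \<Rightarrow> ('a \<Rightarrow> real \<Rightarrow> 'a \<Rightarrow> 'a) \<Rightarrow> ('a \<Rightarrow> 'a \<Rightarrow> real) \<Rightarrow> ('a \<Rightarrow> real) \<Rightarrow> bool" where
  "weak_solution \<Omega> p B K u \<longleftrightarrow>
     u \<in> borel_measurable lebesgue \<and> (\<exists>M. AE x in lebesgue. \<bar>u x\<bar> \<le> M) \<and>
     (\<exists>G. W1p_loc \<Omega> p u G \<and>
        (\<forall>\<Omega>' \<phi> \<Phi>. cc_subset \<Omega>' \<Omega> \<and> W01p \<Omega>' p \<phi> \<Phi> \<longrightarrow>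
           (LINT x:\<Omega>'|lebesgue. B x (u x) (G x) \<bullet> \<Phi> x) +
           (\<integral>z. (case z of (x, y) \<Rightarrow>
                  \<bar>u x - u y\<bar> powr (p - 2) * (u x - u y) * (\<phi> x - \<phi> y) * K x y) \<partial>lebesgue) = 0))"

definition tail :: "real \<Rightarrow> real \<Rightarrow> ('a::euclidean_space \<Rightarrow> real) \<Rightarrow> 'a \<Rightarrow> real \<Rightarrow> real" where
  "tail p s v x0 r =
     (r powr p * (LINT y:(UNIV - ball x0 r)|lebesgue.
        \<bar>v y\<bar> powr (p - 1) / dist y x0 powr (real DIM('a) + p * s))) powr (1 / (p - 1))"

definition neg_part :: "real \<Rightarrow> real" where
  "neg_part k = max (- k) 0"

definition ess_sup_on :: "'a::euclidean_space set \<Rightarrow> ('a \<Rightarrow> real) \<Rightarrow> ereal" where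
  "ess_sup_on S u = esssup (restrict_space lebesgue S) (\<lambda>x. ereal (u x))"

definition ess_inf_on :: "'a::euclidean_space set \<Rightarrow> ('a \<Rightarrow> real) \<Rightarrow> ereal" where
  "ess_inf_on S u = - esssup (restrict_space lebesgue S) (\<lambda>x. ereal (- u x))"

end

theory Submission
 imports Defs "HOL-Probability.Probability"
begin

text \<open>Testing the equation with a cut-off multiple of a truncation of \<open>u\<close> gives a Caccioppoli
inequality that keeps the non-local cross term. From it all further estimates follow for
\<open>v = u + \<tau>\<close>, where the level \<open>\<tau>\<close> is the tail term of the theorem, so that every tail of \<open>v\<close>
is controlled by the levels above \<open>\<tau>\<close>. A De Giorgi iteration shows that a level set of small
density is empty in the half ball, and a relative isoperimetric inequality (proved by
translations) upgrades positive density of \<open>{v \<ge> l}\<close> to \<open>v \<ge> \<delta> l\<close> in the half ball. The cross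
term bounds the tail of the positive part, hence a point where \<open>v\<close> is large has positive
density nearby, provided \<open>v\<close> is at most a multiple as large on a slightly bigger ball. Such a
point exists by DiBenedetto's growth argument: as \<open>u\<close> is bounded, the maxima over
\<open>r\<^sub>j = r/2 + r(1 - 2\<^sup>-\<^sup>j)/4\<close> cannot grow like \<open>\<delta>\<^sup>-\<^sup>j\<close> for all \<open>j\<close>. Starting from the first \<open>j\<close>
where they do not, \<open>j\<close> doublings, each costing a factor \<open>\<delta>\<close>, spread the bound to radius \<open>r\<close>
and cancel the gain exactly.\<close>

text \<open>The role of the Sobolev inequality is played by one L^1 translation estimate for the
  truncation between two levels: at the scale of the ball it is the isoperimetric inequality, at a
  small scale \<open>e\<close> it yields a gain of \<open>e\<close> per step of the iteration. The
  exponent \<open>p / (p - 1)\<close> in the theorem makes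
  \<open>\<tau> powr (p - 1) * r powr (- p)\<close> equal to the tail integral of the negative part.
  So at levels \<open>l >= \<tau>\<close> and radii \<open>\<rho> <= r\<close> the tail of
  \<open>max (l - v) 0\<close> has the size \<open>l powr (p - 1) * \<rho> powr (- p)\<close> of the
  local terms, and below \<open>\<tau>\<close> a lower bound is free since
  \<open>v >= \<tau>\<close> near \<open>x0\<close>. The nonlocal energy scales like
  \<open>\<rho> powr (- p * s)\<close>; \<open>r <= 1\<close> lets the local scaling dominate. The
  bound \<open>M\<close> of \<open>u\<close> must not enter the constant. It serves integrability
  and the existence of a last index \<open>j\<close> of growth; with growth factor
  \<open>b = 1 / \<delta>\<close> the value of \<open>j\<close> cancels. Estimates are stated for
  \<open>\<sigma> * u\<close> with \<open>\<sigma>\<close> equal to 1 or -1, so that one proof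
  covers super- and sublevel sets.\<close>

abbreviation nn_integral_lborel :: "('a::euclidean_space => ennreal) => ennreal" (binder "NN " 10) where
 "nn_integral_lborel f \<equiv> integral\<^sup>N lborel f"

section \<open>Smooth functions\<close>

text \<open>The definition asks for one family closed under partial derivatives, that is a greatest
  fixed point. Any predicate stable under partial derivatives is such a family, so smoothness is
  proved by finding an invariant that contains the function.\<close>

lemma smooth_on_coinduct:
 assumes "P f"
  and "\<And>g x. P g ==> x \<in> S ==> g differentiable (at x)"
  and "\<And>g i. P g ==> i \<in> Basis ==> P (%x. frechet_derivative g (at x) i)"
 shows "smooth_on S f"
 unfolding smooth_on_def by (rule exI[of _ "Collect P"]) (use assms in auto)

lemma smooth_differentiable: "smooth_on UNIV f ==> f differentiable (at x)"
 unfolding smooth_on_def by blast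

lemma smooth_has_derivative:
 "smooth_on UNIV f ==> (f has_derivative frechet_derivative f (at x)) (at x)"
 using smooth_differentiable frechet_derivative_works by blast

lemma smooth_partial:
 "smooth_on UNIV f ==> i \<in> Basis ==> smooth_on UNIV (%x. frechet_derivative f (at x) i)"
 unfolding smooth_on_def by blast

lemma smooth_continuous: "smooth_on UNIV f ==> continuous_on UNIV f"
 by (meson continuous_at_imp_continuous_on differentiable_imp_continuous_within smooth_differentiable)

lemma smooth_measurable: "smooth_on UNIV f ==> f \<in> borel_measurable borel"
 by (simp add: borel_measurable_continuous_onI smooth_continuous)

lemma frechet_derivative_eq:
 "(f has_derivative f') (at x) ==> frechet_derivative f (at x) v = f' v"
 using frechet_derivative_at by metis

section \<open>Closure properties of smooth functions\<close>

lemma smooth_const: "smooth_on UNIV (%x. c)"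
proof (rule smooth_on_coinduct[where P="%g. \<exists>c. g = (%x. c)"])
 fix g :: "'a => real" and i assume "\<exists>c. g = (%x. c)"
 then show "\<exists>c. (%x. frechet_derivative g (at x) i) = (%x. c)"
  by (auto simp: frechet_derivative_const)
qed auto

text \<open>Products are not stable under differentiation, since the Leibniz rule produces a sum of
  two products. Finite sums of products are, and they also cover sums through factors equal to
  1.\<close>

inductive prodsum :: "('a::euclidean_space => real) => bool" where
 prod: "smooth_on UNIV f ==> smooth_on UNIV g ==> prodsum (%x. f x * g x)"
| add: "prodsum f ==> prodsum g ==> prodsum (%x. f x + g x)"

lemma prodsum_differentiable: "prodsum f ==> f differentiable (at x)"
 by (induction rule: prodsum.induct) (auto intro!: differentiable_mult differentiable_add dest: smooth_differentiable)

lemma prodsum_partial: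
 "prodsum f ==> i \<in> Basis ==> prodsum (%x. frechet_derivative f (at x) i)"
proof (induction rule: prodsum.induct)
 case (prod f g)
 have "(%x. frechet_derivative (%x. f x * g x) (at x) i) =
  (%x. f x * frechet_derivative g (at x) i + frechet_derivative f (at x) i * g x)"
  by (rule ext, rule frechet_derivative_eq, rule has_derivative_mult)
    (use prod smooth_has_derivative in auto)
 moreover have "prodsum ..."
  by (intro prodsum.intros smooth_partial prod)
 ultimately show ?case by simp
next
 case (add f g)
 have "(%x. frechet_derivative (%x. f x + g x) (at x) i) =
  (%x. frechet_derivative f (at x) i + frechet_derivative g (at x) i)"
  by (rule ext, rule frechet_derivative_eq, rule has_derivative_add)
    (use add prodsum_differentiable frechet_derivative_works in blast)+
 then show ?case using add by (simp add: prodsum.add)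
qed

lemma prodsum_smooth: "prodsum f ==> smooth_on UNIV f"
 by (rule smooth_on_coinduct[where P=prodsum]) (auto intro: prodsum_differentiable prodsum_partial)

lemma smooth_mult: "smooth_on UNIV f ==> smooth_on UNIV g ==> smooth_on UNIV (%x. f x * g x)"
 by (simp add: prodsum.prod prodsum_smooth)

lemma smooth_add:
 assumes "smooth_on UNIV f" "smooth_on UNIV g" shows "smooth_on UNIV (%x. f x + g x)"
proof -
 have "prodsum (%x. f x * 1 + g x * 1)"
  by (intro prodsum.intros assms smooth_const)
 then show ?thesis using prodsum_smooth by simp
qed

lemma smooth_sum: "finite I ==> (\<And>i. i \<in> I ==> smooth_on UNIV (f i)) ==> smooth_on UNIV (%x. \<Sum>i\<in>I. f i x)"
 by (induction I rule: finite_induct) (auto intro: smooth_const smooth_add)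

lemma smooth_power: "smooth_on UNIV f ==> smooth_on UNIV (%x. f x ^ n)"
 by (induction n) (auto intro: smooth_const smooth_mult)

lemma smooth_inner: "smooth_on UNIV (%x::'a::euclidean_space. x \<bullet> b)"
proof (rule smooth_on_coinduct[where P="%g. (\<exists>b. g = (%x. x \<bullet> b)) \<or> (\<exists>c. g = (%x. c))"])
 fix g :: "'a => real" and i assume "(\<exists>b. g = (%x. x \<bullet> b)) \<or> (\<exists>c. g = (%x. c))"
 then show "(\<exists>b. (%x. frechet_derivative g (at x) i) = (%x. x \<bullet> b)) \<or>
   (\<exists>c. (%x. frechet_derivative g (at x) i) = (%x. c))"
 proof
  assume "\<exists>b. g = (%x. x \<bullet> b)"
  then obtain b where "g = (%x. x \<bullet> b)" by blast
  then have "(%x. frechet_derivative g (at x) i) = (%x. i \<bullet> b)"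
   by (auto intro!: ext frechet_derivative_eq derivative_eq_intros)
  then show ?thesis by blast
 qed (auto simp: frechet_derivative_const)
qed (auto intro!: derivative_intros)

lemma smooth_inner_self: "smooth_on UNIV (%x::'a::euclidean_space. x \<bullet> x)"
proof -
 have "(%x::'a. x \<bullet> x) = (%x. \<Sum>i\<in>Basis. (x \<bullet> i) * (x \<bullet> i))"
  by (rule ext, rule euclidean_inner)
 then show ?thesis by (simp only:) (intro smooth_sum smooth_mult smooth_inner finite_Basis)
qed

text \<open>The chain rule turns \<open>f n (g x) * h x\<close> into a term with
  \<open>f (Suc n)\<close> and a term with \<open>f n\<close>, both with a new smooth factor. Sums
  of such terms are therefore the invariant for compositions; \<open>f\<close> lists the successive
  derivatives of the outer function.\<close>

inductive compsum :: "(nat => real => real) => ('a::euclidean_space => real) => ('a => real) => bool"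
 for f g where
 comp: "smooth_on UNIV h ==> compsum f g (%x. f n (g x) * h x)"
| add: "compsum f g h ==> compsum f g k ==> compsum f g (%x. h x + k x)"

lemma smooth_compose:
 assumes f: "\<And>n x. (f n has_real_derivative f (Suc n) (g x)) (at (g x))"
  and g: "smooth_on UNIV g"
 shows "smooth_on UNIV (%x. f 0 (g x))"
proof (rule smooth_on_coinduct[where P="compsum f g"])
 have fg: "((%x. f n (g x)) has_derivative (%v. f (Suc n) (g x) * frechet_derivative g (at x) v)) (at x)" for n x
  using has_derivative_compose[OF smooth_has_derivative[OF g, of x] f[of n x, unfolded has_field_derivative_def]]
  by simp
 show "compsum f g (%x. f 0 (g x))"
  using compsum.comp[OF smooth_const[of 1], of f g 0] by simp
 show diff: "h differentiable (at x)" if "compsum f g h" for h x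
  using that
  by (induction rule: compsum.induct)
   (auto intro!: differentiable_mult differentiable_add differentiableI[OF fg] dest: smooth_differentiable)
 show "compsum f g (%x. frechet_derivative h (at x) i)" if "compsum f g h" and i: "i \<in> Basis" for h i
  using that(1)
 proof (induction rule: compsum.induct)
  case (comp h n)
  have "(%x. frechet_derivative (%x. f n (g x) * h x) (at x) i) =
    (%x. f n (g x) * frechet_derivative h (at x) i + f (Suc n) (g x) * (frechet_derivative g (at x) i * h x))"
  proof (rule ext)
   fix x
   show "frechet_derivative (%x. f n (g x) * h x) (at x) i =
     f n (g x) * frechet_derivative h (at x) i + f (Suc n) (g x) * (frechet_derivative g (at x) i * h x)"
    using frechet_derivative_eq[OF has_derivative_mult[OF fg[of n x] smooth_has_derivative[OF comp, of x]], of i]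
    by simp
  qed
  moreover have "compsum f g ..."
   by (intro compsum.intros smooth_partial smooth_mult comp g i)
  ultimately show ?case by simp
 next
  case (add h k)
  have "(%x. frechet_derivative (%x. h x + k x) (at x) i) =
   (%x. frechet_derivative h (at x) i + frechet_derivative k (at x) i)"
   by (rule ext, rule frechet_derivative_eq, rule has_derivative_add)
     (use add.hyps diff frechet_derivative_works in blast)+
  then show ?case using add.IH by (simp add: compsum.add)
 qed
qed

lemma smooth_affine:
 fixes g :: "'a::euclidean_space => real"
 assumes "smooth_on UNIV g"
 shows "smooth_on UNIV (%x. g (c *\<^sub>R x + a))"
proof -
 have der: "((%x. g (c *\<^sub>R x + a)) has_derivative (%v. frechet_derivative g (at (c *\<^sub>R x + a)) (c *\<^sub>R v))) (at x)"
  if "smooth_on UNIV g" for g :: "'a => real" and x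
  by (rule has_derivative_compose[OF _ smooth_has_derivative[OF that]])
    (auto intro!: derivative_eq_intros)
 have lin: "frechet_derivative g (at y) (c *\<^sub>R v) = c * frechet_derivative g (at y) v"
  if "smooth_on UNIV g" for g :: "'a => real" and y v
  using linear_cmul[OF linear_frechet_derivative[OF smooth_differentiable[OF that]]] by simp
 \<comment> \<open>Partial derivatives of an affine pull-back are pull-backs of partial derivatives
   up to the factor \<open>c\<close>, so scalar multiples \<open>k\<close> must be part of the
   invariant.\<close>
 define P where "P = (%h. \<exists>g k. smooth_on UNIV g & h = (%x. k * g (c *\<^sub>R x + a)))"
 show ?thesis
 proof (rule smooth_on_coinduct[where P=P])
  show "P (%x. g (c *\<^sub>R x + a))"
   unfolding P_def by (rule exI[of _ g], rule exI[of _ 1]) (use assms in auto)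
  show "h differentiable (at x)" if "P h" for h x
   using that unfolding P_def by (auto intro: differentiable_mult differentiable_const differentiableI[OF der])
  show "P (%x. frechet_derivative h (at x) i)" if Ph: "P h" and i: "i \<in> Basis" for h i
  proof -
   obtain g k where g: "smooth_on UNIV g" and h: "h = (%x. k * g (c *\<^sub>R x + a))"
    using Ph unfolding P_def by blast
   have "(%x. frechet_derivative h (at x) i) = (%x. (k * c) * (frechet_derivative g (at (c *\<^sub>R x + a)) i))"
   proof (rule ext)
    fix x
    show "frechet_derivative h (at x) i = (k * c) * (frechet_derivative g (at (c *\<^sub>R x + a)) i)"
     unfolding h using frechet_derivative_eq[OF has_derivative_mult_right[OF der[OF g], of k x], of i]
     by (simp add: lin[OF g])
   qed
   then show ?thesis unfolding P_def using smooth_partial[OF g i]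
    by (intro exI[of _ "%y. frechet_derivative g (at y) i"] exI[of _ "k * c"]) simp
  qed
 qed
qed

text \<open>With \<open>s = 1/t\<close> one has \<open>ds/dt = - s^2\<close>, hence the derivative
  in \<open>t\<close> of \<open>P s * exp (- s)\<close> is
  \<open>s^2 * (P s - P' s) * exp (- s)\<close>. The recursion lists the polynomials in
  \<open>1/t\<close> that occur in the derivatives of the flat function
  \<open>exp (- 1/t)\<close>.\<close>

primrec bump_poly :: "nat => real poly" where
 "bump_poly 0 = 1"
| "bump_poly (Suc n) = [:0,0,1:] * (bump_poly n - pderiv (bump_poly n))"

definition bump_deriv :: "nat => real => real" where
 "bump_deriv n t = (if t > 0 then poly (bump_poly n) (1/t) * exp (- (1/t)) else 0)"

text \<open>The power \<open>s ^ k\<close> serves the induction on the coefficients: splitting off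
  the constant term leaves a polynomial of lower degree with one more factor
  \<open>s\<close>.\<close>

lemma poly_exp_tendsto_0: "((%s. s ^ k * poly q s * exp (- s)) \<longlongrightarrow> (0::real)) at_top"
proof (induction q arbitrary: k)
 case 0
 then show ?case by simp
next
 case (pCons a q)
 have "((%s. a * (s ^ k / exp s) + s ^ Suc k * poly q s * exp (- s)) \<longlongrightarrow> a * 0 + 0) at_top"
  by (intro tendsto_intros tendsto_power_div_exp_0 pCons)
 moreover have "(%s. a * (s ^ k / exp s) + s ^ Suc k * poly q s * exp (- s)) =
   (%s. s ^ k * poly (pCons a q) s * exp (- s))"
  by (auto simp: algebra_simps exp_minus field_simps)
 ultimately show ?case by simp
qed

lemma bump_deriv_has_derivative: "(bump_deriv n has_real_derivative bump_deriv (Suc n) t) (at t)"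
proof -
 consider "t > 0" | "t < 0" | "t = 0" by linarith
 then show ?thesis
 proof cases
  case 1
  have "((%t. poly (bump_poly n) (1/t) * exp (- (1/t))) has_real_derivative bump_deriv (Suc n) t) (at t)"
   unfolding bump_deriv_def using 1
   by (auto intro!: derivative_eq_intros DERIV_chain'[where g="poly (bump_poly n)"] poly_DERIV simp: field_simps power2_eq_square)
  then show ?thesis
   by (rule has_field_derivative_transform_within_open[where S="{0<..}"])
     (use 1 in \<open>auto simp: bump_deriv_def\<close>)
 next
  case 2
  have "((%t. 0) has_real_derivative bump_deriv (Suc n) t) (at t)"
   using 2 by (auto simp: bump_deriv_def)
  then show ?thesis
   by (rule has_field_derivative_transform_within_open[where S="{..<0}"])
     (use 2 in \<open>auto simp: bump_deriv_def\<close>)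
 next
  case 3
  \<comment> \<open>At the origin the difference quotient is, with \<open>s = 1/h\<close>, again a
    polynomial in \<open>s\<close> times \<open>exp (- s)\<close>, so it tends to 0 from the
    right.\<close>
  have "((%h. bump_deriv n h / h) \<longlongrightarrow> 0) (at_right 0)"
  proof -
   have "((%h. inverse h ^ 1 * poly (bump_poly n) (inverse h) * exp (- inverse h)) \<longlongrightarrow> (0::real)) (at_right 0)"
    by (rule filterlim_compose[OF poly_exp_tendsto_0 filterlim_inverse_at_top_right])
   then show ?thesis
    by (rule Lim_transform_eventually)
      (auto simp: eventually_at_filter bump_deriv_def field_simps)
  qed
  moreover have "((%h. bump_deriv n h / h) \<longlongrightarrow> 0) (at_left 0)"
   by (rule Lim_transform_eventually[OF tendsto_const])
     (auto simp: eventually_at_filter bump_deriv_def)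
  ultimately have "((%h. bump_deriv n h / h) \<longlongrightarrow> 0) (at 0)"
   by (rule filterlim_split_at[rotated])
  then show ?thesis using 3 by (simp add: has_field_derivative_iff bump_deriv_def)
 qed
qed

section \<open>The gradient as a vector\<close>

lemma grad_inner_Basis: "i \<in> Basis ==> grad f x \<bullet> i = frechet_derivative f (at x) i"
 unfolding grad_def by (simp add: inner_sum_left inner_Basis if_distrib cong: if_cong)

lemma frechet_derivative_eq_grad:
 assumes "f differentiable (at x)"
 shows "frechet_derivative f (at x) v = grad f x \<bullet> v"
proof -
 have lin: "linear (frechet_derivative f (at x))" using assms linear_frechet_derivative by blast
 have "frechet_derivative f (at x) v = frechet_derivative f (at x) (\<Sum>i\<in>Basis. (v \<bullet> i) *\<^sub>R i)"
  by (simp add: euclidean_representation)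
 also have "... = (\<Sum>i\<in>Basis. (v \<bullet> i) * frechet_derivative f (at x) i)"
  by (simp add: linear_sum[OF lin] linear_cmul[OF lin])
 also have "... = grad f x \<bullet> v"
  unfolding grad_def by (simp add: inner_sum_right inner_commute[of _ v] mult.commute)
 finally show ?thesis .
qed

lemma smooth_has_derivative_grad:
 "smooth_on UNIV f ==> (f has_derivative (%v. grad f x \<bullet> v)) (at x)"
 by (rule has_derivative_eq_rhs[OF smooth_has_derivative])
   (auto simp: frechet_derivative_eq_grad smooth_differentiable fun_eq_iff)

lemma smooth_grad_continuous: "smooth_on UNIV f ==> continuous_on UNIV (grad f)"
 unfolding grad_def by (intro continuous_intros smooth_continuous smooth_partial)

lemma smooth_grad_measurable: "smooth_on UNIV f ==> grad f \<in> borel_measurable borel"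
 by (simp add: borel_measurable_continuous_onI smooth_grad_continuous)

lemma grad_eqI: "(f has_derivative (%v. w \<bullet> v)) (at x) ==> grad f x = w"
 unfolding grad_def using frechet_derivative_eq[of f "%v. w \<bullet> v" x]
 by (simp add: euclidean_representation)

lemma grad_eq_0_open:
 assumes "open S" "x \<in> S" "\<And>y. y \<in> S ==> f y = c"
 shows "grad f x = 0"
 by (rule grad_eqI, rule has_derivative_transform_within_open[of "%_. c" _ _ _ S])
   (use assms in auto)

lemma compact_support_grad_bounded:
 fixes f :: "'a::euclidean_space => real"
 assumes f: "smooth_on UNIV f" and z: "\<And>x. norm x > e ==> f x = 0"
 obtains L where "L >= 0" "\<And>x. norm (grad f x) <= L"
proof -
 have "compact (grad f ` cball 0 e)"
  by (intro compact_continuous_image continuous_on_subset[OF smooth_grad_continuous[OF f]]) auto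
 then obtain L where L: "\<And>x. x \<in> cball 0 e ==> norm (grad f x) <= L"
  by (metis bounded_iff compact_imp_bounded imageI)
 have "norm (grad f x) <= max L 0" for x
 proof (cases "x \<in> cball 0 e")
  case False
  have "open {x::'a. norm x > e}" by (intro open_Collect_less continuous_intros)
  then have "grad f x = 0" using False z by (intro grad_eq_0_open[of "{x. norm x > e}" _ _ 0]) auto
  then show ?thesis by simp
 qed (use L in force)
 then show ?thesis using that[of "max L 0"] by simp
qed

lemma smooth_lipschitz:
 fixes f :: "'a::euclidean_space => real"
 assumes f: "smooth_on UNIV f" and L: "\<And>x. norm (grad f x) <= L"
 shows "\<bar>f x - f y\<bar> <= L * norm (x - y)"
proof -
 have "norm (f x - f y) <= L * norm (x - y)"
 proof (rule differentiable_bound[of UNIV f "%x v. grad f x \<bullet> v"])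
  show "onorm ((\<bullet>) (grad f z)) <= L" for z
  proof (rule onorm_le)
   fix v
   have "norm (grad f z \<bullet> v) <= norm (grad f z) * norm v" by (simp add: Cauchy_Schwarz_ineq2)
   also have "... <= L * norm v" by (intro mult_right_mono L) auto
   finally show "norm (grad f z \<bullet> v) <= L * norm v" .
  qed
 qed (use smooth_has_derivative_grad[OF f] in auto)
 then show ?thesis by simp
qed

section \<open>Mollification\<close>

lemma nn_integral_lborel_affine:
 fixes t :: "'a::euclidean_space"
 assumes [measurable]: "f \<in> borel_measurable borel" and c: "c \<noteq> 0"
 shows "(NN x. f x) = ennreal (\<bar>c\<bar> ^ DIM('a)) * (NN x. f (t + c *\<^sub>R x))"
 by (subst lborel_affine[OF c, of t]) (simp add: nn_integral_density nn_integral_distr nn_integral_cmult)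

lemma nn_integral_lborel_translate:
 fixes t :: "'a::euclidean_space"
 assumes [measurable]: "f \<in> borel_measurable borel"
 shows "(NN x. f (x + t)) = (NN x. f x)"
 using nn_integral_lborel_affine[of f 1 t] by (simp add: add.commute)

lemma integral_lborel_affine:
 fixes f :: "'a::euclidean_space => real"
 assumes [measurable]: "f \<in> borel_measurable borel" and c: "c \<noteq> 0"
 shows "(\<integral>x. f x \<partial>lborel) = \<bar>c\<bar> ^ DIM('a) * (\<integral>x. f (t + c *\<^sub>R x) \<partial>lborel)"
 by (subst lborel_affine[OF c, of t]) (simp add: integral_density integral_distr)

lemma integrable_lborel_affine:
 fixes f :: "'a::euclidean_space => real"
 assumes f: "integrable lborel f" and c: "c \<noteq> 0"
 shows "integrable lborel (%x. f (t + c *\<^sub>R x))"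
proof (rule integrableI_bounded)
 have [measurable]: "f \<in> borel_measurable borel" using f by auto
 show "(%x. f (t + c *\<^sub>R x)) \<in> borel_measurable lborel" by measurable
 have "ennreal (\<bar>c\<bar> ^ DIM('a)) * (NN x. ennreal (norm (f (t + c *\<^sub>R x)))) < \<infinity>"
  using nn_integral_lborel_affine[of "%x. ennreal (norm (f x))" c t] c f
  by (auto simp: integrable_iff_bounded)
 then show "(NN x. ennreal (norm (f (t + c *\<^sub>R x)))) < \<infinity>"
  using c by (auto simp: ennreal_mult_less_top)
qed

lemma powr_add_le:
 fixes a b q :: real assumes "a >= 0" "b >= 0" "q >= 0"
 shows "(a + b) powr q <= 2 powr q * (a powr q + b powr q)"
proof -
 have "(a + b) powr q <= (2 * max a b) powr q"
  by (rule powr_mono2) (use assms in auto)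
 also have "... = 2 powr q * max a b powr q" using assms by (simp add: powr_mult)
 also have "... <= 2 powr q * (a powr q + b powr q)"
  by (rule mult_left_mono) (auto simp: max_def)
 finally show ?thesis .
qed

text \<open>Young's inequality in the form
  \<open>|X| * a^(p-1) <= |X|^p / p + (1 - 1/p) * a^p\<close> with \<open>a = |E X|\<close> is
  integrated; its left side has expectation at least \<open>a^p\<close>. The bound is an
  \<open>ennreal\<close>, which dispenses with integrability: a non-integrable \<open>X\<close> has
  expectation 0 by default, and a non-integrable power makes the bound infinite.\<close>

lemma (in prob_space) jensen_powr:
 assumes [measurable]: "X \<in> borel_measurable M" and p: "p >= 1"
 shows "ennreal (\<bar>expectation X\<bar> powr p) <= (\<integral>\<^sup>+x. ennreal (\<bar>X x\<bar> powr p) \<partial>M)"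
proof (cases "integrable M X & integrable M (%x. \<bar>X x\<bar> powr p)")
 case False
 show ?thesis
 proof (cases "integrable M X")
  case True
  then have "\<not> integrable M (%x. \<bar>X x\<bar> powr p)" using False by simp
  then have "(\<integral>\<^sup>+x. ennreal (\<bar>X x\<bar> powr p) \<partial>M) = \<infinity>"
   by (simp add: integrable_iff_bounded less_top[symmetric])
  then show ?thesis by simp
 qed (simp add: not_integrable_integral_eq)
next
 case True
 define a where "a = \<bar>expectation X\<bar>"
 define E where "E = expectation (%x. \<bar>X x\<bar> powr p)"
 have aE: "a <= expectation (%x. \<bar>X x\<bar>)"
  unfolding a_def using integral_norm_bound[of M X] by simp
 have "a powr p <= E"
 proof (cases "p = 1")
  case True
  then show ?thesis using aE by (simp add: a_def E_def)
 next
  case False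
  then have p1: "p > 1" using p by simp
  have le: "\<bar>X x\<bar> * a powr (p - 1) <= \<bar>X x\<bar> powr p / p + (p - 1) / p * a powr p" for x
  proof -
   have "(p - 1) * (p / (p - 1)) = p" "1 / p + 1 / (p / (p - 1)) = 1" using p1 by (auto simp: field_simps)
   then show ?thesis
    using Youngs_inequality[of p "p / (p - 1)" "\<bar>X x\<bar>" "a powr (p - 1)"] p1
    by (simp add: powr_powr mult.commute)
  qed
  have int: "integrable M X" "integrable M (%x. \<bar>X x\<bar> powr p)" using \<open>integrable M X & _\<close> by auto
  have "a * a powr (p - 1) <= expectation (%x. \<bar>X x\<bar>) * a powr (p - 1)"
   using aE by (intro mult_right_mono) auto
  also have "... = expectation (%x. \<bar>X x\<bar> * a powr (p - 1))" by simp
  also have "... <= expectation (%x. \<bar>X x\<bar> powr p / p + (p - 1) / p * a powr p)"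
   by (rule integral_mono[OF _ _ le]) (use int in auto)
  also have "... = E / p + (p - 1) / p * a powr p"
   using int by (simp add: E_def prob_space)
  finally have "a * a powr (p - 1) <= E / p + (p - 1) / p * a powr p" .
  moreover have "a * a powr (p - 1) = a powr p"
   by (cases "a = 0") (auto simp: a_def powr_diff)
  ultimately show ?thesis using p1 by (simp add: field_simps)
 qed
 then show ?thesis
  using True unfolding a_def E_def by (subst nn_integral_eq_integral) auto
qed

text \<open>The \<open>p\<close>-th power of the L^p norm. Leaving out the root replaces Minkowski's
  inequality by the factor \<open>2 powr p\<close> of \<open>pnorm_add_le\<close>, and the type
  \<open>ennreal\<close> allows limits and sandwich arguments without integrability side
  conditions.\<close>

definition pnorm :: "real => ('a::euclidean_space => real) => ennreal" where
 "pnorm p f = (NN x. ennreal (\<bar>f x\<bar> powr p))"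

lemma pnorm_mono: "p >= 0 ==> (\<And>x. \<bar>f x\<bar> <= \<bar>g x\<bar>) ==> pnorm p f <= pnorm p g"
 unfolding pnorm_def by (intro nn_integral_mono ennreal_leI powr_mono2) auto

lemma pnorm_add_le:
 assumes [measurable]: "f \<in> borel_measurable borel" "g \<in> borel_measurable borel" and p: "p >= 0"
 shows "pnorm p (%x. f x + g x) <= ennreal (2 powr p) * (pnorm p f + pnorm p g)"
proof -
 have "pnorm p (%x. f x + g x) <= (NN x. ennreal (2 powr p) * (ennreal (\<bar>f x\<bar> powr p) + ennreal (\<bar>g x\<bar> powr p)))"
  unfolding pnorm_def
 proof (intro nn_integral_mono)
  fix x
  have "\<bar>f x + g x\<bar> powr p <= (\<bar>f x\<bar> + \<bar>g x\<bar>) powr p" using p by (intro powr_mono2) auto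
  also have "... <= 2 powr p * (\<bar>f x\<bar> powr p + \<bar>g x\<bar> powr p)" using p by (intro powr_add_le) auto
  finally show "ennreal (\<bar>f x + g x\<bar> powr p) <= ennreal (2 powr p) * (ennreal (\<bar>f x\<bar> powr p) + ennreal (\<bar>g x\<bar> powr p))"
   by (simp add: ennreal_mult[symmetric] ennreal_plus[symmetric] del: ennreal_plus)
 qed
 also have "... = ennreal (2 powr p) * (pnorm p f + pnorm p g)"
  unfolding pnorm_def by (simp add: nn_integral_cmult nn_integral_add)
 finally show ?thesis .
qed

lemma ennreal_tendsto_0I:
 assumes "\<And>e::real. e > 0 ==> eventually (%n. X n <= ennreal e) F"
 shows "(X \<longlongrightarrow> 0) F"
proof (rule order_tendstoI)
 fix a :: ennreal assume "0 < a"
 then obtain z where z: "0 < z" "z < a" using dense by blast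
 then obtain e where e: "z = ennreal e" "e >= 0" by (cases z) auto
 then have "e > 0" using z(1) by (simp add: e(1))
 from assms[OF this] show "\<forall>\<^sub>F n in F. X n < a"
  by eventually_elim (use z e in auto)
qed auto

lemma ennreal_tendsto_0D:
 "(X \<longlongrightarrow> 0) F ==> e > 0 ==> eventually (%n. X n <= ennreal e) F"
 by (drule order_tendstoD(2)[where a="ennreal e"]) (auto elim: eventually_mono)

text \<open>Two cut-offs in succession. \<open>h m\<close> truncates \<open>f\<close> in height and
  in space, which is harmless by dominated convergence. Then continuous functions that converge to
  \<open>f\<close> almost everywhere are truncated in the same way, so that a constant on a ball
  dominates the differences.\<close>

lemma continuous_dense_Lp:
 fixes f :: "'a::euclidean_space => real"
 assumes f[measurable]: "f \<in> borel_measurable borel" and fin: "pnorm p f < \<infinity>" and p: "p > 0" and e: "e > 0"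
 obtains g R where "continuous_on UNIV g" "R > 0" "\<And>x. norm x > R ==> g x = 0"
  "pnorm p (%x. f x - g x) <= ennreal e"
proof -
 define ch where "ch = (%(m::nat) (x::'a). max 0 (min 1 (real m + 1 - norm x)))"
 define cl where "cl = (%(m::nat) t. max (- real m) (min (real m) t))"
 define h where "h = (%m x. cl m (f x) * ch m x)"
 define d where "d = e / (2 * 2 powr p)"
 have d: "d > 0" using e by (simp add: d_def)
 have [measurable]: "ch m \<in> borel_measurable borel" for m unfolding ch_def by measurable
 have [measurable]: "h m \<in> borel_measurable borel" for m unfolding h_def cl_def by measurable
 have chi01: "0 <= ch m x" "ch m x <= 1" for m x by (auto simp: ch_def)
 have hle: "\<bar>f x - h m x\<bar> <= \<bar>f x\<bar>" for m x
 proof -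
  have *: "\<bar>a - b * c\<bar> <= \<bar>a\<bar>" if "0 <= c" "c <= 1" "0 <= a --> 0 <= b & b <= a" "a <= 0 --> a <= b & b <= 0" for a b c :: real
  proof (cases "a >= 0")
   case True
   then have "0 <= b * c" "b * c <= a" using that mult_left_le[of c b] by auto
   then show ?thesis by auto
  next
   case False
   then have "0 <= (-b) * c" "(-b) * c <= -a" using that mult_left_le[of c "-b"] mult_nonneg_nonneg[of "-b" c] by auto
   then show ?thesis using False by auto
  qed
  show ?thesis unfolding h_def by (rule *) (auto simp: cl_def chi01)
 qed
 have "(%m. pnorm p (%x. f x - h m x)) \<longlonglongrightarrow> (\<integral>\<^sup>+x. 0 \<partial>(lborel::'a measure))"
  unfolding pnorm_def
 proof (rule nn_integral_dominated_convergence[where w="%x. ennreal (\<bar>f x\<bar> powr p)"])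
  show "AE x in lborel. ennreal (\<bar>f x - h m x\<bar> powr p) <= ennreal (\<bar>f x\<bar> powr p)" for m
   using hle p by (intro AE_I2 ennreal_leI powr_mono2) auto
  show "AE x in lborel. (%m. ennreal (\<bar>f x - h m x\<bar> powr p)) \<longlonglongrightarrow> 0"
  proof (rule AE_I2)
   fix x
   obtain m0 :: nat where m0: "real m0 >= max \<bar>f x\<bar> (norm x)" using real_arch_simple by blast
   have "h m x = f x" if "m >= m0" for m
   proof -
    have "real m >= \<bar>f x\<bar>" "real m >= norm x" using of_nat_mono[OF that, where 'a=real] m0 by auto
    then show ?thesis by (simp add: h_def cl_def ch_def)
   qed
   then have "eventually (%m. ennreal (\<bar>f x - h m x\<bar> powr p) = 0) sequentially"
    unfolding eventually_sequentially by (intro exI[of _ m0]) auto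
   then show "(%m. ennreal (\<bar>f x - h m x\<bar> powr p)) \<longlonglongrightarrow> 0"
    by (rule tendsto_eventually)
  qed
 qed (use fin in \<open>auto simp: pnorm_def\<close>)
 then have "(%m. pnorm p (%x. f x - h m x)) \<longlonglongrightarrow> 0" by simp
 from ennreal_tendsto_0D[OF this d] obtain m where m: "pnorm p (%x. f x - h m x) <= ennreal d"
  unfolding eventually_sequentially by blast
 have "f measurable_on UNIV"
  by (rule lebesgue_measurable_imp_measurable_on) (auto simp: measurable_completion)
 then obtain Z g where Z: "negligible Z" and gc: "\<And>n. continuous_on UNIV (g n)"
   and lim: "\<And>x. x \<notin> Z ==> (%n. g n x) \<longlonglongrightarrow> f x"
  unfolding measurable_on_def by auto
 define G where "G = (%n x. cl m (g n x) * ch m x)"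
 have [measurable]: "g n \<in> borel_measurable borel" for n using gc by (rule borel_measurable_continuous_onI)
 have [measurable]: "G n \<in> borel_measurable borel" for n unfolding G_def cl_def by measurable
 have AEl: "AE x in lborel. (%n. g n x) \<longlonglongrightarrow> f x"
 proof -
  have "AE x in lebesgue. x \<notin> Z" using Z by (simp add: AE_not_in negligible_iff_null_sets)
  then have "AE x in lebesgue. (%n. g n x) \<longlonglongrightarrow> f x" by eventually_elim (rule lim)
  then show ?thesis by (simp add: AE_completion_iff)
 qed
 have "(%n. pnorm p (%x. h m x - G n x)) \<longlonglongrightarrow> (\<integral>\<^sup>+x. 0 \<partial>(lborel::'a measure))"
  unfolding pnorm_def
 proof (rule nn_integral_dominated_convergence[where w="%x. ennreal ((2 * real m) powr p) * indicator (cball 0 (real m + 1)) x"])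
  show "AE x in lborel. ennreal (\<bar>h m x - G n x\<bar> powr p) <= ennreal ((2 * real m) powr p) * indicator (cball 0 (real m + 1)) x" for n
  proof (rule AE_I2)
   fix x :: 'a
   show "ennreal (\<bar>h m x - G n x\<bar> powr p) <= ennreal ((2 * real m) powr p) * indicator (cball 0 (real m + 1)) x"
   proof (cases "norm x <= real m + 1")
    case True
    have "\<bar>cl m a - cl m b\<bar> <= 2 * real m" for a b by (auto simp: cl_def)
    then have "\<bar>cl m (f x) - cl m (g n x)\<bar> * ch m x <= (2 * real m) * 1"
     by (intro mult_mono) (auto simp: chi01)
    then have "\<bar>h m x - G n x\<bar> <= 2 * real m"
     unfolding h_def G_def left_diff_distrib[symmetric] abs_mult using chi01[of m x] by simp
    then have "\<bar>h m x - G n x\<bar> powr p <= (2 * real m) powr p" using p by (intro powr_mono2) auto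
    then show ?thesis using True by simp
   next
    case False
    then have "ch m x = 0" by (auto simp: ch_def)
    then show ?thesis using p by (simp add: h_def G_def)
   qed
  qed
  show "(NN x. ennreal ((2 * real m) powr p) * indicator (cball (0::'a) (real m + 1)) x) < \<infinity>"
   using emeasure_lborel_cball_finite[of "0::'a" "real m + 1"]
   by (subst nn_integral_cmult_indicator) (simp_all add: ennreal_mult_less_top)
  show "AE x in lborel. (%n. ennreal (\<bar>h m x - G n x\<bar> powr p)) \<longlonglongrightarrow> 0"
   using AEl
  proof eventually_elim
   case (elim x)
   have "(%n. \<bar>h m x - G n x\<bar> powr p) \<longlonglongrightarrow> \<bar>h m x - h m x\<bar> powr p"
    unfolding h_def G_def cl_def using p
    by (intro tendsto_intros elim tendsto_powr') auto
   then have "(%n. \<bar>h m x - G n x\<bar> powr p) \<longlonglongrightarrow> 0" by simp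
   from tendsto_ennrealI[OF this] show ?case by simp
  qed
  show "(%x. ennreal (\<bar>h m x - G i x\<bar> powr p)) \<in> borel_measurable lborel" for i by measurable
  have [measurable]: "cball (0::'a) (real m + 1) \<in> sets borel" by simp
  show "(%x::'a. ennreal ((2 * real m) powr p) * indicator (cball 0 (real m + 1)) x) \<in> borel_measurable lborel"
   by measurable
 qed simp
 then have "(%n. pnorm p (%x. h m x - G n x)) \<longlonglongrightarrow> 0" by simp
 from ennreal_tendsto_0D[OF this d] obtain n where n: "pnorm p (%x. h m x - G n x) <= ennreal d"
  unfolding eventually_sequentially by blast
 show ?thesis
 proof (rule that[of "G n" "real m + 1"])
  show "continuous_on UNIV (G n)"
   unfolding G_def cl_def ch_def by (intro continuous_intros gc)
  show "G n x = 0" if "norm x > real m + 1" for x using that by (auto simp: G_def ch_def)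
  have "pnorm p (%x. f x - G n x) = pnorm p (%x. (f x - h m x) + (h m x - G n x))" by simp
  also have "... <= ennreal (2 powr p) * (pnorm p (%x. f x - h m x) + pnorm p (%x. h m x - G n x))"
   using p by (intro pnorm_add_le) auto
  also have "... <= ennreal (2 powr p) * (ennreal d + ennreal d)"
   by (intro mult_left_mono add_mono m n) auto
  also have "... = ennreal e" using d
   by (simp add: ennreal_mult[symmetric] ennreal_plus[symmetric] del: ennreal_plus) (simp add: d_def)
  finally show "pnorm p (%x. f x - G n x) <= ennreal e" .
 qed auto
qed

section \<open>The normalised bump and convolution with smooth kernels\<close>

definition mollifier :: "'a::euclidean_space => real" where
 "mollifier x = bump_deriv 0 (1 - x \<bullet> x) / (\<integral>y. bump_deriv 0 (1 - y \<bullet> y) \<partial>(lborel::'a measure))"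

lemma continuous_compact_support_integrable:
 fixes f :: "'a::euclidean_space => real"
 assumes "continuous_on UNIV f" "\<And>x. norm x > R ==> f x = 0"
 shows "integrable lborel f"
proof -
 have "integrable lborel (%x. indicator (cball 0 R) x *\<^sub>R f x)"
  by (rule borel_integrable_compact) (auto intro: continuous_on_subset[OF assms(1)])
 moreover have "(%x. indicator (cball 0 R) x *\<^sub>R f x) = f"
  using assms(2) by (auto simp: indicator_def fun_eq_iff not_le)
 ultimately show ?thesis by simp
qed

lemma smooth_bump: "smooth_on UNIV (%x::'a::euclidean_space. bump_deriv 0 (1 - x \<bullet> x))"
proof -
 have "smooth_on UNIV (%x::'a. 1 + (-1) * (x \<bullet> x))"
  by (intro smooth_add smooth_mult smooth_const smooth_inner_self)
 then have "smooth_on UNIV (%x::'a. 1 - x \<bullet> x)" by simp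
 then show ?thesis
  by (intro smooth_compose[of bump_deriv "%x::'a. 1 - x \<bullet> x", OF bump_deriv_has_derivative])
qed

lemma bump_zero:
 assumes "norm (x::'a::euclidean_space) >= 1" shows "bump_deriv 0 (1 - x \<bullet> x) = 0"
proof -
 have "1 <= (norm x)\<^sup>2" using assms by (rule one_le_power)
 then show ?thesis by (simp add: bump_deriv_def dot_square_norm)
qed

lemma bump_integrable: "integrable lborel (%x::'a::euclidean_space. bump_deriv 0 (1 - x \<bullet> x))"
 by (rule continuous_compact_support_integrable[of _ 1, OF smooth_continuous[OF smooth_bump] bump_zero]) simp

lemma bump_integral_pos: "(\<integral>y. bump_deriv 0 (1 - y \<bullet> y) \<partial>(lborel::'a::euclidean_space measure)) > 0"
proof -
 have nn: "0 <= bump_deriv 0 (1 - x \<bullet> x)" for x :: 'a by (simp add: bump_deriv_def)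
 have "0 <= (\<integral>y. bump_deriv 0 (1 - y \<bullet> y) \<partial>(lborel::'a measure))" by (intro integral_nonneg_AE AE_I2 nn)
 moreover have "(\<integral>y. bump_deriv 0 (1 - y \<bullet> y) \<partial>(lborel::'a measure)) \<noteq> 0"
 proof
  assume "(\<integral>y. bump_deriv 0 (1 - y \<bullet> y) \<partial>(lborel::'a measure)) = 0"
  then have "AE x::'a in lborel. bump_deriv 0 (1 - x \<bullet> x) = 0"
   by (subst (asm) integral_nonneg_eq_0_iff_AE) (auto intro: bump_integrable nn)
  moreover have "bump_deriv 0 (1 - x \<bullet> x) = 0 ==> x \<notin> ball 0 1" for x :: 'a
   using power_strict_mono[of "norm x" 1 2] by (auto simp: bump_deriv_def dot_square_norm split: if_splits)
  ultimately have "AE x::'a in lborel. x \<notin> ball 0 1" by (auto elim: eventually_mono)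
  then have "emeasure lborel (ball (0::'a) 1) = 0"
   by (subst (asm) AE_iff_null_sets[symmetric]) auto
  then show False using content_ball_pos[of 1 "0::'a"] by (simp add: measure_def)
 qed
 ultimately show ?thesis by simp
qed

lemma mollifier_smooth: "smooth_on UNIV (mollifier :: 'a::euclidean_space => real)"
proof -
 have "smooth_on UNIV (%x::'a. (1 / (\<integral>y. bump_deriv 0 (1 - y \<bullet> y) \<partial>(lborel::'a measure))) * bump_deriv 0 (1 - x \<bullet> x))"
  by (intro smooth_mult smooth_const smooth_bump)
 then show ?thesis by (simp add: mollifier_def[abs_def])
qed

lemma mollifier_nonneg: "0 <= mollifier x"
 unfolding mollifier_def
 by (rule divide_nonneg_pos[OF _ bump_integral_pos]) (simp add: bump_deriv_def)

lemma mollifier_zero: "norm x >= 1 ==> mollifier x = 0"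
 by (simp add: mollifier_def bump_zero)

lemma mollifier_integrable: "integrable lborel mollifier"
 unfolding mollifier_def by (auto intro: bump_integrable)

lemma mollifier_integral: "(\<integral>x. mollifier x \<partial>(lborel::'a::euclidean_space measure)) = 1"
proof -
 have "(\<integral>x. mollifier x \<partial>(lborel::'a measure)) = (\<integral>y. bump_deriv 0 (1 - y \<bullet> y) \<partial>(lborel::'a measure)) / (\<integral>y. bump_deriv 0 (1 - y \<bullet> y) \<partial>(lborel::'a measure))"
  unfolding mollifier_def by (simp only: integral_divide_zero)
 then show ?thesis using bump_integral_pos[where 'a='a] by simp
qed

lemma mollifier_measurable[measurable]: "mollifier \<in> borel_measurable borel"
 by (rule smooth_measurable[OF mollifier_smooth])

lemma mollifier_bounded: "\<exists>C. \<forall>x::'a::euclidean_space. mollifier x <= C"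
proof (intro exI allI)
 show "mollifier x <= 1 / (\<integral>y. bump_deriv 0 (1 - y \<bullet> y) \<partial>(lborel::'a measure))" for x :: 'a
  unfolding mollifier_def using bump_integral_pos[where 'a='a]
  by (intro divide_right_mono) (auto simp: bump_deriv_def)
qed

definition mollify :: "real => ('a::euclidean_space => real) => 'a => real" where
 "mollify e f x = (\<integral>h. mollifier h * f (x - e *\<^sub>R h) \<partial>lborel)"

text \<open>The usual kernel \<open>e^(-N) * mollifier (z/e)\<close>. The added 0 brings the
  argument into the form expected by \<open>smooth_affine\<close>.\<close>

definition mollifier_scaled :: "real => 'a::euclidean_space => real" where
 "mollifier_scaled e z = (1 / e ^ DIM('a)) * mollifier ((1/e) *\<^sub>R z + 0)"

lemma mollifier_scaled_smooth: "smooth_on UNIV (mollifier_scaled e)"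
 unfolding mollifier_scaled_def[abs_def] by (intro smooth_mult smooth_const smooth_affine mollifier_smooth)

lemma mollifier_scaled_zero: "e > 0 ==> norm x >= e ==> mollifier_scaled e x = 0"
 by (simp add: mollifier_scaled_def mollifier_zero)

lemma mollify_eq:
 assumes [measurable]: "f \<in> borel_measurable borel" and e: "e > 0"
 shows "mollify e f x = (\<integral>y. mollifier_scaled e (x - y) * f y \<partial>lborel)"
 using integral_lborel_affine[of "%y. mollifier_scaled e (x - y) * f y" "- e" x] e
 by (simp add: mollify_def mollifier_scaled_def)

text \<open>Differentiation under the integral sign. The kernel is Lipschitz with constant
  \<open>L\<close>, so the normalised remainder is at most \<open>2 * L\<close> and tends to 0
  pointwise; dominated convergence with majorant \<open>2 * L * |f|\<close> finishes. Limits are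
  taken along sequences because dominated convergence is a statement about sequences.\<close>

lemma convolution_has_derivative:
 fixes k f :: "'a::euclidean_space => real"
 assumes k: "smooth_on UNIV k" and kz: "\<And>x. norm x > e ==> k x = 0" and f: "integrable lborel f"
 shows "((%x. \<integral>y. k (x - y) * f y \<partial>lborel) has_derivative
      (%v. (\<integral>y. f y *\<^sub>R grad k (x - y) \<partial>lborel) \<bullet> v)) (at x)"
  and "integrable lborel (%y. f y *\<^sub>R grad k (x - y))"
  and "integrable lborel (%y. k (x - y) * f y)"
proof -
 obtain L where L0: "L >= 0" and L: "\<And>x. norm (grad k x) <= L"
  using compact_support_grad_bounded[OF k kz] by blast
 have [measurable]: "k \<in> borel_measurable borel" "grad k \<in> borel_measurable borel" "f \<in> borel_measurable borel"
  using k smooth_measurable smooth_grad_measurable f by auto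
 obtain Ck where Ck: "\<And>x. \<bar>k x\<bar> <= Ck"
 proof -
  have "compact (k ` cball 0 e)"
   by (intro compact_continuous_image continuous_on_subset[OF smooth_continuous[OF k]]) auto
  then obtain C where C: "\<And>x. x \<in> cball 0 e ==> \<bar>k x\<bar> <= C"
   by (metis bounded_iff compact_imp_bounded imageI real_norm_def)
  have "\<bar>k x\<bar> <= max C 0" for x
   using C[of x] kz[of x] by (cases "norm x <= e") auto
  then show ?thesis using that by blast
 qed
 have fabs: "integrable lborel (%y. \<bar>f y\<bar>)" using f by simp
 show intg: "integrable lborel (%y. f y *\<^sub>R grad k (x - y))" for x
  by (rule Bochner_Integration.integrable_bound[OF integrable_mult_right[OF fabs, of L]])
    (auto simp: mult.commute[of L] L0 intro!: mult_left_mono L)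
 show intk: "integrable lborel (%y. k (x - y) * f y)" for x
  by (rule Bochner_Integration.integrable_bound[OF integrable_mult_right[OF fabs, of Ck]])
    (auto simp: abs_mult intro!: mult_right_mono order_trans[OF Ck abs_ge_self])
 define W where "W = (\<integral>y. f y *\<^sub>R grad k (x - y) \<partial>lborel)"
 show "((%x. \<integral>y. k (x - y) * f y \<partial>lborel) has_derivative (%v. W \<bullet> v)) (at x)"
  unfolding has_derivative_iff_norm
 proof (intro conjI)
  show "bounded_linear (%v. W \<bullet> v)" by (rule bounded_linear_inner_right)
  show "((%z. norm ((\<integral>y. k (z - y) * f y \<partial>lborel) - (\<integral>y. k (x - y) * f y \<partial>lborel) - W \<bullet> (z - x)) / norm (z - x)) \<longlongrightarrow> 0) (at x)"
   unfolding tendsto_at_iff_sequentially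
  proof (intro allI impI)
   fix X :: "nat => 'a" assume X: "\<forall>i. X i \<in> UNIV - {x}" and Xx: "X \<longlonglongrightarrow> x"
   define r where "r = (%n y. (k (X n - y) - k (x - y) - grad k (x - y) \<bullet> (X n - x)) / norm (X n - x))"
   have [measurable]: "r n \<in> borel_measurable borel" for n unfolding r_def by measurable
   have rb: "\<bar>r n y\<bar> <= 2 * L" for n y
   proof -
    have n0: "norm (X n - x) > 0" using X by simp
    have "\<bar>k (X n - y) - k (x - y)\<bar> <= L * norm (X n - x)"
     using smooth_lipschitz[OF k L, of "X n - y" "x - y"] by simp
    moreover have "\<bar>grad k (x - y) \<bullet> (X n - x)\<bar> <= L * norm (X n - x)"
     by (rule order_trans[OF Cauchy_Schwarz_ineq2]) (intro mult_right_mono L, auto)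
    ultimately have "\<bar>k (X n - y) - k (x - y) - grad k (x - y) \<bullet> (X n - x)\<bar> <= 2 * L * norm (X n - x)" by linarith
    then show ?thesis unfolding r_def using n0 by (simp add: abs_divide field_simps)
   qed
   have eq: "((\<integral>y. k (X n - y) * f y \<partial>lborel) - (\<integral>y. k (x - y) * f y \<partial>lborel) - W \<bullet> (X n - x)) / norm (X n - x)
      = (\<integral>y. r n y * f y \<partial>lborel)" for n
   proof -
    have "W \<bullet> (X n - x) = (\<integral>y. (f y *\<^sub>R grad k (x - y)) \<bullet> (X n - x) \<partial>lborel)"
     unfolding W_def by (rule integral_inner_left[symmetric]) (use intg in auto)
    then have "(\<integral>y. k (X n - y) * f y \<partial>lborel) - (\<integral>y. k (x - y) * f y \<partial>lborel) - W \<bullet> (X n - x)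
     = (\<integral>y. k (X n - y) * f y - k (x - y) * f y - (f y *\<^sub>R grad k (x - y)) \<bullet> (X n - x) \<partial>lborel)"
     using intk integrable_inner_left[OF intg[of x], of "X n - x"]
     by (simp add: Bochner_Integration.integral_diff)
    also have "... = (\<integral>y. norm (X n - x) * (r n y * f y) \<partial>lborel)"
     using X by (intro Bochner_Integration.integral_cong) (auto simp: r_def field_simps)
    also have "... = norm (X n - x) * (\<integral>y. r n y * f y \<partial>lborel)" by simp
    finally show ?thesis using X by simp
   qed
   have "(%n. \<integral>y. r n y * f y \<partial>lborel) \<longlonglongrightarrow> (\<integral>y. 0 \<partial>(lborel::'a measure))"
   proof (rule integral_dominated_convergence[where w="%y. 2 * L * \<bar>f y\<bar>"])
    show "integrable lborel (%y. 2 * L * \<bar>f y\<bar>)" using fabs by simp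
    show "AE y in lborel. norm (r n y * f y) <= 2 * L * \<bar>f y\<bar>" for n
     using rb by (auto simp: abs_mult intro!: mult_right_mono)
    show "AE y in lborel. (%n. r n y * f y) \<longlonglongrightarrow> 0"
    proof (rule AE_I2)
     fix y
     have "((%z. norm (k z - k (x - y) - grad k (x - y) \<bullet> (z - (x - y))) / norm (z - (x - y))) \<longlongrightarrow> 0) (at (x - y))"
      using smooth_has_derivative_grad[OF k, of "x - y"] unfolding has_derivative_iff_norm by simp
     moreover have "filterlim (%n. X n - y) (at (x - y)) sequentially"
      unfolding filterlim_at using X Xx by (auto intro!: tendsto_intros)
     ultimately have "(%n. norm (k (X n - y) - k (x - y) - grad k (x - y) \<bullet> ((X n - y) - (x - y))) / norm ((X n - y) - (x - y))) \<longlonglongrightarrow> 0"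
      by (rule filterlim_compose)
     then have "(%n. \<bar>r n y\<bar>) \<longlonglongrightarrow> 0" by (simp add: r_def abs_divide)
     then have "(%n. r n y) \<longlonglongrightarrow> 0" by (rule tendsto_rabs_zero_cancel)
     then show "(%n. r n y * f y) \<longlonglongrightarrow> 0" by (auto intro: tendsto_mult_left_zero)
    qed
   qed auto
   then have "(%n. \<bar>\<integral>y. r n y * f y \<partial>lborel\<bar>) \<longlonglongrightarrow> 0" by (intro tendsto_rabs_zero) simp
   then show "((%z. norm ((\<integral>y. k (z - y) * f y \<partial>lborel) - (\<integral>y. k (x - y) * f y \<partial>lborel) - W \<bullet> (z - x)) / norm (z - x)) \<circ> X) \<longlonglongrightarrow> 0"
    by (simp add: o_def eq[symmetric] abs_divide)
  qed
 qed
qed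

text \<open>A derivative falls on the kernel alone and keeps its support in the ball of radius
  \<open>e\<close>, so the convolutions of the fixed \<open>f\<close> with such kernels form the
  invariant.\<close>

lemma convolution_smooth:
 fixes k f :: "'a::euclidean_space => real"
 assumes k: "smooth_on UNIV k" and kz: "\<And>x. norm x > e ==> k x = 0" and f: "integrable lborel f"
 shows "smooth_on UNIV (%x. \<integral>y. k (x - y) * f y \<partial>lborel)"
proof -
 define P where "P = (%h. \<exists>k. smooth_on UNIV k & (\<forall>x. norm x > e --> k x = 0) & h = (%x. \<integral>y. k (x - y) * f y \<partial>lborel))"
 show ?thesis
 proof (rule smooth_on_coinduct[where P=P])
  show "P (%x. \<integral>y. k (x - y) * f y \<partial>lborel)" unfolding P_def using k kz by blast
  show "h differentiable (at x)" if "P h" for h x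
   using that convolution_has_derivative(1)[OF _ _ f] unfolding P_def differentiable_def by blast
  show "P (%x. frechet_derivative h (at x) i)" if Ph: "P h" and i: "i \<in> Basis" for h i
  proof -
   obtain k where k: "smooth_on UNIV k" and kz: "\<And>x. norm x > e ==> k x = 0"
    and h: "h = (%x. \<integral>y. k (x - y) * f y \<partial>lborel)" using Ph unfolding P_def by blast
   have "frechet_derivative h (at x) i = (\<integral>y. (grad k (x - y) \<bullet> i) * f y \<partial>lborel)" for x
   proof -
    have "frechet_derivative h (at x) i = (\<integral>y. f y *\<^sub>R grad k (x - y) \<partial>lborel) \<bullet> i"
     unfolding h by (rule frechet_derivative_eq[OF convolution_has_derivative(1)[OF k kz f]])
    also have "... = (\<integral>y. (f y *\<^sub>R grad k (x - y)) \<bullet> i \<partial>lborel)"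
     by (rule integral_inner_left[symmetric]) (use convolution_has_derivative(2)[OF k kz f] in auto)
    finally show ?thesis by (simp add: mult.commute)
   qed
   moreover have "smooth_on UNIV (%x. grad k x \<bullet> i)"
    using smooth_partial[OF k i] by (simp add: grad_inner_Basis[OF i])
   moreover have "grad k x \<bullet> i = 0" if "norm x > e" for x
   proof -
    have "open {x::'a. norm x > e}" by (intro open_Collect_less continuous_intros)
    then have "grad k x = 0" using that kz by (intro grad_eq_0_open[of "{x. norm x > e}" _ _ 0]) auto
    then show ?thesis by simp
   qed
   ultimately show ?thesis unfolding P_def by (intro exI[of _ "%x. grad k x \<bullet> i"]) auto
  qed
 qed
qed

lemma mollify_smooth:
 fixes f :: "'a::euclidean_space => real"
 assumes f: "integrable lborel f" and e: "e > 0"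
 shows "smooth_on UNIV (mollify e f)"
proof -
 have [measurable]: "f \<in> borel_measurable borel" using f by auto
 have eq: "mollify e f = (%x. \<integral>y. mollifier_scaled e (x - y) * f y \<partial>lborel)"
  by (rule ext, rule mollify_eq) (use e in auto)
 have z: "norm x > e ==> mollifier_scaled e x = 0" for x :: 'a using mollifier_scaled_zero[OF e, where x=x] by simp
 show ?thesis unfolding eq by (rule convolution_smooth[OF mollifier_scaled_smooth z f])
qed

lemma mollify_grad_inner:
 fixes f :: "'a::euclidean_space => real"
 assumes f: "integrable lborel f" and e: "e > 0"
 shows "grad (mollify e f) x \<bullet> v = (\<integral>y. (grad (mollifier_scaled e) (x - y) \<bullet> v) * f y \<partial>lborel)"
proof -
 have [measurable]: "f \<in> borel_measurable borel" using f by auto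
 have eq: "mollify e f = (%x. \<integral>y. mollifier_scaled e (x - y) * f y \<partial>lborel)"
  by (rule ext, rule mollify_eq) (use e in auto)
 have z: "norm x > e ==> mollifier_scaled e x = 0" for x :: 'a using mollifier_scaled_zero[OF e, where x=x] by simp
 note c = convolution_has_derivative[OF mollifier_scaled_smooth[of e] z f]
 have "grad (mollify e f) x = (\<integral>y. f y *\<^sub>R grad (mollifier_scaled e) (x - y) \<partial>lborel)"
  unfolding eq by (rule grad_eqI[OF c(1)])
 then have "grad (mollify e f) x \<bullet> v = (\<integral>y. f y *\<^sub>R grad (mollifier_scaled e) (x - y) \<partial>lborel) \<bullet> v" by simp
 also have "... = (\<integral>y. (f y *\<^sub>R grad (mollifier_scaled e) (x - y)) \<bullet> v \<partial>lborel)"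
  by (rule integral_inner_left[symmetric]) (use c(2) in auto)
 finally show ?thesis by (simp add: mult.commute)
qed

lemma prob_space_mollifier: "prob_space (density lborel (%h. ennreal (mollifier (h::'a::euclidean_space))))"
proof
 have "emeasure (density lborel (%h. ennreal (mollifier (h::'a)))) UNIV = (NN h. ennreal (mollifier (h::'a)))"
  by (subst emeasure_density) auto
 also have "... = ennreal 1"
  using mollifier_integral[where 'a='a]
  by (subst nn_integral_eq_integral) (auto simp: mollifier_integrable mollifier_nonneg)
 finally show "emeasure (density lborel (%h. ennreal (mollifier (h::'a)))) (space (density lborel (%h. ennreal (mollifier (h::'a))))) = 1"
  by simp
qed

lemma mollify_eq_expectation:
 assumes [measurable]: "f \<in> borel_measurable borel"
 shows "mollify e f x = (\<integral>h. f (x - e *\<^sub>R h) \<partial>density lborel (%h. ennreal (mollifier h)))"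
 unfolding mollify_def by (subst integral_density) (auto simp: mollifier_nonneg)

lemma mollify_measurable [measurable]:
 assumes [measurable]: "f \<in> borel_measurable borel"
 shows "mollify e f \<in> borel_measurable borel"
 unfolding mollify_def by measurable

text \<open>For the probability density \<open>mollifier\<close> the mollification is an expectation
  of translates, so Jensen's inequality applies at each point. Fubini and translation invariance
  then remove the translation, and the total mass 1 remains.\<close>

lemma pnorm_mollify_le:
 fixes f :: "'a::euclidean_space => real"
 assumes [measurable]: "f \<in> borel_measurable borel" and p: "p >= 1"
 shows "pnorm p (mollify e f) <= pnorm p f"
proof -
 let ?M = "density lborel (%h. ennreal (mollifier (h::'a)))"
 interpret prob_space ?M by (rule prob_space_mollifier)
 have "pnorm p (mollify e f) <= (NN x. (\<integral>\<^sup>+h. ennreal (\<bar>f (x - e *\<^sub>R h)\<bar> powr p) \<partial>?M))"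
  unfolding pnorm_def mollify_eq_expectation[OF assms(1)]
  by (intro nn_integral_mono jensen_powr p) auto
 also have "... = (NN x. (NN h. ennreal (mollifier h) * ennreal (\<bar>f (x - e *\<^sub>R h)\<bar> powr p)))"
  by (intro nn_integral_cong, subst nn_integral_density) auto
 also have "... = (NN h. (NN x. ennreal (mollifier h) * ennreal (\<bar>f (x - e *\<^sub>R h)\<bar> powr p)))"
  by (rule lborel_pair.Fubini') measurable
 also have "... = (\<integral>\<^sup>+h. ennreal (mollifier h) * pnorm p f \<partial>(lborel::'a measure))"
  unfolding pnorm_def
  using nn_integral_lborel_translate[of "%x. ennreal (\<bar>f x\<bar> powr p)" "- (e *\<^sub>R _)"]
  by (intro nn_integral_cong) (simp add: nn_integral_cmult)
 also have "... = pnorm p f * emeasure ?M (space ?M)"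
  by (simp add: nn_integral_multc emeasure_density mult.commute)
 finally show ?thesis unfolding emeasure_space_1 by simp
qed

lemma mollify_integrable:
 fixes f :: "'a::euclidean_space => real"
 assumes f: "integrable lborel f" and e: "e > 0"
 shows "integrable lborel (%h. mollifier h * f (x - e *\<^sub>R h))"
proof -
 obtain C where C: "\<And>x::'a. mollifier x <= C" using mollifier_bounded[where 'a='a] by auto
 have [measurable]: "f \<in> borel_measurable borel" using f by auto
 have "integrable lborel (%h. f (x + (-e) *\<^sub>R h))"
  using integrable_lborel_affine[OF f, of "-e" x] e by simp
 then have "integrable lborel (%h. C * \<bar>f (x + (-e) *\<^sub>R h)\<bar>)"
  by (intro integrable_mult_right integrable_abs)
 then have "integrable lborel (%h. C * \<bar>f (x - e *\<^sub>R h)\<bar>)" by simp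
 then show ?thesis
 proof (rule Bochner_Integration.integrable_bound)
  have le: "\<bar>mollifier h\<bar> * \<bar>t\<bar> <= \<bar>C\<bar> * \<bar>t\<bar>" for h :: 'a and t :: real
   using C[of h] mollifier_nonneg[of h] by (intro mult_right_mono) auto
  show "AE h in lborel. norm (mollifier h * f (x - e *\<^sub>R h)) <= norm (C * \<bar>f (x - e *\<^sub>R h)\<bar>)"
   by (rule AE_I2) (simp only: real_norm_def abs_mult abs_abs le)
 qed measurable
qed

lemma mollify_diff:
 fixes f g :: "'a::euclidean_space => real"
 assumes "integrable lborel f" "integrable lborel g" "e > 0"
 shows "mollify e (%x. f x - g x) x = mollify e f x - mollify e g x"
 unfolding mollify_def right_diff_distrib
 by (rule Bochner_Integration.integral_diff[OF mollify_integrable[OF assms(1,3)] mollify_integrable[OF assms(2,3)]])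

text \<open>An average of values within \<open>d\<close> of \<open>c\<close> stays within
  \<open>d\<close> of \<open>c\<close>. The free centre makes this serve for locality
  (\<open>d = 0\<close>), for uniform continuity, and for the bounds 0 and 1 of a mollified
  indicator (\<open>c = d = 1/2\<close>).\<close>

lemma mollify_bound:
 fixes f :: "'a::euclidean_space => real"
 assumes f: "integrable lborel f" and e: "e > 0" and b: "\<And>y. norm (y - x) < e ==> \<bar>f y - c\<bar> <= d"
 shows "\<bar>mollify e f x - c\<bar> <= d"
proof -
 have "mollify e f x - c = (\<integral>h. mollifier h * f (x - e *\<^sub>R h) - mollifier h * c \<partial>lborel)"
  unfolding mollify_def
  by (subst Bochner_Integration.integral_diff, rule mollify_integrable[OF f e])
    (simp_all add: mollifier_integrable mollifier_integral)
 also have "\<bar>...\<bar> <= (\<integral>h. \<bar>mollifier h * f (x - e *\<^sub>R h) - mollifier h * c\<bar> \<partial>lborel)"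
  by (rule integral_abs_bound)
 also have "... <= (\<integral>h. mollifier h * d \<partial>(lborel::'a measure))"
 proof (rule integral_mono)
  show "integrable lborel (%h. \<bar>mollifier h * f (x - e *\<^sub>R h) - mollifier h * c\<bar>)"
   by (intro integrable_abs Bochner_Integration.integrable_diff mollify_integrable f e integrable_mult_left mollifier_integrable)
  fix h :: 'a
  have "\<bar>mollifier h * (f (x - e *\<^sub>R h) - c)\<bar> <= mollifier h * d"
  proof (cases "norm h < 1")
   case True
   have "norm ((x - e *\<^sub>R h) - x) < e" using True e by simp
   then have "\<bar>f (x - e *\<^sub>R h) - c\<bar> <= d" by (rule b)
   then show ?thesis using mollifier_nonneg[of h] by (simp add: abs_mult mult_left_mono)
  qed (simp add: mollifier_zero)
  then show "\<bar>mollifier h * f (x - e *\<^sub>R h) - mollifier h * c\<bar> <= mollifier h * d"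
   by (simp add: right_diff_distrib)
 qed (auto intro: mollifier_integrable)
 also have "... = d" by (simp add: mollifier_integral)
 finally show ?thesis .
qed

text \<open>Uniform smallness is available for a continuous \<open>g\<close> with bounded support,
  and the contraction property transports it to \<open>f\<close>: the mollification of
  \<open>f - g\<close>, the error for \<open>g\<close>, and \<open>g - f\<close> all have
  \<open>pnorm\<close> at most \<open>d\<close>.\<close>

lemma mollify_Lp_tendsto:
 fixes f :: "'a::euclidean_space => real"
 assumes f: "integrable lborel f" and fin: "pnorm p f < \<infinity>" and p: "p >= 1"
  and e: "\<And>n. e n > 0" "e \<longlonglongrightarrow> 0"
 shows "(%n. pnorm p (%x. mollify (e n) f x - f x)) \<longlonglongrightarrow> 0"
proof (rule ennreal_tendsto_0I)
 fix \<epsilon> :: real assume \<epsilon>: "\<epsilon> > 0"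
 have [measurable]: "f \<in> borel_measurable borel" using f by auto
 \<comment> \<open>Two uses of \<open>pnorm_add_le\<close> give
   \<open>2 powr p * (d + 2 powr p * (d + d))\<close>, which this \<open>d\<close> makes equal to
   \<open>\<epsilon>\<close>.\<close>
 define d where "d = \<epsilon> / (2 powr p * (1 + 2 powr p * 2))"
 have d: "d > 0" using \<epsilon> by (simp add: d_def add_pos_pos)
 obtain g R where g: "continuous_on UNIV g" and R: "R > 0" and gz: "\<And>x. norm x > R ==> g x = 0"
  and fg: "pnorm p (%x. f x - g x) <= ennreal d"
  using continuous_dense_Lp[OF _ fin _ d] p by auto
 have [measurable]: "g \<in> borel_measurable borel" by (rule borel_measurable_continuous_onI[OF g])
 have gi: "integrable lborel g" by (rule continuous_compact_support_integrable[OF g gz])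
 define V where "V = measure lborel (cball (0::'a) (R + 1))"
 have V: "V > 0" unfolding V_def using R by (intro content_cball_pos) auto
 have EV: "emeasure lborel (cball (0::'a) (R + 1)) = ennreal V" unfolding V_def
  by (rule emeasure_eq_ennreal_measure) (use emeasure_lborel_cball_finite[of "0::'a" "R + 1"] in simp)
 \<comment> \<open>Chosen so that the constant \<open>t\<close> on a ball of volume \<open>V\<close>
   has \<open>pnorm\<close> exactly \<open>d\<close>.\<close>
 define t where "t = (d / V) powr (1 / p)"
 have t: "t > 0" using d V by (simp add: t_def)
 have tp: "t powr p = d / V" using d V p by (simp add: t_def powr_powr)
 have "uniformly_continuous_on (cball 0 (R + 2)) g"
  by (rule compact_uniformly_continuous) (auto intro: continuous_on_subset[OF g])
 then obtain \<delta> where \<delta>: "\<delta> > 0" and uc: "\<And>x y. x \<in> cball 0 (R+2) ==> y \<in> cball 0 (R+2) ==> dist y x < \<delta> ==> dist (g y) (g x) < t"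
  unfolding uniformly_continuous_on_def using t by metis
 have "eventually (%n. e n < min \<delta> 1) sequentially"
  using order_tendstoD(2)[OF e(2), of "min \<delta> 1"] \<delta> by simp
 then show "eventually (%n. pnorm p (%x. mollify (e n) f x - f x) <= ennreal \<epsilon>) sequentially"
 proof eventually_elim
  case (elim n)
  have gg: "pnorm p (%x. mollify (e n) g x - g x) <= ennreal d"
  proof -
   have pt: "\<bar>mollify (e n) g x - g x\<bar> <= t * indicator (cball 0 (R + 1)) x" for x
   proof (cases "norm x <= R + 1")
    case True
    have "\<bar>mollify (e n) g x - g x\<bar> <= t"
    proof (rule mollify_bound[OF gi e(1)])
     fix y assume y: "norm (y - x) < e n"
     then have "norm y <= R + 2" using True elim norm_triangle_ineq2[of y x] by auto
     then show "\<bar>g y - g x\<bar> <= t"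
      using uc[of x y] True y elim by (auto simp: dist_norm)
    qed
    then show ?thesis using True by simp
   next
    case False
    have "\<bar>mollify (e n) g x - 0\<bar> <= 0"
    proof (rule mollify_bound[OF gi e(1)])
     fix y assume y: "norm (y - x) < e n"
     then have "norm y > R" using False elim norm_triangle_ineq2[of x y] by (auto simp: norm_minus_commute)
     then show "\<bar>g y - 0\<bar> <= 0" using gz by simp
    qed
    then show ?thesis using False gz[of x] by simp
   qed
   have "pnorm p (%x. mollify (e n) g x - g x) <= pnorm p (%x. t * indicator (cball (0::'a) (R + 1)) x)"
    by (rule pnorm_mono) (use p in \<open>auto intro: order_trans[OF pt abs_ge_self]\<close>)
   also have "... = (NN x. ennreal (d / V) * indicator (cball (0::'a) (R + 1)) x)"
    unfolding pnorm_def tp[symmetric] using t p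
    by (intro nn_integral_cong) (auto simp: indicator_def)
   also have "... = ennreal (d / V) * ennreal V"
    unfolding EV[symmetric] by (rule nn_integral_cmult_indicator) auto
   also have "... = ennreal d" using V d by (simp add: ennreal_mult[symmetric])
   finally show ?thesis .
  qed
  have mfg: "pnorm p (%x. mollify (e n) f x - mollify (e n) g x) <= ennreal d"
  proof -
   have "pnorm p (%x. mollify (e n) f x - mollify (e n) g x) = pnorm p (mollify (e n) (%x. f x - g x))"
    by (rule arg_cong[of _ _ "pnorm p"], rule ext, rule mollify_diff[symmetric, OF f gi e(1)])
   also have "... <= pnorm p (%x. f x - g x)" by (rule pnorm_mollify_le) (use p in auto)
   finally show ?thesis using fg by simp
  qed
  have "pnorm p (%x. mollify (e n) f x - f x) =
    pnorm p (%x. (mollify (e n) f x - mollify (e n) g x) + ((mollify (e n) g x - g x) + - (f x - g x)))" by simp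
  also have "... <= ennreal (2 powr p) * (pnorm p (%x. mollify (e n) f x - mollify (e n) g x) +
    pnorm p (%x. (mollify (e n) g x - g x) + - (f x - g x)))"
   using p by (intro pnorm_add_le) auto
  also have "... <= ennreal (2 powr p) * (ennreal d + ennreal (2 powr p) * (ennreal d + ennreal d))"
  proof (intro mult_left_mono add_mono mfg)
   have "pnorm p (%x. (mollify (e n) g x - g x) + - (f x - g x)) <=
     ennreal (2 powr p) * (pnorm p (%x. mollify (e n) g x - g x) + pnorm p (%x. - (f x - g x)))"
    using p by (intro pnorm_add_le) auto
   also have "pnorm p (%x. - (f x - g x)) = pnorm p (%x. f x - g x)"
    by (simp add: pnorm_def abs_minus_commute)
   also have "ennreal (2 powr p) * (pnorm p (%x. mollify (e n) g x - g x) + pnorm p (%x. f x - g x)) <=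
    ennreal (2 powr p) * (ennreal d + ennreal d)"
    by (intro mult_left_mono add_mono gg fg) auto
   finally show "pnorm p (%x. (mollify (e n) g x - g x) + - (f x - g x)) <= ennreal (2 powr p) * (ennreal d + ennreal d)" .
  qed auto
  also have "... = ennreal (2 powr p * (d + 2 powr p * (d + d)))"
  proof -
   have nn: "0 <= d" "0 <= d + d" "0 <= 2 powr p" "0 <= 2 powr p * (d + d)" "0 <= d + 2 powr p * (d + d)"
    using d by simp_all
   show ?thesis
    by (simp only: ennreal_mult[OF nn(3,5)] ennreal_plus[OF nn(1,4)] ennreal_mult[OF nn(3,2)] ennreal_plus[OF nn(1,1)])
  qed
  also have "2 powr p * (d + 2 powr p * (d + d)) = 2 powr p * (1 + 2 powr p * 2) * d" by (simp add: algebra_simps)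
  also have "... = \<epsilon>" proof -
   have "1 + 2 powr p * 2 > 0" by (intro add_pos_pos mult_pos_pos) auto
   then show ?thesis unfolding d_def by simp
  qed
  finally show ?case .
 qed
qed

section \<open>Approximation and truncation of Sobolev functions\<close>

lemma pnorm_finite_iff:
 "f \<in> borel_measurable borel ==> pnorm p f < \<infinity> \<longleftrightarrow> integrable lborel (%x. \<bar>f x\<bar> powr p)"
 by (simp add: pnorm_def integrable_iff_bounded)

lemma pnorm_cmult: "f \<in> borel_measurable borel ==> pnorm p (%x. c * f x) = ennreal (\<bar>c\<bar> powr p) * pnorm p f"
 unfolding pnorm_def by (subst nn_integral_cmult[symmetric]) (auto simp: abs_mult powr_mult ennreal_mult intro!: nn_integral_cong)

lemma pnorm_tendsto_sandwich:
 assumes "(%n. pnorm p (g n)) \<longlonglongrightarrow> 0" "p >= 0" "\<And>n x. \<bar>f n x\<bar> <= \<bar>g n x\<bar>"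
 shows "(%n. pnorm p (f n)) \<longlonglongrightarrow> 0"
 by (rule tendsto_sandwich[OF _ _ tendsto_const assms(1)])
   (auto intro!: always_eventually pnorm_mono assms(2,3))

lemma pnorm_tendsto_add:
 assumes [measurable]: "\<And>n. f n \<in> borel_measurable borel" "\<And>n. g n \<in> borel_measurable borel" and p: "p >= 0"
  and f: "(%n. pnorm p (f n)) \<longlonglongrightarrow> 0" and g: "(%n. pnorm p (g n)) \<longlonglongrightarrow> 0"
 shows "(%n. pnorm p (%x. f n x + g n x)) \<longlonglongrightarrow> 0"
proof (rule tendsto_sandwich[OF _ _ tendsto_const])
 have "(%n. ennreal (2 powr p) * (pnorm p (f n) + pnorm p (g n))) \<longlonglongrightarrow> ennreal (2 powr p) * (0 + 0)"
  by (intro ennreal_tendsto_cmult tendsto_add f g) auto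
 then show "(%n. ennreal (2 powr p) * (pnorm p (f n) + pnorm p (g n))) \<longlonglongrightarrow> 0" by simp
 show "\<forall>\<^sub>F n in sequentially. pnorm p (%x. f n x + g n x) <= ennreal (2 powr p) * (pnorm p (f n) + pnorm p (g n))"
  by (intro always_eventually allI pnorm_add_le assms)
qed auto

lemma pnorm_tendsto_cmult:
 assumes [measurable]: "\<And>n. f n \<in> borel_measurable borel"
  and f: "(%n. pnorm p (f n)) \<longlonglongrightarrow> 0"
 shows "(%n. pnorm p (%x. c * f n x)) \<longlonglongrightarrow> 0"
proof -
 have "(%n. ennreal (\<bar>c\<bar> powr p) * pnorm p (f n)) \<longlonglongrightarrow> ennreal (\<bar>c\<bar> powr p) * 0"
  by (intro ennreal_tendsto_cmult f) auto
 then show ?thesis by (simp add: pnorm_cmult)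
qed

lemma pnorm_tendsto_sum:
 assumes "finite I" and m: "\<And>i n. i \<in> I ==> f i n \<in> borel_measurable borel" and p: "p > 0"
  and f: "\<And>i. i \<in> I ==> (%n. pnorm p (f i n)) \<longlonglongrightarrow> 0"
 shows "(%n. pnorm p (%x. \<Sum>i\<in>I. f i n x)) \<longlonglongrightarrow> 0"
 using assms(1) m f
proof (induction I rule: finite_induct)
 case empty
 then show ?case using p by (simp add: pnorm_def)
next
 case (insert i I)
 have "(%n. pnorm p (%x. f i n x + (\<Sum>i\<in>I. f i n x))) \<longlonglongrightarrow> 0"
  by (rule pnorm_tendsto_add) (use insert p in \<open>auto intro!: borel_measurable_sum\<close>)
 then show ?case using insert by simp
qed

lemma Lp_bounded_support_integrable:
 fixes f :: "'a::euclidean_space => real"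
 assumes [measurable]: "f \<in> borel_measurable borel" and fin: "pnorm p f < \<infinity>" and p: "p >= 1"
  and S: "bounded S" "S \<in> sets borel" "\<And>x. x \<notin> S ==> f x = 0"
 shows "integrable lborel f"
proof (rule Bochner_Integration.integrable_bound)
 have "emeasure lborel S < \<infinity>" by (rule emeasure_bounded_finite[OF S(1)])
 then show "integrable lborel (%x. indicator S x + \<bar>f x\<bar> powr p)"
  using S(2) iffD1[OF pnorm_finite_iff fin]
  by (intro Bochner_Integration.integrable_add) auto
 have "t <= 1 + t powr p" if "t >= 0" for t :: real
 proof (cases "t <= 1")
  case False
  then have "t powr 1 <= t powr p" using p by (intro powr_mono) auto
  then show ?thesis using False by simp
 qed (use that in \<open>auto intro: order_trans[of _ 1]\<close>)
 then have "\<bar>f x\<bar> <= indicator S x + \<bar>f x\<bar> powr p" for x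
  using S(3)[of x] by (cases "x \<in> S") auto
 then show "AE x in lborel. norm (f x) <= norm (indicator S x + \<bar>f x\<bar> powr p)"
  by (auto intro: order_trans[OF _ abs_ge_self])
qed measurable

text \<open>Membership in the closure of the test functions with respect to function and gradient in
  L^p, in epsilon form. The integrability and support clauses of \<open>W01p\<close> are left out,
  so that closedness under limits can be shown first and the upgrade made afterwards by
  \<open>test_approx_W01p\<close>.\<close>

definition test_approx :: "'a::euclidean_space set => real => ('a => real) => ('a => 'a) => bool" where
 "test_approx U p \<phi> \<Phi> \<longleftrightarrow> (\<forall>e>0. \<exists>\<psi>. test_fun U \<psi> & pnorm p (%x. \<psi> x - \<phi> x) <= ennreal e &
   pnorm p (%x. norm (grad \<psi> x - \<Phi> x)) <= ennreal e)"

lemma test_approx_limit: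
 fixes \<phi> :: "'a::euclidean_space => real"
 assumes [measurable]: "\<phi> \<in> borel_measurable borel" "\<Phi> \<in> borel_measurable borel"
   "\<And>n. \<phi>n n \<in> borel_measurable borel" "\<And>n. \<Phi>n n \<in> borel_measurable borel"
  and p: "p >= 0" and ap: "\<And>n. test_approx U p (\<phi>n n) (\<Phi>n n)"
  and l1: "(%n. pnorm p (%x. \<phi>n n x - \<phi> x)) \<longlonglongrightarrow> 0"
  and l2: "(%n. pnorm p (%x. norm (\<Phi>n n x - \<Phi> x))) \<longlonglongrightarrow> 0"
 shows "test_approx U p \<phi> \<Phi>"
 unfolding test_approx_def
proof (intro allI impI)
 fix e :: real assume e: "e > 0"
 define d where "d = e / (2 * 2 powr p)"
 have d: "d > 0" using e by (simp add: d_def)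
 have de: "ennreal (2 powr p) * (ennreal d + ennreal d) = ennreal e"
  using d by (simp add: ennreal_mult[symmetric] ennreal_plus[symmetric] del: ennreal_plus) (simp add: d_def)
 have "eventually (%n. pnorm p (%x. \<phi>n n x - \<phi> x) <= ennreal d & pnorm p (%x. norm (\<Phi>n n x - \<Phi> x)) <= ennreal d) sequentially"
  by (intro eventually_conj ennreal_tendsto_0D[OF l1 d] ennreal_tendsto_0D[OF l2 d])
 then obtain n where n: "pnorm p (%x. \<phi>n n x - \<phi> x) <= ennreal d" "pnorm p (%x. norm (\<Phi>n n x - \<Phi> x)) <= ennreal d"
  unfolding eventually_sequentially by auto
 obtain \<psi> where \<psi>: "test_fun U \<psi>" "pnorm p (%x. \<psi> x - \<phi>n n x) <= ennreal d"
   "pnorm p (%x. norm (grad \<psi> x - \<Phi>n n x)) <= ennreal d"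
  using ap[of n] d unfolding test_approx_def by blast
 have sm: "smooth_on UNIV \<psi>" using \<psi>(1) by (simp add: test_fun_def)
 have [measurable]: "\<psi> \<in> borel_measurable borel" "grad \<psi> \<in> borel_measurable borel"
  using sm smooth_measurable smooth_grad_measurable by auto
 show "\<exists>\<psi>. test_fun U \<psi> & pnorm p (%x. \<psi> x - \<phi> x) <= ennreal e & pnorm p (%x. norm (grad \<psi> x - \<Phi> x)) <= ennreal e"
 proof (intro exI[of _ \<psi>] conjI \<psi>(1))
  have "pnorm p (%x. \<psi> x - \<phi> x) = pnorm p (%x. (\<psi> x - \<phi>n n x) + (\<phi>n n x - \<phi> x))" by simp
  also have "... <= ennreal (2 powr p) * (pnorm p (%x. \<psi> x - \<phi>n n x) + pnorm p (%x. \<phi>n n x - \<phi> x))"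
   by (rule pnorm_add_le[OF _ _ p]) measurable
  also have "... <= ennreal (2 powr p) * (ennreal d + ennreal d)"
   by (intro mult_left_mono add_mono \<psi> n) auto
  finally show "pnorm p (%x. \<psi> x - \<phi> x) <= ennreal e" unfolding de .
  have "pnorm p (%x. norm (grad \<psi> x - \<Phi> x)) <= pnorm p (%x. norm (grad \<psi> x - \<Phi>n n x) + norm (\<Phi>n n x - \<Phi> x))"
  proof (rule pnorm_mono[OF p])
   fix x
   show "\<bar>norm (grad \<psi> x - \<Phi> x)\<bar> <= \<bar>norm (grad \<psi> x - \<Phi>n n x) + norm (\<Phi>n n x - \<Phi> x)\<bar>"
    using norm_triangle_ineq[of "grad \<psi> x - \<Phi>n n x" "\<Phi>n n x - \<Phi> x"] by simp
  qed
  also have "... <= ennreal (2 powr p) * (pnorm p (%x. norm (grad \<psi> x - \<Phi>n n x)) + pnorm p (%x. norm (\<Phi>n n x - \<Phi> x)))"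
   by (rule pnorm_add_le[OF _ _ p]) measurable
  also have "... <= ennreal (2 powr p) * (ennreal d + ennreal d)"
   by (intro mult_left_mono add_mono \<psi> n) auto
  finally show "pnorm p (%x. norm (grad \<psi> x - \<Phi> x)) <= ennreal e" unfolding de .
 qed
qed

lemma test_approxI_seq:
 assumes "\<And>n. test_fun U (\<psi> n)" "(%n. pnorm p (%x. \<psi> n x - \<phi> x)) \<longlonglongrightarrow> 0"
  "(%n. pnorm p (%x. norm (grad (\<psi> n) x - \<Phi> x))) \<longlonglongrightarrow> 0"
 shows "test_approx U p \<phi> \<Phi>"
 unfolding test_approx_def
proof (intro allI impI)
 fix e :: real assume e: "e > 0"
 have "eventually (%n. pnorm p (%x. \<psi> n x - \<phi> x) <= ennreal e & pnorm p (%x. norm (grad (\<psi> n) x - \<Phi> x)) <= ennreal e) sequentially"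
  by (intro eventually_conj ennreal_tendsto_0D[OF assms(2) e] ennreal_tendsto_0D[OF assms(3) e])
 then show "\<exists>\<psi>. test_fun U \<psi> & pnorm p (%x. \<psi> x - \<phi> x) <= ennreal e & pnorm p (%x. norm (grad \<psi> x - \<Phi> x)) <= ennreal e"
  unfolding eventually_sequentially using assms(1) by blast
qed

lemma test_approx_W01p:
 fixes \<phi> :: "'a::euclidean_space => real"
 assumes [measurable]: "\<phi> \<in> borel_measurable borel" "\<Phi> \<in> borel_measurable borel"
  and z: "\<And>x. x \<notin> U ==> \<phi> x = 0 & \<Phi> x = 0"
  and fin: "pnorm p \<phi> < \<infinity>" "pnorm p (%x. norm (\<Phi> x)) < \<infinity>"
  and ap: "test_approx U p \<phi> \<Phi>"
 shows "W01p U p \<phi> \<Phi>"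
proof -
 have "\<forall>k::nat. \<exists>\<psi>. test_fun U \<psi> & pnorm p (%x. \<psi> x - \<phi> x) <= ennreal (1 / (real k + 1)) &
   pnorm p (%x. norm (grad \<psi> x - \<Phi> x)) <= ennreal (1 / (real k + 1))"
  using ap unfolding test_approx_def by simp
 then obtain \<psi> where \<psi>: "\<And>k. test_fun U (\<psi> k)" "\<And>k. pnorm p (%x. \<psi> k x - \<phi> x) <= ennreal (1 / (real k + 1))"
   "\<And>k. pnorm p (%x. norm (grad (\<psi> k) x - \<Phi> x)) <= ennreal (1 / (real k + 1))"
  by metis
 have sm: "smooth_on UNIV (\<psi> k)" for k using \<psi>(1) by (simp add: test_fun_def)
 have [measurable]: "\<psi> k \<in> borel_measurable borel" "grad (\<psi> k) \<in> borel_measurable borel" for k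
  using sm smooth_measurable smooth_grad_measurable by auto
 have lim: "(%k. \<integral>x. \<bar>f k x\<bar> powr p \<partial>lebesgue) \<longlonglongrightarrow> 0"
  if [measurable]: "\<And>k. f k \<in> borel_measurable borel" and f: "\<And>k. pnorm p (f k) <= ennreal (1 / (real k + 1))" for f :: "nat => 'a => real"
 proof (rule tendsto_sandwich[OF _ _ tendsto_const])
  show "\<forall>\<^sub>F k in sequentially. (\<integral>x. \<bar>f k x\<bar> powr p \<partial>lebesgue) <= 1 / (real k + 1)"
  proof (intro always_eventually allI)
   fix k
   have "(\<integral>x. \<bar>f k x\<bar> powr p \<partial>lebesgue) = (\<integral>x. \<bar>f k x\<bar> powr p \<partial>lborel)"
    by (rule integral_completion) measurable
   also have "... = enn2real (pnorm p (f k))"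
    unfolding pnorm_def by (rule integral_eq_nn_integral) auto
   also have "... <= 1 / (real k + 1)"
    by (rule enn2real_leI[OF _ f]) simp
   finally show "(\<integral>x. \<bar>f k x\<bar> powr p \<partial>lebesgue) <= 1 / (real k + 1)" .
  qed
  show "(%k. 1 / (real k + 1)) \<longlonglongrightarrow> 0"
   using LIMSEQ_inverse_real_of_nat by (simp add: inverse_eq_divide add.commute)
 qed (auto intro!: always_eventually integral_nonneg_AE)
 have meas: "f \<in> borel_measurable borel ==> f \<in> borel_measurable lebesgue" for f :: "'a => 'b::{second_countable_topology,t2_space}"
  by (simp add: measurable_completion)
 show ?thesis
  unfolding W01p_def
 proof (intro conjI)
  show "\<phi> \<in> borel_measurable lebesgue" "\<Phi> \<in> borel_measurable lebesgue" by (auto simp: measurable_completion)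
  show "\<forall>x. x \<notin> U --> \<phi> x = 0 & \<Phi> x = 0" using z by blast
  have "integrable lborel (%x. \<bar>\<phi> x\<bar> powr p)" using iffD1[OF pnorm_finite_iff fin(1)] by simp
  then show "integrable lebesgue (%x. \<bar>\<phi> x\<bar> powr p)" by (subst integrable_completion) auto
  have "integrable lborel (%x. \<bar>norm (\<Phi> x)\<bar> powr p)" using iffD1[OF pnorm_finite_iff fin(2)] by simp
  then show "integrable lebesgue (%x. norm (\<Phi> x) powr p)" by (subst integrable_completion) auto
  show "\<exists>\<psi>. (\<forall>k. test_fun U (\<psi> k)) & (%k. \<integral>x. \<bar>\<psi> k x - \<phi> x\<bar> powr p \<partial>lebesgue) \<longlonglongrightarrow> 0 &
    (%k. \<integral>x. norm (grad (\<psi> k) x - \<Phi> x) powr p \<partial>lebesgue) \<longlonglongrightarrow> 0"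
  proof (intro exI[of _ \<psi>] conjI allI \<psi>(1))
   show "(%k. \<integral>x. \<bar>\<psi> k x - \<phi> x\<bar> powr p \<partial>lebesgue) \<longlonglongrightarrow> 0"
    by (rule lim[OF _ \<psi>(2)]) measurable
   have "(%k. \<integral>x. \<bar>norm (grad (\<psi> k) x - \<Phi> x)\<bar> powr p \<partial>lebesgue) \<longlonglongrightarrow> 0"
    by (rule lim[OF _ \<psi>(3)]) measurable
   then show "(%k. \<integral>x. norm (grad (\<psi> k) x - \<Phi> x) powr p \<partial>lebesgue) \<longlonglongrightarrow> 0" by simp
  qed
 qed
qed

text \<open>As a function of \<open>y\<close>, the reflected kernel
  \<open>mollifier_scaled e (x - y)\<close> is a test function supported in
  \<open>cball x e\<close>, and the definition of the weak gradient is applied to it. The sign of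
  the reflection cancels the sign of the integration by parts. Cutting off to \<open>K\<close>
  secures integrability and is not seen from \<open>x\<close>.\<close>

lemma mollify_grad_weak:
 fixes u :: "'a::euclidean_space => real"
 assumes W: "W1p_loc \<Omega> p u G" and [measurable]: "u \<in> borel_measurable borel" "G \<in> borel_measurable borel"
  and e: "e > 0" and K: "cball x e \<subseteq> K" "K \<subseteq> \<Omega>" and Kb[measurable]: "K \<in> sets borel"
  and int: "integrable lborel (%y. indicator K y * u y)" and i: "i \<in> Basis"
 shows "grad (mollify e (%y. indicator K y * u y)) x \<bullet> i = mollify e (%y. indicator K y * (G y \<bullet> i)) x"
proof -
 define \<phi> where "\<phi> = (%y. mollifier_scaled e ((-1) *\<^sub>R y + x))"
 have sm: "smooth_on UNIV \<phi>" unfolding \<phi>_def by (intro smooth_affine mollifier_scaled_smooth)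
 have z: "\<phi> y = 0" if "y \<notin> cball x e" for y
  unfolding \<phi>_def by (rule mollifier_scaled_zero[OF e]) (use that in \<open>simp add: dist_norm\<close>)
 have supp: "closure {y. \<phi> y \<noteq> 0} \<subseteq> cball x e"
  by (rule closure_minimal) (use z in blast, simp)
 have tf: "test_fun \<Omega> \<phi>"
  unfolding test_fun_def
 proof (intro conjI sm)
  show "compact (closure {y. \<phi> y \<noteq> 0})"
   unfolding compact_eq_bounded_closed using bounded_subset[OF bounded_cball supp] by simp
  show "closure {y. \<phi> y \<noteq> 0} \<subseteq> \<Omega>" using supp K by blast
 qed
 have [measurable]: "mollifier_scaled e \<in> borel_measurable (borel::'a measure)"
   "grad (mollifier_scaled e) \<in> borel_measurable (borel::'a measure)"
  by (auto intro: smooth_measurable smooth_grad_measurable mollifier_scaled_smooth)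
 have gr: "grad \<phi> y = - grad (mollifier_scaled e) (x - y)" for y
 proof (rule grad_eqI)
  have "(\<phi> has_derivative (%v. grad (mollifier_scaled e) ((-1) *\<^sub>R y + x) \<bullet> ((-1) *\<^sub>R v))) (at y)"
   unfolding \<phi>_def
   by (rule has_derivative_compose[OF _ smooth_has_derivative_grad[OF mollifier_scaled_smooth]])
     (auto intro!: derivative_eq_intros)
  then show "(\<phi> has_derivative (\<bullet>) (- grad (mollifier_scaled e) (x - y))) (at y)"
   by (rule has_derivative_eq_rhs) (simp add: fun_eq_iff)
 qed
 have gz: "grad (mollifier_scaled e) (x - y) = 0" if "y \<notin> cball x e" for y
 proof -
  have "grad \<phi> y = 0"
   by (rule grad_eq_0_open[of "- cball x e" _ _ 0]) (use that z in auto)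
  then show ?thesis using gr by simp
 qed
 have "grad (mollify e (%y. indicator K y * u y)) x \<bullet> i =
  (\<integral>y. (grad (mollifier_scaled e) (x - y) \<bullet> i) * (indicator K y * u y) \<partial>lborel)"
  by (rule mollify_grad_inner[OF int e])
 also have "... = (\<integral>y. - (u y * (grad \<phi> y \<bullet> i)) \<partial>lborel)"
  by (rule Bochner_Integration.integral_cong) (use gz K in \<open>force simp: gr indicator_def\<close>)+
 also have "... = - (\<integral>y. u y * (grad \<phi> y \<bullet> i) \<partial>lborel)" by simp
 also have "(\<integral>y. u y * (grad \<phi> y \<bullet> i) \<partial>lborel) = (\<integral>y. u y * (grad \<phi> y \<bullet> i) \<partial>lebesgue)"
  unfolding gr by (rule integral_completion[symmetric]) measurable
 also have "... = - (\<integral>y. (G y \<bullet> i) * \<phi> y \<partial>lebesgue)"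
  using W tf i unfolding W1p_loc_def by blast
 also have "(\<integral>y. (G y \<bullet> i) * \<phi> y \<partial>lebesgue) = (\<integral>y. (G y \<bullet> i) * \<phi> y \<partial>lborel)"
  by (rule integral_completion) (use smooth_measurable[OF sm] in measurable)
 also have "- (- (\<integral>y. (G y \<bullet> i) * \<phi> y \<partial>lborel)) = (\<integral>y. mollifier_scaled e (x - y) * (indicator K y * (G y \<bullet> i)) \<partial>lborel)"
  unfolding minus_minus
  by (rule Bochner_Integration.integral_cong) (use z K in \<open>force simp: \<phi>_def indicator_def\<close>)+
 also have "... = mollify e (%y. indicator K y * (G y \<bullet> i)) x"
  by (rule mollify_eq[symmetric, OF _ e]) measurable
 finally show ?thesis .
qed

lemma smooth_real_compose:
 fixes f :: "real => real" and g :: "'a::euclidean_space => real"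
 assumes f: "smooth_on UNIV f" and g: "smooth_on UNIV g"
 shows "smooth_on UNIV (%x. f (g x))"
proof -
 define D where "D = (%h::real=>real. (%x. frechet_derivative h (at x) 1))"
 have sm: "smooth_on UNIV ((D ^^ n) f)" for n
 proof (induction n)
  case (Suc n)
  then show ?case using smooth_partial[of "(D ^^ n) f" 1] by (simp add: D_def)
 qed (simp add: f)
 have der: "((D ^^ n) f has_real_derivative (D ^^ Suc n) f t) (at t)" for n t
 proof -
  have "frechet_derivative ((D ^^ n) f) (at t) = (*) (frechet_derivative ((D ^^ n) f) (at t) 1)"
  proof
   fix v :: real
   show "frechet_derivative ((D ^^ n) f) (at t) v = frechet_derivative ((D ^^ n) f) (at t) 1 * v"
    using linear_cmul[OF linear_frechet_derivative[OF smooth_differentiable[OF sm]], of n t v 1] by simp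
  qed
  then show ?thesis
   using smooth_has_derivative[OF sm, of n t] by (simp add: has_field_derivative_def D_def)
 qed
 show ?thesis using smooth_compose[of "%n. (D ^^ n) f" g, OF der g] by simp
qed

text \<open>Compose with mollifications \<open>un\<close> of \<open>u\<close>. In the gradient,
  \<open>f' un * (grad un - G)\<close> tends to 0 in L^p, while \<open>(f' un - f' u) * G\<close>
  converges almost everywhere along a subsequence and is handled by dominated convergence, as
  \<open>f'\<close> is bounded by 1. The cut-off \<open>\<xi>\<close> restricts everything to a
  compact part of \<open>\<Omega>\<close>, where mollification and weak gradient commute.\<close>

lemma test_approx_compose:
 fixes u :: "'a::euclidean_space => real"
 assumes p: "p > 1" and um[measurable]: "u \<in> borel_measurable borel" and Gm[measurable]: "G \<in> borel_measurable borel"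
  and W: "W1p_loc \<Omega> p u G" and \<Omega>: "open \<Omega>"
  and \<xi>U: "test_fun U \<xi>" and \<xi>\<Omega>: "test_fun \<Omega> \<xi>"
  and f: "smooth_on UNIV f" and f': "\<And>t. (f has_real_derivative f' t) (at t)"
  and fb: "\<And>t. \<bar>f' t\<bar> <= 1" and fc: "continuous_on UNIV f'"
 shows "test_approx U p (%x. f (u x) * \<xi> x) (%x. (f' (u x) * \<xi> x) *\<^sub>R G x + f (u x) *\<^sub>R grad \<xi> x)"
proof -
 define S where "S = closure {x. \<xi> x \<noteq> 0}"
 have S: "compact S" "S \<subseteq> \<Omega>" and \<xi>: "smooth_on UNIV \<xi>" using \<xi>\<Omega> by (auto simp: S_def test_fun_def)
 have \<xi>z: "\<xi> x = 0" if "x \<notin> S" for x using that closure_subset[of "{x. \<xi> x \<noteq> 0}"] by (auto simp: S_def)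
 have Sc: "closed S" by (simp add: S_def)
 have g\<xi>z: "grad \<xi> x = 0" if "x \<notin> S" for x
  by (rule grad_eq_0_open[of "- S" _ _ 0]) (use that Sc \<xi>z in auto)
 have [measurable]: "\<xi> \<in> borel_measurable borel" "grad \<xi> \<in> borel_measurable borel"
  using \<xi> smooth_measurable smooth_grad_measurable by auto
 have [measurable]: "f \<in> borel_measurable borel" "f' \<in> borel_measurable borel"
  using f smooth_measurable fc by (auto intro: borel_measurable_continuous_onI)
 obtain Cx where Cx: "\<And>x. \<bar>\<xi> x\<bar> <= Cx" "Cx >= 0" and Cg: "\<And>x. norm (grad \<xi> x) <= Cx"
 proof -
  have c1: "continuous_on S \<xi>" by (rule continuous_on_subset[OF smooth_continuous[OF \<xi>]]) simp
  have c2: "continuous_on S (grad \<xi>)" by (rule continuous_on_subset[OF smooth_grad_continuous[OF \<xi>]]) simp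
  obtain A where A: "\<forall>y\<in>\<xi> ` S. norm y <= A"
   using compact_imp_bounded[OF compact_continuous_image[OF c1 S(1)]] unfolding bounded_iff by blast
  obtain B where B: "\<forall>y\<in>grad \<xi> ` S. norm y <= B"
   using compact_imp_bounded[OF compact_continuous_image[OF c2 S(1)]] unfolding bounded_iff by blast
  have "\<bar>\<xi> x\<bar> <= max 0 (max A B)" "norm (grad \<xi> x) <= max 0 (max A B)" for x
   using A B \<xi>z[of x] g\<xi>z[of x] by (cases "x \<in> S"; force)+
  then show ?thesis using that[of "max 0 (max A B)"] by auto
 qed
 have flip: "\<bar>f s - f t\<bar> <= \<bar>s - t\<bar>" for s t
 proof -
  have "norm (f s - f t) <= 1 * norm (s - t)"
   by (rule field_differentiable_bound[of UNIV f f']) (use f' fb in \<open>auto intro: has_field_derivative_at_within\<close>)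
  then show ?thesis by simp
 qed
 obtain d where d: "d > 0" "(\<Union>x\<in>S. cball x d) \<subseteq> \<Omega>"
  using compact_subset_open_imp_cball_epsilon_subset[OF S(1) \<Omega> S(2)] by blast
 \<comment> \<open>A closed \<open>d\<close>-neighbourhood of the support: mollifying at a point of
   \<open>S\<close> with parameter at most \<open>d\<close> uses only values in
   \<open>K\<close>.\<close>
 define K where "K = (\<Union>x\<in>S. cball x d)"
 have Kc: "compact K"
 proof -
  have cb: "cball x d = (\<Union>y\<in>cball 0 d. {x + y})" for x :: 'a
  proof (intro set_eqI iffI)
   fix z assume "z \<in> cball x d"
   then have "z - x \<in> cball 0 d" "z \<in> {x + (z - x)}" by (auto simp: dist_norm norm_minus_commute)
   then show "z \<in> (\<Union>y\<in>cball 0 d. {x + y})" by blast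
  qed (auto simp: dist_norm)
  have "K = (\<Union>x\<in>S. \<Union>y\<in>cball 0 d. {x + y})" unfolding K_def by (rule SUP_cong[OF refl cb])
  then show ?thesis using compact_sums'[OF S(1) compact_cball[of 0 d]] by (simp only:)
 qed
 have K\<Omega>: "K \<subseteq> \<Omega>" using d by (simp add: K_def)
 have SK: "S \<subseteq> K" using d by (force simp: K_def)
 have [measurable]: "K \<in> sets borel" using Kc by (simp add: borel_closed compact_imp_closed)
 have Kbd: "bounded K" using Kc compact_imp_bounded by blast
 define U0 where "U0 = (%y. indicator K y * u y)"
 define Gi where "Gi = (%i y. indicator K y * (G y \<bullet> i))"
 have [measurable]: "U0 \<in> borel_measurable borel" "Gi i \<in> borel_measurable borel" for i
  unfolding U0_def Gi_def by measurable
 have siu: "integrable lborel (%x. indicator K x * \<bar>u x\<bar> powr p)" and siG: "integrable lborel (%x. indicator K x * norm (G x) powr p)"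
 proof -
  have "set_integrable lebesgue K (%x. \<bar>u x\<bar> powr p)" "set_integrable lebesgue K (%x. norm (G x) powr p)"
   using W Kc K\<Omega> unfolding W1p_loc_def by blast+
  then show "integrable lborel (%x. indicator K x * \<bar>u x\<bar> powr p)" "integrable lborel (%x. indicator K x * norm (G x) powr p)"
   unfolding set_integrable_def by (subst (asm) integrable_completion; simp)+
 qed
 have finU: "pnorm p U0 < \<infinity>"
 proof (rule iffD2[OF pnorm_finite_iff])
  have "(%x. \<bar>U0 x\<bar> powr p) = (%x. indicator K x * \<bar>u x\<bar> powr p)"
   by (auto simp: U0_def indicator_def fun_eq_iff)
  then show "integrable lborel (%x. \<bar>U0 x\<bar> powr p)" using siu by simp
 qed measurable
 have finKG: "pnorm p (%x. indicator K x * norm (G x)) < \<infinity>"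
 proof (rule iffD2[OF pnorm_finite_iff])
  have "(%x. \<bar>indicator K x * norm (G x)\<bar> powr p) = (%x. indicator K x * norm (G x) powr p)"
   by (auto simp: indicator_def fun_eq_iff)
  then show "integrable lborel (%x. \<bar>indicator K x * norm (G x)\<bar> powr p)" using siG by simp
 qed measurable
 have finG: "pnorm p (Gi i) < \<infinity>" if "i \<in> Basis" for i
 proof -
  have "pnorm p (Gi i) <= pnorm p (%x. indicator K x * norm (G x))"
   by (rule pnorm_mono) (use p Basis_le_norm[OF that] in \<open>auto simp: Gi_def indicator_def\<close>)
  then show ?thesis using finKG by (rule le_less_trans)
 qed
 have intU: "integrable lborel U0"
  by (rule Lp_bounded_support_integrable[OF _ finU _ Kbd]) (use p in \<open>auto simp: U0_def\<close>)
 have intG: "integrable lborel (Gi i)" if "i \<in> Basis" for i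
  by (rule Lp_bounded_support_integrable[OF _ finG[OF that] _ Kbd]) (use p in \<open>auto simp: Gi_def\<close>)
 define e where "e = (%n. d / (real n + 1))"
 have e: "e n > 0" "e n <= d" for n using d by (auto simp: e_def field_simps)
 have e0: "e \<longlonglongrightarrow> 0"
 proof -
  have "(%n. d * inverse (real (Suc n))) \<longlonglongrightarrow> d * 0" by (intro tendsto_intros LIMSEQ_inverse_real_of_nat)
  then show ?thesis by (simp add: e_def[abs_def] field_simps)
 qed
 have cU: "(%n. pnorm p (%x. mollify (e n) U0 x - U0 x)) \<longlonglongrightarrow> 0"
  by (rule mollify_Lp_tendsto[OF intU finU]) (use p e e0 in auto)
 have cG: "(%n. pnorm p (%x. mollify (e n) (Gi i) x - Gi i x)) \<longlonglongrightarrow> 0" if "i \<in> Basis" for i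
  by (rule mollify_Lp_tendsto[OF intG finG]) (use p e e0 that in auto)
 obtain r where r: "strict_mono r" "AE x in lborel. (%n. \<bar>mollify (e (r n)) U0 x - U0 x\<bar> powr p) \<longlonglongrightarrow> 0"
 proof -
  \<comment> \<open>The subsequence theorem asks every term to be integrable; discarding the first
    \<open>n0\<close> terms makes every \<open>pnorm\<close> at most 1.\<close>
  obtain n0 where n0: "\<And>n. n >= n0 ==> pnorm p (%x. mollify (e n) U0 x - U0 x) <= ennreal 1"
   using ennreal_tendsto_0D[OF cU, of 1] unfolding eventually_sequentially by auto
  define w where "w = (%n x. \<bar>mollify (e (n + n0)) U0 x - U0 x\<bar> powr p)"
  have pw: "(NN x. ennreal (w n x)) = pnorm p (%x. mollify (e (n + n0)) U0 x - U0 x)" for n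
   by (simp add: w_def pnorm_def)
  have wi: "integrable lborel (w n)" for n
  proof (rule integrableI_bounded)
   show "w n \<in> borel_measurable lborel" unfolding w_def by measurable
   have "(NN x. ennreal (norm (w n x))) <= ennreal 1" using n0[of "n + n0"] pw[of n] by (simp add: w_def)
   then show "(NN x. ennreal (norm (w n x))) < \<infinity>" using le_less_trans by fastforce
  qed
  have "(%n. ennreal (\<integral>x. norm (w n x) \<partial>lborel)) \<longlonglongrightarrow> 0"
  proof -
   have "ennreal (\<integral>x. norm (w n x) \<partial>lborel) = pnorm p (%x. mollify (e (n + n0)) U0 x - U0 x)" for n
    unfolding pw[symmetric] using wi[of n]
    by (subst nn_integral_eq_integral) (auto simp: w_def)
   then show ?thesis using LIMSEQ_ignore_initial_segment[OF cU, of n0] by simp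
  qed
  then have "(%n. \<integral>x. norm (w n x) \<partial>lborel) \<longlonglongrightarrow> 0"
   by (subst (asm) ennreal_tendsto_0_iff) auto
  from tendsto_L1_AE_subseq[OF wi this] obtain r where r: "strict_mono r" "AE x in lborel. (%n. w (r n) x) \<longlonglongrightarrow> 0" by blast
  show ?thesis
   by (rule that[of "%n. r n + n0"]) (use r in \<open>auto simp: w_def strict_mono_def\<close>)
 qed
 define un where "un = (%n. mollify (e (r n)) U0)"
 have unsm: "smooth_on UNIV (un n)" for n unfolding un_def by (rule mollify_smooth[OF intU e(1)])
 have [measurable]: "un n \<in> borel_measurable borel" for n using unsm smooth_measurable by blast
 have cun: "(%n. pnorm p (%x. un n x - U0 x)) \<longlonglongrightarrow> 0"
  using LIMSEQ_subseq_LIMSEQ[OF cU r(1)] by (simp add: o_def un_def)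
 have cGn: "(%n. pnorm p (%x. mollify (e (r n)) (Gi i) x - Gi i x)) \<longlonglongrightarrow> 0" if "i \<in> Basis" for i
  using LIMSEQ_subseq_LIMSEQ[OF cG[OF that] r(1)] by (simp add: o_def)
 have aeun: "AE x in lborel. (%n. un n x) \<longlonglongrightarrow> U0 x"
  using r(2)
 proof eventually_elim
  case (elim x)
  have "(%n. (\<bar>un n x - U0 x\<bar> powr p) powr (1/p)) \<longlonglongrightarrow> 0 powr (1/p)"
   unfolding un_def by (rule tendsto_powr'[OF elim tendsto_const]) (use p in auto)
  then have "(%n. \<bar>un n x - U0 x\<bar>) \<longlonglongrightarrow> 0" using p by (simp add: powr_powr)
  then have "(%n. un n x - U0 x) \<longlonglongrightarrow> 0" by (rule tendsto_rabs_zero_cancel)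
  then show ?case by (simp add: LIM_zero_iff)
 qed
 have gun: "grad (un n) x \<bullet> i = mollify (e (r n)) (Gi i) x" if "x \<in> S" "i \<in> Basis" for n x i
  unfolding un_def U0_def Gi_def
 proof (rule mollify_grad_weak[OF W um Gm e(1) _ K\<Omega> _ _ that(2)])
  show "cball x (e (r n)) \<subseteq> K" using that(1) e(2)[of "r n"] by (force simp: K_def)
  show "integrable lborel (%y. indicat_real K y * u y)" using intU by (simp add: U0_def)
 qed measurable
 define \<psi> where "\<psi> = (%n x. f (un n x) * \<xi> x)"
 have \<psi>sm: "smooth_on UNIV (\<psi> n)" for n
  unfolding \<psi>_def by (intro smooth_mult smooth_real_compose[OF f] unsm \<xi>)
 have g\<psi>: "grad (\<psi> n) x = (f' (un n x) * \<xi> x) *\<^sub>R grad (un n) x + f (un n x) *\<^sub>R grad \<xi> x" for n x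
 proof (rule grad_eqI)
  have "((%x. f (un n x)) has_derivative (%v. f' (un n x) * (grad (un n) x \<bullet> v))) (at x)"
   using has_derivative_compose[OF smooth_has_derivative_grad[OF unsm, of n x] f'[unfolded has_field_derivative_def, of "un n x"]] by simp
  from has_derivative_mult[OF this smooth_has_derivative_grad[OF \<xi>, of x]]
  show "(\<psi> n has_derivative (\<bullet>) ((f' (un n x) * \<xi> x) *\<^sub>R grad (un n) x + f (un n x) *\<^sub>R grad \<xi> x)) (at x)"
   unfolding \<psi>_def by (rule has_derivative_eq_rhs) (auto simp: fun_eq_iff inner_add_left algebra_simps)
 qed
 show ?thesis
 proof (rule test_approxI_seq[of _ \<psi>])
  show "test_fun U (\<psi> n)" for n
  proof -
   have sub: "closure {x. \<psi> n x \<noteq> 0} \<subseteq> S" unfolding S_def by (rule closure_mono) (auto simp: \<psi>_def)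
   have "compact (closure {x. \<psi> n x \<noteq> 0})"
    unfolding compact_eq_bounded_closed using bounded_subset[OF compact_imp_bounded[OF S(1)] sub] by simp
   then show ?thesis using sub \<xi>U \<psi>sm by (auto simp: test_fun_def S_def)
  qed
  have Ueq: "u x = U0 x" if "x \<in> S" for x using that SK by (auto simp: U0_def)
  show "(%n. pnorm p (%x. \<psi> n x - f (u x) * \<xi> x)) \<longlonglongrightarrow> 0"
  proof (rule pnorm_tendsto_sandwich[OF pnorm_tendsto_cmult[OF _ cun, of Cx]])
   fix n x
   show "\<bar>\<psi> n x - f (u x) * \<xi> x\<bar> <= \<bar>Cx * (un n x - U0 x)\<bar>"
   proof (cases "x \<in> S")
    case True
    have "\<bar>f (un n x) - f (u x)\<bar> * \<bar>\<xi> x\<bar> <= \<bar>un n x - u x\<bar> * Cx"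
     by (intro mult_mono flip Cx) auto
    moreover have "\<psi> n x - f (u x) * \<xi> x = (f (un n x) - f (u x)) * \<xi> x"
     by (simp add: \<psi>_def left_diff_distrib)
    ultimately show ?thesis using Cx(2) Ueq[OF True]
     by (simp add: abs_mult mult.commute)
   qed (simp add: \<psi>_def \<xi>z)
  qed (use p in auto)
  \<comment> \<open>An explicit majorant of the gradient error with its three sources kept apart:
    the coordinates of the mollified gradient, the change of \<open>f'\<close>, and the change of
    \<open>f\<close> against \<open>grad \<xi>\<close>.\<close>
  define R where "R = (%n x. Cx * (\<Sum>i\<in>Basis. \<bar>mollify (e (r n)) (Gi i) x - Gi i x\<bar>) +
    ((Cx * (\<bar>f' (un n x) - f' (U0 x)\<bar> * (indicator K x * norm (G x)))) + Cx * \<bar>un n x - U0 x\<bar>))"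
  have lim2: "(%n. pnorm p (%x. \<bar>f' (un n x) - f' (U0 x)\<bar> * (indicator K x * norm (G x)))) \<longlonglongrightarrow> 0"
  proof -
   have "(%n. pnorm p (%x. \<bar>f' (un n x) - f' (U0 x)\<bar> * (indicator K x * norm (G x)))) \<longlonglongrightarrow> (\<integral>\<^sup>+x. 0 \<partial>(lborel::'a measure))"
    unfolding pnorm_def
   proof (rule nn_integral_dominated_convergence[where w="%x. ennreal (\<bar>2 * (indicator K x * norm (G x))\<bar> powr p)"])
    show "(%x. ennreal (\<bar>\<bar>f' (un j x) - f' (U0 x)\<bar> * (indicat_real K x * norm (G x))\<bar> powr p)) \<in> borel_measurable lborel" for j
     by measurable
    show "(%x. ennreal (\<bar>2 * (indicat_real K x * norm (G x))\<bar> powr p)) \<in> borel_measurable lborel" by measurable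
    show "(NN x. ennreal (\<bar>2 * (indicat_real K x * norm (G x))\<bar> powr p)) < \<infinity>"
     using pnorm_cmult[of "%x. indicator K x * norm (G x)" p 2] finKG
     unfolding pnorm_def by (auto simp: ennreal_mult_less_top)
    show "AE x in lborel. ennreal (\<bar>\<bar>f' (un j x) - f' (U0 x)\<bar> * (indicat_real K x * norm (G x))\<bar> powr p)
      <= ennreal (\<bar>2 * (indicat_real K x * norm (G x))\<bar> powr p)" for j
    proof (intro AE_I2 ennreal_leI powr_mono2)
     fix x
     have "\<bar>f' (un j x) - f' (U0 x)\<bar> <= 2" using fb[of "un j x"] fb[of "U0 x"] by linarith
     then show "\<bar>\<bar>f' (un j x) - f' (U0 x)\<bar> * (indicat_real K x * norm (G x))\<bar> <= \<bar>2 * (indicat_real K x * norm (G x))\<bar>"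
      unfolding abs_mult by (intro mult_right_mono) auto
    qed (use p in auto)
    show "AE x in lborel. (%j. ennreal (\<bar>\<bar>f' (un j x) - f' (U0 x)\<bar> * (indicat_real K x * norm (G x))\<bar> powr p)) \<longlonglongrightarrow> 0"
     using aeun
    proof eventually_elim
     case (elim x)
     have "(%j. f' (un j x)) \<longlonglongrightarrow> f' (U0 x)"
      by (rule continuous_on_tendsto_compose[OF fc elim]) auto
     then have "(%j. \<bar>\<bar>f' (un j x) - f' (U0 x)\<bar> * (indicat_real K x * norm (G x))\<bar> powr p) \<longlonglongrightarrow>
       \<bar>\<bar>f' (U0 x) - f' (U0 x)\<bar> * (indicat_real K x * norm (G x))\<bar> powr p"
      by (intro tendsto_powr' tendsto_intros) (use p in auto)
     then have "(%j. \<bar>\<bar>f' (un j x) - f' (U0 x)\<bar> * (indicat_real K x * norm (G x))\<bar> powr p) \<longlonglongrightarrow> 0"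
      by simp
     from tendsto_ennrealI[OF this] show ?case by simp
    qed
   qed simp
   then show ?thesis by simp
  qed
  have R0: "(%n. pnorm p (R n)) \<longlonglongrightarrow> 0"
   unfolding R_def
  proof (intro pnorm_tendsto_add pnorm_tendsto_cmult pnorm_tendsto_sum lim2)
   show "(%n. pnorm p (%x. \<bar>mollify (e (r n)) (Gi i) x - Gi i x\<bar>)) \<longlonglongrightarrow> 0" if "i \<in> Basis" for i
    using cGn[OF that] by (simp add: pnorm_def)
   show "(%n. pnorm p (%x. \<bar>un n x - U0 x\<bar>)) \<longlonglongrightarrow> 0"
    using cun by (simp add: pnorm_def)
  qed (use p in \<open>auto intro!: borel_measurable_sum\<close>)
  show "(%n. pnorm p (%x. norm (grad (\<psi> n) x - ((f' (u x) * \<xi> x) *\<^sub>R G x + f (u x) *\<^sub>R grad \<xi> x)))) \<longlonglongrightarrow> 0"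
  proof (rule pnorm_tendsto_sandwich[OF R0])
   fix n x
   show "\<bar>norm (grad (\<psi> n) x - ((f' (u x) * \<xi> x) *\<^sub>R G x + f (u x) *\<^sub>R grad \<xi> x))\<bar> <= \<bar>R n x\<bar>"
   proof (cases "x \<in> S")
    case False
    then show ?thesis by (simp add: g\<psi> \<xi>z g\<xi>z)
   next
    case True
    have xK: "x \<in> K" using True SK by blast
    have eq: "grad (\<psi> n) x - ((f' (u x) * \<xi> x) *\<^sub>R G x + f (u x) *\<^sub>R grad \<xi> x) =
      (f' (un n x) * \<xi> x) *\<^sub>R (grad (un n) x - G x) + (((f' (un n x) - f' (u x)) * \<xi> x) *\<^sub>R G x + (f (un n x) - f (u x)) *\<^sub>R grad \<xi> x)"
     unfolding g\<psi> by (simp add: algebra_simps)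
    have "norm (grad (\<psi> n) x - ((f' (u x) * \<xi> x) *\<^sub>R G x + f (u x) *\<^sub>R grad \<xi> x)) <= \<bar>f' (un n x) * \<xi> x\<bar> * norm (grad (un n) x - G x) + (\<bar>(f' (un n x) - f' (u x)) * \<xi> x\<bar> * norm (G x) + \<bar>f (un n x) - f (u x)\<bar> * norm (grad \<xi> x))"
     unfolding eq by (rule order_trans[OF norm_triangle_ineq], rule add_mono, simp, rule order_trans[OF norm_triangle_ineq], simp)
    also have "... <= Cx * (\<Sum>i\<in>Basis. \<bar>mollify (e (r n)) (Gi i) x - Gi i x\<bar>) +
      (Cx * (\<bar>f' (un n x) - f' (U0 x)\<bar> * (indicator K x * norm (G x))) + Cx * \<bar>un n x - U0 x\<bar>)"
    proof (intro add_mono)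
     have "norm (grad (un n) x - G x) <= (\<Sum>i\<in>Basis. \<bar>(grad (un n) x - G x) \<bullet> i\<bar>)" by (rule norm_le_l1)
     also have "... = (\<Sum>i\<in>Basis. \<bar>mollify (e (r n)) (Gi i) x - Gi i x\<bar>)"
      by (rule sum.cong) (use True xK in \<open>auto simp: inner_diff_left gun Gi_def\<close>)
     finally have n1: "norm (grad (un n) x - G x) <= (\<Sum>i\<in>Basis. \<bar>mollify (e (r n)) (Gi i) x - Gi i x\<bar>)" .
     have "\<bar>f' (un n x)\<bar> * \<bar>\<xi> x\<bar> <= 1 * Cx" by (intro mult_mono fb Cx) auto
     then show "\<bar>f' (un n x) * \<xi> x\<bar> * norm (grad (un n) x - G x) <= Cx * (\<Sum>i\<in>Basis. \<bar>mollify (e (r n)) (Gi i) x - Gi i x\<bar>)"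
      by (intro mult_mono n1 Cx(2)) (auto simp: abs_mult)
     have "\<bar>\<xi> x\<bar> * (\<bar>f' (un n x) - f' (U0 x)\<bar> * norm (G x)) <= Cx * (\<bar>f' (un n x) - f' (U0 x)\<bar> * norm (G x))"
      by (intro mult_right_mono Cx) auto
     then show "\<bar>(f' (un n x) - f' (u x)) * \<xi> x\<bar> * norm (G x) <= Cx * (\<bar>f' (un n x) - f' (U0 x)\<bar> * (indicator K x * norm (G x)))"
      using xK Ueq[OF True] by (simp add: abs_mult mult_ac)
     have "\<bar>f (un n x) - f (u x)\<bar> * norm (grad \<xi> x) <= \<bar>un n x - u x\<bar> * Cx"
      by (intro mult_mono flip Cg) auto
     then show "\<bar>f (un n x) - f (u x)\<bar> * norm (grad \<xi> x) <= Cx * \<bar>un n x - U0 x\<bar>"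
      using Ueq[OF True] by (simp add: mult.commute)
    qed
    finally show ?thesis unfolding R_def by (auto intro: order_trans[OF _ abs_ge_self])
   qed
  qed (use p in auto)
 qed
qed

section \<open>Smooth approximations of the positive part\<close>

lemma smooth_id_real: "smooth_on UNIV (%t::real. t)"
 using smooth_inner[of "1::real"] by simp

text \<open>\<open>fd n\<close> is the \<open>n\<close>-th derivative of the square root, a falling
  factorial times a power. The shift by \<open>b^2\<close> keeps the argument away from the
  singularity at 0.\<close>

lemma smooth_sqrt_shift:
 assumes b: "b \<noteq> 0" shows "smooth_on UNIV (%t::real. sqrt (t\<^sup>2 + b\<^sup>2))"
proof -
 define fd where "fd = (%n t. (\<Prod>j<n. (1/2 - real j)) * t powr (1/2 - real n))"
 have pos: "t\<^sup>2 + b\<^sup>2 > 0" for t :: real using b by (simp add: add_nonneg_pos)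
 have der: "(fd n has_real_derivative fd (Suc n) t) (at t)" if t: "t > 0" for n t
 proof -
  have "((%t. t powr (1/2 - real n)) has_real_derivative (1/2 - real n) * t powr (1/2 - real n - 1)) (at t)"
   by (rule has_real_derivative_powr[OF t])
  from DERIV_cmult[OF this, of "\<Prod>j<n. (1/2 - real j)"] show ?thesis
   unfolding fd_def by (simp add: algebra_simps)
 qed
 have "smooth_on UNIV (%t::real. t * t + b\<^sup>2)"
  by (intro smooth_add smooth_mult smooth_id_real smooth_const)
 then have sm: "smooth_on UNIV (%t::real. t\<^sup>2 + b\<^sup>2)" by (simp add: power2_eq_square)
 have "smooth_on UNIV (%t::real. fd 0 (t\<^sup>2 + b\<^sup>2))"
  by (rule smooth_compose[of fd "%t. t\<^sup>2 + b\<^sup>2", OF der[OF pos] sm])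
 moreover have "fd 0 (t\<^sup>2 + b\<^sup>2) = sqrt (t\<^sup>2 + b\<^sup>2)" for t
  using pos[of t] by (simp add: fd_def powr_half_sqrt)
 ultimately show ?thesis by simp
qed

text \<open>A smooth approximation of the positive part whose derivative converges to the indicator
 of the open half line; the shift by \<open>a\<close> forces the limit \<open>0\<close> (and not \<open>1/2\<close>) at the origin.\<close>

definition smooth_pos :: "real => real => real" where
 "smooth_pos a t = 1/2 * ((t - a) + sqrt ((t - a)\<^sup>2 + (a\<^sup>2)\<^sup>2))"

definition smooth_pos' :: "real => real => real" where
 "smooth_pos' a t = 1/2 * (1 + (t - a) / sqrt ((t - a)\<^sup>2 + (a\<^sup>2)\<^sup>2))"

lemma smooth_pos_smooth:
 assumes "a > 0" shows "smooth_on UNIV (%t::real. smooth_pos a (\<sigma> * t - k))"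
proof -
 have aff: "smooth_on UNIV (%t::real. (\<sigma> * t + (- k)) + (- a))"
  by (intro smooth_add smooth_mult smooth_id_real smooth_const)
 have "smooth_on UNIV (%t::real. sqrt (((\<sigma> * t + (- k)) + (- a))\<^sup>2 + (a\<^sup>2)\<^sup>2))"
  by (rule smooth_real_compose[OF smooth_sqrt_shift aff]) (use assms in simp)
 then have "smooth_on UNIV (%t::real. 1/2 * (((\<sigma> * t + (- k)) + (- a)) + sqrt (((\<sigma> * t + (- k)) + (- a))\<^sup>2 + (a\<^sup>2)\<^sup>2)))"
  by (intro smooth_add smooth_mult smooth_const aff)
 then show ?thesis by (simp add: smooth_pos_def)
qed

lemma smooth_pos_sqrt_pos: "a > 0 ==> sqrt ((t - a)\<^sup>2 + (a\<^sup>2)\<^sup>2) > 0"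
 by (simp add: add_nonneg_pos)

lemma smooth_pos_deriv:
 assumes "a > 0" shows "(smooth_pos a has_real_derivative smooth_pos' a t) (at t)"
proof -
 have "(t - a)\<^sup>2 + (a\<^sup>2)\<^sup>2 > 0" using assms by (simp add: add_nonneg_pos)
 then show ?thesis unfolding smooth_pos_def[abs_def] smooth_pos'_def
  by (auto intro!: derivative_eq_intros simp: field_simps)
qed

lemma smooth_pos'_bounds: "a > 0 ==> 0 <= smooth_pos' a t" "a > 0 ==> smooth_pos' a t <= 1"
proof -
 assume a: "a > 0"
 have "\<bar>t - a\<bar> <= sqrt ((t - a)\<^sup>2 + (a\<^sup>2)\<^sup>2)" by (rule real_le_rsqrt) simp
 then have "\<bar>(t - a) / sqrt ((t - a)\<^sup>2 + (a\<^sup>2)\<^sup>2)\<bar> <= 1" using smooth_pos_sqrt_pos[OF a, of t] by (simp add: abs_divide)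
 then have "- 1 <= (t - a) / sqrt ((t - a)\<^sup>2 + (a\<^sup>2)\<^sup>2)" "(t - a) / sqrt ((t - a)\<^sup>2 + (a\<^sup>2)\<^sup>2) <= 1"
  by (simp_all only: abs_le_iff) linarith
 then show "0 <= smooth_pos' a t" and "smooth_pos' a t <= 1" unfolding smooth_pos'_def by simp_all
qed

lemma smooth_pos'_continuous: "a > 0 ==> continuous_on UNIV (smooth_pos' a)"
 unfolding smooth_pos'_def[abs_def]
 by (intro continuous_intros ballI) (rule less_imp_neq[OF smooth_pos_sqrt_pos, THEN not_sym])

lemma smooth_pos_approx: "a > 0 ==> \<bar>smooth_pos a t - max t 0\<bar> <= a + a\<^sup>2"
proof -
 assume a: "a > 0"
 define b where "b = a\<^sup>2"
 have b: "b >= 0" by (simp add: b_def)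
 define s where "s = sqrt ((t - a)\<^sup>2 + b\<^sup>2)"
 have s1: "\<bar>t - a\<bar> <= s" unfolding s_def by (rule real_le_rsqrt) simp
 have s2: "s <= \<bar>t - a\<bar> + b"
  using sqrt_sum_squares_le_sum_abs[of "t - a" b] b by (simp add: s_def)
 show ?thesis unfolding smooth_pos_def b_def[symmetric] s_def[symmetric] using a b s1 s2
  by (simp add: max_def abs_if field_simps split: if_splits)
qed

lemma smooth_pos'_tendsto:
 assumes "a \<longlonglongrightarrow> 0" "\<And>n. a n > 0"
 shows "(%n. smooth_pos' (a n) t) \<longlonglongrightarrow> (if t > 0 then 1 else 0)"
proof (cases "t > 0")
 case True
 have "(%n. 1/2 * (1 + (t - a n) / sqrt ((t - a n)\<^sup>2 + ((a n)\<^sup>2)\<^sup>2))) \<longlonglongrightarrow> 1/2 * (1 + (t - 0) / sqrt ((t - 0)\<^sup>2 + (0\<^sup>2)\<^sup>2))"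
  by (intro tendsto_intros assms) (use True in auto)
 then show ?thesis using True by (simp add: smooth_pos'_def)
next
 case False
 \<comment> \<open>For \<open>t <= 0\<close> put \<open>z = a - t >= a\<close>. Then
   \<open>(s - z) * (s + z) = a^4 <= a^2 * s^2\<close>, hence \<open>1 - z/s <= a^2\<close>: the
   smoothing width \<open>a^2\<close> is negligible against the shift \<open>a\<close>.\<close>
 have b: "smooth_pos' (a n) t <= (a n)\<^sup>2" for n
 proof -
  define z where "z = a n - t"
  define s where "s = sqrt (z\<^sup>2 + ((a n)\<^sup>2)\<^sup>2)"
  have an: "a n > 0" by (rule assms)
  have z: "z >= a n" "z > 0" using False an by (auto simp: z_def)
  have sz: "z <= s" unfolding s_def by (rule real_le_rsqrt) simp
  have "s\<^sup>2 = z\<^sup>2 + ((a n)\<^sup>2)\<^sup>2" unfolding s_def by simp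
  then have "(s - z) * (s + z) = (a n)\<^sup>2 * (a n)\<^sup>2" by (simp add: power2_eq_square algebra_simps)
  moreover have "(a n)\<^sup>2 * (a n)\<^sup>2 <= (a n)\<^sup>2 * (s * s)"
   using z sz an by (intro mult_left_mono) (auto simp: power2_eq_square intro!: mult_mono)
  moreover have "(s - z) * s <= (s - z) * (s + z)" using sz z by (intro mult_left_mono) auto
  ultimately have "(s - z) * s <= ((a n)\<^sup>2 * s) * s" by (simp add: mult.assoc)
  then have "s - z <= (a n)\<^sup>2 * s" using sz z by (simp add: mult_le_cancel_right)
  then have "(s - z) / s <= (a n)\<^sup>2" using sz z by (simp add: divide_le_eq)
  moreover have "smooth_pos' (a n) t = 1/2 * ((s - z) / s)"
  proof -
   have "(t - a n)\<^sup>2 = z\<^sup>2" by (simp add: z_def power2_commute)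
   then have "smooth_pos' (a n) t = 1/2 * (1 + (t - a n) / s)" by (simp add: smooth_pos'_def s_def)
   also have "(t - a n) / s = - (z / s)" by (simp add: z_def minus_divide_left)
   finally show ?thesis using sz z by (simp add: diff_divide_distrib)
  qed
  moreover have "(s - z) / s >= 0" using sz z by simp
  ultimately show ?thesis by linarith
 qed
 have "(%n. (a n)\<^sup>2) \<longlonglongrightarrow> 0\<^sup>2" by (intro tendsto_intros assms)
 then have l: "(%n. (a n)\<^sup>2) \<longlonglongrightarrow> 0" by simp
 have "(%n. smooth_pos' (a n) t) \<longlonglongrightarrow> 0"
  by (rule tendsto_sandwich[OF _ _ tendsto_const l])
    (use b smooth_pos'_bounds(1)[OF assms(2)] in \<open>auto intro!: always_eventually\<close>)
 then show ?thesis using False by simp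
qed

section \<open>Truncations multiplied by cut-offs\<close>

lemma bounded_support_pnorm_finite:
 assumes f: "f \<in> borel_measurable borel" and S: "S \<in> sets borel" "bounded S" and p: "p > 0"
  and b: "\<And>x. \<bar>f x\<bar> <= C * indicator S x"
 shows "pnorm p f < \<infinity>"
proof -
 have "pnorm p f <= (NN x. ennreal (\<bar>C\<bar> powr p) * indicator S x)"
  unfolding pnorm_def
 proof (rule nn_integral_mono)
  fix x
  show "ennreal (\<bar>f x\<bar> powr p) <= ennreal (\<bar>C\<bar> powr p) * indicator S x"
   using b[of x] p by (cases "x \<in> S") (auto intro!: ennreal_leI powr_mono2)
 qed
 also have "... = ennreal (\<bar>C\<bar> powr p) * emeasure lborel S"
  by (rule nn_integral_cmult_indicator) (use S in simp)
 also have "... < \<infinity>" using emeasure_bounded_finite[OF S(2)] by (simp add: ennreal_mult_less_top)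
 finally show ?thesis .
qed

lemma test_fun_facts:
 fixes \<xi> :: "'a::euclidean_space => real"
 assumes \<xi>: "test_fun \<Omega> \<xi>"
 obtains S C where "compact S" "S \<subseteq> \<Omega>" "C >= 0" "\<And>x. x \<notin> S ==> \<xi> x = 0" "\<And>x. x \<notin> S ==> grad \<xi> x = 0"
  "\<And>x. \<bar>\<xi> x\<bar> <= C * indicator S x" "\<And>x. norm (grad \<xi> x) <= C * indicator S x"
proof -
 define S where "S = closure {x. \<xi> x \<noteq> 0}"
 have S: "compact S" "S \<subseteq> \<Omega>" and sm: "smooth_on UNIV \<xi>" using \<xi> by (auto simp: S_def test_fun_def)
 have z: "\<xi> x = 0" if "x \<notin> S" for x using that closure_subset[of "{x. \<xi> x \<noteq> 0}"] by (auto simp: S_def)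
 have Sc: "closed S" by (simp add: S_def)
 have gz: "grad \<xi> x = 0" if "x \<notin> S" for x
  by (rule grad_eq_0_open[of "- S" _ _ 0]) (use that Sc z in auto)
 have c1: "continuous_on S \<xi>" by (rule continuous_on_subset[OF smooth_continuous[OF sm]]) simp
 have c2: "continuous_on S (grad \<xi>)" by (rule continuous_on_subset[OF smooth_grad_continuous[OF sm]]) simp
 obtain A where A: "\<forall>y\<in>\<xi> ` S. norm y <= A"
  using compact_imp_bounded[OF compact_continuous_image[OF c1 S(1)]] unfolding bounded_iff by blast
 obtain B where B: "\<forall>y\<in>grad \<xi> ` S. norm y <= B"
  using compact_imp_bounded[OF compact_continuous_image[OF c2 S(1)]] unfolding bounded_iff by blast
 have "\<bar>\<xi> x\<bar> <= max 0 (max A B) * indicator S x" "norm (grad \<xi> x) <= max 0 (max A B) * indicator S x" for x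
  using A B z[of x] gz[of x] by (cases "x \<in> S"; force)+
 then show ?thesis using that[of S "max 0 (max A B)"] S z gz by auto
qed

lemma test_fun_pnorm_finite:
 fixes u :: "'a::euclidean_space => real"
 assumes p: "p > 0" and Gm[measurable]: "G \<in> borel_measurable borel"
  and W: "W1p_loc \<Omega> p u G" and \<xi>: "test_fun \<Omega> \<xi>"
 shows "pnorm p \<xi> < \<infinity>" "pnorm p (%x. norm (grad \<xi> x)) < \<infinity>" "pnorm p (%x. \<xi> x * norm (G x)) < \<infinity>"
proof -
 obtain S C where S: "compact S" "S \<subseteq> \<Omega>" and C: "C >= 0" "\<And>x. \<bar>\<xi> x\<bar> <= C * indicator S x" "\<And>x. norm (grad \<xi> x) <= C * indicator S x"
  using test_fun_facts[OF \<xi>] by metis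
 have sm: "smooth_on UNIV \<xi>" using \<xi> by (simp add: test_fun_def)
 have [measurable]: "\<xi> \<in> borel_measurable borel" "grad \<xi> \<in> borel_measurable borel"
  using sm smooth_measurable smooth_grad_measurable by auto
 have Sb[measurable]: "S \<in> sets borel" and Sbd: "bounded S"
  using S by (auto simp: borel_closed compact_imp_closed compact_imp_bounded)
 show "pnorm p \<xi> < \<infinity>" by (rule bounded_support_pnorm_finite[OF _ Sb Sbd p C(2)]) measurable
 show "pnorm p (%x. norm (grad \<xi> x)) < \<infinity>"
  by (rule bounded_support_pnorm_finite[OF _ Sb Sbd p, of _ C]) (use C(3) in auto)
 have "set_integrable lebesgue S (%x. norm (G x) powr p)" using W S unfolding W1p_loc_def by blast
 then have "integrable lborel (%x. indicator S x * norm (G x) powr p)"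
  unfolding set_integrable_def by (subst (asm) integrable_completion; simp)
 moreover have "(%x. \<bar>indicator S x * norm (G x)\<bar> powr p) = (%x. indicator S x * norm (G x) powr p)"
  by (auto simp: indicator_def fun_eq_iff)
 ultimately have "pnorm p (%x. indicator S x * norm (G x)) < \<infinity>"
  by (intro iffD2[OF pnorm_finite_iff]) auto
 then have "pnorm p (%x. C * (indicator S x * norm (G x))) < \<infinity>"
  by (subst pnorm_cmult) (auto simp: ennreal_mult_less_top)
 moreover have "pnorm p (%x. \<xi> x * norm (G x)) <= pnorm p (%x. C * (indicator S x * norm (G x)))"
 proof (rule pnorm_mono)
  fix x
  have "\<bar>\<xi> x\<bar> * norm (G x) <= (C * indicator S x) * norm (G x)" by (intro mult_right_mono C) auto
  then show "\<bar>\<xi> x * norm (G x)\<bar> <= \<bar>C * (indicator S x * norm (G x))\<bar>"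
   using C(1) by (simp add: abs_mult mult.assoc)
 qed (use p in auto)
 ultimately show "pnorm p (%x. \<xi> x * norm (G x)) < \<infinity>" by (rule le_less_trans[rotated])
qed

text \<open>The weak gradient of \<open>max (\<sigma> * u - k) 0 * \<xi>\<close>. On the level set
  \<open>\<sigma> * u = k\<close> the derivative of the positive part is given the value 0, in
  agreement with the pointwise limit of \<open>smooth_pos'\<close>.\<close>

definition trunc_grad :: "real => real => ('a::euclidean_space => real) => ('a => 'a) => ('a => real) => 'a => 'a" where
 "trunc_grad \<sigma> k u G \<xi> x = ((if \<sigma> * u x > k then \<sigma> else 0) * \<xi> x) *\<^sub>R G x + max (\<sigma> * u x - k) 0 *\<^sub>R grad \<xi> x"

text \<open>\<open>smooth_pos (a n)\<close> converges uniformly to the positive part, and its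
  derivative converges at every point, including the level \<open>k\<close>, with values in [0,1].
  Hence the gradients converge in L^p by domination with \<open>\<xi> * norm G\<close>.\<close>

lemma test_approx_truncate:
 fixes u :: "'a::euclidean_space => real"
 assumes p: "p > 1" and um[measurable]: "u \<in> borel_measurable borel" and Gm[measurable]: "G \<in> borel_measurable borel"
  and W: "W1p_loc \<Omega> p u G" and \<Omega>: "open \<Omega>"
  and \<xi>U: "test_fun U \<xi>" and \<xi>\<Omega>: "test_fun \<Omega> \<xi>" and \<sigma>: "\<bar>\<sigma>\<bar> = 1"
 shows "test_approx U p (%x. max (\<sigma> * u x - k) 0 * \<xi> x) (trunc_grad \<sigma> k u G \<xi>)"
proof -
 define a where "a = (%n. 1 / (real n + 1))"
 have a: "a n > 0" for n by (simp add: a_def)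
 have a0: "a \<longlonglongrightarrow> 0"
  using LIMSEQ_inverse_real_of_nat by (simp add: a_def[abs_def] inverse_eq_divide add.commute)
 have sm: "smooth_on UNIV \<xi>" using \<xi>\<Omega> by (simp add: test_fun_def)
 have [measurable]: "\<xi> \<in> borel_measurable borel" "grad \<xi> \<in> borel_measurable borel"
  using sm smooth_measurable smooth_grad_measurable by auto
 have [measurable]: "smooth_pos c \<in> borel_measurable borel" "smooth_pos' c \<in> borel_measurable borel" for c
  unfolding smooth_pos_def[abs_def] smooth_pos'_def[abs_def] by measurable
 note fin = test_fun_pnorm_finite[OF _ Gm W \<xi>\<Omega>]
 have p0: "p > 0" "p >= 0" using p by auto
 define c where "c = (%n. a n + (a n)\<^sup>2)"
 have cpos: "c n >= 0" for n using a[of n] by (simp add: c_def add_nonneg_nonneg less_imp_le)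
 have c0: "(%n. c n) \<longlonglongrightarrow> 0"
 proof -
  have "(%n. a n + (a n)\<^sup>2) \<longlonglongrightarrow> 0 + 0\<^sup>2" by (intro tendsto_intros a0)
  then show ?thesis by (simp add: c_def)
 qed
 have cl: "(%n. pnorm p (%x. c n * g x)) \<longlonglongrightarrow> 0" if [measurable]: "g \<in> borel_measurable borel" and g: "pnorm p g < \<infinity>" for g :: "'a => real"
 proof -
  have "(%n. c n powr p) \<longlonglongrightarrow> 0 powr p"
   by (rule tendsto_powr'[OF c0 tendsto_const]) (use p cpos in auto)
  then have "(%n. c n powr p) \<longlonglongrightarrow> 0" by simp
  from tendsto_ennrealI[OF this] have "(%n. ennreal (c n powr p)) \<longlonglongrightarrow> 0" by simp
  from ennreal_tendsto_cmult[OF _ this, of "pnorm p g"] g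
  have "(%n. pnorm p g * ennreal (c n powr p)) \<longlonglongrightarrow> 0" by simp
  moreover have "pnorm p (%x. c n * g x) = pnorm p g * ennreal (c n powr p)" for n
   using pnorm_cmult[of g p "c n"] cpos[of n] by (simp add: mult.commute)
  ultimately show ?thesis by simp
 qed
 show ?thesis
 proof (rule test_approx_limit[where \<phi>n="%n x. smooth_pos (a n) (\<sigma> * u x - k) * \<xi> x"
    and \<Phi>n="%n x. ((\<sigma> * smooth_pos' (a n) (\<sigma> * u x - k)) * \<xi> x) *\<^sub>R G x + smooth_pos (a n) (\<sigma> * u x - k) *\<^sub>R grad \<xi> x"])
  show "test_approx U p (%x. smooth_pos (a n) (\<sigma> * u x - k) * \<xi> x)
    (%x. ((\<sigma> * smooth_pos' (a n) (\<sigma> * u x - k)) * \<xi> x) *\<^sub>R G x + smooth_pos (a n) (\<sigma> * u x - k) *\<^sub>R grad \<xi> x)" for n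
  proof (rule test_approx_compose[OF p um Gm W \<Omega> \<xi>U \<xi>\<Omega>,
     where f="%t. smooth_pos (a n) (\<sigma> * t - k)" and f'="%t. \<sigma> * smooth_pos' (a n) (\<sigma> * t - k)"])
   show "smooth_on UNIV (%t. smooth_pos (a n) (\<sigma> * t - k))" by (rule smooth_pos_smooth[OF a])
   show "((%t. smooth_pos (a n) (\<sigma> * t - k)) has_real_derivative \<sigma> * smooth_pos' (a n) (\<sigma> * t - k)) (at t)" for t
   proof -
    have "((%t. \<sigma> * t - k) has_real_derivative \<sigma>) (at t)" by (auto intro!: derivative_eq_intros)
    from DERIV_chain'[OF this smooth_pos_deriv[OF a]] show ?thesis by (simp add: mult.commute)
   qed
   show "\<bar>\<sigma> * smooth_pos' (a n) (\<sigma> * t - k)\<bar> <= 1" for t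
    using smooth_pos'_bounds[OF a, of n "\<sigma> * t - k"] \<sigma> by (simp add: abs_mult)
   show "continuous_on UNIV (%t. \<sigma> * smooth_pos' (a n) (\<sigma> * t - k))"
    by (intro continuous_intros continuous_on_compose2[OF smooth_pos'_continuous[OF a]]) auto
  qed
  show "(%n. pnorm p (%x. smooth_pos (a n) (\<sigma> * u x - k) * \<xi> x - max (\<sigma> * u x - k) 0 * \<xi> x)) \<longlonglongrightarrow> 0"
  proof (rule pnorm_tendsto_sandwich[OF cl[of \<xi>]])
   fix n x
   have "\<bar>smooth_pos (a n) (\<sigma> * u x - k) - max (\<sigma> * u x - k) 0\<bar> * \<bar>\<xi> x\<bar> <= c n * \<bar>\<xi> x\<bar>"
    unfolding c_def by (intro mult_right_mono smooth_pos_approx a) auto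
   then show "\<bar>smooth_pos (a n) (\<sigma> * u x - k) * \<xi> x - max (\<sigma> * u x - k) 0 * \<xi> x\<bar> <= \<bar>c n * \<xi> x\<bar>"
    unfolding left_diff_distrib[symmetric] abs_mult using cpos[of n] by simp
  qed (use p0 fin(1) in auto)
  define D where "D = (%n x. \<bar>smooth_pos' (a n) (\<sigma> * u x - k) - (if \<sigma> * u x > k then 1 else 0)\<bar> * (\<xi> x * norm (G x)))"
  have [measurable]: "D n \<in> borel_measurable borel" for n unfolding D_def by measurable
  have Dl: "(%n. pnorm p (D n)) \<longlonglongrightarrow> 0"
  proof -
   have "(%n. pnorm p (D n)) \<longlonglongrightarrow> (\<integral>\<^sup>+x. 0 \<partial>(lborel::'a measure))"
    unfolding pnorm_def
   proof (rule nn_integral_dominated_convergence[where w="%x. ennreal (\<bar>\<xi> x * norm (G x)\<bar> powr p)"])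
    show "(NN x. ennreal (\<bar>\<xi> x * norm (G x)\<bar> powr p)) < \<infinity>"
     using fin(3)[OF p0(1)] by (simp add: pnorm_def)
    show "AE x in lborel. ennreal (\<bar>D n x\<bar> powr p) <= ennreal (\<bar>\<xi> x * norm (G x)\<bar> powr p)" for n
    proof (intro AE_I2 ennreal_leI powr_mono2)
     fix x
     have "\<bar>smooth_pos' (a n) (\<sigma> * u x - k) - (if \<sigma> * u x > k then 1 else 0)\<bar> <= 1"
      using smooth_pos'_bounds[OF a, of n "\<sigma> * u x - k"] by auto
     then have "\<bar>smooth_pos' (a n) (\<sigma> * u x - k) - (if \<sigma> * u x > k then 1 else 0)\<bar> * \<bar>\<xi> x * norm (G x)\<bar> <= 1 * \<bar>\<xi> x * norm (G x)\<bar>"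
      by (intro mult_right_mono) auto
     then show "\<bar>D n x\<bar> <= \<bar>\<xi> x * norm (G x)\<bar>" by (simp add: D_def abs_mult)
    qed (use p in auto)
    show "AE x in lborel. (%n. ennreal (\<bar>D n x\<bar> powr p)) \<longlonglongrightarrow> 0"
    proof (rule AE_I2)
     fix x
     have "(%n. smooth_pos' (a n) (\<sigma> * u x - k)) \<longlonglongrightarrow> (if \<sigma> * u x > k then 1 else 0)"
      using smooth_pos'_tendsto[OF a0 a, of "\<sigma> * u x - k"] by simp
     then have "(%n. D n x) \<longlonglongrightarrow> \<bar>(if \<sigma> * u x > k then 1 else 0) - (if \<sigma> * u x > k then 1 else 0)\<bar> * (\<xi> x * norm (G x))"
      unfolding D_def by (intro tendsto_mult tendsto_rabs tendsto_diff tendsto_const)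
     then have "(%n. D n x) \<longlonglongrightarrow> 0" by simp
     then have "(%n. \<bar>D n x\<bar>) \<longlonglongrightarrow> 0" by (rule tendsto_rabs_zero)
     from tendsto_powr'[OF this tendsto_const, of p] have "(%n. \<bar>D n x\<bar> powr p) \<longlonglongrightarrow> 0" using p by simp
     from tendsto_ennrealI[OF this] show "(%n. ennreal (\<bar>D n x\<bar> powr p)) \<longlonglongrightarrow> 0" by simp
    qed
   qed measurable
   then show ?thesis by simp
  qed
  show "(%n. pnorm p (%x. norm (((\<sigma> * smooth_pos' (a n) (\<sigma> * u x - k)) * \<xi> x) *\<^sub>R G x +
    smooth_pos (a n) (\<sigma> * u x - k) *\<^sub>R grad \<xi> x - trunc_grad \<sigma> k u G \<xi> x))) \<longlonglongrightarrow> 0"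
  proof (rule pnorm_tendsto_sandwich[where g="%n x. \<bar>D n x\<bar> + c n * norm (grad \<xi> x)"])
   show "(%n. pnorm p (%x. \<bar>D n x\<bar> + c n * norm (grad \<xi> x))) \<longlonglongrightarrow> 0"
   proof (rule pnorm_tendsto_add)
    show "(%n. pnorm p (%x. \<bar>D n x\<bar>)) \<longlonglongrightarrow> 0" using Dl by (simp add: pnorm_def)
    show "(%n. pnorm p (%x. c n * norm (grad \<xi> x))) \<longlonglongrightarrow> 0" by (rule cl) (use fin(2) p0 in auto)
   qed (use p0 in auto)
   fix n x
   define I where "I = (if \<sigma> * u x > k then 1 else (0::real))"
   define P where "P = smooth_pos (a n) (\<sigma> * u x - k)"
   define P' where "P' = smooth_pos' (a n) (\<sigma> * u x - k)"
   have "trunc_grad \<sigma> k u G \<xi> x = ((\<sigma> * I) * \<xi> x) *\<^sub>R G x + max (\<sigma> * u x - k) 0 *\<^sub>R grad \<xi> x"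
    by (simp add: trunc_grad_def I_def)
   then have eq: "((\<sigma> * P') * \<xi> x) *\<^sub>R G x + P *\<^sub>R grad \<xi> x - trunc_grad \<sigma> k u G \<xi> x =
     (\<sigma> * (P' - I) * \<xi> x) *\<^sub>R G x + (P - max (\<sigma> * u x - k) 0) *\<^sub>R grad \<xi> x"
    by (simp add: algebra_simps)
   have "norm (((\<sigma> * P') * \<xi> x) *\<^sub>R G x + P *\<^sub>R grad \<xi> x - trunc_grad \<sigma> k u G \<xi> x) <= \<bar>\<sigma> * (P' - I) * \<xi> x\<bar> * norm (G x) + \<bar>P - max (\<sigma> * u x - k) 0\<bar> * norm (grad \<xi> x)"
    unfolding eq by (rule order_trans[OF norm_triangle_ineq]) simp
   also have "... <= \<bar>D n x\<bar> + c n * norm (grad \<xi> x)"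
   proof (rule add_mono)
    show "\<bar>\<sigma> * (P' - I) * \<xi> x\<bar> * norm (G x) <= \<bar>D n x\<bar>"
     using \<sigma> by (simp add: D_def P'_def I_def abs_mult)
    show "\<bar>P - max (\<sigma> * u x - k) 0\<bar> * norm (grad \<xi> x) <= c n * norm (grad \<xi> x)"
     unfolding c_def P_def by (intro mult_right_mono smooth_pos_approx a) auto
   qed
   finally show "\<bar>norm (((\<sigma> * smooth_pos' (a n) (\<sigma> * u x - k)) * \<xi> x) *\<^sub>R G x +
    smooth_pos (a n) (\<sigma> * u x - k) *\<^sub>R grad \<xi> x - trunc_grad \<sigma> k u G \<xi> x)\<bar> <= \<bar>\<bar>D n x\<bar> + c n * norm (grad \<xi> x)\<bar>"
    unfolding P_def P'_def by (auto intro: order_trans[OF _ abs_ge_self])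
  qed (use p0 in auto)
  show "trunc_grad \<sigma> k u G \<xi> \<in> borel_measurable borel"
   unfolding trunc_grad_def[abs_def] by measurable
 qed (use p0 in \<open>auto\<close>)
qed

text \<open>This makes the truncation admissible as a test function in the weak equation; the bound
  \<open>M\<close> keeps the term \<open>max (\<sigma> * u - k) 0 * grad \<xi>\<close> in
  L^p.\<close>

lemma W01p_truncate:
 fixes u :: "'a::euclidean_space => real"
 assumes p: "p > 1" and um[measurable]: "u \<in> borel_measurable borel" and Gm[measurable]: "G \<in> borel_measurable borel"
  and W: "W1p_loc \<Omega> p u G" and \<Omega>: "open \<Omega>"
  and \<xi>U: "test_fun U \<xi>" and \<xi>\<Omega>: "test_fun \<Omega> \<xi>" and \<sigma>: "\<bar>\<sigma>\<bar> = 1" and M: "\<And>x. \<bar>u x\<bar> <= M"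
 shows "W01p U p (%x. max (\<sigma> * u x - k) 0 * \<xi> x) (trunc_grad \<sigma> k u G \<xi>)"
proof -
 have sm: "smooth_on UNIV \<xi>" using \<xi>\<Omega> by (simp add: test_fun_def)
 have [measurable]: "\<xi> \<in> borel_measurable borel" "grad \<xi> \<in> borel_measurable borel"
  using sm smooth_measurable smooth_grad_measurable by auto
 have tm[measurable]: "trunc_grad \<sigma> k u G \<xi> \<in> borel_measurable borel"
  unfolding trunc_grad_def[abs_def] by measurable
 have p0: "p > 0" "p >= 0" using p by auto
 note fin = test_fun_pnorm_finite[OF p0(1) Gm W \<xi>\<Omega>]
 have wb: "\<bar>max (\<sigma> * u x - k) 0\<bar> <= M + \<bar>k\<bar>" for x
 proof -
  have "\<bar>\<sigma> * u x\<bar> <= M" using M[of x] \<sigma> by (simp add: abs_mult)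
  then show ?thesis by (auto simp: max_def)
 qed
 have Mk: "M + \<bar>k\<bar> >= 0" using wb[of undefined] by linarith
 obtain S where S: "S \<subseteq> U" "\<And>x. x \<notin> S ==> \<xi> x = 0" "\<And>x. x \<notin> S ==> grad \<xi> x = 0"
  using test_fun_facts[OF \<xi>U] by metis
 show ?thesis
 proof (rule test_approx_W01p[OF _ tm _ _ _ test_approx_truncate[OF p um Gm W \<Omega> \<xi>U \<xi>\<Omega> \<sigma>]])
  show "max (\<sigma> * u x - k) 0 * \<xi> x = 0 & trunc_grad \<sigma> k u G \<xi> x = 0" if "x \<notin> U" for x
  proof -
   have "x \<notin> S" using S(1) that by blast
   then show ?thesis by (simp add: trunc_grad_def S(2,3))
  qed
  have "pnorm p (%x. max (\<sigma> * u x - k) 0 * \<xi> x) <= pnorm p (%x. (M + \<bar>k\<bar>) * \<xi> x)"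
  proof (rule pnorm_mono[OF p0(2)])
   show "\<bar>max (\<sigma> * u x - k) 0 * \<xi> x\<bar> <= \<bar>(M + \<bar>k\<bar>) * \<xi> x\<bar>" for x
    unfolding abs_mult using wb[of x] Mk by (intro mult_right_mono) auto
  qed
  also have "... < \<infinity>" using fin(1) by (subst pnorm_cmult) (auto simp: ennreal_mult_less_top)
  finally show "pnorm p (%x. max (\<sigma> * u x - k) 0 * \<xi> x) < \<infinity>" .
  have "pnorm p (%x. norm (trunc_grad \<sigma> k u G \<xi> x)) <= pnorm p (%x. \<bar>\<xi> x * norm (G x)\<bar> + (M + \<bar>k\<bar>) * norm (grad \<xi> x))"
  proof (rule pnorm_mono[OF p0(2)])
   fix x
   have "norm (trunc_grad \<sigma> k u G \<xi> x) <= norm (((if \<sigma> * u x > k then \<sigma> else 0) * \<xi> x) *\<^sub>R G x) + norm (max (\<sigma> * u x - k) 0 *\<^sub>R grad \<xi> x)"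
    unfolding trunc_grad_def by (rule norm_triangle_ineq)
   also have "... <= \<bar>\<xi> x * norm (G x)\<bar> + (M + \<bar>k\<bar>) * norm (grad \<xi> x)"
   proof (rule add_mono)
    show "norm (((if \<sigma> * u x > k then \<sigma> else 0) * \<xi> x) *\<^sub>R G x) <= \<bar>\<xi> x * norm (G x)\<bar>"
     using \<sigma> by (simp add: abs_mult)
    show "norm (max (\<sigma> * u x - k) 0 *\<^sub>R grad \<xi> x) <= (M + \<bar>k\<bar>) * norm (grad \<xi> x)"
     unfolding norm_scaleR by (intro mult_right_mono wb) auto
   qed
   finally show "\<bar>norm (trunc_grad \<sigma> k u G \<xi> x)\<bar> <= \<bar>\<bar>\<xi> x * norm (G x)\<bar> + (M + \<bar>k\<bar>) * norm (grad \<xi> x)\<bar>"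
    by (auto intro: order_trans[OF _ abs_ge_self])
  qed
  also have "... <= ennreal (2 powr p) * (pnorm p (%x. \<bar>\<xi> x * norm (G x)\<bar>) + pnorm p (%x. (M + \<bar>k\<bar>) * norm (grad \<xi> x)))"
   by (rule pnorm_add_le[OF _ _ p0(2)]) measurable
  also have "... < \<infinity>"
  proof -
   have "pnorm p (%x. \<bar>\<xi> x * norm (G x)\<bar>) < \<infinity>" using fin(3) by (simp add: pnorm_def)
   moreover have "pnorm p (%x. (M + \<bar>k\<bar>) * norm (grad \<xi> x)) < \<infinity>"
    using fin(2) by (subst pnorm_cmult) (auto simp: ennreal_mult_less_top)
   ultimately show ?thesis by (simp add: ennreal_mult_less_top)
  qed
  finally show "pnorm p (%x. norm (trunc_grad \<sigma> k u G \<xi> x)) < \<infinity>" .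
 qed measurable
qed

section \<open>Translation estimates on convex sets\<close>

lemma prob_space_unit_interval: "prob_space (density lborel (%t::real. ennreal (indicator {0..1} t)))"
proof
 have "(\<integral>\<^sup>+t. ennreal (indicator {0..1} t) \<partial>(lborel::real measure)) = (\<integral>\<^sup>+t. indicator {0..1} t \<partial>(lborel::real measure))"
  by (simp add: ennreal_indicator)
 then show "emeasure (density lborel (%t::real. ennreal (indicator {0..1} t))) (space (density lborel (%t::real. ennreal (indicator {0..1} t)))) = 1"
  by (simp add: emeasure_density)
qed

text \<open>The increment is the integral of the directional derivative along the segment, which
  stays in \<open>B\<close> by convexity. With \<open>t\<close> uniform in [0,1] this is an
  expectation, so Jensen, Fubini and translation invariance work as in
  \<open>pnorm_mollify_le\<close>.\<close>

lemma smooth_translation_estimate: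
 fixes \<psi> :: "'a::euclidean_space => real"
 assumes \<psi>: "smooth_on UNIV \<psi>" and B: "convex B" and Bm[measurable]: "B \<in> sets borel" and q: "q >= 1"
 shows "pnorm q (%x. indicator B x * indicator B (x + h) * (\<psi> (x + h) - \<psi> x)) <=
   ennreal (norm h powr q) * pnorm q (%x. indicator B x * norm (grad \<psi> x))"
proof -
 let ?M = "density lborel (%t::real. ennreal (indicator {0..1} t))"
 interpret M: prob_space ?M by (rule prob_space_unit_interval)
 have [measurable]: "\<psi> \<in> borel_measurable borel" "grad \<psi> \<in> borel_measurable borel"
  using \<psi> smooth_measurable smooth_grad_measurable by auto
 define g where "g = (%y. ennreal (\<bar>indicator B y * norm (grad \<psi> y)\<bar> powr q))"
 have [measurable]: "g \<in> borel_measurable borel" unfolding g_def by measurable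
 have FTC: "\<psi> (x + h) - \<psi> x = M.expectation (%t. grad \<psi> (x + t *\<^sub>R h) \<bullet> h)" for x
 proof -
  have "(\<integral>t. (grad \<psi> (x + t *\<^sub>R h) \<bullet> h) * indicator {0..1} t \<partial>lborel) = \<psi> (x + 1 *\<^sub>R h) - \<psi> (x + 0 *\<^sub>R h)"
  proof (rule integral_FTC_Icc_real)
   fix t :: real
   have "((%t. \<psi> (x + t *\<^sub>R h)) has_derivative (%s. grad \<psi> (x + t *\<^sub>R h) \<bullet> (s *\<^sub>R h))) (at t)"
    by (rule has_derivative_compose[OF _ smooth_has_derivative_grad[OF \<psi>]]) (auto intro!: derivative_eq_intros)
   then show "((%t. \<psi> (x + t *\<^sub>R h)) has_real_derivative grad \<psi> (x + t *\<^sub>R h) \<bullet> h) (at t)"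
    unfolding has_field_derivative_def by (rule has_derivative_eq_rhs) (auto simp: mult.commute)
   have "continuous_on UNIV (%t. grad \<psi> (x + t *\<^sub>R h) \<bullet> h)"
    by (intro continuous_intros continuous_on_compose2[OF smooth_grad_continuous[OF \<psi>]]) auto
   then show "isCont (%t. grad \<psi> (x + t *\<^sub>R h) \<bullet> h) t" by (simp add: continuous_on_eq_continuous_at)
  qed simp
  moreover have "M.expectation (%t. grad \<psi> (x + t *\<^sub>R h) \<bullet> h) = (\<integral>t. indicator {0..1} t *\<^sub>R (grad \<psi> (x + t *\<^sub>R h) \<bullet> h) \<partial>lborel)"
   by (subst integral_density) auto
  ultimately show ?thesis by (simp add: mult.commute)
 qed
 have "pnorm q (%x. indicator B x * indicator B (x + h) * (\<psi> (x + h) - \<psi> x)) <=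
   (NN x. (NN t. ennreal (indicator {0..1} t) * (ennreal (norm h powr q) * g (x + t *\<^sub>R h))))"
  unfolding pnorm_def
 proof (rule nn_integral_mono)
  fix x
  show "ennreal (\<bar>indicator B x * indicator B (x + h) * (\<psi> (x + h) - \<psi> x)\<bar> powr q) <=
   (NN t. ennreal (indicator {0..1} t) * (ennreal (norm h powr q) * g (x + t *\<^sub>R h)))"
  proof (cases "x \<in> B & x + h \<in> B")
   case True
   have "ennreal (\<bar>\<psi> (x + h) - \<psi> x\<bar> powr q) <= (\<integral>\<^sup>+t. ennreal (\<bar>grad \<psi> (x + t *\<^sub>R h) \<bullet> h\<bar> powr q) \<partial>?M)"
    unfolding FTC by (rule M.jensen_powr[OF _ q]) measurable
   also have "... = (NN t. ennreal (indicator {0..1} t) * ennreal (\<bar>grad \<psi> (x + t *\<^sub>R h) \<bullet> h\<bar> powr q))"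
    by (subst nn_integral_density) auto
   also have "... <= (NN t. ennreal (indicator {0..1} t) * (ennreal (norm h powr q) * g (x + t *\<^sub>R h)))"
   proof (rule nn_integral_mono)
    fix t :: real
    show "ennreal (indicator {0..1} t) * ennreal (\<bar>grad \<psi> (x + t *\<^sub>R h) \<bullet> h\<bar> powr q) <=
     ennreal (indicator {0..1} t) * (ennreal (norm h powr q) * g (x + t *\<^sub>R h))"
    proof (cases "t \<in> {0..1}")
     case t: True
     have "(1 - t) *\<^sub>R x + t *\<^sub>R (x + h) \<in> B" using True t B by (intro convexD_alt) auto
     moreover have "(1 - t) *\<^sub>R x + t *\<^sub>R (x + h) = x + t *\<^sub>R h" by (simp add: algebra_simps)
     ultimately have inB: "x + t *\<^sub>R h \<in> B" by simp
     have "\<bar>grad \<psi> (x + t *\<^sub>R h) \<bullet> h\<bar> powr q <= (norm (grad \<psi> (x + t *\<^sub>R h)) * norm h) powr q"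
      using q by (intro powr_mono2 Cauchy_Schwarz_ineq2) auto
     also have "... = norm h powr q * norm (grad \<psi> (x + t *\<^sub>R h)) powr q" by (simp add: powr_mult mult.commute)
     finally show ?thesis using inB t by (simp add: g_def ennreal_mult[symmetric])
    qed simp
   qed
   finally show ?thesis using True by simp
  qed (use q in auto)
 qed
 also have "... = (NN t. (NN x. ennreal (indicator {0..1} t) * (ennreal (norm h powr q) * g (x + t *\<^sub>R h))))"
  by (rule lborel_pair.Fubini') measurable
 also have "... = (\<integral>\<^sup>+t. ennreal (indicator {0..1} t) * (ennreal (norm h powr q) * (NN x. g x)) \<partial>(lborel::real measure))"
  by (simp add: nn_integral_cmult nn_integral_lborel_translate)
 also have "... = (ennreal (norm h powr q) * (NN x. g x)) * emeasure ?M (space ?M)"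
  by (subst nn_integral_multc) (simp_all add: emeasure_density mult.commute)
 also have "... = ennreal (norm h powr q) * (NN x. g x)" unfolding M.emeasure_space_1 by simp
 finally show ?thesis by (simp add: g_def pnorm_def)
qed

text \<open>The smooth estimate passes to limits with the crude triangle inequality of
  \<open>pnorm\<close>. The factor \<open>4 powr q\<close> comes from applying it twice; it does not
  depend on \<open>h\<close>, so the bound can later be integrated over \<open>h\<close>.\<close>

lemma translation_estimate:
 fixes \<phi> :: "'a::euclidean_space => real"
 assumes B: "convex B" and Bm[measurable]: "B \<in> sets borel" and q: "q >= 1"
  and [measurable]: "\<phi> \<in> borel_measurable borel" "\<Phi> \<in> borel_measurable borel"
  and ap: "\<And>e. e > 0 ==> \<exists>\<psi>. smooth_on UNIV \<psi> & pnorm q (%x. indicator B x * (\<psi> x - \<phi> x)) <= ennreal e &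
    pnorm q (%x. indicator B x * norm (grad \<psi> x - \<Phi> x)) <= ennreal e"
 shows "pnorm q (%x. indicator B x * indicator B (x + h) * (\<phi> (x + h) - \<phi> x)) <=
   ennreal (4 powr q * norm h powr q) * pnorm q (%x. indicator B x * norm (\<Phi> x))"
proof (rule ennreal_le_epsilon)
 \<comment> \<open>Collects the coefficients of \<open>e\<close> in the final bound, so that the
   approximation error is exactly \<open>e0\<close>.\<close>
 define E where "E = 4 powr q * norm h powr q + 2 powr q * (2 powr q * 2)"
 have E: "E > 0" unfolding E_def by (intro add_nonneg_pos) auto
 fix e0 :: real assume e0: "e0 > 0"
 define e where "e = e0 / E"
 have e: "e > 0" using E e0 by (simp add: e_def)
 obtain \<psi> where sm: "smooth_on UNIV \<psi>" and \<psi>1: "pnorm q (%x. indicator B x * (\<psi> x - \<phi> x)) <= ennreal e"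
   and \<psi>2: "pnorm q (%x. indicator B x * norm (grad \<psi> x - \<Phi> x)) <= ennreal e" using ap[OF e] by blast
 have [measurable]: "\<psi> \<in> borel_measurable borel" "grad \<psi> \<in> borel_measurable borel"
  using sm smooth_measurable smooth_grad_measurable by auto
 have q0: "q >= 0" using q by simp
 define A where "A = (%x. indicator B x * indicator B (x + h) * (\<psi> (x + h) - \<psi> x))"
 define D where "D = (%x. indicator B x * (\<psi> x - \<phi> x))"
 have [measurable]: "A \<in> borel_measurable borel" "D \<in> borel_measurable borel" unfolding A_def D_def by measurable
 have "pnorm q (%x. indicator B x * indicator B (x + h) * (\<phi> (x + h) - \<phi> x)) <= pnorm q (%x. \<bar>A x\<bar> + (\<bar>D (x + h)\<bar> + \<bar>D x\<bar>))"
  by (rule pnorm_mono[OF q0]) (auto simp: A_def D_def indicator_def)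
 also have "... <= ennreal (2 powr q) * (pnorm q (%x. \<bar>A x\<bar>) + pnorm q (%x. \<bar>D (x + h)\<bar> + \<bar>D x\<bar>))"
  by (rule pnorm_add_le[OF _ _ q0]) measurable
 also have "... <= ennreal (2 powr q) * (ennreal (norm h powr q) * (ennreal (2 powr q) * (ennreal e + pnorm q (%x. indicator B x * norm (\<Phi> x)))) +
   ennreal (2 powr q) * (ennreal e + ennreal e))"
 proof (intro mult_left_mono add_mono)
  have "pnorm q (%x. \<bar>A x\<bar>) = pnorm q A" by (simp add: pnorm_def)
  also have "... <= ennreal (norm h powr q) * pnorm q (%x. indicator B x * norm (grad \<psi> x))"
   unfolding A_def by (rule smooth_translation_estimate[OF sm B Bm q])
  also have "... <= ennreal (norm h powr q) * (ennreal (2 powr q) * (ennreal e + pnorm q (%x. indicator B x * norm (\<Phi> x))))"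
  proof (rule mult_left_mono)
   have "pnorm q (%x. indicator B x * norm (grad \<psi> x)) <= pnorm q (%x. indicator B x * norm (grad \<psi> x - \<Phi> x) + indicator B x * norm (\<Phi> x))"
   proof (rule pnorm_mono[OF q0])
    fix x
    show "\<bar>indicator B x * norm (grad \<psi> x)\<bar> <= \<bar>indicator B x * norm (grad \<psi> x - \<Phi> x) + indicator B x * norm (\<Phi> x)\<bar>"
     using norm_triangle_ineq[of "grad \<psi> x - \<Phi> x" "\<Phi> x"] by (cases "x \<in> B") auto
   qed
   also have "... <= ennreal (2 powr q) * (pnorm q (%x. indicator B x * norm (grad \<psi> x - \<Phi> x)) + pnorm q (%x. indicator B x * norm (\<Phi> x)))"
    by (rule pnorm_add_le[OF _ _ q0]) measurable
   also have "... <= ennreal (2 powr q) * (ennreal e + pnorm q (%x. indicator B x * norm (\<Phi> x)))"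
    by (intro mult_left_mono add_mono \<psi>2) auto
   finally show "pnorm q (%x. indicator B x * norm (grad \<psi> x)) <= ennreal (2 powr q) * (ennreal e + pnorm q (%x. indicator B x * norm (\<Phi> x)))" .
  qed simp
  finally show "pnorm q (%x. \<bar>A x\<bar>) <= ennreal (norm h powr q) * (ennreal (2 powr q) * (ennreal e + pnorm q (%x. indicator B x * norm (\<Phi> x))))" .
  have tr: "pnorm q (%x. \<bar>D (x + h)\<bar>) = pnorm q D"
   using nn_integral_lborel_translate[of "%x. ennreal (\<bar>D x\<bar> powr q)" h] by (simp add: pnorm_def)
  have "pnorm q (%x. \<bar>D (x + h)\<bar> + \<bar>D x\<bar>) <= ennreal (2 powr q) * (pnorm q (%x. \<bar>D (x + h)\<bar>) + pnorm q (%x. \<bar>D x\<bar>))"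
   by (rule pnorm_add_le[OF _ _ q0]) measurable
  also have "... = ennreal (2 powr q) * (pnorm q D + pnorm q D)" unfolding tr by (simp add: pnorm_def)
  also have "... <= ennreal (2 powr q) * (ennreal e + ennreal e)"
   using \<psi>1 unfolding D_def by (intro mult_left_mono add_mono) auto
  finally show "pnorm q (%x. \<bar>D (x + h)\<bar> + \<bar>D x\<bar>) <= ennreal (2 powr q) * (ennreal e + ennreal e)" .
 qed auto
 also have "... = ennreal (4 powr q * norm h powr q) * pnorm q (%x. indicator B x * norm (\<Phi> x)) + ennreal e0"
 proof -
  define P where "P = pnorm q (%x. indicator B x * norm (\<Phi> x))"
  have four: "(4::real) powr q = 2 powr q * 2 powr q" using powr_mult[of 2 2 q] by simp
  have nn: "0 <= e" "0 <= (2::real) powr q" "0 <= norm h powr q" using e by auto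
  have gen: "ennreal a * (ennreal n * (ennreal a * (ennreal e + P)) + ennreal a * ennreal w)
   = ennreal (a * n * a) * P + ennreal (a * n * a * e + a * (a * w))" if "0 <= a" "0 <= n" "0 <= w" for a n w
   using that nn by (simp add: ennreal_mult ennreal_plus distrib_left mult.assoc add.assoc add.commute add.left_commute)
  have ee: "ennreal e + ennreal e = ennreal (e + e)" using nn by (intro ennreal_plus[symmetric])
  have "ennreal (2 powr q) * (ennreal (norm h powr q) * (ennreal (2 powr q) * (ennreal e + P)) + ennreal (2 powr q) * (ennreal e + ennreal e))
   = ennreal (2 powr q * norm h powr q * 2 powr q) * P + ennreal (2 powr q * norm h powr q * 2 powr q * e + 2 powr q * (2 powr q * (e + e)))"
   unfolding ee by (rule gen) (use nn in auto)
  also have "2 powr q * norm h powr q * 2 powr q = 4 powr q * norm h powr q" by (simp add: four)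
  also have "4 powr q * norm h powr q * e + 2 powr q * (2 powr q * (e + e)) = E * e" by (simp add: E_def algebra_simps)
  also have "E * e = e0" using E by (simp add: e_def)
  finally show ?thesis unfolding P_def .
 qed
 finally show "pnorm q (%x. indicator B x * indicator B (x + h) * (\<phi> (x + h) - \<phi> x)) <=
   ennreal (4 powr q * norm h powr q) * pnorm q (%x. indicator B x * norm (\<Phi> x)) + ennreal e0" .
qed

section \<open>Algebraic inequalities, radial kernels and cut-offs\<close>

lemma powr_tangent:
 fixes t a q :: real assumes "t >= 0" "a >= 0" "q >= 1"
 shows "a powr q + q * a powr (q - 1) * (t - a) <= t powr q"
proof (cases "q = 1 \<or> a = 0")
 case True
 then show ?thesis
 proof
  assume "q = 1"
  then show ?thesis using assms by (cases "a = 0") auto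
 next
  assume "a = 0"
  then show ?thesis using assms by (cases "q = 1") auto
 qed
next
 case False
 then have q: "q > 1" and a: "a > 0" using assms by auto
 have "(q - 1) * (q / (q - 1)) = q" "1 / q + 1 / (q / (q - 1)) = 1" using q by (auto simp: field_simps)
 then have "t * a powr (q - 1) <= t powr q / q + (a powr q) * ((q - 1) / q)"
  using Youngs_inequality[of q "q / (q - 1)" t "a powr (q - 1)"] q assms by (simp add: powr_powr)
 then have "q * (t * a powr (q - 1)) <= q * (t powr q / q + (a powr q) * ((q - 1) / q))"
  using q by (intro mult_left_mono) auto
 also have "... = t powr q + a powr q * (q - 1)" using q by (simp add: distrib_left)
 finally have "q * (t * a powr (q - 1)) <= t powr q + a powr q * (q - 1)" .
 moreover have aa: "a * a powr (q - 1) = a powr q" using a by (simp add: powr_diff)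
 have "q * a powr (q - 1) * (t - a) = q * (t * a powr (q - 1)) - q * a powr q"
  unfolding aa[symmetric] by (simp add: algebra_simps)
 moreover have "a powr q * (q - 1) = q * a powr q - a powr q" by (simp add: algebra_simps)
 ultimately show ?thesis by linarith
qed

lemma powr_diff_le:
 fixes a b q :: real assumes "0 <= b" "b <= a" "q >= 1"
 shows "a powr q - b powr q <= q * a powr (q - 1) * (a - b)"
 using powr_tangent[of b a q] assms by (simp add: algebra_simps)

lemma powr_lipschitz_unit:
 fixes a b q :: real assumes "0 <= a" "a <= 1" "0 <= b" "b <= 1" "q >= 1"
 shows "\<bar>a powr q - b powr q\<bar> <= q * \<bar>a - b\<bar>"
proof -
 have *: "\<bar>a powr q - b powr q\<bar> <= q * \<bar>a - b\<bar>" if "0 <= b" "b <= a" "a <= 1" for a b :: real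
 proof -
  have "a powr (q - 1) <= 1" using that assms powr_mono2[of "q - 1" a 1] by simp
  then have "q * a powr (q - 1) * (a - b) <= q * 1 * (a - b)"
   using that assms by (intro mult_right_mono mult_left_mono) auto
  moreover have "b powr q <= a powr q" using that assms by (intro powr_mono2) auto
  ultimately show ?thesis using powr_diff_le[OF that(1,2) assms(5)] that by simp
 qed
 show ?thesis
  using *[of b a] *[of a b] assms by (cases "b <= a") (auto simp: abs_minus_commute)
qed

text \<open>Either \<open>\<beta> <= \<epsilon> * A\<close>, and the product is at most the first
  term, or \<open>A < \<beta> / \<epsilon>\<close>, and it is at most the second. This explicit form
  of Young's inequality is the one used to absorb gradient terms.\<close>

lemma young_absorb:
 fixes A \<beta> \<epsilon> p :: real assumes "A >= 0" "\<beta> >= 0" "\<epsilon> > 0" "p > 1"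
 shows "A powr (p - 1) * \<beta> <= \<epsilon> * A powr p + (1 / \<epsilon>) powr (p - 1) * \<beta> powr p"
proof (cases "\<beta> <= \<epsilon> * A")
 case True
 have "A powr (p - 1) * \<beta> <= A powr (p - 1) * (\<epsilon> * A)" using True by (intro mult_left_mono) auto
 also have "... = \<epsilon> * A powr p" using assms by (cases "A = 0") (auto simp: powr_diff)
 finally show ?thesis using assms by (simp add: add_increasing2)
next
 case False
 then have "A <= (1 / \<epsilon>) * \<beta>" using assms by (simp add: field_simps)
 then have "A powr (p - 1) <= ((1 / \<epsilon>) * \<beta>) powr (p - 1)" using assms by (intro powr_mono2) auto
 then have "A powr (p - 1) * \<beta> <= ((1 / \<epsilon>) * \<beta>) powr (p - 1) * \<beta>" using assms by (intro mult_right_mono) auto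
 also have "... = (1 / \<epsilon>) powr (p - 1) * \<beta> powr p"
 proof -
  have "\<beta> powr (p - 1) * \<beta> = \<beta> powr p" using assms by (cases "\<beta> = 0") (auto simp: powr_diff)
  moreover have "((1 / \<epsilon>) * \<beta>) powr (p - 1) = (1 / \<epsilon>) powr (p - 1) * \<beta> powr (p - 1)" by (rule powr_mult)
  ultimately show ?thesis by (simp only: mult.assoc)
 qed
 finally show ?thesis using assms by (simp add: add_increasing)
qed

definition jump :: "real => real => real" where
 "jump p t = \<bar>t\<bar> powr (p - 2) * t"

lemma jump_nonneg: "t >= 0 ==> jump p t = t powr (p - 1)"
proof -
 assume t: "t >= 0"
 have "t powr (p - 2) * t powr 1 = t powr (p - 2 + 1)" by (rule powr_add[symmetric])
 then show ?thesis using t by (cases "t = 0") (simp_all add: jump_def)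
qed

lemma jump_minus: "jump p (- t) = - jump p t" by (simp add: jump_def)

lemma jump_abs: "\<bar>jump p t\<bar> = \<bar>t\<bar> powr (p - 1)"
 using jump_nonneg[of "\<bar>t\<bar>" p] by (cases "t >= 0") (auto simp: jump_def abs_mult)

text \<open>The discrete counterpart of testing with \<open>a\<^sub>+ \<eta>\<^sup>p\<close>: it keeps the mixed term \<open>a\<^sub>+ b\<^sub>-\<^sup>p\<^sup>-\<^sup>1\<close>,
 which later controls the tail of a solution by its supremum.\<close>

lemma jump_caccioppoli_aux:
 fixes a b X Y p :: real
 assumes p: "p > 1" and XY: "0 <= X" "0 <= Y" and ab: "b <= a"
 shows "jump p (a - b) * (max a 0 * X powr p - max b 0 * Y powr p) >=
   max a 0 * max (- b) 0 powr (p - 1) * X powr p - p powr p * max a 0 powr p * \<bar>X - Y\<bar> powr p"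
proof -
 have J: "jump p (a - b) = (a - b) powr (p - 1)" using ab by (intro jump_nonneg) auto
 consider "a <= 0" | "a > 0" "b <= 0" | "a > 0" "b > 0" by linarith
 then show ?thesis
 proof cases
  case 1
  then show ?thesis using ab p by simp
 next
  case 2
  have "max (- b) 0 powr (p - 1) <= (a - b) powr (p - 1)" using 2 p by (intro powr_mono2) auto
  then have "max a 0 * max (- b) 0 powr (p - 1) * X powr p <= max a 0 * (a - b) powr (p - 1) * X powr p"
   using 2 by (intro mult_right_mono mult_left_mono) auto
  moreover have "(a - b) powr (p - 1) * (max a 0 * X powr p - max b 0 * Y powr p) = max a 0 * (a - b) powr (p - 1) * X powr p"
   using 2 by (simp add: max_absorb2)
  moreover have "0 <= p powr p * max a 0 powr p * \<bar>X - Y\<bar> powr p" by simp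
  ultimately show ?thesis unfolding J by linarith
 next
  case 3
  have "- (p powr p * a powr p * \<bar>X - Y\<bar> powr p) <= (a - b) powr (p - 1) * (a * X powr p - b * Y powr p)"
  proof (cases "Y <= X")
   case True
   have "b * Y powr p <= a * X powr p" using 3 ab True XY p by (intro mult_mono powr_mono2) auto
   then have "0 <= (a - b) powr (p - 1) * (a * X powr p - b * Y powr p)" by simp
   moreover have "0 <= p powr p * a powr p * \<bar>X - Y\<bar> powr p" by simp
   ultimately show ?thesis by linarith
  next
   case False
   \<comment> \<open>The cut-off increases from \<open>X\<close> to \<open>Y\<close>. From
     \<open>a * X^p - b * Y^p = (a - b) * Y^p - a * (Y^p - X^p)\<close> and the tangent bound for
     \<open>Y^p - X^p\<close>, Young's inequality with \<open>\<epsilon> = 1\<close> produces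
     exactly the good term \<open>((a - b) * Y)^p\<close> and the error term.\<close>
   define Z where "Z = (a - b) * Y"
   define W where "W = a * (Y - X)"
   have ZW: "Z >= 0" "W >= 0" using ab XY False 3 by (auto simp: Z_def W_def)
   have d: "Y powr p - X powr p <= p * Y powr (p - 1) * (Y - X)" using False XY p by (intro powr_diff_le) auto
   have eq: "a * X powr p - b * Y powr p = (a - b) * Y powr p - a * (Y powr p - X powr p)" by (simp add: algebra_simps)
   have "(a - b) powr (p - 1) * (a * (Y powr p - X powr p)) <= (a - b) powr (p - 1) * (a * (p * Y powr (p - 1) * (Y - X)))"
    using d 3 by (intro mult_left_mono) auto
   also have "... = Z powr (p - 1) * (p * W)" using ab XY by (simp add: Z_def W_def powr_mult)
   also have "... <= 1 * Z powr p + (1 / 1) powr (p - 1) * (p * W) powr p"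
    using ZW p by (intro young_absorb) auto
   also have "... = Z powr p + p powr p * a powr p * \<bar>X - Y\<bar> powr p"
    using ZW p 3 False by (simp add: W_def powr_mult abs_minus_commute)
   finally have "(a - b) powr (p - 1) * (a * (Y powr p - X powr p)) <= Z powr p + p powr p * a powr p * \<bar>X - Y\<bar> powr p" .
   moreover have "(a - b) powr (p - 1) * ((a - b) * Y powr p) = Z powr p"
    using ab XY by (cases "a = b") (auto simp: Z_def powr_mult powr_diff)
   ultimately show ?thesis unfolding eq right_diff_distrib by linarith
  qed
  then show ?thesis unfolding J using 3 p by (simp add: max_def)
 qed
qed

text \<open>Only \<open>b <= a\<close> is substantial. If \<open>a < b\<close>, a positive
  \<open>a\<close> forces \<open>b > 0\<close>, so the mixed term vanishes, and the first case with
  the arguments exchanged shows that the right side is nonnegative.\<close>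

lemma jump_caccioppoli:
 fixes a b X Y p :: real
 assumes p: "p > 1" and XY: "0 <= X" "0 <= Y"
 shows "max a 0 * max (- b) 0 powr (p - 1) * X powr p <=
   jump p (a - b) * (max a 0 * X powr p - max b 0 * Y powr p) +
   p powr p * (max a 0 powr p + max b 0 powr p) * \<bar>X - Y\<bar> powr p"
proof (cases "b <= a")
 case True
 have "p powr p * max a 0 powr p * \<bar>X - Y\<bar> powr p <= p powr p * (max a 0 powr p + max b 0 powr p) * \<bar>X - Y\<bar> powr p"
  by (intro mult_right_mono mult_left_mono) auto
 then show ?thesis using jump_caccioppoli_aux[OF p XY True] by linarith
next
 case False
 then have ab: "a <= b" by simp
 have z: "max a 0 * max (- b) 0 powr (p - 1) * X powr p = 0" using False p by (auto simp: max_def)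
 have "jump p (b - a) * (max b 0 * Y powr p - max a 0 * X powr p) = jump p (a - b) * (max a 0 * X powr p - max b 0 * Y powr p)"
  using jump_minus[of p "a - b"] by (simp add: algebra_simps)
 moreover have "p powr p * max b 0 powr p * \<bar>Y - X\<bar> powr p <= p powr p * (max a 0 powr p + max b 0 powr p) * \<bar>X - Y\<bar> powr p"
  unfolding abs_minus_commute[of Y X] by (intro mult_right_mono mult_left_mono) auto
 moreover have "0 <= max b 0 * max (- a) 0 powr (p - 1) * Y powr p" by simp
 ultimately show ?thesis using jump_caccioppoli_aux[OF p XY(2,1) ab] z by linarith
qed

text \<open>This treats a partner point outside the support of the cut-off, where no term in
  \<open>b\<close> is tested. The jump is harmful only when \<open>b > a\<close>, and then its size
  is at most \<open>max b 0 powr (p - 1)\<close>: the price is the tail of the positive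
  part.\<close>

lemma jump_tail:
 fixes a b X p :: real
 assumes p: "p > 1" and X: "0 <= X"
 shows "max a 0 * max (- b) 0 powr (p - 1) * X <= jump p (a - b) * (max a 0 * X) + max a 0 * max b 0 powr (p - 1) * X"
proof -
 have "max (- b) 0 powr (p - 1) <= jump p (a - b) + max b 0 powr (p - 1)" if a: "a > 0"
 proof (cases "b <= a")
  case True
  have "max (- b) 0 powr (p - 1) <= (a - b) powr (p - 1)" using True a p by (intro powr_mono2) auto
  then show ?thesis using True by (simp add: jump_nonneg add_increasing2)
 next
  case False
  have "jump p (a - b) = - ((b - a) powr (p - 1))" using False jump_minus[of p "b - a"] jump_nonneg[of "b - a" p] by simp
  moreover have "(b - a) powr (p - 1) <= max b 0 powr (p - 1)" using False a p by (intro powr_mono2) auto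
  ultimately show ?thesis using False a p by (simp add: max_def)
 qed
 then have "max a 0 * X * max (- b) 0 powr (p - 1) <= max a 0 * X * (jump p (a - b) + max b 0 powr (p - 1))"
  using X by (cases "a > 0") (auto intro!: mult_left_mono)
 then show ?thesis by (simp add: algebra_simps)
qed

section \<open>Integrals of radial powers\<close>

lemma measure_ball_eq:
 fixes z :: "'a::euclidean_space" assumes "r >= 0"
 shows "emeasure lborel (ball z r) = ennreal (r ^ DIM('a) * measure lborel (ball (0::'a) 1))"
proof -
 have "emeasure lborel (ball z r) = ennreal (measure lborel (ball z r))"
  by (rule emeasure_eq_ennreal_measure) (use emeasure_lborel_ball_finite[of z r] in simp)
 then show ?thesis using content_ball_conv_unit_ball[OF assms, of z] by simp
qed

lemma suminf_geometric_ennreal: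
 fixes c q :: real assumes "c >= 0" "0 <= q" "q < 1"
 shows "(\<Sum>k. ennreal (c * q ^ k)) = ennreal (c / (1 - q))"
proof -
 have "(%k. c * q ^ k) sums (c * (1 / (1 - q)))"
  by (intro sums_mult geometric_sums) (use assms in auto)
 then have "(%k. c * q ^ k) sums (c / (1 - q))" by simp
 then show ?thesis using assms
  by (subst suminf_ennreal_eq) (auto)
qed

text \<open>Dyadic shells: between the radii \<open>d (Suc k)\<close> and \<open>d k\<close> the
  integrand is at most \<open>d k powr \<alpha> * d (Suc k) powr (- N)\<close>, and the shell lies
  in a ball of volume \<open>V * d k ^ N\<close>. The resulting series is geometric with ratio
  \<open>2 powr (- \<alpha>)\<close>.\<close>

lemma radial_near:
 assumes \<alpha>: "\<alpha> > 0"
 shows "\<exists>C>0. \<forall>r>0. (NN h. ennreal (norm h powr (\<alpha> - real DIM('a))) * indicator (ball (0::'a::euclidean_space) r) h)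
   <= ennreal (C * r powr \<alpha>)"
proof -
 define N where "N = DIM('a)"
 define V where "V = measure lborel (ball (0::'a) 1)"
 have V: "V > 0" unfolding V_def by (intro content_ball_pos) auto
 define q where "q = (1/2::real) powr \<alpha>"
 have q: "0 < q" "q < 1" using \<alpha> powr_less_mono2[of \<alpha> "1/2" 1] by (auto simp: q_def)
 define C where "C = 2 ^ N * V / (1 - q)"
 have "(NN h. ennreal (norm h powr (\<alpha> - real N)) * indicator (ball (0::'a) r) h) <= ennreal (C * r powr \<alpha>)" if r: "r > 0" for r
 proof -
  define d where "d = (%k::nat. r * (1/2) ^ k)"
  have d: "d k > 0" "d (Suc k) = d k / 2" for k using r by (auto simp: d_def)
  define t where "t = (%(k::nat) (h::'a). ennreal (d k powr \<alpha> * d (Suc k) powr (- real N)) * indicator (ball 0 (d k)) h)"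
  have tm: "t k \<in> borel_measurable lborel" for k
   unfolding t_def by (intro borel_measurable_times_ennreal borel_measurable_const borel_measurable_indicator) simp
  have "(NN h. ennreal (norm h powr (\<alpha> - real N)) * indicator (ball (0::'a) r) h) <= (NN h. (\<Sum>k. t k h))"
  proof (rule nn_integral_mono)
   fix h :: 'a
   show "ennreal (norm h powr (\<alpha> - real N)) * indicator (ball (0::'a) r) h <= (\<Sum>k. t k h)"
   \<comment> \<open>The origin contributes nothing, since \<open>powr\<close> has the value 0 at
     base 0.\<close>
   proof (cases "h \<noteq> 0 & norm h < r")
    case True
    obtain n where "(1/2::real) ^ n < norm h / r" using real_arch_pow_inv[of "norm h / r" "1/2"] True r by auto
    then have ex: "d n <= norm h" using r by (simp add: d_def field_simps)
    define m where "m = (LEAST n. d n <= norm h)"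
    have m: "d m <= norm h" unfolding m_def by (rule LeastI[of "%n. d n <= norm h", OF ex])
    have "m \<noteq> 0" using m True by (auto simp: d_def intro: ccontr)
    then obtain k where k: "m = Suc k" by (cases m) auto
    have hk: "norm h < d k" using not_less_Least[of k "%n. d n <= norm h"] k by (simp add: m_def[symmetric])
    have "norm h powr (\<alpha> - real N) = norm h powr \<alpha> * norm h powr (- real N)" by (simp add: powr_add[symmetric])
    also have "... <= d k powr \<alpha> * d (Suc k) powr (- real N)"
     using hk m k \<alpha> d(1)[of "Suc k"] by (intro mult_mono powr_mono2 powr_mono2') auto
    finally have "ennreal (norm h powr (\<alpha> - real N)) * indicator (ball (0::'a) r) h <= t k h"
     using hk True by (simp add: t_def ennreal_leI)
    also have "... <= (\<Sum>k. t k h)" using sum_le_suminf[of "%k. t k h" "{k}"] by (simp add: summableI)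
    finally show ?thesis .
   qed (auto simp: indicator_def)
  qed
  also have "... = (\<Sum>k. NN h. t k h)" by (rule nn_integral_suminf[OF tm])
  also have "... = (\<Sum>k. ennreal ((2 ^ N * V * r powr \<alpha>) * q ^ k))"
  proof (rule suminf_cong)
   fix k
   have "(NN h. t k h) = ennreal (d k powr \<alpha> * d (Suc k) powr (- real N)) * emeasure lborel (ball (0::'a) (d k))"
    unfolding t_def by (rule nn_integral_cmult_indicator) simp
   also have "... = ennreal (d k powr \<alpha> * d (Suc k) powr (- real N) * (d k ^ N * V))"
    using d(1)[of k] by (simp add: measure_ball_eq ennreal_mult[symmetric] N_def V_def)
   also have "d k powr \<alpha> * d (Suc k) powr (- real N) * (d k ^ N * V) = (2 ^ N * V * r powr \<alpha>) * q ^ k"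
   proof -
    have "d (Suc k) powr (- real N) = 2 ^ N / d k ^ N"
     using d(1)[of k] by (simp add: d(2) powr_minus powr_realpow power_divide field_simps)
    moreover have "d k powr \<alpha> = r powr \<alpha> * q ^ k"
     using r by (simp add: d_def q_def powr_mult powr_realpow[symmetric] powr_powr mult.commute)
    ultimately show ?thesis using d(1)[of k] by simp
   qed
   finally show "(NN h. t k h) = ennreal ((2 ^ N * V * r powr \<alpha>) * q ^ k)" .
  qed
  also have "... = ennreal ((2 ^ N * V * r powr \<alpha>) / (1 - q))"
   by (rule suminf_geometric_ennreal) (use V q in auto)
  finally show ?thesis by (simp add: C_def)
 qed
 moreover have "C > 0" using V q by (simp add: C_def)
 ultimately show ?thesis unfolding N_def by blast
qed

text \<open>The shells of \<open>radial_near\<close> now grow outwards, \<open>d k\<close> doubling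
  with \<open>k\<close>; convergence comes from the decay
  \<open>2 powr (- \<alpha>)\<close>.\<close>

lemma radial_far:
 assumes \<alpha>: "\<alpha> > 0"
 shows "\<exists>C>0. \<forall>r>0. (NN h. ennreal (norm h powr (- (real DIM('a) + \<alpha>))) * indicator (- ball (0::'a::euclidean_space) r) h)
   <= ennreal (C * r powr (- \<alpha>))"
proof -
 define N where "N = DIM('a)"
 define V where "V = measure lborel (ball (0::'a) 1)"
 have V: "V > 0" unfolding V_def by (intro content_ball_pos) auto
 define q where "q = (2::real) powr (- \<alpha>)"
 have q: "0 < q" "q < 1" using \<alpha> by (auto simp: q_def powr_less_one)
 define C where "C = 2 ^ N * V / (1 - q)"
 have "(NN h. ennreal (norm h powr (- (real N + \<alpha>))) * indicator (- ball (0::'a) r) h) <= ennreal (C * r powr (- \<alpha>))" if r: "r > 0" for r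
 proof -
  define d where "d = (%k::nat. r * 2 ^ k)"
  have d: "d k > 0" "d (Suc k) = 2 * d k" for k using r by (auto simp: d_def)
  define t where "t = (%(k::nat) (h::'a). ennreal (d k powr (- (real N + \<alpha>))) * indicator (ball 0 (d (Suc k))) h)"
  have tm: "t k \<in> borel_measurable lborel" for k
   unfolding t_def by (intro borel_measurable_times_ennreal borel_measurable_const borel_measurable_indicator) simp
  have "(NN h. ennreal (norm h powr (- (real N + \<alpha>))) * indicator (- ball (0::'a) r) h) <= (NN h. (\<Sum>k. t k h))"
  proof (rule nn_integral_mono)
   fix h :: 'a
   show "ennreal (norm h powr (- (real N + \<alpha>))) * indicator (- ball (0::'a) r) h <= (\<Sum>k. t k h)"
   proof (cases "norm h >= r")
    case True
    obtain n where "norm h / r < 2 ^ n" using real_arch_pow[of 2 "norm h / r"] by auto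
    then have ex: "norm h < d n" using r by (simp add: d_def field_simps)
    define m where "m = (LEAST n. norm h < d n)"
    have m: "norm h < d m" unfolding m_def by (rule LeastI[of "%n. norm h < d n", OF ex])
    have "m \<noteq> 0" using m True by (auto simp: d_def intro: ccontr)
    then obtain k where k: "m = Suc k" by (cases m) auto
    have hk: "d k <= norm h" using not_less_Least[of k "%n. norm h < d n"] k by (simp add: m_def[symmetric])
    have "norm h powr (- (real N + \<alpha>)) <= d k powr (- (real N + \<alpha>))"
     using hk \<alpha> d(1)[of k] by (intro powr_mono2') auto
    then have "ennreal (norm h powr (- (real N + \<alpha>))) * indicator (- ball (0::'a) r) h <= t k h"
     using m k True by (simp add: t_def ennreal_leI)
    also have "... <= (\<Sum>k. t k h)" using sum_le_suminf[of "%k. t k h" "{k}"] by (simp add: summableI)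
    finally show ?thesis .
   qed (auto simp: indicator_def)
  qed
  also have "... = (\<Sum>k. NN h. t k h)" by (rule nn_integral_suminf[OF tm])
  also have "... = (\<Sum>k. ennreal ((2 ^ N * V * r powr (- \<alpha>)) * q ^ k))"
  proof (rule suminf_cong)
   fix k
   have "(NN h. t k h) = ennreal (d k powr (- (real N + \<alpha>))) * emeasure lborel (ball (0::'a) (d (Suc k)))"
    unfolding t_def by (rule nn_integral_cmult_indicator) simp
   also have "... = ennreal (d k powr (- (real N + \<alpha>)) * (d (Suc k) ^ N * V))"
    using d(1)[of "Suc k"] by (simp add: measure_ball_eq ennreal_mult[symmetric] N_def V_def)
   also have "d k powr (- (real N + \<alpha>)) * (d (Suc k) ^ N * V) = (2 ^ N * V * r powr (- \<alpha>)) * q ^ k"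
   proof -
    have "- (real N + \<alpha>) = - real N + - \<alpha>" by simp
    then have "d k powr (- (real N + \<alpha>)) = d k powr (- real N) * d k powr (- \<alpha>)" by (simp only: powr_add)
    moreover have "d k powr (- real N) = 1 / d k ^ N"
     using d(1)[of k] by (simp add: powr_minus powr_realpow field_simps)
    moreover have "d k powr (- \<alpha>) = r powr (- \<alpha>) * q ^ k"
     using r by (simp add: d_def q_def powr_mult powr_realpow[symmetric] powr_powr mult.commute)
    ultimately show ?thesis using d(1)[of k] by (simp add: d(2) power_mult_distrib)
   qed
   finally show "(NN h. t k h) = ennreal ((2 ^ N * V * r powr (- \<alpha>)) * q ^ k)" .
  qed
  also have "... = ennreal ((2 ^ N * V * r powr (- \<alpha>)) / (1 - q))"
   by (rule suminf_geometric_ennreal) (use V q in auto)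
  finally show ?thesis by (simp add: C_def)
 qed
 moreover have "C > 0" using V q by (simp add: C_def)
 ultimately show ?thesis unfolding N_def by blast
qed

section \<open>Cut-off functions with scale-invariant bounds\<close>

lemma mollify_indicator_grad:
 "\<exists>L>0. \<forall>e>0. \<forall>(B::'a::euclidean_space set) x. B \<in> sets borel & bounded B --> norm (grad (mollify e (indicator B)) x) <= L / e"
proof -
 define V where "V = measure lborel (ball (0::'a) 1)"
 have V: "V > 0" unfolding V_def by (intro content_ball_pos) auto
 have z: "norm x > 1 ==> mollifier x = 0" for x :: 'a by (simp add: mollifier_zero)
 obtain L0 where L0: "L0 >= 0" "\<And>x::'a. norm (grad mollifier x) <= L0"
  using compact_support_grad_bounded[OF mollifier_smooth z] by blast
 have "norm (grad (mollify e (indicator B)) x) <= ((L0 + 1) * V) / e"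
  if e: "e > 0" and [measurable]: "B \<in> sets borel" and B: "bounded B" for e and B :: "'a set" and x
 proof -
  have intB: "integrable lborel (indicator B :: 'a => real)"
   using emeasure_bounded_finite[OF B] by simp
  define k where "k = (mollifier_scaled e :: 'a => real)"
  have gk: "grad k w = (1 / e ^ DIM('a) * (1 / e)) *\<^sub>R grad mollifier ((1/e) *\<^sub>R w + 0)" for w
  proof (rule grad_eqI)
   have "((%w. mollifier ((1/e) *\<^sub>R w + 0)) has_derivative (%v. grad mollifier ((1/e) *\<^sub>R w + 0) \<bullet> ((1/e) *\<^sub>R v))) (at w)"
    by (rule has_derivative_compose[OF _ smooth_has_derivative_grad[OF mollifier_smooth]]) (auto intro!: derivative_eq_intros)
   from has_derivative_mult_right[OF this, of "1 / e ^ DIM('a)"]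
   show "(k has_derivative (\<bullet>) ((1 / e ^ DIM('a) * (1 / e)) *\<^sub>R grad mollifier ((1/e) *\<^sub>R w + 0))) (at w)"
    unfolding k_def mollifier_scaled_def[abs_def] by (rule has_derivative_eq_rhs) (auto simp: fun_eq_iff)
  qed
  have sm: "smooth_on UNIV k" unfolding k_def by (rule mollifier_scaled_smooth)
  have [measurable]: "grad k \<in> borel_measurable borel" by (rule smooth_grad_measurable[OF sm])
  have gz: "grad k w = 0" if "norm w > e" for w
  proof -
   have "open {x::'a. norm x > e}" by (intro open_Collect_less continuous_intros)
   moreover have "k y = 0" if "norm y > e" for y
    unfolding k_def by (rule mollifier_scaled_zero[OF e]) (use that in simp)
   ultimately show ?thesis
    by (intro grad_eq_0_open[of "{x. norm x > e}" _ _ 0]) (use that in auto)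
  qed
  \<comment> \<open>\<open>A\<close> bounds the gradient of the scaled kernel, of order
    \<open>e^(-N-1)\<close>. It acts on a ball of volume \<open>V * e^N\<close>, which leaves
    \<open>1/e\<close>; the constant depends on the dimension alone and not on the set
    \<open>B\<close>.\<close>
  define A where "A = 1 / e ^ DIM('a) * (1 / e) * (L0 + 1)"
  have A: "A >= 0" using e L0 by (simp add: A_def)
  have gb: "norm (grad k w) <= A" for w
  proof -
   have "norm (grad k w) = (1 / e ^ DIM('a) * (1 / e)) * norm (grad mollifier ((1/e) *\<^sub>R w + 0))"
    unfolding gk norm_scaleR using e by simp
   also have "... <= (1 / e ^ DIM('a) * (1 / e)) * (L0 + 1)"
    using e L0(2)[of "(1/e) *\<^sub>R w + 0"] by (intro mult_left_mono) auto
   finally show ?thesis by (simp add: A_def)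
  qed
  define v where "v = grad (mollify e (indicator B)) x"
  have "v \<bullet> v = (\<integral>y. (grad k (x - y) \<bullet> v) * indicator B y \<partial>lborel)"
   unfolding v_def k_def by (rule mollify_grad_inner[OF intB e])
  also have "... <= (\<integral>y. (A * norm v) * indicator (cball x e) y \<partial>lborel)"
  proof (rule integral_mono_AE')
   show "integrable lborel (%y. (A * norm v) * indicator (cball x e) y)"
    using emeasure_lborel_cball_finite[of x e] by (intro integrable_mult_right) simp
   show "AE y in lborel. (grad k (x - y) \<bullet> v) * indicator B y <= (A * norm v) * indicator (cball x e) y"
   proof (rule AE_I2)
    fix y
    show "(grad k (x - y) \<bullet> v) * indicator B y <= (A * norm v) * indicator (cball x e) y"
    proof (cases "norm (x - y) > e")
     case True
     then show ?thesis using A by (simp add: gz)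
    next
     case False
     have "grad k (x - y) \<bullet> v <= norm (grad k (x - y)) * norm v" by (rule norm_cauchy_schwarz)
     also have "... <= A * norm v" by (intro mult_right_mono gb) auto
     finally show ?thesis using False A by (auto simp: indicator_def dist_norm)
    qed
   qed
   show "AE y in lborel. 0 <= (A * norm v) * indicator (cball x e) y" using A by simp
  qed
  also have "... = A * norm v * measure lborel (cball x e)"
   by (subst integral_mult_right_zero) simp
  also have "measure lborel (cball x e) = e ^ DIM('a) * V"
   unfolding V_def using content_ball_conv_unit_ball[of e x] e by (simp add: content_cball_conv_ball)
  also have "A * norm v * (e ^ DIM('a) * V) = ((L0 + 1) * V / e) * norm v"
   using e by (simp add: A_def)
  finally have "norm v * norm v <= ((L0 + 1) * V / e) * norm v" by (simp add: dot_square_norm power2_eq_square)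
  then have "norm v <= (L0 + 1) * V / e"
   using e V L0(1) mult_right_le_imp_le[of "norm v" "norm v" "(L0 + 1) * V / e"] by (cases "v = 0") auto
  then show ?thesis by (simp add: v_def)
 qed
 then show ?thesis using V L0 by (intro exI[of _ "(L0 + 1) * V"]) auto
qed

text \<open>\<open>\<xi>\<close> is a power \<open>\<eta> ^ m\<close> with \<open>m >= p\<close> of
  a mollified indicator. The power makes \<open>grad \<xi>\<close> controllable by
  \<open>\<xi> powr ((p - 1) / p)\<close>, as the local Young inequality demands, and keeps
  \<open>\<xi> powr (1 / p)\<close> Lipschitz, as \<open>jump_caccioppoli\<close> demands, which is
  written for \<open>X powr p\<close>. Both constants scale like
  \<open>1 / (r - r')\<close>.\<close>

lemma cutoff_exists:
 assumes p: "p > 1"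
 shows "\<exists>C>0. \<forall>(z::'a::euclidean_space) r' r. 0 < r' & r' < r --> (\<exists>\<xi>. smooth_on UNIV \<xi> & (\<forall>x. 0 <= \<xi> x & \<xi> x <= 1) &
   (\<forall>x\<in>ball z r'. \<xi> x = 1) & (\<forall>x. dist z x >= (r' + r) / 2 --> \<xi> x = 0) &
   (\<forall>x. norm (grad \<xi> x) <= C / (r - r') * \<xi> x powr ((p - 1) / p)) &
   (\<forall>x y. \<bar>\<xi> x powr (1 / p) - \<xi> y powr (1 / p)\<bar> <= C / (r - r') * dist x y))"
proof -
 obtain L where L: "L > 0" and Lb: "\<And>e (B::'a set) x. e > 0 ==> B \<in> sets borel ==> bounded B ==> norm (grad (mollify e (indicator B)) x) <= L / e"
  using mollify_indicator_grad by blast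
 define m where "m = nat \<lceil>p\<rceil>"
 have mp: "real m >= p" unfolding m_def by linarith
 have m2: "m >= 2" using p mp by (cases m) (auto simp: not_le)
 define C where "C = 4 * L * real m"
 have C: "C > 0" using L m2 by (simp add: C_def)
 have "\<exists>\<xi>. smooth_on UNIV \<xi> & (\<forall>x. 0 <= \<xi> x & \<xi> x <= 1) &
   (\<forall>x\<in>ball z r'. \<xi> x = 1) & (\<forall>x. dist z x >= (r' + r) / 2 --> \<xi> x = 0) &
   (\<forall>x. norm (grad \<xi> x) <= C / (r - r') * \<xi> x powr ((p - 1) / p)) &
   (\<forall>x y. \<bar>\<xi> x powr (1 / p) - \<xi> y powr (1 / p)\<bar> <= C / (r - r') * dist x y)"
  if r: "0 < r'" "r' < r" for z :: 'a and r' r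
 proof -
  \<comment> \<open>A ball of radius \<open>r' + e\<close>, mollified with \<open>e\<close>, gives 1
    on \<open>ball z r'\<close> and 0 from radius \<open>(r' + r) / 2\<close> on. The gap that
    remains up to radius \<open>r\<close> separates the support from the exterior when tails are
    estimated.\<close>
  define e where "e = (r - r') / 4"
  have e: "e > 0" using r by (simp add: e_def)
  define B where "B = ball z (r' + e)"
  define \<eta> where "\<eta> = mollify e (indicator B :: 'a => real)"
  have intB: "integrable lborel (indicator B :: 'a => real)"
   using emeasure_lborel_ball_finite[of z "r' + e"] by (simp add: B_def)
  have sm: "smooth_on UNIV \<eta>" unfolding \<eta>_def by (rule mollify_smooth[OF intB e])
  have half: "\<bar>\<eta> x - 1/2\<bar> <= 1/2" for x
   unfolding \<eta>_def by (rule mollify_bound[OF intB e]) (auto simp: indicator_def)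
  have \<eta>01: "0 <= \<eta> x" "\<eta> x <= 1" for x using half[of x] by linarith+
  have one: "\<eta> x = 1" if "dist z x < r'" for x
  proof -
   have "\<bar>\<eta> x - 1\<bar> <= 0" unfolding \<eta>_def
   proof (rule mollify_bound[OF intB e])
    fix y assume "norm (y - x) < e"
    then have "dist z y < r' + e" using that dist_triangle[of z y x] by (simp add: dist_norm norm_minus_commute)
    then show "\<bar>indicator B y - 1\<bar> <= (0::real)" by (simp add: B_def)
   qed
   then show ?thesis by simp
  qed
  have zero: "\<eta> x = 0" if "dist z x >= (r' + r) / 2" for x
  proof -
   have "\<bar>\<eta> x - 0\<bar> <= 0" unfolding \<eta>_def
   proof (rule mollify_bound[OF intB e])
    fix y assume "norm (y - x) < e"
    moreover have "(r' + r) / 2 = r' + e + e" by (simp add: e_def field_simps)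
    ultimately have "\<not> dist z y < r' + e" using that dist_triangle[of z x y] by (simp add: dist_norm norm_minus_commute)
    then show "\<bar>indicator B y - 0\<bar> <= (0::real)" by (simp add: B_def)
   qed
   then show ?thesis by simp
  qed
  have ge: "norm (grad \<eta> x) <= L / e" for x unfolding \<eta>_def by (rule Lb) (auto simp: e B_def)
  have Le: "L / e = 4 * L / (r - r')" by (simp add: e_def)
  define \<xi> where "\<xi> = (%x. \<eta> x ^ m)"
  have xsm: "smooth_on UNIV \<xi>" unfolding \<xi>_def by (rule smooth_power[OF sm])
  have gx: "grad \<xi> x = (real m * \<eta> x ^ (m - 1)) *\<^sub>R grad \<eta> x" for x
  proof (rule grad_eqI)
   have "(\<xi> has_derivative (%v. real m * (grad \<eta> x \<bullet> v) * \<eta> x ^ (m - 1))) (at x)"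
    unfolding \<xi>_def by (rule has_derivative_power[OF smooth_has_derivative_grad[OF sm]])
   then show "(\<xi> has_derivative (\<bullet>) ((real m * \<eta> x ^ (m - 1)) *\<^sub>R grad \<eta> x)) (at x)"
    by (rule has_derivative_eq_rhs) (auto simp: fun_eq_iff)
  qed
  have gb: "norm (grad \<xi> x) <= C / (r - r') * \<xi> x powr ((p - 1) / p)" for x
  proof -
   have pw: "\<eta> x ^ (m - 1) <= \<xi> x powr ((p - 1) / p)"
   proof (cases "\<eta> x = 0")
    case True
    then show ?thesis using m2 by (simp add: power_0_left)
   next
    case False
    then have pos: "\<eta> x > 0" using \<eta>01[of x] by simp
    have "\<xi> x powr ((p - 1) / p) = \<eta> x powr (real m * ((p - 1) / p))"
     using pos by (simp add: \<xi>_def powr_realpow[symmetric] powr_powr)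
    moreover have "\<eta> x ^ (m - 1) = \<eta> x powr (real m - 1)"
     using pos m2 by (simp add: powr_realpow[symmetric] of_nat_diff)
    \<comment> \<open>Here \<open>m >= p\<close> enters: differentiating \<open>\<eta> ^ m\<close>
      lowers the exponent by 1, which is at most the allowed loss \<open>m / p\<close>.\<close>
    moreover have "real m * ((p - 1) / p) <= real m - 1"
    proof -
     have "real m * ((p - 1) / p) = real m - real m / p" using p by (simp add: field_simps)
     moreover have "1 <= real m / p" using mp p by simp
     ultimately show ?thesis by linarith
    qed
    ultimately show ?thesis using powr_mono'[of "real m * ((p - 1) / p)" "real m - 1" "\<eta> x"] \<eta>01[of x] by simp
   qed
   have "norm (grad \<xi> x) = (real m * \<eta> x ^ (m - 1)) * norm (grad \<eta> x)"
    unfolding gx norm_scaleR using \<eta>01[of x] by simp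
   also have "... <= (real m * \<xi> x powr ((p - 1) / p)) * (L / e)"
    using pw ge[of x] \<eta>01[of x] by (intro mult_mono) auto
   finally show ?thesis unfolding Le by (simp add: C_def mult_ac)
  qed
  have tb: "\<bar>\<xi> x powr (1 / p) - \<xi> y powr (1 / p)\<bar> <= C / (r - r') * dist x y" for x y
  proof -
   have pr: "\<xi> x powr (1 / p) = \<eta> x powr (real m / p)" for x
    using \<eta>01[of x] m2 p by (cases "\<eta> x = 0") (auto simp: \<xi>_def powr_realpow[symmetric] powr_powr power_0_left)
   have "\<bar>\<xi> x powr (1 / p) - \<xi> y powr (1 / p)\<bar> <= (real m / p) * \<bar>\<eta> x - \<eta> y\<bar>"
    unfolding pr using mp p by (intro powr_lipschitz_unit \<eta>01) auto
   also have "... <= real m * ((L / e) * dist x y)"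
   proof (rule mult_mono)
    show "real m / p <= real m" using p by (simp add: divide_le_eq mult_le_cancel_left1)
    show "\<bar>\<eta> x - \<eta> y\<bar> <= (L / e) * dist x y" using smooth_lipschitz[OF sm ge, of x y] by (simp add: dist_norm)
   qed auto
   finally show ?thesis unfolding Le by (simp add: C_def mult_ac)
  qed
  show ?thesis
  proof (intro exI[of _ \<xi>] conjI allI ballI impI)
   show "0 <= \<xi> x" "\<xi> x <= 1" for x using \<eta>01[of x] by (auto simp: \<xi>_def power_le_one)
   show "\<xi> x = 1" if "x \<in> ball z r'" for x using one[of x] that by (simp add: \<xi>_def)
   show "\<xi> x = 0" if "dist z x >= (r' + r) / 2" for x using zero[OF that] m2 by (simp add: \<xi>_def power_0_left)
  qed (fact xsm gb tb)+
 qed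
 then show ?thesis using C by blast
qed

lemma radial_near_at:
 assumes \<alpha>: "\<alpha> > 0"
 shows "\<exists>C>0. \<forall>r>0. \<forall>x::'a::euclidean_space. (NN y. ennreal (dist x y powr (\<alpha> - real DIM('a))) * indicator (ball x r) y)
   <= ennreal (C * r powr \<alpha>)"
proof -
 obtain C where C: "C > 0" "\<And>r. r > 0 ==> (NN h. ennreal (norm h powr (\<alpha> - real DIM('a))) * indicator (ball (0::'a) r) h) <= ennreal (C * r powr \<alpha>)"
  using radial_near[OF \<alpha>, where 'a='a] by blast
 have "(NN y. ennreal (dist x y powr (\<alpha> - real DIM('a))) * indicator (ball x r) y) =
   (NN h. ennreal (norm h powr (\<alpha> - real DIM('a))) * indicator (ball (0::'a) r) h)" for x :: 'a and r
 proof -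
  define g where "g = (%h::'a. ennreal (norm h powr (\<alpha> - real DIM('a))) * indicator {h. norm h < r} h)"
  have "{h::'a. norm h < r} \<in> sets borel" by measurable
  then have gm: "g \<in> borel_measurable borel" unfolding g_def by measurable
  have "(NN y. g (y + (- x))) = (NN h. g h)"
   by (rule nn_integral_lborel_translate[OF gm])
  then show ?thesis by (simp add: g_def dist_norm norm_minus_commute indicator_def ball_def cong: if_cong)
 qed
 then show ?thesis using C by auto
qed

lemma radial_far_at:
 assumes \<alpha>: "\<alpha> > 0"
 shows "\<exists>C>0. \<forall>r>0. \<forall>x::'a::euclidean_space. (NN y. ennreal (dist x y powr (- (real DIM('a) + \<alpha>))) * indicator (- ball x r) y)
   <= ennreal (C * r powr (- \<alpha>))"
proof -
 obtain C where C: "C > 0" "\<And>r. r > 0 ==> (NN h. ennreal (norm h powr (- (real DIM('a) + \<alpha>))) * indicator (- ball (0::'a) r) h) <= ennreal (C * r powr (- \<alpha>))"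
  using radial_far[OF \<alpha>, where 'a='a] by blast
 have "(NN y. ennreal (dist x y powr (- (real DIM('a) + \<alpha>))) * indicator (- ball x r) y) =
   (NN h. ennreal (norm h powr (- (real DIM('a) + \<alpha>))) * indicator (- ball (0::'a) r) h)" for x :: 'a and r
 proof -
  define g where "g = (%h::'a. ennreal (norm h powr (- (real DIM('a) + \<alpha>))) * indicator {h. \<not> norm h < r} h)"
  have "{h::'a. \<not> norm h < r} \<in> sets borel" by measurable
  then have gm: "g \<in> borel_measurable borel" unfolding g_def by measurable
  have "(NN y. g (y + (- x))) = (NN h. g h)"
   by (rule nn_integral_lborel_translate[OF gm])
  then show ?thesis by (simp add: g_def dist_norm norm_minus_commute indicator_def ball_def cong: if_cong)
 qed
 then show ?thesis using C by auto
qed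

text \<open>Where \<open>|f| > \<mu>\<close> one has \<open>|f| <= \<mu>^(1-p) * |f|^p\<close>. The
  free threshold \<open>\<mu>\<close> takes the place of Hoelder's inequality and is chosen later to
  balance both terms.\<close>

lemma pnorm1_le:
 fixes f :: "'a::euclidean_space => real"
 assumes [measurable]: "f \<in> borel_measurable borel" "B \<in> sets borel" and \<mu>: "\<mu> > 0" and p: "p > 1"
 shows "pnorm 1 (%x. indicator B x * f x) <= ennreal \<mu> * emeasure lborel B + ennreal (\<mu> powr (1 - p)) * pnorm p f"
proof -
 have "pnorm 1 (%x. indicator B x * f x) <= (NN x. ennreal \<mu> * indicator B x + ennreal (\<mu> powr (1 - p)) * ennreal (\<bar>f x\<bar> powr p))"
  unfolding pnorm_def
 proof (rule nn_integral_mono)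
  fix x
  show "ennreal (\<bar>indicator B x * f x\<bar> powr 1) <= ennreal \<mu> * indicator B x + ennreal (\<mu> powr (1 - p)) * ennreal (\<bar>f x\<bar> powr p)"
  proof (cases "x \<in> B")
   case True
   have "\<bar>f x\<bar> <= \<mu> + \<mu> powr (1 - p) * \<bar>f x\<bar> powr p"
   proof (cases "\<bar>f x\<bar> <= \<mu>")
    case False
    then have fpos: "\<bar>f x\<bar> > 0" using \<mu> by linarith
    have "\<bar>f x\<bar> powr (1 - p) <= \<mu> powr (1 - p)" using False \<mu> p by (intro powr_mono2') auto
    then have "\<bar>f x\<bar> powr (1 - p) * \<bar>f x\<bar> powr p <= \<mu> powr (1 - p) * \<bar>f x\<bar> powr p" by (intro mult_right_mono) auto
    moreover have "\<bar>f x\<bar> powr (1 - p) * \<bar>f x\<bar> powr p = \<bar>f x\<bar>" using fpos by (simp add: powr_add[symmetric])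
    ultimately show ?thesis using \<mu> by linarith
   qed (simp add: add_increasing2)
   then have "ennreal \<bar>f x\<bar> <= ennreal (\<mu> + \<mu> powr (1 - p) * \<bar>f x\<bar> powr p)" by (rule ennreal_leI)
   also have "... = ennreal \<mu> + ennreal (\<mu> powr (1 - p)) * ennreal (\<bar>f x\<bar> powr p)"
    using \<mu> by (simp add: ennreal_mult)
   finally show ?thesis using True by simp
  qed simp
 qed
 also have "... = ennreal \<mu> * emeasure lborel B + ennreal (\<mu> powr (1 - p)) * pnorm p f"
  unfolding pnorm_def by (subst nn_integral_add) (auto simp: nn_integral_cmult nn_integral_cmult_indicator)
 finally show ?thesis .
qed

lemma cball_enlarge:
 fixes z :: "'a::euclidean_space" assumes "open \<Omega>" "cball z \<rho> \<subseteq> \<Omega>"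
 obtains e where "e > 0" "cball z (\<rho> + e) \<subseteq> \<Omega>"
proof (cases "\<rho> >= 0")
 case True
 obtain e where e: "e > 0" "(\<Union>x\<in>cball z \<rho>. cball x e) \<subseteq> \<Omega>"
  using compact_subset_open_imp_cball_epsilon_subset[OF compact_cball assms] by blast
 have "cball z (\<rho> + e) \<subseteq> \<Omega>"
 proof
  fix y assume y: "y \<in> cball z (\<rho> + e)"
  show "y \<in> \<Omega>"
  proof (cases "dist z y <= \<rho>")
   case False
   define x where "x = z + (\<rho> / dist z y) *\<^sub>R (y - z)"
   have pos: "dist z y > 0" using False True by linarith
   have "dist z x = \<rho>" using pos True by (simp add: x_def dist_norm norm_minus_commute)
   moreover have "dist x y = dist z y - \<rho>"
   proof -
    have "y - x = (1 - \<rho> / dist z y) *\<^sub>R (y - z)" by (simp add: x_def algebra_simps)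
    then have "norm (y - x) = \<bar>1 - \<rho> / dist z y\<bar> * dist z y" by (simp add: dist_norm norm_minus_commute)
    also have "... = dist z y - \<rho>" using pos False by (simp add: abs_of_nonneg field_simps)
    finally show ?thesis by (simp add: dist_norm norm_minus_commute)
   qed
   ultimately have "x \<in> cball z \<rho>" "y \<in> cball x e" using y by auto
   then show ?thesis using e(2) by blast
  qed (use assms(2) in auto)
 qed
 then show ?thesis using that e(1) by blast
next
 case False
 then show ?thesis using that[of "- \<rho> / 2"] by auto
qed

lemma cutoff_test_fun:
 fixes z :: "'a::euclidean_space"
 assumes \<xi>: "smooth_on UNIV \<xi>" "\<And>x. dist z x >= \<rho> ==> \<xi> x = 0" and U: "cball z \<rho> \<subseteq> U"
 shows "test_fun U \<xi>"
proof -
 have sub: "closure {x. \<xi> x \<noteq> 0} \<subseteq> cball z \<rho>"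
  by (rule closure_minimal) (use \<xi>(2) in \<open>force simp: not_le\<close>, simp)
 have "compact (closure {x. \<xi> x \<noteq> 0})"
  unfolding compact_eq_bounded_closed using bounded_subset[OF bounded_cball sub] by simp
 then show ?thesis using sub U \<xi>(1) by (auto simp: test_fun_def)
qed

text \<open>A cut-off equal to 1 on the ball makes the truncations limits of test functions, so the
  translation estimate applies inside. The first part serves the Gagliardo seminorm. The second
  concerns the truncation between the levels \<open>k\<close> and \<open>k + l\<close>, a difference
  of two positive parts whose gradient lives on \<open>k < \<sigma> * u <= k + l\<close>; it is in
  L^1 because it will be compared with measures of level sets.\<close>

lemma truncation_translation:
 fixes u :: "'a::euclidean_space => real"
 assumes p: "p > 1" and um[measurable]: "u \<in> borel_measurable borel" and Gm[measurable]: "G \<in> borel_measurable borel"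
  and W: "W1p_loc \<Omega> p u G" and \<Omega>: "open \<Omega>" and \<sigma>: "\<bar>\<sigma>\<bar> = 1"
  and \<rho>: "\<rho> > 0" "cball z \<rho> \<subseteq> \<Omega>"
 shows "pnorm p (%x. indicator (ball z \<rho>) x * indicator (ball z \<rho>) (x + h) * (max (\<sigma> * u (x + h) - k) 0 - max (\<sigma> * u x - k) 0)) <=
   ennreal (4 powr p * norm h powr p) * pnorm p (%x. indicator (ball z \<rho>) x * norm ((if \<sigma> * u x > k then \<sigma> else 0) *\<^sub>R G x))" (is ?P)
  and "l >= 0 ==> pnorm 1 (%x. indicator (ball z \<rho>) x * indicator (ball z \<rho>) (x + h) *
    ((max (\<sigma> * u (x + h) - k) 0 - max (\<sigma> * u (x + h) - (k + l)) 0) - (max (\<sigma> * u x - k) 0 - max (\<sigma> * u x - (k + l)) 0))) <=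
   ennreal (4 powr 1 * norm h powr 1) * pnorm 1 (%x. indicator (ball z \<rho>) x * norm ((if \<sigma> * u x > k & \<sigma> * u x <= k + l then \<sigma> else 0) *\<^sub>R G x))"
proof -
 define B where "B = ball z \<rho>"
 have Bm[measurable]: "B \<in> sets borel" and Bc: "convex B" by (auto simp: B_def)
 obtain e0 where e0: "e0 > 0" "cball z (\<rho> + e0) \<subseteq> \<Omega>" by (rule cball_enlarge[OF \<Omega> \<rho>(2)])
 obtain \<xi> where \<xi>: "smooth_on UNIV \<xi>" "\<forall>x\<in>ball z \<rho>. \<xi> x = 1" "\<forall>x. dist z x >= (\<rho> + (\<rho> + e0)) / 2 --> \<xi> x = 0"
  using cutoff_exists[OF p, where 'a='a] \<rho> e0 by (metis less_add_same_cancel1)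
 have tf: "test_fun \<Omega> \<xi>"
 proof (rule cutoff_test_fun[OF \<xi>(1)])
  show "\<xi> x = 0" if "dist z x >= (\<rho> + (\<rho> + e0)) / 2" for x using \<xi>(3) that by blast
  have "cball z ((\<rho> + (\<rho> + e0)) / 2) \<subseteq> cball z (\<rho> + e0)" using e0 by (intro subset_cball) (simp add: field_simps)
  then show "cball z ((\<rho> + (\<rho> + e0)) / 2) \<subseteq> \<Omega>" using e0 by blast
 qed
 have gz: "grad \<xi> x = 0" if "x \<in> B" for x
  by (rule grad_eq_0_open[of B _ _ 1]) (use that \<xi>(2) in \<open>auto simp: B_def\<close>)
 have one: "\<xi> x = 1" if "x \<in> B" for x using \<xi>(2) that by (simp add: B_def)
 have [measurable]: "\<xi> \<in> borel_measurable borel" "grad \<xi> \<in> borel_measurable borel"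
  using \<xi>(1) smooth_measurable smooth_grad_measurable by auto
 have tm[measurable]: "trunc_grad \<sigma> k u G \<xi> \<in> borel_measurable borel" for k
  unfolding trunc_grad_def[abs_def] by measurable
 define \<phi> where "\<phi> = (%k x. max (\<sigma> * u x - k) 0 * \<xi> x)"
 have [measurable]: "\<phi> k \<in> borel_measurable borel" for k unfolding \<phi>_def by measurable
 have ap: "test_approx \<Omega> p (\<phi> k) (trunc_grad \<sigma> k u G \<xi>)" for k
  unfolding \<phi>_def by (rule test_approx_truncate[OF p um Gm W \<Omega> tf tf \<sigma>])
 have \<phi>B: "\<phi> k x = max (\<sigma> * u x - k) 0" if "x \<in> B" for k x using one[OF that] by (simp add: \<phi>_def)
 have gB: "trunc_grad \<sigma> k u G \<xi> x = (if \<sigma> * u x > k then \<sigma> else 0) *\<^sub>R G x" if "x \<in> B" for k x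
  using one[OF that] gz[OF that] by (simp add: trunc_grad_def)
 have p0: "p >= 0" using p by simp
 show ?P
  unfolding B_def[symmetric]
 proof (rule translation_estimate[OF Bc Bm, where \<phi>="%x. max (\<sigma> * u x - k) 0"])
  fix e :: real assume "e > 0"
  then obtain \<psi> where \<psi>: "test_fun \<Omega> \<psi>" "pnorm p (%x. \<psi> x - \<phi> k x) <= ennreal e"
    "pnorm p (%x. norm (grad \<psi> x - trunc_grad \<sigma> k u G \<xi> x)) <= ennreal e"
   using ap[of k] unfolding test_approx_def by blast
  have "pnorm p (%x. indicator B x * (\<psi> x - max (\<sigma> * u x - k) 0)) <= pnorm p (%x. \<psi> x - \<phi> k x)"
   by (rule pnorm_mono[OF p0]) (auto simp: \<phi>B indicator_def)
  moreover have "pnorm p (%x. indicator B x * norm (grad \<psi> x - (if \<sigma> * u x > k then \<sigma> else 0) *\<^sub>R G x)) <= pnorm p (%x. norm (grad \<psi> x - trunc_grad \<sigma> k u G \<xi> x))"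
   by (rule pnorm_mono[OF p0]) (auto simp: gB indicator_def)
  ultimately show "\<exists>\<psi>. smooth_on UNIV \<psi> & pnorm p (%x. indicator B x * (\<psi> x - max (\<sigma> * u x - k) 0)) <= ennreal e &
    pnorm p (%x. indicator B x * norm (grad \<psi> x - (if \<sigma> * u x > k then \<sigma> else 0) *\<^sub>R G x)) <= ennreal e"
   using \<psi> by (intro exI[of _ \<psi>]) (auto simp: test_fun_def intro: order_trans)
 qed (use p in auto)
 assume l: "l >= 0"
 let ?f = "%x. max (\<sigma> * u x - k) 0 - max (\<sigma> * u x - (k + l)) 0"
 let ?G = "%x. (if \<sigma> * u x > k & \<sigma> * u x <= k + l then \<sigma> else 0) *\<^sub>R G x"
 show "pnorm 1 (%x. indicator (ball z \<rho>) x * indicator (ball z \<rho>) (x + h) * (?f (x + h) - ?f x)) <=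
   ennreal (4 powr 1 * norm h powr 1) * pnorm 1 (%x. indicator (ball z \<rho>) x * norm (?G x))"
  unfolding B_def[symmetric]
 proof (rule translation_estimate[OF Bc Bm, where \<phi>="?f"])
  fix e :: real assume e: "e > 0"
  define V where "V = measure lborel B"
  have V: "emeasure lborel B = ennreal V" "V >= 0" unfolding V_def B_def
   using emeasure_lborel_ball_finite[of z \<rho>] by (auto intro!: emeasure_eq_ennreal_measure)
  \<comment> \<open>\<open>\<mu>\<close> and \<open>d\<close> are tuned so that
    \<open>pnorm1_le\<close> turns an L^p error \<open>d\<close> into an L^1 error of at most
    \<open>e / 4\<close>; the difference of two approximations then costs
    \<open>2 * (e / 4 + e / 4) = e\<close>.\<close>
  define \<mu> where "\<mu> = e / (8 * (V + 1))"
  have \<mu>: "\<mu> > 0" using e V by (simp add: \<mu>_def)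
  define d where "d = e / 8 / \<mu> powr (1 - p)"
  have d: "d > 0" using e \<mu> by (simp add: d_def)
  have "\<forall>j. \<exists>\<psi>. test_fun \<Omega> \<psi> & pnorm p (%x. \<psi> x - \<phi> j x) <= ennreal d &
    pnorm p (%x. norm (grad \<psi> x - trunc_grad \<sigma> j u G \<xi> x)) <= ennreal d"
   using ap d unfolding test_approx_def by blast
  from choice[OF this] obtain \<psi> where \<psi>': "\<forall>j. test_fun \<Omega> (\<psi> j) & pnorm p (%x. \<psi> j x - \<phi> j x) <= ennreal d &
    pnorm p (%x. norm (grad (\<psi> j) x - trunc_grad \<sigma> j u G \<xi> x)) <= ennreal d" by blast
  have \<psi>: "test_fun \<Omega> (\<psi> j)" "pnorm p (%x. \<psi> j x - \<phi> j x) <= ennreal d"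
    "pnorm p (%x. norm (grad (\<psi> j) x - trunc_grad \<sigma> j u G \<xi> x)) <= ennreal d" for j
   using \<psi>' by blast+
  have sm: "smooth_on UNIV (\<psi> j)" for j using \<psi>(1) by (simp add: test_fun_def)
  have [measurable]: "\<psi> j \<in> borel_measurable borel" "grad (\<psi> j) \<in> borel_measurable borel" for j
   using sm smooth_measurable smooth_grad_measurable by auto
  have small: "pnorm 1 (%x. indicator B x * g x) <= ennreal (e / 4)" if [measurable]: "g \<in> borel_measurable borel" and g: "pnorm p g <= ennreal d" for g :: "'a => real"
  proof -
   have "pnorm 1 (%x. indicator B x * g x) <= ennreal \<mu> * emeasure lborel B + ennreal (\<mu> powr (1 - p)) * pnorm p g"
    by (rule pnorm1_le[OF _ _ \<mu> p]) measurable
   also have "... <= ennreal \<mu> * ennreal V + ennreal (\<mu> powr (1 - p)) * ennreal d"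
    unfolding V(1) by (intro add_mono mult_left_mono g) auto
   also have "... = ennreal (\<mu> * V + \<mu> powr (1 - p) * d)" using \<mu> V d by (simp add: ennreal_mult[symmetric] ennreal_plus[symmetric] del: ennreal_plus)
   also have "... <= ennreal (e / 4)"
   proof (rule ennreal_leI)
    have "\<mu> * V <= \<mu> * (V + 1)" using \<mu> by (intro mult_left_mono) auto
    also have "... = e / 8"
    proof -
     define V1 where "V1 = V + 1"
     have "V1 > 0" using V(2) by (simp add: V1_def)
     then show ?thesis unfolding \<mu>_def V1_def[symmetric] by (simp add: field_simps)
    qed
    finally have "\<mu> * V <= e / 8" .
    moreover have "\<mu> powr (1 - p) * d = e / 8" using \<mu> by (simp add: d_def)
    ultimately show "\<mu> * V + \<mu> powr (1 - p) * d <= e / 4" by simp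
   qed
   finally show ?thesis .
  qed
  have comb: "pnorm 1 (%x. \<bar>indicator B x * a x\<bar> + \<bar>indicator B x * b x\<bar>) <= ennreal e"
   if [measurable]: "a \<in> borel_measurable borel" "b \<in> borel_measurable borel" and ab: "pnorm p a <= ennreal d" "pnorm p b <= ennreal d" for a b :: "'a => real"
  proof -
   have "pnorm 1 (%x. \<bar>indicator B x * a x\<bar> + \<bar>indicator B x * b x\<bar>) <= ennreal (2 powr 1) * (pnorm 1 (%x. \<bar>indicator B x * a x\<bar>) + pnorm 1 (%x. \<bar>indicator B x * b x\<bar>))"
    by (rule pnorm_add_le) auto
   also have "... = ennreal 2 * (pnorm 1 (%x. indicator B x * a x) + pnorm 1 (%x. indicator B x * b x))"
    by (simp add: pnorm_def)
   also have "... <= ennreal 2 * (ennreal (e/4) + ennreal (e/4))"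
    by (intro mult_left_mono add_mono small ab) auto
   also have "ennreal (e/4) + ennreal (e/4) = ennreal (e/4 + e/4)" using e by (intro ennreal_plus[symmetric]) auto
   also have "ennreal 2 * ennreal (e/4 + e/4) = ennreal (2 * (e/4 + e/4))" using e by (intro ennreal_mult[symmetric]) auto
   also have "2 * (e/4 + e/4) = e" by simp
   finally show ?thesis .
  qed
  have sd: "smooth_on UNIV (%x. \<psi> k x + (-1) * \<psi> (k + l) x)"
   by (intro smooth_add smooth_mult smooth_const sm)
  have gd: "grad (%x. \<psi> k x + (-1) * \<psi> (k + l) x) x = grad (\<psi> k) x - grad (\<psi> (k + l)) x" for x
  proof (rule grad_eqI)
   have "((%x. \<psi> k x + (-1) * \<psi> (k + l) x) has_derivative (%v. grad (\<psi> k) x \<bullet> v + (-1) * (grad (\<psi> (k + l)) x \<bullet> v))) (at x)"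
    by (intro has_derivative_add has_derivative_mult_right smooth_has_derivative_grad sm)
   then show "((%x. \<psi> k x + (-1) * \<psi> (k + l) x) has_derivative (\<bullet>) (grad (\<psi> k) x - grad (\<psi> (k + l)) x)) (at x)"
    by (rule has_derivative_eq_rhs) (auto simp: fun_eq_iff inner_diff_left)
  qed
  show "\<exists>\<psi>. smooth_on UNIV \<psi> & pnorm 1 (%x. indicator B x * (\<psi> x - ?f x)) <= ennreal e &
    pnorm 1 (%x. indicator B x * norm (grad \<psi> x - ?G x)) <= ennreal e"
  proof (intro exI[of _ "%x. \<psi> k x + (-1) * \<psi> (k + l) x"] conjI sd)
   have "pnorm 1 (%x. indicator B x * (\<psi> k x + (-1) * \<psi> (k + l) x - ?f x)) <=
     pnorm 1 (%x. \<bar>indicator B x * (\<psi> k x - \<phi> k x)\<bar> + \<bar>indicator B x * (\<psi> (k + l) x - \<phi> (k + l) x)\<bar>)"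
    by (rule pnorm_mono) (auto simp: \<phi>B indicator_def)
   also have "... <= ennreal e" by (rule comb) (use \<psi> in auto)
   finally show "pnorm 1 (%x. indicator B x * (\<psi> k x + (-1) * \<psi> (k + l) x - ?f x)) <= ennreal e" .
   have "pnorm 1 (%x. indicator B x * norm (grad (%x. \<psi> k x + (-1) * \<psi> (k + l) x) x - ?G x)) <=
     pnorm 1 (%x. \<bar>indicator B x * norm (grad (\<psi> k) x - trunc_grad \<sigma> k u G \<xi> x)\<bar> + \<bar>indicator B x * norm (grad (\<psi> (k + l)) x - trunc_grad \<sigma> (k + l) u G \<xi> x)\<bar>)"
   proof (rule pnorm_mono)
    fix x
    show "\<bar>indicator B x * norm (grad (%x. \<psi> k x + (-1) * \<psi> (k + l) x) x - ?G x)\<bar> <=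
     \<bar>\<bar>indicator B x * norm (grad (\<psi> k) x - trunc_grad \<sigma> k u G \<xi> x)\<bar> + \<bar>indicator B x * norm (grad (\<psi> (k + l)) x - trunc_grad \<sigma> (k + l) u G \<xi> x)\<bar>\<bar>"
    proof (cases "x \<in> B")
     case True
     have "?G x = trunc_grad \<sigma> k u G \<xi> x - trunc_grad \<sigma> (k + l) u G \<xi> x"
      using l by (simp add: gB[OF True])
     then have "grad (%x. \<psi> k x + (-1) * \<psi> (k + l) x) x - ?G x =
      (grad (\<psi> k) x - trunc_grad \<sigma> k u G \<xi> x) - (grad (\<psi> (k + l)) x - trunc_grad \<sigma> (k + l) u G \<xi> x)"
      unfolding gd by (simp add: algebra_simps)
     then show ?thesis using True norm_triangle_ineq4[of "grad (\<psi> k) x - trunc_grad \<sigma> k u G \<xi> x" "grad (\<psi> (k + l)) x - trunc_grad \<sigma> (k + l) u G \<xi> x"]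
      by simp
    qed simp
   qed simp
   also have "... <= ennreal e" by (rule comb) (use \<psi> in auto)
   finally show "pnorm 1 (%x. indicator B x * norm (grad (%x. \<psi> k x + (-1) * \<psi> (k + l) x) x - ?G x)) <= ennreal e" .
  qed
 qed (use p in auto)
qed

section \<open>The Caccioppoli inequality\<close>

lemma nn_integral_lborel_pair:
 fixes f :: "'a::euclidean_space => 'b::euclidean_space => ennreal"
 assumes m: "(%(x, y). f x y) \<in> borel_measurable (borel \<Otimes>\<^sub>M borel)"
 shows "(NN z. (case z of (x, y) => f x y)) = (NN x. NN y. f x y)"
  and "(NN z. (case z of (x, y) => f x y)) = (NN y. NN x. f x y)"
proof -
 have m': "(%(x, y). f x y) \<in> borel_measurable (lborel \<Otimes>\<^sub>M lborel)"
  using m by (simp add: measurable_def space_pair_measure cong: sets_pair_measure_cong)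
 show "(NN z. (case z of (x, y) => f x y)) = (NN x. NN y. f x y)"
  using lborel.nn_integral_fst[OF m'] unfolding lborel_prod by simp
 show "(NN z. (case z of (x, y) => f x y)) = (NN y. NN x. f x y)"
  using lborel_pair.nn_integral_snd[OF m'] unfolding lborel_prod by simp
qed

text \<open>The model kernel \<open>|x - y|^(-N-a)\<close>, to which \<open>K\<close> is comparable
  for \<open>a = p * s\<close>. On the diagonal its value is 0, by the convention for
  \<open>powr\<close> at base 0.\<close>

definition riesz :: "real => 'a::euclidean_space => 'a => real" where
 "riesz a x y = dist x y powr (- (real DIM('a) + a))"

lemma riesz_nonneg: "riesz a x y >= 0" by (simp add: riesz_def)

lemma riesz_commute: "riesz a x y = riesz a y x" by (simp add: riesz_def dist_commute)

lemma riesz_measurable[measurable]: "(%(x, y). riesz a x y) \<in> borel_measurable (borel \<Otimes>\<^sub>M borel)"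
 unfolding riesz_def by measurable

lemma riesz_measurable2[measurable (raw)]:
 assumes [measurable]: "f \<in> borel_measurable M" "g \<in> borel_measurable M"
 shows "(%x. riesz a (f x) (g x)) \<in> borel_measurable M"
 unfolding riesz_def by measurable

text \<open>A weak solution after regularisation: \<open>u\<close> and its weak gradient
  \<open>G\<close> are Borel functions, the bound \<open>M\<close> holds at every point, and the
  structure conditions on \<open>B\<close> are recorded along \<open>(u, G)\<close> only. Constants
  derived from it must depend on \<open>p\<close>, \<open>s\<close>, \<open>\<Lambda>\<close>,
  \<open>C1\<close>, \<open>C2\<close> and the dimension alone, hence they are quantified outside
  the locale.\<close>

locale mixed_solution =
 fixes \<Omega> :: "'a::euclidean_space set" and p s \<Lambda> C1 C2 M :: real
  and B :: "'a => real => 'a => 'a" and K :: "'a => 'a => real" and u :: "'a => real" and G :: "'a => 'a"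
 assumes p: "1 < p" and s: "0 < s" "s < 1" and \<Lambda>: "\<Lambda> >= 1" and C1: "C1 > 0" and C2: "C2 > 0"
  and \<Omega>: "open \<Omega>" and um[measurable]: "u \<in> borel_measurable borel" and Gm[measurable]: "G \<in> borel_measurable borel"
  and uM: "\<And>x. \<bar>u x\<bar> <= M" and W: "W1p_loc \<Omega> p u G"
  and Bm: "(%x. indicator \<Omega> x *\<^sub>R B x (u x) (G x)) \<in> borel_measurable lebesgue"
  and Bs: "AE x in lebesgue. x \<in> \<Omega> --> B x (u x) (G x) \<bullet> G x >= C1 * norm (G x) powr p &
                      norm (B x (u x) (G x)) <= C2 * norm (G x) powr (p - 1)"
  and Km: "(%(x, y). K x y) \<in> borel_measurable lebesgue"
  and Kb: "\<And>x y. x \<noteq> y ==> inverse \<Lambda> * riesz (p * s) x y <= K x y & K x y <= \<Lambda> * riesz (p * s) x y"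
  and weq: "\<And>\<Omega>' \<phi> \<Phi>. cc_subset \<Omega>' \<Omega> ==> W01p \<Omega>' p \<phi> \<Phi> ==>
      (LINT x:\<Omega>'|lebesgue. B x (u x) (G x) \<bullet> \<Phi> x) +
      (\<integral>z. (case z of (x, y) =>
         \<bar>u x - u y\<bar> powr (p - 2) * (u x - u y) * (\<phi> x - \<phi> y) * K x y) \<partial>lebesgue) = 0"
begin

lemma M_nonneg: "M >= 0" using uM[of undefined] by linarith

lemma G_finite_ball:
 assumes "cball z \<rho> \<subseteq> \<Omega>"
 shows "(NN x. ennreal (norm (G x) powr p) * indicator (cball z \<rho>) x) < \<infinity>"
proof -
 have "set_integrable lebesgue (cball z \<rho>) (%x. norm (G x) powr p)"
  using W assms compact_cball[of z \<rho>] unfolding W1p_loc_def by blast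
 moreover have [measurable]: "cball z \<rho> \<in> sets borel" by simp
 ultimately have "integrable lborel (%x. indicator (cball z \<rho>) x * norm (G x) powr p)"
  unfolding set_integrable_def by (subst (asm) integrable_completion; simp)
 then have "(NN x. ennreal (norm (indicator (cball z \<rho>) x * norm (G x) powr p))) < \<infinity>"
  unfolding integrable_iff_bounded by blast
 also have "(NN x. ennreal (norm (indicator (cball z \<rho>) x * norm (G x) powr p))) = (NN x. ennreal (norm (G x) powr p) * indicator (cball z \<rho>) x)"
  by (intro nn_integral_cong) (auto simp: indicator_def)
 finally show ?thesis .
qed

text \<open>The gradient controls the fractional energy: increments by \<open>h\<close> have
  \<open>pnorm\<close> of order \<open>norm h powr p\<close>, and
  \<open>norm h powr (p - p * s - N)\<close> is integrable near 0 because \<open>s < 1\<close>. For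
  \<open>norm h >= 2 * \<rho>\<close> no pair of points \<open>x\<close> and \<open>x + h\<close>
  lies in the ball.\<close>

lemma gagliardo_finite:
 assumes \<rho>: "\<rho> > 0" "cball z \<rho> \<subseteq> \<Omega>"
 shows "(NN x. NN y. ennreal (indicator (ball z \<rho>) x * indicator (ball z \<rho>) y * (\<bar>u x - u y\<bar> powr p * riesz (p * s) x y))) < \<infinity>"
proof -
 define Bz where "Bz = ball z \<rho>"
 have [measurable]: "Bz \<in> sets borel" by (simp add: Bz_def)
 define \<alpha> where "\<alpha> = p - p * s"
 have \<alpha>: "\<alpha> > 0" using p s by (simp add: \<alpha>_def)
 obtain Cn where Cn: "Cn > 0" "\<And>r. r > 0 ==> (NN h. ennreal (norm h powr (\<alpha> - real DIM('a))) * indicator (ball (0::'a) r) h) <= ennreal (Cn * r powr \<alpha>)"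
  using radial_near[OF \<alpha>, where 'a='a] by blast
 define PG where "PG = pnorm p (%x. indicator Bz x * norm ((if 1 * u x > - M - 1 then 1 else 0::real) *\<^sub>R G x))"
 have PG: "PG < \<infinity>"
 proof -
  have "PG <= (NN x. ennreal (norm (G x) powr p) * indicator (cball z \<rho>) x)"
   unfolding PG_def pnorm_def using p
   by (intro nn_integral_mono) (auto simp: indicator_def Bz_def intro!: ennreal_leI)
  then show ?thesis using G_finite_ball[OF \<rho>(2)] le_less_trans by blast
 qed
 define D where "D = (%h x. indicator Bz x * indicator Bz (x + h) * (u (x + h) - u x))"
 have Dm[measurable]: "(%(h, x). D h x) \<in> borel_measurable (borel \<Otimes>\<^sub>M borel)" unfolding D_def by measurable
 have [measurable]: "D h \<in> borel_measurable borel" for h unfolding D_def by measurable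
 have est: "pnorm p (D h) <= ennreal (4 powr p * norm h powr p) * PG" for h
 proof -
  \<comment> \<open>Truncating at the level \<open>- M - 1\<close>, below all values, turns the
    estimate for positive parts into one for \<open>u\<close> itself.\<close>
  have "max (1 * u x - (- M - 1)) 0 = u x + M + 1" for x using uM[of x] by (auto simp: max_def)
  then have "D h = (%x. indicator (ball z \<rho>) x * indicator (ball z \<rho>) (x + h) * (max (1 * u (x + h) - (- M - 1)) 0 - max (1 * u x - (- M - 1)) 0))"
   by (simp add: D_def Bz_def)
  then show ?thesis
   using truncation_translation(1)[OF p um Gm W \<Omega> _ \<rho>, of 1 h "- M - 1"] by (simp add: PG_def Bz_def)
 qed
 have "(NN x. NN y. ennreal (indicator Bz x * indicator Bz y * (\<bar>u x - u y\<bar> powr p * riesz (p * s) x y)))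
   = (NN x. NN h. ennreal (\<bar>D h x\<bar> powr p) * ennreal (norm h powr (- (real DIM('a) + p * s))))"
 proof (rule nn_integral_cong)
  fix x
  have "(NN y. ennreal (indicator Bz x * indicator Bz y * (\<bar>u x - u y\<bar> powr p * riesz (p * s) x y)))
   = (NN h. ennreal (indicator Bz x * indicator Bz (h + x) * (\<bar>u x - u (h + x)\<bar> powr p * riesz (p * s) x (h + x))))"
   by (rule nn_integral_lborel_translate[symmetric]) measurable
  also have "... = (NN h. ennreal (\<bar>D h x\<bar> powr p) * ennreal (norm h powr (- (real DIM('a) + p * s))))"
  proof (rule nn_integral_cong)
   fix h
   have "dist x (h + x) = norm h" by (simp add: dist_norm)
   then show "ennreal (indicator Bz x * indicator Bz (h + x) * (\<bar>u x - u (h + x)\<bar> powr p * riesz (p * s) x (h + x))) =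
    ennreal (\<bar>D h x\<bar> powr p) * ennreal (norm h powr (- (real DIM('a) + p * s)))"
    using p by (auto simp: D_def riesz_def indicator_def abs_minus_commute add.commute ennreal_mult[symmetric])
  qed
  finally show "(NN y. ennreal (indicator Bz x * indicator Bz y * (\<bar>u x - u y\<bar> powr p * riesz (p * s) x y))) =
   (NN h. ennreal (\<bar>D h x\<bar> powr p) * ennreal (norm h powr (- (real DIM('a) + p * s))))" .
 qed
 also have "... = (NN h. NN x. ennreal (\<bar>D h x\<bar> powr p) * ennreal (norm h powr (- (real DIM('a) + p * s))))"
  by (rule lborel_pair.Fubini') measurable
 also have "... = (NN h. pnorm p (D h) * ennreal (norm h powr (- (real DIM('a) + p * s))))"
  unfolding pnorm_def by (intro nn_integral_cong nn_integral_multc) measurable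
 also have "... <= (NN h. (ennreal (4 powr p) * PG) * (ennreal (norm h powr (\<alpha> - real DIM('a))) * indicator (ball (0::'a) (2 * \<rho>)) h))"
 proof (rule nn_integral_mono)
  fix h :: 'a
  show "pnorm p (D h) * ennreal (norm h powr (- (real DIM('a) + p * s))) <=
   (ennreal (4 powr p) * PG) * (ennreal (norm h powr (\<alpha> - real DIM('a))) * indicator (ball (0::'a) (2 * \<rho>)) h)"
  proof (cases "norm h < 2 * \<rho>")
   case False
   have "D h x = 0" for x
   proof (rule ccontr)
    assume "D h x \<noteq> 0"
    then have "x \<in> Bz" "x + h \<in> Bz" by (auto simp: D_def indicator_def split: if_splits)
    then have "dist z x < \<rho>" "dist z (x + h) < \<rho>" by (auto simp: Bz_def)
    then have "dist x (x + h) < 2 * \<rho>" using dist_triangle[of x "x + h" z] by (simp add: dist_commute)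
    then show False using False by (simp add: dist_norm)
   qed
   then have "pnorm p (D h) = 0" using p by (simp add: pnorm_def)
   then show ?thesis by simp
  next
   case True
   have eq: "norm h powr p * norm h powr (- (real DIM('a) + p * s)) = norm h powr (\<alpha> - real DIM('a))"
    by (simp add: powr_add[symmetric] \<alpha>_def algebra_simps)
   have "pnorm p (D h) * ennreal (norm h powr (- (real DIM('a) + p * s))) <=
     ennreal (4 powr p * norm h powr p) * PG * ennreal (norm h powr (- (real DIM('a) + p * s)))"
    by (intro mult_right_mono est) auto
   also have "... = (ennreal (4 powr p) * PG) * ennreal (norm h powr p * norm h powr (- (real DIM('a) + p * s)))"
    by (simp add: ennreal_mult mult_ac)
   finally show ?thesis unfolding eq using True by simp
  qed
 qed
 also have "... = (ennreal (4 powr p) * PG) * (NN h. ennreal (norm h powr (\<alpha> - real DIM('a))) * indicator (ball (0::'a) (2 * \<rho>)) h)"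
 proof (rule nn_integral_cmult)
  have [measurable]: "ball (0::'a) (2 * \<rho>) \<in> sets borel" by simp
  show "(%h::'a. ennreal (norm h powr (\<alpha> - real DIM('a))) * indicator (ball 0 (2 * \<rho>)) h) \<in> borel_measurable lborel" by measurable
 qed
 also have "... <= (ennreal (4 powr p) * PG) * ennreal (Cn * (2 * \<rho>) powr \<alpha>)"
  by (rule mult_left_mono[OF Cn(2)]) (use \<rho> in auto)
 also have "... < \<infinity>" using PG by (simp add: ennreal_mult_less_top)
 finally show ?thesis by (simp add: Bz_def)
qed

text \<open>The double integral in the weak equation is a Bochner integral, which would be 0 by
  default if it diverged; integrability must be known before it can be split or estimated.\<close>

lemma nonlocal_integrable:
 assumes \<rho>: "0 < \<rho>'" "\<rho>' < \<rho>" "cball z \<rho> \<subseteq> \<Omega>" and \<sigma>: "\<bar>\<sigma>\<bar> = 1"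
  and \<xi>m[measurable]: "\<xi> \<in> borel_measurable borel" and \<xi>01: "\<And>x. 0 <= \<xi> x" "\<And>x. \<xi> x <= 1"
  and \<xi>z: "\<And>x. dist z x >= (\<rho>' + \<rho>) / 2 ==> \<xi> x = 0"
  and \<xi>L: "\<And>x y. \<bar>\<xi> x - \<xi> y\<bar> <= Lx * dist x y"
 shows "integrable lebesgue (%w. case w of (x, y) => \<bar>u x - u y\<bar> powr (p - 2) * (u x - u y) *
   (max (\<sigma> * u x - k) 0 * \<xi> x - max (\<sigma> * u y - k) 0 * \<xi> y) * K x y)"
proof -
 define \<phi> where "\<phi> = (%x. max (\<sigma> * u x - k) 0 * \<xi> x)"
 define Bz where "Bz = ball z \<rho>"
 define Sz where "Sz = ball z ((\<rho>' + \<rho>) / 2)"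
 have [measurable]: "Bz \<in> sets borel" "Sz \<in> sets borel" by (auto simp: Bz_def Sz_def)
 have SB: "Sz \<subseteq> Bz" unfolding Bz_def Sz_def using \<rho> by (intro subset_ball) auto
 have \<phi>m[measurable]: "\<phi> \<in> borel_measurable borel" unfolding \<phi>_def by measurable
 define Mp where "Mp = M + \<bar>k\<bar>"
 have pos: "0 <= max (\<sigma> * u x - k) 0" "max (\<sigma> * u x - k) 0 <= Mp" for x
 proof -
  have "\<bar>\<sigma> * u x\<bar> <= M" using uM[of x] \<sigma> by (simp add: abs_mult)
  then show "0 <= max (\<sigma> * u x - k) 0" "max (\<sigma> * u x - k) 0 <= Mp" by (auto simp: max_def Mp_def)
 qed
 have Mp: "Mp >= 0" using M_nonneg by (simp add: Mp_def)
 have \<xi>S: "\<xi> x = 0" if "x \<notin> Sz" for x using \<xi>z[of x] that by (simp add: Sz_def)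
 have \<phi>b: "0 <= \<phi> x" "\<phi> x <= Mp" for x
  using pos[of x] \<xi>01[of x] mult_mono[of "max (\<sigma> * u x - k) 0" Mp "\<xi> x" 1] by (auto simp: \<phi>_def)
 have \<phi>S: "\<phi> x = 0" if "x \<notin> Sz" for x using \<xi>S[OF that] by (simp add: \<phi>_def)
 have Lx: "Lx * dist x y >= 0" for x y :: 'a using \<xi>L[of x y] by linarith
 have \<phi>d: "\<bar>\<phi> x - \<phi> y\<bar> <= \<bar>u x - u y\<bar> + Mp * Lx * dist x y" for x y
 proof -
  have "\<bar>\<sigma> * u x - \<sigma> * u y\<bar> = \<bar>u x - u y\<bar>" using \<sigma> by (simp add: abs_mult right_diff_distrib[symmetric])
  then have d: "\<bar>max (\<sigma> * u x - k) 0 - max (\<sigma> * u y - k) 0\<bar> <= \<bar>u x - u y\<bar>" by (auto simp: max_def)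
  have "\<phi> x - \<phi> y = (max (\<sigma> * u x - k) 0 - max (\<sigma> * u y - k) 0) * \<xi> x + max (\<sigma> * u y - k) 0 * (\<xi> x - \<xi> y)"
   by (simp add: \<phi>_def algebra_simps)
  also have "\<bar>...\<bar> <= \<bar>max (\<sigma> * u x - k) 0 - max (\<sigma> * u y - k) 0\<bar> * \<bar>\<xi> x\<bar> + \<bar>max (\<sigma> * u y - k) 0\<bar> * \<bar>\<xi> x - \<xi> y\<bar>"
   by (rule order_trans[OF abs_triangle_ineq]) (simp add: abs_mult)
  also have "... <= \<bar>u x - u y\<bar> * 1 + Mp * (Lx * dist x y)"
   using pos[of y] by (intro add_mono mult_mono d \<xi>L) (use \<xi>01[of x] Mp in auto)
  finally show ?thesis by simp
 qed
 define F where "F = (%x y. \<bar>u x - u y\<bar> powr (p - 2) * (u x - u y) * (\<phi> x - \<phi> y) * K x y)"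
 define c where "c = (Mp * \<bar>Lx\<bar>) powr p"
 define c2 where "c2 = (2 * M) powr (p - 1) * Mp"
 define R where "R = (%x y::'a. riesz (p * s) x y)"
 have R0: "R x y >= 0" for x y by (simp add: R_def riesz_nonneg)
 have [measurable]: "(%(x, y). R x y) \<in> borel_measurable (borel \<Otimes>\<^sub>M borel)" unfolding R_def by measurable
 \<comment> \<open>Majorants: \<open>H1\<close> is the fractional energy of \<open>u\<close> in the
   ball, \<open>H2\<close> the contribution of the Lipschitz cut-off, and \<open>H3\<close> the
   interaction of the support with the exterior of the ball, needed in both orders of the
   variables.\<close>
 define H1 where "H1 = (%x y. ennreal (indicator Bz x * indicator Bz y * (\<bar>u x - u y\<bar> powr p * R x y)))"
 define H2 where "H2 = (%x y. ennreal (indicator Bz x * indicator Bz y * (dist x y powr p * R x y)))"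
 define H3 where "H3 = (%x y. ennreal (indicator Sz x * indicator (- Bz) y * R x y))"
 define H where "H = (%x y. ennreal (2 * \<Lambda>) * H1 x y + (ennreal (c * \<Lambda>) * H2 x y + (ennreal (c2 * \<Lambda>) * H3 x y + ennreal (c2 * \<Lambda>) * H3 y x)))"
 have Hm[measurable]: "(%(x, y). H1 x y) \<in> borel_measurable (borel \<Otimes>\<^sub>M borel)" "(%(x, y). H2 x y) \<in> borel_measurable (borel \<Otimes>\<^sub>M borel)"
   "(%(x, y). H3 x y) \<in> borel_measurable (borel \<Otimes>\<^sub>M borel)" "(%(x, y). H3 y x) \<in> borel_measurable (borel \<Otimes>\<^sub>M borel)"
  unfolding H1_def H2_def H3_def R_def by measurable
 have bound: "ennreal \<bar>F x y\<bar> <= H x y" for x y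
 proof (cases "x = y")
  case True
  then show ?thesis by (simp add: F_def)
 next
  case False
  have K: "\<bar>K x y\<bar> <= \<Lambda> * R x y"
  proof -
   have "0 <= inverse \<Lambda> * R x y" using \<Lambda> R0 by simp
   then show ?thesis using Kb[OF False] unfolding R_def by linarith
  qed
  have J: "\<bar>\<bar>u x - u y\<bar> powr (p - 2) * (u x - u y)\<bar> = \<bar>u x - u y\<bar> powr (p - 1)"
   using jump_abs[of p "u x - u y"] by (simp add: jump_def)
  have FF: "\<bar>F x y\<bar> <= \<bar>u x - u y\<bar> powr (p - 1) * \<bar>\<phi> x - \<phi> y\<bar> * (\<Lambda> * R x y)"
   unfolding F_def abs_mult[of _ "K x y"] abs_mult[of _ "\<phi> x - \<phi> y"] J using K by (intro mult_left_mono) auto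
  have far: "\<bar>F x y\<bar> <= c2 * \<Lambda> * R x y" if "\<bar>\<phi> x - \<phi> y\<bar> <= Mp"
  proof -
   have "\<bar>u x - u y\<bar> powr (p - 1) <= (2 * M) powr (p - 1)"
    using uM[of x] uM[of y] p by (intro powr_mono2) auto
   then have "\<bar>u x - u y\<bar> powr (p - 1) * \<bar>\<phi> x - \<phi> y\<bar> * (\<Lambda> * R x y) <= (2 * M) powr (p - 1) * Mp * (\<Lambda> * R x y)"
    using that \<Lambda> R0 by (intro mult_mono) auto
   then show ?thesis using FF by (simp add: c2_def mult.assoc)
  qed
  \<comment> \<open>In the second and third case the test function vanishes at both points; in the
    last two the gap between \<open>Sz\<close> and \<open>Bz\<close> keeps the pair away from the
    diagonal.\<close>
  consider "x \<in> Bz & y \<in> Bz" | "x \<notin> Bz & y \<notin> Sz" | "x \<notin> Sz & y \<notin> Bz" | "x \<in> Sz & y \<notin> Bz" | "y \<in> Sz & x \<notin> Bz" by blast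
  then show ?thesis
  proof cases
   case 1
   have "\<bar>u x - u y\<bar> powr (p - 1) * \<bar>\<phi> x - \<phi> y\<bar> <= \<bar>u x - u y\<bar> powr (p - 1) * (\<bar>u x - u y\<bar> + Mp * Lx * dist x y)"
    by (intro mult_left_mono \<phi>d) auto
   also have "... = \<bar>u x - u y\<bar> powr p + \<bar>u x - u y\<bar> powr (p - 1) * (Mp * Lx * dist x y)"
   proof -
    have "\<bar>u x - u y\<bar> powr (p - 1) * \<bar>u x - u y\<bar> = \<bar>u x - u y\<bar> powr p"
     by (cases "u x = u y") (auto simp: powr_diff)
    then show ?thesis by (simp only: distrib_left)
   qed
   also have "... <= \<bar>u x - u y\<bar> powr p + (1 * \<bar>u x - u y\<bar> powr p + (1 / 1) powr (p - 1) * (Mp * Lx * dist x y) powr p)"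
    using Mp Lx[of x y] p by (intro add_left_mono young_absorb) (auto simp: mult.assoc)
   also have "(Mp * Lx * dist x y) powr p = c * dist x y powr p"
   proof -
    have "Lx >= 0" using Lx[of x y] False by (simp add: zero_le_mult_iff)
    then show ?thesis using Mp by (simp add: c_def powr_mult)
   qed
   finally have "\<bar>u x - u y\<bar> powr (p - 1) * \<bar>\<phi> x - \<phi> y\<bar> <= 2 * \<bar>u x - u y\<bar> powr p + c * dist x y powr p" by simp
   then have "\<bar>u x - u y\<bar> powr (p - 1) * \<bar>\<phi> x - \<phi> y\<bar> * (\<Lambda> * R x y) <= (2 * \<bar>u x - u y\<bar> powr p + c * dist x y powr p) * (\<Lambda> * R x y)"
    using \<Lambda> R0 by (intro mult_right_mono) auto
   also have "... = 2 * \<Lambda> * (\<bar>u x - u y\<bar> powr p * R x y) + c * \<Lambda> * (dist x y powr p * R x y)" by (simp add: algebra_simps)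
   finally have "\<bar>F x y\<bar> <= 2 * \<Lambda> * (\<bar>u x - u y\<bar> powr p * R x y) + c * \<Lambda> * (dist x y powr p * R x y)" using FF by linarith
   then have "ennreal \<bar>F x y\<bar> <= ennreal (2 * \<Lambda> * (\<bar>u x - u y\<bar> powr p * R x y) + c * \<Lambda> * (dist x y powr p * R x y))" by (rule ennreal_leI)
   also have "... = ennreal (2 * \<Lambda>) * H1 x y + ennreal (c * \<Lambda>) * H2 x y"
   proof -
    have "ennreal (2 * \<Lambda> * (\<bar>u x - u y\<bar> powr p * R x y) + c * \<Lambda> * (dist x y powr p * R x y)) =
     ennreal (2 * \<Lambda> * (\<bar>u x - u y\<bar> powr p * R x y)) + ennreal (c * \<Lambda> * (dist x y powr p * R x y))"
     by (rule ennreal_plus) (use \<Lambda> R0 in \<open>auto simp: c_def\<close>)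
    also have "... = ennreal (2 * \<Lambda>) * ennreal (\<bar>u x - u y\<bar> powr p * R x y) + ennreal (c * \<Lambda>) * ennreal (dist x y powr p * R x y)"
     using \<Lambda> R0 by (intro arg_cong2[of _ _ _ _ "(+)"] ennreal_mult) (auto simp: c_def)
    finally show ?thesis using 1 by (simp add: H1_def H2_def)
   qed
   also have "... <= H x y" unfolding H_def by (intro add_left_mono) (simp add: add_increasing2)
   finally show ?thesis .
  next
   case 2
   then have "\<phi> x = 0" "\<phi> y = 0" using \<phi>S SB by blast+
   then show ?thesis by (simp add: F_def)
  next
   case 3
   then have "\<phi> x = 0" "\<phi> y = 0" using \<phi>S SB by blast+
   then show ?thesis by (simp add: F_def)
  next
   case 4
   then have "\<phi> y = 0" using \<phi>S SB by blast
   then have "\<bar>F x y\<bar> <= c2 * \<Lambda> * R x y" using \<phi>b[of x] by (intro far) auto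
   then have "ennreal \<bar>F x y\<bar> <= ennreal (c2 * \<Lambda> * R x y)" by (rule ennreal_leI)
   also have "... = ennreal (c2 * \<Lambda>) * H3 x y"
    using 4 \<Lambda> R0 Mp by (simp add: H3_def ennreal_mult c2_def)
   also have "... <= H x y" unfolding H_def by (simp add: add_increasing add_increasing2)
   finally show ?thesis .
  next
   case 5
   then have "\<phi> x = 0" using \<phi>S SB by blast
   then have "\<bar>F x y\<bar> <= c2 * \<Lambda> * R x y" using \<phi>b[of y] by (intro far) auto
   then have "ennreal \<bar>F x y\<bar> <= ennreal (c2 * \<Lambda> * R x y)" by (rule ennreal_leI)
   also have "... = ennreal (c2 * \<Lambda>) * H3 y x"
    using 5 \<Lambda> R0 Mp riesz_commute[of "p * s" x y] by (simp add: H3_def ennreal_mult c2_def R_def)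
   also have "... <= H x y" unfolding H_def by (simp add: add_increasing)
   finally show ?thesis .
  qed
 qed
 define \<alpha> where "\<alpha> = p - p * s"
 have \<alpha>: "\<alpha> > 0" and ps: "p * s > 0" using p s by (auto simp: \<alpha>_def)
 obtain Cn where Cn: "Cn > 0" "\<And>r x. r > 0 ==> (NN y. ennreal (dist x y powr (\<alpha> - real DIM('a))) * indicator (ball (x::'a) r) y) <= ennreal (Cn * r powr \<alpha>)"
  using radial_near_at[OF \<alpha>, where 'a='a] by blast
 obtain Cf where Cf: "Cf > 0" "\<And>r x. r > 0 ==> (NN y. ennreal (dist x y powr (- (real DIM('a) + p * s))) * indicator (- ball (x::'a) r) y) <= ennreal (Cf * r powr (- (p * s)))"
  using radial_far_at[OF ps, where 'a='a] by blast
 have finB: "emeasure lborel Bz < \<infinity>" "emeasure lborel Sz < \<infinity>"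
  unfolding Bz_def Sz_def by (rule emeasure_lborel_ball_finite)+
 have f1: "(NN x. NN y. H1 x y) < \<infinity>"
  unfolding H1_def R_def Bz_def using gagliardo_finite[of \<rho> z] \<rho> by simp
 have f2: "(NN x. NN y. H2 x y) < \<infinity>"
 proof -
  have "(NN x. NN y. H2 x y) <= (NN x. ennreal (Cn * (2 * \<rho>) powr \<alpha>) * indicator Bz x)"
  proof (rule nn_integral_mono)
   fix x
   show "(NN y. H2 x y) <= ennreal (Cn * (2 * \<rho>) powr \<alpha>) * indicator Bz x"
   proof (cases "x \<in> Bz")
    case True
    have "(NN y. H2 x y) <= (NN y. ennreal (dist x y powr (\<alpha> - real DIM('a))) * indicator (ball x (2 * \<rho>)) y)"
    proof (rule nn_integral_mono)
     fix y
     have "dist x y powr p * riesz (p * s) x y = dist x y powr (\<alpha> - real DIM('a))"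
      by (simp add: riesz_def powr_add[symmetric] \<alpha>_def algebra_simps)
     moreover have "y \<in> ball x (2 * \<rho>)" if "y \<in> Bz"
     proof -
      have "dist z x < \<rho>" "dist z y < \<rho>" using True that by (auto simp: Bz_def)
      then show ?thesis using dist_triangle[of x y z] by (simp add: dist_commute)
     qed
     ultimately show "H2 x y <= ennreal (dist x y powr (\<alpha> - real DIM('a))) * indicator (ball x (2 * \<rho>)) y"
      using True by (auto simp: H2_def R_def indicator_def)
    qed
    also have "... <= ennreal (Cn * (2 * \<rho>) powr \<alpha>)" by (rule Cn(2)) (use \<rho> in auto)
    finally show ?thesis using True by simp
   qed (simp add: H2_def)
  qed
  also have "... = ennreal (Cn * (2 * \<rho>) powr \<alpha>) * emeasure lborel Bz" by (rule nn_integral_cmult_indicator) simp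
  also have "... < \<infinity>" using finB by (simp add: ennreal_mult_less_top)
  finally show ?thesis .
 qed
 have f3: "(NN x. NN y. H3 x y) < \<infinity>"
 proof -
  define d0 where "d0 = (\<rho> - \<rho>') / 2"
  have d0: "d0 > 0" using \<rho> by (simp add: d0_def)
  have "(NN x. NN y. H3 x y) <= (NN x. ennreal (Cf * d0 powr (- (p * s))) * indicator Sz x)"
  proof (rule nn_integral_mono)
   fix x
   show "(NN y. H3 x y) <= ennreal (Cf * d0 powr (- (p * s))) * indicator Sz x"
   proof (cases "x \<in> Sz")
    case True
    have "(NN y. H3 x y) <= (NN y. ennreal (dist x y powr (- (real DIM('a) + p * s))) * indicator (- ball x d0) y)"
    proof (rule nn_integral_mono)
     fix y
     have "y \<in> - ball x d0" if "y \<notin> Bz"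
     proof -
      have "dist z x < (\<rho>' + \<rho>) / 2" "dist z y >= \<rho>" using True that by (auto simp: Bz_def Sz_def)
      then show ?thesis using dist_triangle[of z y x] by (simp add: d0_def field_simps)
     qed
     then show "H3 x y <= ennreal (dist x y powr (- (real DIM('a) + p * s))) * indicator (- ball x d0) y"
      using True by (auto simp: H3_def R_def riesz_def indicator_def)
    qed
    also have "... <= ennreal (Cf * d0 powr (- (p * s)))" by (rule Cf(2)[OF d0])
    finally show ?thesis using True by simp
   qed (simp add: H3_def)
  qed
  also have "... = ennreal (Cf * d0 powr (- (p * s))) * emeasure lborel Sz" by (rule nn_integral_cmult_indicator) simp
  also have "... < \<infinity>" using finB by (simp add: ennreal_mult_less_top)
  finally show ?thesis .
 qed
 let ?c = "%f w. case w of (x::'a, y::'a) => f x y"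
 have bp: "f \<in> borel_measurable (borel \<Otimes>\<^sub>M borel) ==> f \<in> borel_measurable lborel" for f :: "'a \<times> 'a => ennreal"
  by (simp add: borel_prod)
 have Hfin: "(NN w. ?c H w) < \<infinity>"
 proof -
  have "(NN w. ?c H w) = (NN w. ennreal (2 * \<Lambda>) * ?c H1 w + (ennreal (c * \<Lambda>) * ?c H2 w + (ennreal (c2 * \<Lambda>) * ?c H3 w + ennreal (c2 * \<Lambda>) * ?c (%x y. H3 y x) w)))"
   by (intro nn_integral_cong) (auto simp: H_def)
  also have "... = ennreal (2 * \<Lambda>) * (NN w. ?c H1 w) + (ennreal (c * \<Lambda>) * (NN w. ?c H2 w) +
    (ennreal (c2 * \<Lambda>) * (NN w. ?c H3 w) + ennreal (c2 * \<Lambda>) * (NN w. ?c (%x y. H3 y x) w)))"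
   using Hm[THEN bp] by (simp add: nn_integral_add nn_integral_cmult)
  also have "... < \<infinity>"
   using f1 f2 f3 unfolding nn_integral_lborel_pair(1)[OF Hm(1)] nn_integral_lborel_pair(1)[OF Hm(2)] nn_integral_lborel_pair(1)[OF Hm(3)]
    nn_integral_lborel_pair(2)[OF Hm(4)] by (simp add: ennreal_mult_less_top)
  finally show ?thesis .
 qed
 have HBm: "?c H \<in> borel_measurable (borel \<Otimes>\<^sub>M borel)"
  unfolding H_def by measurable
 have "integrable lebesgue (?c F)"
 proof (rule integrableI_bounded)
  have m1: "(%(x, y). \<bar>u x - u y\<bar> powr (p - 2) * (u x - u y) * (\<phi> x - \<phi> y)) \<in> borel_measurable (borel \<Otimes>\<^sub>M borel)" by measurable
  then have "(%(x, y). \<bar>u x - u y\<bar> powr (p - 2) * (u x - u y) * (\<phi> x - \<phi> y)) \<in> borel_measurable lebesgue"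
   by (simp add: borel_prod measurable_completion)
  from borel_measurable_times[OF this Km] show "?c F \<in> borel_measurable lebesgue"
   by (simp add: F_def case_prod_beta')
  have "(\<integral>\<^sup>+w. ennreal (norm (?c F w)) \<partial>lebesgue) <= (\<integral>\<^sup>+w. ?c H w \<partial>lebesgue)"
   by (intro nn_integral_mono) (use bound in auto)
  also have "... = (NN w. ?c H w)" by (rule nn_integral_completion)
  also have "... < \<infinity>" by (rule Hfin)
  finally show "(\<integral>\<^sup>+w. ennreal (norm (?c F w)) \<partial>lebesgue) < \<infinity>" .
 qed
 then show ?thesis by (simp add: F_def \<phi>_def)
qed

end

text \<open>Recentring the kernel from \<open>x\<close> to the centre \<open>z\<close>. The triangle
  inequality gives \<open>dist z y - (\<rho>' + \<rho>) / 2 <= dist x y\<close>, and since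
  \<open>dist z y >= \<rho>\<close> the left side is at least the fraction
  \<open>(\<rho> - \<rho>') / (2 * \<rho>)\<close> of \<open>dist z y\<close>.\<close>

lemma riesz_far_le:
 fixes z :: "'a::euclidean_space"
 assumes "0 < \<rho>'" "\<rho>' < \<rho>" "dist z x < (\<rho>' + \<rho>) / 2" "dist z y >= \<rho>" "a > 0"
 shows "riesz a x y <= (2 * (\<rho> / (\<rho> - \<rho>'))) powr (real DIM('a) + a) * riesz a z y"
proof -
 define D where "D = 2 * (\<rho> / (\<rho> - \<rho>'))"
 have D: "D > 0" using assms by (simp add: D_def)
 have zy: "dist z y > 0" using assms by linarith
 have "dist z y <= D * dist x y"
 proof -
  have "dist z y <= dist z x + dist x y" by (rule dist_triangle)
  then have 1: "dist z y - (\<rho>' + \<rho>) / 2 <= dist x y" using assms by linarith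
  have "dist z y * (\<rho> - \<rho>') <= 2 * \<rho> * (dist z y - (\<rho>' + \<rho>) / 2)"
  proof -
   have "0 <= (\<rho>' + \<rho>) * (dist z y - \<rho>)" using assms by simp
   then show ?thesis by (simp add: algebra_simps)
  qed
  also have "... <= 2 * \<rho> * dist x y" using 1 assms by (intro mult_left_mono) auto
  finally show ?thesis using assms by (simp add: D_def field_simps)
 qed
 then have xy: "dist z y / D <= dist x y" using D by (simp add: field_simps)
 have "riesz a x y <= (dist z y / D) powr (- (real DIM('a) + a))"
  unfolding riesz_def using xy zy D assms by (intro powr_mono2') auto
 also have "... = D powr (real DIM('a) + a) * riesz a z y"
 proof -
  define e where "e = real DIM('a) + a"
  have "(dist z y / D) powr (- e) = D powr e * dist z y powr (- e)"
  proof -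
   have "(dist z y / D) powr (- e) = dist z y powr (- e) / D powr (- e)" by (rule powr_divide)
   also have "D powr (- e) = 1 / D powr e" by (rule powr_minus_divide)
   finally show ?thesis by (simp add: mult.commute)
  qed
  then show ?thesis by (simp add: riesz_def e_def)
 qed
 finally show ?thesis unfolding D_def .
qed

text \<open>The equation is tested with \<open>max (\<sigma> * u - k) 0 * \<xi>\<close>.
  \<open>H\<close> measures the tail relative to the height \<open>Mm\<close>, so that local and
  nonlocal errors take one common form. The exponent \<open>N + p\<close> of
  \<open>\<rho> / (\<rho> - \<rho>')\<close> dominates both the power \<open>p\<close> from the
  cut-off and the power \<open>N + p * s\<close> from recentring the kernel. In the mixed term on
  the left \<open>y\<close> ranges over the whole space; \<open>positive_tail\<close> exploits
  this.\<close>

lemma caccioppoli: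
 fixes p s \<Lambda> C1 C2 :: real
 assumes par: "1 < p" "0 < s" "s < 1" "\<Lambda> >= 1" "C1 > 0" "C2 > 0"
 shows "\<exists>C>0. \<forall>(\<Omega>::'a::euclidean_space set) M B K u G. mixed_solution \<Omega> p s \<Lambda> C1 C2 M B K u G -->
  (\<forall>z \<rho> \<rho>' k \<sigma> Mm H. 0 < \<rho>' & \<rho>' < \<rho> & \<rho> <= 1 & cball z \<rho> \<subseteq> \<Omega> & \<bar>\<sigma>\<bar> = 1 & Mm > 0 & H >= 0 &
   (AE x in lborel. x \<in> ball z \<rho> --> \<sigma> * u x <= k + Mm) &
   (NN y. ennreal (max (\<sigma> * u y - k) 0 powr (p - 1) * riesz (p * s) z y) * indicator (- ball z \<rho>) y) <= ennreal (H * Mm powr (p - 1) * \<rho> powr (- p)) -->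
   (NN x. ennreal (if \<sigma> * u x > k then norm (G x) powr p else 0) * indicator (ball z \<rho>') x) +
   (NN x. NN y. ennreal (indicator (ball z \<rho>') x * (max (\<sigma> * u x - k) 0 * max (k - \<sigma> * u y) 0 powr (p - 1) * riesz (p * s) x y)))
   <= ennreal (C * (1 + H) * (\<rho> / (\<rho> - \<rho>')) powr (real DIM('a) + p) * \<rho> powr (- p) * Mm powr p * measure lborel {x \<in> ball z \<rho>. \<sigma> * u x > k}))"
proof -
 define \<alpha> where "\<alpha> = p - p * s"
 have \<alpha>: "\<alpha> > 0" and ps: "p * s > 0" "p * s < p" using par by (auto simp: \<alpha>_def)
 obtain Cn where Cn: "Cn > 0" "\<And>r x. r > 0 ==> (NN y. ennreal (dist x y powr (\<alpha> - real DIM('a))) * indicator (ball (x::'a) r) y) <= ennreal (Cn * r powr \<alpha>)"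
  using radial_near_at[OF \<alpha>, where 'a='a] by blast
 obtain Cc where Cc: "Cc > 0" and cut: "\<And>(z::'a) r' r. 0 < r' ==> r' < r ==> (\<exists>\<xi>. smooth_on UNIV \<xi> & (\<forall>x. 0 <= \<xi> x & \<xi> x <= 1) &
   (\<forall>x\<in>ball z r'. \<xi> x = 1) & (\<forall>x. dist z x >= (r' + r) / 2 --> \<xi> x = 0) &
   (\<forall>x. norm (grad \<xi> x) <= Cc / (r - r') * \<xi> x powr ((p - 1) / p)) &
   (\<forall>x y. \<bar>\<xi> x powr (1 / p) - \<xi> y powr (1 / p)\<bar> <= Cc / (r - r') * dist x y))"
  using cutoff_exists[OF par(1), where 'a='a] by blast
 \<comment> \<open>\<open>k1\<close> stems from absorbing into half of the coercive term,
   \<open>k2\<close> from the cut-off in pairs inside the ball, \<open>k3\<close> from the tail. The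
   factor \<open>2 / C1 + \<Lambda>\<close> appears because the gradient term and the mixed term are
   bounded separately by the same total.\<close>
 define k1 where "k1 = (2 / C1) powr (p - 1) * (C2 * Cc) powr p"
 define k2 where "k2 = p powr p * Cc powr p * 2 * Cn * 2 powr \<alpha>"
 define k3 where "k3 = 2 * 2 powr (real DIM('a) + p * s)"
 define C where "C = (2 / C1 + \<Lambda>) * (k1 + \<Lambda> * (k2 + k3))"
 have kk: "k1 > 0" "k2 > 0" "k3 > 0" using par Cc Cn by (auto simp: k1_def k2_def k3_def)
 have C: "C > 0" unfolding C_def using par kk by (intro mult_pos_pos add_pos_pos) auto
 show ?thesis
 proof (intro exI[of _ C] conjI C allI impI, elim conjE)
  fix \<Omega> :: "'a set" and M B K u G z \<rho> \<rho>' k \<sigma> Mm H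
  assume sol: "mixed_solution \<Omega> p s \<Lambda> C1 C2 M B K u G"
   and \<rho>: "0 < \<rho>'" "\<rho>' < \<rho>" "\<rho> <= 1" "cball z \<rho> \<subseteq> \<Omega>" and \<sigma>: "\<bar>\<sigma>\<bar> = 1" and Mm: "Mm > 0" and H: "H >= 0"
   and ub: "AE x in lborel. x \<in> ball z \<rho> --> \<sigma> * u x <= k + Mm"
   and tail: "(NN y. ennreal (max (\<sigma> * u y - k) 0 powr (p - 1) * riesz (p * s) z y) * indicator (- ball z \<rho>) y) <= ennreal (H * Mm powr (p - 1) * \<rho> powr (- p))"
  interpret mixed_solution \<Omega> p s \<Lambda> C1 C2 M B K u G by (rule sol)
  define \<delta> where "\<delta> = \<rho> - \<rho>'"
  have \<delta>: "\<delta> > 0" "\<delta> <= \<rho>" using \<rho> by (auto simp: \<delta>_def)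
  define Lc where "Lc = Cc / \<delta>"
  have Lc: "Lc > 0" using Cc \<delta> by (simp add: Lc_def)
  obtain \<xi> where \<xi>: "smooth_on UNIV \<xi>" and \<xi>01: "\<And>x. 0 <= \<xi> x" "\<And>x. \<xi> x <= 1" and \<xi>1: "\<And>x. x \<in> ball z \<rho>' ==> \<xi> x = 1"
   and \<xi>z: "\<And>x. dist z x >= (\<rho>' + \<rho>) / 2 ==> \<xi> x = 0" and \<xi>g: "\<And>x. norm (grad \<xi> x) <= Lc * \<xi> x powr ((p - 1) / p)"
   and \<xi>L: "\<And>x y. \<bar>\<xi> x powr (1 / p) - \<xi> y powr (1 / p)\<bar> <= Lc * dist x y"
  proof -
   from cut[OF \<rho>(1,2), of z] show ?thesis using that unfolding Lc_def \<delta>_def by blast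
  qed
  have [measurable]: "\<xi> \<in> borel_measurable borel" "grad \<xi> \<in> borel_measurable borel"
   using \<xi> smooth_measurable smooth_grad_measurable by auto
  have \<xi>gb: "norm (grad \<xi> x) <= Lc" for x
  proof -
   have "\<xi> x powr ((p - 1) / p) <= 1" using powr_mono2[of "(p - 1) / p" "\<xi> x" 1] \<xi>01[of x] p by simp
   then have "Lc * \<xi> x powr ((p - 1) / p) <= Lc * 1" using Lc by (intro mult_left_mono) auto
   then show ?thesis using \<xi>g[of x] by simp
  qed
  have sub: "cball z ((\<rho>' + \<rho>) / 2) \<subseteq> ball z \<rho>" using \<rho> by auto
  have bO: "ball z \<rho> \<subseteq> \<Omega>" using \<rho>(4) ball_subset_cball by blast
  have tfB: "test_fun (ball z \<rho>) \<xi>" by (rule cutoff_test_fun[OF \<xi> \<xi>z sub])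
  have tfO: "test_fun \<Omega> \<xi>" by (rule cutoff_test_fun[OF \<xi> \<xi>z order_trans[OF sub bO]])
  have cc: "cc_subset (ball z \<rho>) \<Omega>" using \<rho> by (simp add: cc_subset_def closure_ball)
  define pos where "pos = (%x. max (\<sigma> * u x - k) 0)"
  have [measurable]: "pos \<in> borel_measurable borel" unfolding pos_def by measurable
  have pos0: "pos x >= 0" for x by (simp add: pos_def)
  have posM: "pos x <= M + \<bar>k\<bar>" for x
  proof -
   have "\<bar>\<sigma> * u x\<bar> <= M" using uM[of x] \<sigma> by (simp add: abs_mult)
   then show ?thesis by (auto simp: pos_def max_def)
  qed
  define \<phi> where "\<phi> = (%x. max (\<sigma> * u x - k) 0 * \<xi> x)"
  define \<Phi> where "\<Phi> = trunc_grad \<sigma> k u G \<xi>"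
  have \<Phi>m[measurable]: "\<Phi> \<in> borel_measurable borel" unfolding \<Phi>_def trunc_grad_def[abs_def] by measurable
  have W0: "W01p (ball z \<rho>) p \<phi> \<Phi>"
   unfolding \<phi>_def \<Phi>_def by (rule W01p_truncate[OF p um Gm W \<Omega> tfB tfO \<sigma> uM])
  define F where "F = (%w. case w of (x, y) => \<bar>u x - u y\<bar> powr (p - 2) * (u x - u y) * (\<phi> x - \<phi> y) * K x y)"
  define L0 where "L0 = (LINT x:ball z \<rho>|lebesgue. B x (u x) (G x) \<bullet> \<Phi> x)"
  have eq: "L0 + (\<integral>w. F w \<partial>lebesgue) = 0" unfolding L0_def F_def by (rule weq[OF cc W0])
  have Fint: "integrable lebesgue F"
   unfolding F_def \<phi>_def
   by (rule nonlocal_integrable[OF \<rho>(1,2,4) \<sigma> _ \<xi>01 \<xi>z, where Lx=Lc])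
     (use smooth_lipschitz[OF \<xi> \<xi>gb] in \<open>auto simp: dist_norm\<close>)
  define As where "As = {x \<in> ball z \<rho>. \<sigma> * u x > k}"
  have Asm[measurable]: "As \<in> sets borel"
  proof -
   have "As = ball z \<rho> \<inter> {x \<in> space borel. \<sigma> * u x > k}" by (auto simp: As_def)
   also have "... \<in> sets borel" by (intro sets.Int) (simp, measurable)
   finally show ?thesis .
  qed
  define A where "A = measure lborel As"
  have Ae: "emeasure lborel As = ennreal A"
  proof -
   have "emeasure lborel As <= emeasure lborel (ball z \<rho>)" by (rule emeasure_mono) (auto simp: As_def)
   also have "... < \<infinity>" by (rule emeasure_lborel_ball_finite)
   finally show ?thesis unfolding A_def by (intro emeasure_eq_ennreal_measure) auto
  qed
  have A0: "A >= 0" by (simp add: A_def)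
  define Bz where "Bz = ball z \<rho>"
  define Sz where "Sz = ball z ((\<rho>' + \<rho>) / 2)"
  have [measurable]: "Bz \<in> sets borel" "Sz \<in> sets borel" by (auto simp: Bz_def Sz_def)
  have SB: "Sz \<subseteq> Bz" unfolding Bz_def Sz_def using \<rho> by (intro subset_ball) auto
  have posAE: "AE x in lborel. x \<in> Bz --> pos x <= Mm * indicator As x"
   using ub by eventually_elim (auto simp: Bz_def pos_def As_def max_def indicator_def)
  have powint: "(NN x. ennreal (indicator Bz x * pos x powr q)) <= ennreal (Mm powr q * A)" if q: "q > 0" for q
  proof -
   have "(NN x. ennreal (indicator Bz x * pos x powr q)) <= (NN x. ennreal (Mm powr q) * indicator As x)"
   proof (rule nn_integral_mono_AE)
    show "AE x in lborel. ennreal (indicator Bz x * pos x powr q) <= ennreal (Mm powr q) * indicator As x"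
     using posAE
    proof eventually_elim
     case (elim x)
     show ?case
     proof (cases "x \<in> As")
      case True
      then have "x \<in> Bz" by (simp add: As_def Bz_def)
      then have "pos x <= Mm" using elim True by simp
      then have "pos x powr q <= Mm powr q" using pos0 q by (intro powr_mono2) auto
      then show ?thesis using True \<open>x \<in> Bz\<close> by (simp add: ennreal_leI)
     next
      case False
      then have "x \<in> Bz --> pos x = 0" using elim pos0[of x] by (auto simp: indicator_def)
      then show ?thesis using q by (auto simp: indicator_def)
     qed
    qed
   qed
   also have "... = ennreal (Mm powr q) * ennreal A" unfolding Ae[symmetric] by (rule nn_integral_cmult_indicator) simp
   finally show ?thesis using A0 by (simp add: ennreal_mult)
  qed
  have powint1: "(NN x. ennreal (indicator Sz x * pos x)) <= ennreal (Mm * A)"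
  proof -
   have "(NN x. ennreal (indicator Sz x * pos x)) <= (NN x. ennreal (indicator Bz x * pos x powr 1))"
    using SB pos0 by (intro nn_integral_mono ennreal_leI) (auto simp: indicator_def)
   also have "... <= ennreal (Mm powr 1 * A)" by (rule powint) simp
   finally show ?thesis using Mm by simp
  qed
  define I where "I = (%x. if \<sigma> * u x > k then 1 else 0::real)"
  have [measurable]: "I \<in> borel_measurable borel" unfolding I_def by measurable
  define E where "E = (\<integral>x. indicator Bz x * (I x * \<xi> x * norm (G x) powr p) \<partial>lborel)"
  define P where "P = (\<integral>x. indicator Bz x * pos x powr p \<partial>lborel)"
  define c3 where "c3 = (2 / C1) powr (p - 1) * (C2 * Lc) powr p"
  have Gint: "integrable lborel (%x. indicator Bz x * norm (G x) powr p)"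
  proof (rule integrableI_bounded)
   have "(NN x. ennreal (norm (indicator Bz x * norm (G x) powr p))) <= (NN x. ennreal (norm (G x) powr p) * indicator (cball z \<rho>) x)"
    by (intro nn_integral_mono) (auto simp: indicator_def Bz_def)
   then show "(NN x. ennreal (norm (indicator Bz x * norm (G x) powr p))) < \<infinity>"
    using G_finite_ball[OF \<rho>(4)] le_less_trans by blast
  qed measurable
  have Eint: "integrable lborel (%x. indicator Bz x * (I x * \<xi> x * norm (G x) powr p))"
  proof (rule Bochner_Integration.integrable_bound[OF Gint])
   show "AE x in lborel. norm (indicator Bz x * (I x * \<xi> x * norm (G x) powr p)) <= norm (indicator Bz x * norm (G x) powr p)"
   proof (rule AE_I2)
    fix x
    have "I x * \<xi> x <= 1" "0 <= I x * \<xi> x" using \<xi>01[of x] by (auto simp: I_def)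
    then have "(I x * \<xi> x) * norm (G x) powr p <= 1 * norm (G x) powr p" by (intro mult_right_mono) auto
    then show "norm (indicator Bz x * (I x * \<xi> x * norm (G x) powr p)) <= norm (indicator Bz x * norm (G x) powr p)"
     using \<open>0 <= I x * \<xi> x\<close> by (simp add: indicator_def abs_mult[symmetric])
   qed
  qed measurable
  have Pint: "integrable lborel (%x. indicator Bz x * pos x powr p)" and Pb: "P <= Mm powr p * A"
  proof -
   have n: "(NN x. ennreal (norm (indicator Bz x * pos x powr p))) <= ennreal (Mm powr p * A)"
    using powint[of p] p by (simp add: indicator_def)
   show "integrable lborel (%x. indicator Bz x * pos x powr p)"
    by (rule integrableI_bounded) (measurable, use n le_less_trans in fastforce)
   have "P = enn2real (NN x. ennreal (indicator Bz x * pos x powr p))"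
    unfolding P_def by (rule integral_eq_nn_integral) auto
   also have "... <= Mm powr p * A" by (rule enn2real_leI) (use powint[of p] p A0 in auto)
   finally show "P <= Mm powr p * A" .
  qed
  \<comment> \<open>Coercivity yields \<open>C1 * norm G powr p * \<xi>\<close>. The term with
    \<open>grad \<xi>\<close> is absorbed with \<open>\<epsilon> = C1 / 2\<close>; the bound of
    \<open>grad \<xi>\<close> by \<open>\<xi> powr ((p - 1) / p)\<close> puts the weight
    \<open>\<xi>\<close> on the absorbed energy.\<close>
  have local: "\<sigma> * L0 >= C1 / 2 * E - c3 * P"
  proof -
   define f where "f = (%x. indicator Bz x *\<^sub>R (B x (u x) (G x) \<bullet> \<Phi> x))"
   have fe: "f = (%x. indicator Bz x * ((indicator \<Omega> x *\<^sub>R B x (u x) (G x)) \<bullet> \<Phi> x))"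
    using bO by (auto simp: f_def indicator_def Bz_def fun_eq_iff)
   have fm: "f \<in> borel_measurable lebesgue"
   proof -
    have "\<Phi> \<in> borel_measurable lebesgue" "indicator Bz \<in> borel_measurable (lebesgue :: 'a measure)"
     by (auto simp: measurable_completion)
    then show ?thesis unfolding fe using Bm by (intro borel_measurable_times borel_measurable_inner)
   qed
   have \<sigma>2: "\<sigma> * \<sigma> = 1" using \<sigma> by (auto simp: abs_if split: if_splits)
   have \<Phi>eq: "\<Phi> x = (\<sigma> * I x * \<xi> x) *\<^sub>R G x + pos x *\<^sub>R grad \<xi> x" for x
    by (simp add: \<Phi>_def trunc_grad_def I_def pos_def)
   define Mp where "Mp = M + \<bar>k\<bar>"
   have Mp: "Mp >= 0" using posM[of z] pos0[of z] by (simp add: Mp_def)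
   have fb: "AE x in lebesgue. norm (f x) <= C2 * (2 * (indicator Bz x * norm (G x) powr p)) + C2 * ((Mp * Lc) powr p * indicator Bz x)"
    using Bs
   proof eventually_elim
    case (elim x)
    show ?case
    proof (cases "x \<in> Bz")
     case True
     then have b: "norm (B x (u x) (G x)) <= C2 * norm (G x) powr (p - 1)" using elim bO by (auto simp: Bz_def)
     have "norm (\<Phi> x) <= norm (G x) + Mp * Lc"
     proof -
      have "norm (\<Phi> x) <= \<bar>\<sigma> * I x * \<xi> x\<bar> * norm (G x) + \<bar>pos x\<bar> * norm (grad \<xi> x)"
       unfolding \<Phi>eq by (rule order_trans[OF norm_triangle_ineq]) simp
      also have "... <= 1 * norm (G x) + Mp * Lc"
       using \<sigma> \<xi>01[of x] pos0[of x] posM[of x] \<xi>gb[of x] Mp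
       by (intro add_mono mult_mono) (auto simp: abs_mult I_def Mp_def)
      finally show ?thesis by simp
     qed
     then have "norm (f x) <= (C2 * norm (G x) powr (p - 1)) * (norm (G x) + Mp * Lc)"
      using True b C2 by (auto simp: f_def intro!: order_trans[OF Cauchy_Schwarz_ineq2] mult_mono)
     also have "... = C2 * (norm (G x) powr (p - 1) * norm (G x) + norm (G x) powr (p - 1) * (Mp * Lc))" by (simp add: algebra_simps)
     also have "... <= C2 * (norm (G x) powr p + (1 * norm (G x) powr p + (1 / 1) powr (p - 1) * (Mp * Lc) powr p))"
     proof (intro mult_left_mono add_mono young_absorb)
      show "norm (G x) powr (p - 1) * norm (G x) <= norm (G x) powr p" by (cases "G x = 0") (auto simp: powr_diff)
     qed (use C2 p Mp Lc in auto)
     finally show ?thesis using True by (simp add: algebra_simps)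
    qed (use C2 in \<open>simp add: f_def\<close>)
   qed
   have fint: "integrable lebesgue f"
   proof (rule Bochner_Integration.integrable_bound[OF _ fm])
    have "integrable lborel (indicator Bz :: 'a => real)"
     using emeasure_lborel_ball_finite[of z \<rho>] by (simp add: Bz_def)
    then have "integrable lborel (%x. C2 * (2 * (indicator Bz x * norm (G x) powr p)) + C2 * ((Mp * Lc) powr p * indicator Bz x))"
     using Gint by (intro Bochner_Integration.integrable_add integrable_mult_right)
    then show "integrable lebesgue (%x. C2 * (2 * (indicator Bz x * norm (G x) powr p)) + C2 * ((Mp * Lc) powr p * indicator Bz x))"
     by (subst integrable_completion) auto
    show "AE x in lebesgue. norm (f x) <= norm (C2 * (2 * (indicator Bz x * norm (G x) powr p)) + C2 * ((Mp * Lc) powr p * indicator Bz x))"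
     using fb by eventually_elim (auto intro: order_trans[OF _ abs_ge_self])
   qed
   define g where "g = (%x. C1 / 2 * (indicator Bz x * (I x * \<xi> x * norm (G x) powr p)) - c3 * (indicator Bz x * pos x powr p))"
   have gint: "integrable lborel g" unfolding g_def using Eint Pint by (intro Bochner_Integration.integrable_diff integrable_mult_right)
   have gm: "g \<in> borel_measurable borel" using borel_measurable_integrable[OF gint] by simp
   have "C1 / 2 * E - c3 * P = (\<integral>x. g x \<partial>lborel)"
    unfolding g_def E_def P_def using Eint Pint by simp
   also have "... = (\<integral>x. g x \<partial>lebesgue)" by (rule integral_completion[symmetric]) (use gm in simp)
   also have "... <= (\<integral>x. \<sigma> * f x \<partial>lebesgue)"
   proof (rule integral_mono_AE)
    show "integrable lebesgue g" using gint gm by (subst integrable_completion) auto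
    show "integrable lebesgue (%x. \<sigma> * f x)" using fint by simp
    show "AE x in lebesgue. g x <= \<sigma> * f x"
     using Bs
    proof eventually_elim
     case (elim x)
     show ?case
     proof (cases "x \<in> Bz & \<sigma> * u x > k")
      case False
      then have "x \<notin> Bz \<or> (I x = 0 & pos x = 0)" by (auto simp: I_def pos_def max_def)
      then show ?thesis using p by (auto simp: g_def f_def \<Phi>eq)
     next
      case True
      then have xO: "x \<in> \<Omega>" and I1: "I x = 1" using bO by (auto simp: Bz_def I_def)
      define b where "b = B x (u x) (G x)"
      have b1: "b \<bullet> G x >= C1 * norm (G x) powr p" and b2: "norm b <= C2 * norm (G x) powr (p - 1)"
       using elim xO by (auto simp: b_def)
      have fx: "\<sigma> * f x = \<xi> x * (b \<bullet> G x) + \<sigma> * pos x * (b \<bullet> grad \<xi> x)"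
      proof -
       have "f x = b \<bullet> \<Phi> x" using True by (simp add: f_def b_def)
       also have "... = (\<sigma> * \<xi> x) * (b \<bullet> G x) + pos x * (b \<bullet> grad \<xi> x)"
        unfolding \<Phi>eq I1 by (simp add: inner_add_right)
       finally have "\<sigma> * f x = (\<sigma> * \<sigma>) * (\<xi> x * (b \<bullet> G x)) + \<sigma> * pos x * (b \<bullet> grad \<xi> x)" by (simp add: algebra_simps)
       then show ?thesis by (simp add: \<sigma>2)
      qed
      define Av where "Av = norm (G x) * \<xi> x powr (1 / p)"
      have Ap: "Av powr p = norm (G x) powr p * \<xi> x" using p \<xi>01(1)[of x] by (simp add: Av_def powr_mult powr_powr)
      have Ap1: "Av powr (p - 1) = norm (G x) powr (p - 1) * \<xi> x powr ((p - 1) / p)" by (simp add: Av_def powr_mult powr_powr)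
      have "\<bar>\<sigma> * pos x * (b \<bullet> grad \<xi> x)\<bar> <= pos x * ((C2 * norm (G x) powr (p - 1)) * (Lc * \<xi> x powr ((p - 1) / p)))"
      proof -
       have "\<bar>b \<bullet> grad \<xi> x\<bar> <= norm b * norm (grad \<xi> x)" by (rule Cauchy_Schwarz_ineq2)
       also have "... <= (C2 * norm (G x) powr (p - 1)) * (Lc * \<xi> x powr ((p - 1) / p))"
        using b2 \<xi>g[of x] C2 by (intro mult_mono) auto
       finally show ?thesis using \<sigma> pos0[of x] by (simp add: abs_mult mult_left_mono)
      qed
      also have "... = Av powr (p - 1) * (pos x * (C2 * Lc))" unfolding Ap1 by (simp add: mult_ac)
      also have "... <= C1 / 2 * Av powr p + (1 / (C1 / 2)) powr (p - 1) * (pos x * (C2 * Lc)) powr p"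
       using pos0[of x] C1 C2 Lc p by (intro young_absorb) (auto simp: Av_def)
      also have "... = C1 / 2 * (norm (G x) powr p * \<xi> x) + c3 * pos x powr p"
       unfolding Ap c3_def using pos0[of x] C2 Lc by (simp add: powr_mult mult_ac)
      finally have 1: "\<bar>\<sigma> * pos x * (b \<bullet> grad \<xi> x)\<bar> <= C1 / 2 * (norm (G x) powr p * \<xi> x) + c3 * pos x powr p" .
      have 2: "\<xi> x * (b \<bullet> G x) >= \<xi> x * (C1 * norm (G x) powr p)" using b1 \<xi>01(1)[of x] by (intro mult_left_mono) auto
      have "g x = C1 / 2 * (norm (G x) powr p * \<xi> x) - c3 * pos x powr p"
       using True by (simp add: g_def I1 mult_ac)
      moreover have "\<xi> x * (C1 * norm (G x) powr p) = C1 / 2 * (norm (G x) powr p * \<xi> x) + C1 / 2 * (norm (G x) powr p * \<xi> x)"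
       by (simp add: algebra_simps)
      ultimately show ?thesis using 1 2 fx by linarith
     qed
    qed
   qed
   also have "... = \<sigma> * L0" by (simp add: L0_def f_def set_lebesgue_integral_def Bz_def)
   finally show ?thesis .
  qed
  define R where "R = (%x y::'a. riesz (p * s) x y)"
  have R0: "R x y >= 0" for x y by (simp add: R_def riesz_nonneg)
  have Rc: "R x y = R y x" for x y by (simp add: R_def riesz_commute)
  have Rm[measurable]: "(%(x, y). R x y) \<in> borel_measurable (borel \<Otimes>\<^sub>M borel)" unfolding R_def by measurable
  define c1 where "c1 = p powr p * Lc powr p"
  have c1: "c1 >= 0" by (simp add: c1_def)
  \<comment> \<open>The errors: \<open>t1\<close> for pairs inside the ball, from the Lipschitz
    cut-off, and \<open>t2\<close> for pairs across its boundary, where the exterior point enters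
    through the positive part only.\<close>
  define t1 where "t1 = (%x y. indicator Bz x * indicator Bz y * (pos x powr p * (dist x y powr p * R x y)))"
  define t2 where "t2 = (%x y. indicator Sz x * indicator (- Bz) y * (pos x * (pos y powr (p - 1) * R x y)))"
  have t0: "t1 x y >= 0" "t2 x y >= 0" for x y using R0 pos0 by (auto simp: t1_def t2_def)
  have tm[measurable]: "(%(x, y). t1 x y) \<in> borel_measurable (borel \<Otimes>\<^sub>M borel)" "(%(x, y). t2 x y) \<in> borel_measurable (borel \<Otimes>\<^sub>M borel)"
    "(%(x, y). t1 y x) \<in> borel_measurable (borel \<Otimes>\<^sub>M borel)" "(%(x, y). t2 y x) \<in> borel_measurable (borel \<Otimes>\<^sub>M borel)"
   unfolding t1_def t2_def R_def by measurable
  define bad where "bad = (%x y. c1 * (t1 x y + t1 y x) + (t2 x y + t2 y x))"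
  have bad0: "bad x y >= 0" for x y unfolding bad_def using t0 c1 by (intro add_nonneg_nonneg mult_nonneg_nonneg) auto
  define g0 where "g0 = (%x y. indicator (ball z \<rho>') x * (pos x * max (k - \<sigma> * u y) 0 powr (p - 1) * R x y))"
  have g00: "g0 x y >= 0" for x y using R0 pos0 by (simp add: g0_def)
  \<comment> \<open>The pointwise inequality behind the estimate. The mixed term is measured with
    the lower bound of \<open>K\<close>, the errors with the upper bound, and
    \<open>\<sigma> * F\<close> stays as the integrand of the equation itself.\<close>
  have key: "inverse \<Lambda> * g0 x y <= \<sigma> * F (x, y) + \<Lambda> * bad x y" for x y
  proof (cases "x = y")
   case True
   have "g0 x y = 0" using p unfolding g0_def True by (auto simp: pos_def max_def R_def riesz_def)
   moreover have "F (x, y) = 0" by (simp add: F_def True)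
   ultimately show ?thesis using bad0[of x y] \<Lambda> by simp
  next
   case False
   define a where "a = \<sigma> * u x - k"
   define b where "b = \<sigma> * u y - k"
   define X where "X = \<xi> x powr (1 / p)"
   define Y where "Y = \<xi> y powr (1 / p)"
   have XY: "X >= 0" "Y >= 0" "X powr p = \<xi> x" "Y powr p = \<xi> y" using p \<xi>01 by (auto simp: X_def Y_def powr_powr)
   have K1: "inverse \<Lambda> * R x y <= K x y" "K x y <= \<Lambda> * R x y" using Kb[OF False] by (auto simp: R_def)
   have K0: "K x y >= 0" using K1(1) R0[of x y] \<Lambda> by (meson inverse_nonnegative_iff_nonnegative mult_nonneg_nonneg order_trans zero_le_one)
   have sF: "\<sigma> * F (x, y) = jump p (a - b) * (\<phi> x - \<phi> y) * K x y"
   proof -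
    have "a - b = \<sigma> * (u x - u y)" by (simp add: a_def b_def algebra_simps)
    then have "jump p (a - b) = \<sigma> * (\<bar>u x - u y\<bar> powr (p - 2) * (u x - u y))" using \<sigma> by (simp add: jump_def abs_mult)
    then show ?thesis by (simp add: F_def)
   qed
   have \<phi>x: "\<phi> x = max a 0 * \<xi> x" "\<phi> y = max b 0 * \<xi> y" by (auto simp: \<phi>_def a_def b_def)
   have px: "pos x = max a 0" "pos y = max b 0" "max (k - \<sigma> * u y) 0 = max (- b) 0" by (auto simp: pos_def a_def b_def)
   define gd where "gd = max a 0 * max (- b) 0 powr (p - 1)"
   have gd0: "gd >= 0" by (simp add: gd_def)
   have lhs: "inverse \<Lambda> * g0 x y <= (gd * \<xi> x) * K x y"
   proof -
    have "indicator (ball z \<rho>') x <= \<xi> x" using \<xi>1[of x] \<xi>01(1)[of x] by (auto simp: indicator_def)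
    then have "indicator (ball z \<rho>') x * gd * (inverse \<Lambda> * R x y) <= \<xi> x * gd * K x y"
     using K1(1) gd0 R0[of x y] \<Lambda> \<xi>01(1)[of x] by (intro mult_mono) auto
    then show ?thesis by (simp add: g0_def px gd_def mult_ac)
   qed
   have upgrade: "T * K x y <= \<Lambda> * (T * R x y)" if "T >= 0" for T
    using mult_left_mono[OF K1(2) that] by (simp add: mult_ac)
   have zero: "\<xi> w = 0" if "w \<notin> Sz" for w using \<xi>z[of w] that by (simp add: Sz_def)
   consider "x \<in> Bz & y \<in> Bz" | "x \<in> Bz & y \<notin> Bz" | "x \<notin> Bz" by blast
   then show ?thesis
   proof cases
    case 1
    have "gd * \<xi> x <= jump p (a - b) * (\<phi> x - \<phi> y) + p powr p * (max a 0 powr p + max b 0 powr p) * \<bar>X - Y\<bar> powr p"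
     using jump_caccioppoli[OF p XY(1,2), of a b] unfolding XY \<phi>x gd_def .
    also have "p powr p * (max a 0 powr p + max b 0 powr p) * \<bar>X - Y\<bar> powr p <= p powr p * (max a 0 powr p + max b 0 powr p) * (Lc * dist x y) powr p"
     using \<xi>L[of x y] p by (intro mult_left_mono powr_mono2) (auto simp: X_def Y_def)
    also have "... = (max a 0 powr p + max b 0 powr p) * (c1 * dist x y powr p)"
     using Lc by (simp add: c1_def powr_mult mult_ac)
    finally have "gd * \<xi> x <= jump p (a - b) * (\<phi> x - \<phi> y) + (max a 0 powr p + max b 0 powr p) * (c1 * dist x y powr p)" by simp
    then have "gd * \<xi> x * K x y <= (jump p (a - b) * (\<phi> x - \<phi> y) + (max a 0 powr p + max b 0 powr p) * (c1 * dist x y powr p)) * K x y"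
     by (rule mult_right_mono[OF _ K0])
    also have "... = \<sigma> * F (x, y) + ((max a 0 powr p + max b 0 powr p) * (c1 * dist x y powr p)) * K x y" unfolding sF by (simp add: algebra_simps)
    also have "... <= \<sigma> * F (x, y) + \<Lambda> * (((max a 0 powr p + max b 0 powr p) * (c1 * dist x y powr p)) * R x y)"
     using c1 by (intro add_left_mono upgrade) auto
    also have "((max a 0 powr p + max b 0 powr p) * (c1 * dist x y powr p)) * R x y = c1 * (t1 x y + t1 y x)"
     using 1 Rc[of x y] by (simp add: t1_def px dist_commute algebra_simps)
    also have "\<sigma> * F (x, y) + \<Lambda> * (c1 * (t1 x y + t1 y x)) <= \<sigma> * F (x, y) + \<Lambda> * bad x y"
     unfolding bad_def using t0[of x y] t0[of y x] \<Lambda> by (intro add_left_mono mult_left_mono) auto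
    finally show ?thesis using lhs by simp
   next
    case 2
    then have "y \<notin> Sz" using SB by blast
    then have y0: "\<phi> y = 0" using zero[of y] by (simp add: \<phi>x)
    have "gd * \<xi> x <= jump p (a - b) * (max a 0 * \<xi> x) + max a 0 * max b 0 powr (p - 1) * \<xi> x"
     unfolding gd_def by (rule jump_tail[OF p \<xi>01(1)])
    then have "gd * \<xi> x * K x y <= (jump p (a - b) * (max a 0 * \<xi> x) + max a 0 * max b 0 powr (p - 1) * \<xi> x) * K x y"
     by (rule mult_right_mono[OF _ K0])
    also have "... = \<sigma> * F (x, y) + (max a 0 * max b 0 powr (p - 1) * \<xi> x) * K x y" unfolding sF y0 by (simp add: \<phi>x algebra_simps)
    also have "... <= \<sigma> * F (x, y) + \<Lambda> * ((max a 0 * max b 0 powr (p - 1) * \<xi> x) * R x y)"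
     using \<xi>01(1)[of x] by (intro add_left_mono upgrade) auto
    also have "... <= \<sigma> * F (x, y) + \<Lambda> * t2 x y"
    proof -
     have "\<xi> x <= indicator Sz x" using zero[of x] \<xi>01(2)[of x] by (auto simp: indicator_def)
     then have "max a 0 * max b 0 powr (p - 1) * R x y * \<xi> x <= max a 0 * max b 0 powr (p - 1) * R x y * indicator Sz x"
      using R0[of x y] by (intro mult_left_mono) auto
     then have "(max a 0 * max b 0 powr (p - 1) * \<xi> x) * R x y <= t2 x y" using 2 by (simp add: t2_def px mult_ac)
     then show ?thesis using \<Lambda> by simp
    qed
    also have "... <= \<sigma> * F (x, y) + \<Lambda> * bad x y"
     unfolding bad_def using t0[of x y] t0[of y x] \<Lambda> c1 by (intro add_left_mono mult_left_mono) (auto simp: add_increasing)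
    finally show ?thesis using lhs by simp
   next
    case 3
    then have xS: "x \<notin> Sz" using SB by blast
    then have x0: "\<phi> x = 0" using zero[of x] by (simp add: \<phi>x)
    have g0z: "g0 x y = 0"
    proof -
     have "x \<notin> ball z \<rho>'" using 3 \<rho> by (auto simp: Bz_def)
     then show ?thesis by (simp add: g0_def)
    qed
    \<comment> \<open>The variables exchange their roles: now \<open>y\<close> may lie in the
      support. As \<open>g0\<close> vanishes, nonnegativity of the right side suffices.\<close>
    have "0 <= max b 0 * max (- a) 0 powr (p - 1) * \<xi> y" using \<xi>01(1)[of y] by simp
    also have "... <= jump p (b - a) * (max b 0 * \<xi> y) + max b 0 * max a 0 powr (p - 1) * \<xi> y"
     by (rule jump_tail[OF p \<xi>01(1)])
    finally have "0 <= (jump p (b - a) * (max b 0 * \<xi> y) + max b 0 * max a 0 powr (p - 1) * \<xi> y) * K x y" using K0 by simp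
    also have "... = \<sigma> * F (x, y) + (max b 0 * max a 0 powr (p - 1) * \<xi> y) * K x y"
     unfolding sF x0 using jump_minus[of p "a - b"] by (simp add: \<phi>x algebra_simps)
    also have "... <= \<sigma> * F (x, y) + \<Lambda> * ((max b 0 * max a 0 powr (p - 1) * \<xi> y) * R x y)"
     using \<xi>01(1)[of y] by (intro add_left_mono upgrade) auto
    also have "... <= \<sigma> * F (x, y) + \<Lambda> * t2 y x"
    proof -
     have "\<xi> y <= indicator Sz y" using zero[of y] \<xi>01(2)[of y] by (auto simp: indicator_def)
     then have "max b 0 * max a 0 powr (p - 1) * R x y * \<xi> y <= max b 0 * max a 0 powr (p - 1) * R x y * indicator Sz y"
      using R0[of x y] by (intro mult_left_mono) auto
     then have "(max b 0 * max a 0 powr (p - 1) * \<xi> y) * R x y <= t2 y x" using 3 Rc[of x y] by (simp add: t2_def px mult_ac)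
     then show ?thesis using \<Lambda> by simp
    qed
    also have "... <= \<sigma> * F (x, y) + \<Lambda> * bad x y"
     unfolding bad_def using t0[of x y] t0[of y x] \<Lambda> c1 by (intro add_left_mono mult_left_mono) (auto simp: add_increasing)
    finally show ?thesis using g0z by simp
   qed
  qed
  define D where "D = \<rho> / (\<rho> - \<rho>')"
  have D: "D >= 1" using \<rho> by (simp add: D_def)
  have n1: "(NN x. NN y. ennreal (t1 x y)) <= ennreal (Cn * (2 * \<rho>) powr \<alpha> * (Mm powr p * A))"
  proof -
   have "(NN x. NN y. ennreal (t1 x y)) <= (NN x. ennreal (Cn * (2 * \<rho>) powr \<alpha>) * ennreal (indicator Bz x * pos x powr p))"
   proof (rule nn_integral_mono)
    fix x
    show "(NN y. ennreal (t1 x y)) <= ennreal (Cn * (2 * \<rho>) powr \<alpha>) * ennreal (indicator Bz x * pos x powr p)"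
    proof (cases "x \<in> Bz")
     case True
     have [measurable]: "ball x (2 * \<rho>) \<in> sets borel" by simp
     have "(NN y. ennreal (t1 x y)) <= (NN y. ennreal (pos x powr p) * (ennreal (dist x y powr (\<alpha> - real DIM('a))) * indicator (ball x (2 * \<rho>)) y))"
     proof (rule nn_integral_mono)
      fix y
      have e: "dist x y powr p * R x y = dist x y powr (\<alpha> - real DIM('a))"
       by (simp add: R_def riesz_def powr_add[symmetric] \<alpha>_def algebra_simps)
      have "y \<in> ball x (2 * \<rho>)" if "y \<in> Bz"
      proof -
       have "dist z x < \<rho>" "dist z y < \<rho>" using True that by (auto simp: Bz_def)
       then show ?thesis using dist_triangle[of x y z] by (simp add: dist_commute)
      qed
      then show "ennreal (t1 x y) <= ennreal (pos x powr p) * (ennreal (dist x y powr (\<alpha> - real DIM('a))) * indicator (ball x (2 * \<rho>)) y)"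
       unfolding t1_def e using True by (cases "y \<in> Bz") (auto simp: ennreal_mult)
     qed
     also have "... = ennreal (pos x powr p) * (NN y. ennreal (dist x y powr (\<alpha> - real DIM('a))) * indicator (ball x (2 * \<rho>)) y)"
      by (rule nn_integral_cmult) measurable
     also have "... <= ennreal (pos x powr p) * ennreal (Cn * (2 * \<rho>) powr \<alpha>)"
      by (rule mult_left_mono[OF Cn(2)]) (use \<rho> in auto)
     finally show ?thesis using True by (simp add: mult.commute)
    qed (simp add: t1_def)
   qed
   also have "... = ennreal (Cn * (2 * \<rho>) powr \<alpha>) * (NN x. ennreal (indicator Bz x * pos x powr p))"
    by (rule nn_integral_cmult) measurable
   also have "... <= ennreal (Cn * (2 * \<rho>) powr \<alpha>) * ennreal (Mm powr p * A)"
    by (rule mult_left_mono[OF powint]) (use p in auto)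
   also have "... = ennreal (Cn * (2 * \<rho>) powr \<alpha> * (Mm powr p * A))" using Cn A0 by (simp add: ennreal_mult)
   finally show ?thesis .
  qed
  have n2: "(NN x. NN y. ennreal (t2 x y)) <= ennreal ((2 * D) powr (real DIM('a) + p * s) * (H * Mm powr (p - 1) * \<rho> powr (- p)) * (Mm * A))"
  proof -
   define TT where "TT = (2 * D) powr (real DIM('a) + p * s) * (H * Mm powr (p - 1) * \<rho> powr (- p))"
   have "(NN x. NN y. ennreal (t2 x y)) <= (NN x. ennreal TT * ennreal (indicator Sz x * pos x))"
   proof (rule nn_integral_mono)
    fix x
    show "(NN y. ennreal (t2 x y)) <= ennreal TT * ennreal (indicator Sz x * pos x)"
    proof (cases "x \<in> Sz")
     case True
     have "(NN y. ennreal (t2 x y)) <= (NN y. ennreal (pos x * (2 * D) powr (real DIM('a) + p * s)) * (ennreal (pos y powr (p - 1) * riesz (p * s) z y) * indicator (- Bz) y))"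
     proof (rule nn_integral_mono)
      fix y
      show "ennreal (t2 x y) <= ennreal (pos x * (2 * D) powr (real DIM('a) + p * s)) * (ennreal (pos y powr (p - 1) * riesz (p * s) z y) * indicator (- Bz) y)"
      proof (cases "y \<in> Bz")
       case False
       have "R x y <= (2 * D) powr (real DIM('a) + p * s) * riesz (p * s) z y"
        unfolding R_def D_def by (rule riesz_far_le) (use \<rho> True False ps in \<open>auto simp: Sz_def Bz_def\<close>)
       then have "pos x * (pos y powr (p - 1) * R x y) <= pos x * (pos y powr (p - 1) * ((2 * D) powr (real DIM('a) + p * s) * riesz (p * s) z y))"
        using pos0[of x] by (intro mult_left_mono) auto
       then have "t2 x y <= (pos x * (2 * D) powr (real DIM('a) + p * s)) * (pos y powr (p - 1) * riesz (p * s) z y)"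
        using True False by (simp add: t2_def mult_ac)
       then have "ennreal (t2 x y) <= ennreal ((pos x * (2 * D) powr (real DIM('a) + p * s)) * (pos y powr (p - 1) * riesz (p * s) z y))" by (rule ennreal_leI)
       also have "... = ennreal (pos x * (2 * D) powr (real DIM('a) + p * s)) * ennreal (pos y powr (p - 1) * riesz (p * s) z y)"
        using pos0[of x] riesz_nonneg[of "p * s" z y] by (intro ennreal_mult) auto
       finally show ?thesis using False by simp
      qed (simp add: t2_def)
     qed
     also have "... = ennreal (pos x * (2 * D) powr (real DIM('a) + p * s)) * (NN y. ennreal (pos y powr (p - 1) * riesz (p * s) z y) * indicator (- Bz) y)"
      by (rule nn_integral_cmult) measurable
     also have "... <= ennreal (pos x * (2 * D) powr (real DIM('a) + p * s)) * ennreal (H * Mm powr (p - 1) * \<rho> powr (- p))"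
      by (rule mult_left_mono) (use tail in \<open>auto simp: pos_def Bz_def\<close>)
     also have "... = ennreal TT * ennreal (indicator Sz x * pos x)"
      using True pos0[of x] H by (simp add: TT_def ennreal_mult[symmetric] mult_ac)
     finally show ?thesis .
    qed (simp add: t2_def)
   qed
   also have "... = ennreal TT * (NN x. ennreal (indicator Sz x * pos x))"
    by (rule nn_integral_cmult) measurable
   also have "... <= ennreal TT * ennreal (Mm * A)" by (rule mult_left_mono[OF powint1]) simp
   also have "... = ennreal (TT * (Mm * A))" using H Mm A0 by (simp add: TT_def ennreal_mult)
   finally show ?thesis by (simp add: TT_def)
  qed
  define Bb where "Bb = c1 * (2 * (Cn * (2 * \<rho>) powr \<alpha> * (Mm powr p * A))) + 2 * ((2 * D) powr (real DIM('a) + p * s) * (H * Mm powr (p - 1) * \<rho> powr (- p)) * (Mm * A))"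
  let ?c = "%f w. case w of (x::'a, y::'a) => f x y"
  have bm: "?c bad \<in> borel_measurable (borel \<Otimes>\<^sub>M borel)" unfolding bad_def by measurable
  have bme: "?c bad \<in> borel_measurable lborel" using bm by (simp add: borel_prod)
  have nbad: "(NN w. ennreal (?c bad w)) <= ennreal Bb"
  proof -
   define N1 where "N1 = Cn * (2 * \<rho>) powr \<alpha> * (Mm powr p * A)"
   define N2 where "N2 = (2 * D) powr (real DIM('a) + p * s) * (H * Mm powr (p - 1) * \<rho> powr (- p)) * (Mm * A)"
   have N0: "N1 >= 0" "N2 >= 0" using Cn A0 Mm H by (auto simp: N1_def N2_def)
   have em: "(%(x, y). ennreal (t1 x y)) \<in> borel_measurable (borel \<Otimes>\<^sub>M borel)" "(%(x, y). ennreal (t2 x y)) \<in> borel_measurable (borel \<Otimes>\<^sub>M borel)"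
    "(%(x, y). ennreal (t1 y x)) \<in> borel_measurable (borel \<Otimes>\<^sub>M borel)" "(%(x, y). ennreal (t2 y x)) \<in> borel_measurable (borel \<Otimes>\<^sub>M borel)"
    by measurable
   have bp: "f \<in> borel_measurable (borel \<Otimes>\<^sub>M borel) ==> f \<in> borel_measurable lborel" for f :: "'a \<times> 'a => ennreal"
    by (simp add: borel_prod)
   have "(NN w. ennreal (?c bad w)) = (NN w. ennreal c1 * (?c (%x y. ennreal (t1 x y)) w + ?c (%x y. ennreal (t1 y x)) w) + (?c (%x y. ennreal (t2 x y)) w + ?c (%x y. ennreal (t2 y x)) w))"
   proof (intro nn_integral_cong)
    fix w :: "'a \<times> 'a"
    obtain x y where w: "w = (x, y)" by (cases w)
    have "ennreal (bad x y) = ennreal (c1 * (t1 x y + t1 y x)) + ennreal (t2 x y + t2 y x)"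
     unfolding bad_def using t0 c1 by (intro ennreal_plus mult_nonneg_nonneg add_nonneg_nonneg) auto
    also have "ennreal (c1 * (t1 x y + t1 y x)) = ennreal c1 * ennreal (t1 x y + t1 y x)"
     using t0 c1 by (intro ennreal_mult add_nonneg_nonneg) auto
    also have "ennreal (t1 x y + t1 y x) = ennreal (t1 x y) + ennreal (t1 y x)" using t0 by (intro ennreal_plus) auto
    also have "ennreal (t2 x y + t2 y x) = ennreal (t2 x y) + ennreal (t2 y x)" using t0 by (intro ennreal_plus) auto
    finally show "ennreal (?c bad w) = ennreal c1 * (?c (%x y. ennreal (t1 x y)) w + ?c (%x y. ennreal (t1 y x)) w) + (?c (%x y. ennreal (t2 x y)) w + ?c (%x y. ennreal (t2 y x)) w)"
     unfolding w by simp
   qed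
   also have "... = ennreal c1 * ((NN w. ?c (%x y. ennreal (t1 x y)) w) + (NN w. ?c (%x y. ennreal (t1 y x)) w)) +
     ((NN w. ?c (%x y. ennreal (t2 x y)) w) + (NN w. ?c (%x y. ennreal (t2 y x)) w))"
    using em[THEN bp] by (simp add: nn_integral_add nn_integral_cmult)
   also have "... <= ennreal c1 * (ennreal N1 + ennreal N1) + (ennreal N2 + ennreal N2)"
    unfolding nn_integral_lborel_pair(1)[OF em(1)] nn_integral_lborel_pair(1)[OF em(2)] nn_integral_lborel_pair(2)[OF em(3)] nn_integral_lborel_pair(2)[OF em(4)]
    using n1 n2 unfolding N1_def[symmetric] N2_def[symmetric] by (intro add_mono mult_left_mono) auto
   also have "ennreal N1 + ennreal N1 = ennreal (N1 + N1)" using N0 by (intro ennreal_plus[symmetric])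
   also have "ennreal N2 + ennreal N2 = ennreal (N2 + N2)" using N0 by (intro ennreal_plus[symmetric])
   also have "ennreal c1 * ennreal (N1 + N1) = ennreal (c1 * (N1 + N1))" using N0 c1 by (intro ennreal_mult[symmetric]) auto
   also have "ennreal (c1 * (N1 + N1)) + ennreal (N2 + N2) = ennreal (c1 * (N1 + N1) + (N2 + N2))" using N0 c1 by (intro ennreal_plus[symmetric]) auto
   also have "c1 * (N1 + N1) + (N2 + N2) = Bb" unfolding Bb_def N1_def[symmetric] N2_def[symmetric] by (simp add: algebra_simps)
   finally show ?thesis .
  qed
  have Bb0: "Bb >= 0" unfolding Bb_def using c1 Cn A0 Mm H by (intro add_nonneg_nonneg mult_nonneg_nonneg) auto
  have badint: "integrable lebesgue (?c bad)" and badle: "(\<integral>w. ?c bad w \<partial>lebesgue) <= Bb"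
  proof -
   have nb: "norm (?c bad w) = ?c bad w" for w using bad0 by (cases w) auto
   have i: "integrable lborel (?c bad)"
   proof (rule integrableI_bounded[OF bme])
    show "(NN w. ennreal (norm (?c bad w))) < \<infinity>"
     unfolding nb using nbad le_less_trans by fastforce
   qed
   then show "integrable lebesgue (?c bad)" by (subst integrable_completion) (use bme in auto)
   have "(\<integral>w. ?c bad w \<partial>lebesgue) = (\<integral>w. ?c bad w \<partial>lborel)" by (rule integral_completion[OF bme])
   also have "... = enn2real (NN w. ennreal (?c bad w))"
    by (rule integral_eq_nn_integral[OF bme]) (use bad0 in auto)
   also have "... <= Bb" by (rule enn2real_leI[OF Bb0 nbad])
   finally show "(\<integral>w. ?c bad w \<partial>lebesgue) <= Bb" .
  qed
  define I0 where "I0 = (\<integral>w. F w \<partial>lebesgue)"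
  have g0m: "(%(x, y). ennreal (g0 x y)) \<in> borel_measurable (borel \<Otimes>\<^sub>M borel)"
  proof -
   have [measurable]: "ball z \<rho>' \<in> sets borel" by simp
   show ?thesis unfolding g0_def R_def by measurable
  qed
  define gg where "gg = (NN x. NN y. ennreal (g0 x y))"
  have good: "ennreal (inverse \<Lambda>) * gg <= ennreal (\<sigma> * I0 + \<Lambda> * Bb)"
  proof -
   have "ennreal (inverse \<Lambda>) * gg = ennreal (inverse \<Lambda>) * (NN w. ?c (%x y. ennreal (g0 x y)) w)"
    unfolding gg_def nn_integral_lborel_pair(1)[OF g0m] ..
   also have "... = (NN w. ennreal (inverse \<Lambda>) * ?c (%x y. ennreal (g0 x y)) w)"
    by (rule nn_integral_cmult[symmetric]) (use g0m in \<open>simp add: borel_prod\<close>)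
   also have "... = (\<integral>\<^sup>+w. ennreal (inverse \<Lambda>) * ?c (%x y. ennreal (g0 x y)) w \<partial>lebesgue)"
    by (rule nn_integral_completion[symmetric])
   also have "... <= (\<integral>\<^sup>+w. ennreal (\<sigma> * F w + \<Lambda> * ?c bad w) \<partial>lebesgue)"
   proof (intro nn_integral_mono)
    fix w :: "'a \<times> 'a"
    obtain x y where w: "w = (x, y)" by (cases w)
    have "ennreal (inverse \<Lambda>) * ennreal (g0 x y) = ennreal (inverse \<Lambda> * g0 x y)" using g00[of x y] \<Lambda> by (simp add: ennreal_mult)
    then show "ennreal (inverse \<Lambda>) * ?c (%x y. ennreal (g0 x y)) w <= ennreal (\<sigma> * F w + \<Lambda> * ?c bad w)"
     using key[of x y] by (simp add: w ennreal_leI)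
   qed
   also have "... = ennreal (\<integral>w. \<sigma> * F w + \<Lambda> * ?c bad w \<partial>lebesgue)"
   proof (rule nn_integral_eq_integral)
    show "integrable lebesgue (%w. \<sigma> * F w + \<Lambda> * ?c bad w)"
     using Fint badint by (intro Bochner_Integration.integrable_add integrable_mult_right)
    show "AE w in lebesgue. 0 <= \<sigma> * F w + \<Lambda> * ?c bad w"
    proof (rule AE_I2)
     fix w :: "'a \<times> 'a"
     obtain x y where w: "w = (x, y)" by (cases w)
     have "0 <= inverse \<Lambda> * g0 x y" using g00[of x y] \<Lambda> by simp
     then show "0 <= \<sigma> * F w + \<Lambda> * ?c bad w" using key[of x y] by (simp add: w)
    qed
   qed
   also have "(\<integral>w. \<sigma> * F w + \<Lambda> * ?c bad w \<partial>lebesgue) = \<sigma> * I0 + \<Lambda> * (\<integral>w. ?c bad w \<partial>lebesgue)"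
    using Fint badint by (simp add: I0_def)
   also have "ennreal (\<sigma> * I0 + \<Lambda> * (\<integral>w. ?c bad w \<partial>lebesgue)) <= ennreal (\<sigma> * I0 + \<Lambda> * Bb)"
    using badle \<Lambda> by (intro ennreal_leI add_left_mono mult_left_mono) auto
   finally show ?thesis .
  qed
  define EE where "EE = (NN x. ennreal (if \<sigma> * u x > k then norm (G x) powr p else 0) * indicator (ball z \<rho>') x)"
  have E0: "E >= 0" unfolding E_def using \<xi>01 by (intro integral_nonneg_AE AE_I2) (auto simp: I_def)
  have EEE: "EE <= ennreal E"
  proof -
   have "EE <= (NN x. ennreal (indicator Bz x * (I x * \<xi> x * norm (G x) powr p)))"
    unfolding EE_def
   proof (rule nn_integral_mono)
    fix x
    show "ennreal (if \<sigma> * u x > k then norm (G x) powr p else 0) * indicator (ball z \<rho>') x <= ennreal (indicator Bz x * (I x * \<xi> x * norm (G x) powr p))"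
    proof (cases "x \<in> ball z \<rho>'")
     case True
     then have "x \<in> Bz" using \<rho> by (auto simp: Bz_def)
     then show ?thesis using True \<xi>1[OF True] by (simp add: I_def)
    qed simp
   qed
   also have "... = ennreal E" unfolding E_def
    by (rule nn_integral_eq_integral[OF Eint]) (use \<xi>01 in \<open>auto simp: I_def\<close>)
   finally show ?thesis .
  qed
  define Q where "Q = D powr (real DIM('a) + p) * \<rho> powr (- p) * (Mm powr p * A)"
  have Q0: "Q >= 0" using A0 by (simp add: Q_def)
  have Dp: "D powr p <= D powr (real DIM('a) + p)" "D powr (real DIM('a) + p * s) <= D powr (real DIM('a) + p)"
   using D ps s by (auto intro!: powr_mono)
  have Lcp: "Lc powr p = Cc powr p * D powr p * \<rho> powr (- p)"
  proof -
   have "Lc = Cc * D * (1 / \<rho>)" using \<rho> by (simp add: Lc_def D_def \<delta>_def)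
   then have "Lc powr p = Cc powr p * D powr p * (1 / \<rho>) powr p" using Cc D \<rho> by (simp only: powr_mult)
   then show ?thesis using \<rho> by (simp add: powr_divide powr_minus field_simps)
  qed
  have e1: "c3 * P <= k1 * Q"
  proof -
   have c3e: "c3 = k1 * (D powr p * \<rho> powr (- p))"
    using C2 Lc Cc by (simp add: c3_def k1_def powr_mult Lcp)
   have "c3 * P <= c3 * (Mm powr p * A)" using Pb by (intro mult_left_mono) (auto simp: c3_def)
   also have "... = k1 * (D powr p * \<rho> powr (- p)) * (Mm powr p * A)" by (simp only: c3e)
   also have "... <= k1 * (D powr (real DIM('a) + p) * \<rho> powr (- p)) * (Mm powr p * A)"
    using kk Dp A0 by (intro mult_right_mono mult_left_mono) auto
   finally show ?thesis by (simp add: Q_def mult_ac)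
  qed
  have e2: "c1 * (2 * (Cn * (2 * \<rho>) powr \<alpha> * (Mm powr p * A))) <= k2 * Q"
  proof -
   \<comment> \<open>Here \<open>\<rho> <= 1\<close> is used: pairs inside the ball produce the
     scaling \<open>\<rho> powr (- p * s)\<close>, which is thereby bounded by the local scaling
     \<open>\<rho> powr (- p)\<close>.\<close>
   have "(2 * \<rho>) powr \<alpha> <= 2 powr \<alpha>" using \<rho> \<alpha> by (intro powr_mono2) auto
   then have "c1 * (2 * (Cn * (2 * \<rho>) powr \<alpha> * (Mm powr p * A))) <= c1 * (2 * (Cn * 2 powr \<alpha> * (Mm powr p * A)))"
    using c1 Cn A0 by (intro mult_left_mono mult_right_mono) auto
   also have "... = k2 * (D powr p * \<rho> powr (- p) * (Mm powr p * A))"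
    by (simp add: c1_def Lcp k2_def mult_ac)
   also have "... <= k2 * Q" unfolding Q_def using kk Dp A0 by (intro mult_left_mono mult_right_mono) auto
   finally show ?thesis .
  qed
  have e3: "2 * ((2 * D) powr (real DIM('a) + p * s) * (H * Mm powr (p - 1) * \<rho> powr (- p)) * (Mm * A)) <= k3 * (H * Q)"
  proof -
   have mm: "Mm powr (p - 1) * Mm = Mm powr p" using Mm by (simp add: powr_diff)
   have "2 * ((2 * D) powr (real DIM('a) + p * s) * (H * Mm powr (p - 1) * \<rho> powr (- p)) * (Mm * A)) =
    k3 * (H * (D powr (real DIM('a) + p * s) * \<rho> powr (- p) * ((Mm powr (p - 1) * Mm) * A)))"
    using D by (simp add: k3_def powr_mult mult_ac)
   also have "... <= k3 * (H * Q)" unfolding mm Q_def using kk Dp A0 H by (intro mult_left_mono mult_right_mono) auto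
   finally show ?thesis .
  qed
  define TOT where "TOT = (k1 + \<Lambda> * (k2 + k3)) * ((1 + H) * Q)"
  have tot: "c3 * P + \<Lambda> * Bb <= TOT"
  proof -
   have HQ: "Q <= (1 + H) * Q" "H * Q <= (1 + H) * Q" using H Q0 by (auto simp: algebra_simps)
   have "Bb <= k2 * Q + k3 * (H * Q)" unfolding Bb_def using e2 e3 by linarith
   also have "... <= k2 * ((1 + H) * Q) + k3 * ((1 + H) * Q)" using HQ kk by (intro add_mono mult_left_mono) auto
   finally have "\<Lambda> * Bb <= \<Lambda> * (k2 * ((1 + H) * Q) + k3 * ((1 + H) * Q))" using \<Lambda> by (intro mult_left_mono) auto
   moreover have "c3 * P <= k1 * ((1 + H) * Q)"
    using e1 mult_left_mono[OF HQ(1), of k1] kk by linarith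
   ultimately show ?thesis unfolding TOT_def by (simp add: algebra_simps)
  qed
  \<comment> \<open>The weak equation itself: the nonlocal part is minus the local one, so
    coercivity bounds it from above.\<close>
  have sI: "\<sigma> * I0 = - (\<sigma> * L0)"
  proof -
   have "I0 = - L0" using eq unfolding I0_def by linarith
   then show ?thesis by simp
  qed
  have TOT0: "TOT >= 0" unfolding TOT_def using kk \<Lambda> H Q0 by (intro mult_nonneg_nonneg add_nonneg_nonneg) auto
  have low: "C1 / 2 * E + (\<sigma> * I0 + \<Lambda> * Bb) <= TOT" using local sI tot by linarith
  have ggb: "gg <= ennreal (\<Lambda> * TOT)"
  proof -
   have "\<sigma> * I0 + \<Lambda> * Bb <= TOT" using low E0 C1 by (smt (verit) mult_nonneg_nonneg divide_nonneg_nonneg)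
   then have "ennreal (inverse \<Lambda>) * gg <= ennreal TOT" using good by (meson ennreal_leI order_trans)
   then have "ennreal \<Lambda> * (ennreal (inverse \<Lambda>) * gg) <= ennreal \<Lambda> * ennreal TOT" by (intro mult_left_mono) auto
   moreover have "ennreal \<Lambda> * (ennreal (inverse \<Lambda>) * gg) = gg"
   proof -
    have "ennreal \<Lambda> * ennreal (inverse \<Lambda>) = ennreal 1" using \<Lambda> by (subst ennreal_mult[symmetric]) auto
    then show ?thesis by (simp add: mult.assoc[symmetric])
   qed
   ultimately show ?thesis using \<Lambda> TOT0 by (simp add: ennreal_mult)
  qed
  have nonneg: "\<sigma> * I0 + \<Lambda> * Bb >= 0"
  proof -
   have "0 <= (\<integral>w. \<sigma> * F w + \<Lambda> * ?c bad w \<partial>lebesgue)"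
   proof (intro integral_nonneg_AE AE_I2)
    fix w :: "'a \<times> 'a"
    obtain x y where w: "w = (x, y)" by (cases w)
    have "0 <= inverse \<Lambda> * g0 x y" using g00[of x y] \<Lambda> by simp
    then show "0 <= \<sigma> * F w + \<Lambda> * ?c bad w" using key[of x y] by (simp add: w)
   qed
   also have "... = \<sigma> * I0 + \<Lambda> * (\<integral>w. ?c bad w \<partial>lebesgue)" using Fint badint by (simp add: I0_def)
   also have "... <= \<sigma> * I0 + \<Lambda> * Bb" using badle \<Lambda> by (intro add_left_mono mult_left_mono) auto
   finally show ?thesis .
  qed
  have Eb: "E <= 2 / C1 * TOT"
  proof -
   have "C1 / 2 * E <= TOT" using low nonneg by linarith
   then show ?thesis using C1 by (simp add: field_simps)
  qed
  have "EE + gg <= ennreal (2 / C1 * TOT) + ennreal (\<Lambda> * TOT)"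
   by (rule add_mono[OF order_trans[OF EEE ennreal_leI[OF Eb]] ggb])
  also have "... = ennreal (2 / C1 * TOT + \<Lambda> * TOT)" using C1 \<Lambda> TOT0 by (intro ennreal_plus[symmetric]) auto
  also have "2 / C1 * TOT + \<Lambda> * TOT = C * (1 + H) * D powr (real DIM('a) + p) * \<rho> powr (- p) * Mm powr p * A"
   unfolding distrib_right[symmetric] unfolding TOT_def C_def Q_def by (simp only: mult.assoc)
  finally show "(NN x. ennreal (if \<sigma> * u x > k then norm (G x) powr p else 0) * indicator (ball z \<rho>') x) +
   (NN x. NN y. ennreal (indicator (ball z \<rho>') x * (max (\<sigma> * u x - k) 0 * max (k - \<sigma> * u y) 0 powr (p - 1) * riesz (p * s) x y)))
   <= ennreal (C * (1 + H) * (\<rho> / (\<rho> - \<rho>')) powr (real DIM('a) + p) * \<rho> powr (- p) * Mm powr p * measure lborel {x \<in> ball z \<rho>. \<sigma> * u x > k})"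
   unfolding EE_def gg_def g0_def pos_def R_def D_def A_def As_def .
 qed
qed

section \<open>De Giorgi iteration\<close>

text \<open>From here on the equation is replaced by two consequences, the energy inequality and the
  L^1 translation estimate. Both families of estimates persist when a constant is added to
  \<open>v\<close>, which allows the shift by \<open>\<tau>\<close>. The bound \<open>M\<close> is
  recorded for the stopping argument in \<open>harnack_shifted\<close> and enters no
  constant.\<close>

locale de_giorgi =
 fixes Cd p s :: real and \<Omega> :: "'a::euclidean_space set" and v :: "'a => real" and G :: "'a => 'a" and M :: real
 assumes p: "1 < p" and s: "0 < s" "s < 1" and Cd: "Cd > 0"
  and vm[measurable]: "v \<in> borel_measurable borel" and Gm[measurable]: "G \<in> borel_measurable borel"
  and vM: "\<And>x. \<bar>v x\<bar> <= M"
  and energy: "\<And>z \<rho> \<rho>' k \<sigma> Mm H. 0 < \<rho>' ==> \<rho>' < \<rho> ==> \<rho> <= 1 ==> cball z \<rho> \<subseteq> \<Omega> ==> \<bar>\<sigma>\<bar> = 1 ==> Mm > 0 ==> H >= 0 ==>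
   (AE x in lborel. x \<in> ball z \<rho> --> \<sigma> * v x <= k + Mm) ==>
   (NN y. ennreal (max (\<sigma> * v y - k) 0 powr (p - 1) * riesz (p * s) z y) * indicator (- ball z \<rho>) y) <= ennreal (H * Mm powr (p - 1) * \<rho> powr (- p)) ==>
   (NN x. ennreal (if \<sigma> * v x > k then norm (G x) powr p else 0) * indicator (ball z \<rho>') x) +
   (NN x. NN y. ennreal (indicator (ball z \<rho>') x * (max (\<sigma> * v x - k) 0 * max (k - \<sigma> * v y) 0 powr (p - 1) * riesz (p * s) x y)))
   <= ennreal (Cd * (1 + H) * (\<rho> / (\<rho> - \<rho>')) powr (real DIM('a) + p) * \<rho> powr (- p) * Mm powr p * measure lborel {x \<in> ball z \<rho>. \<sigma> * v x > k})"
  and transl: "\<And>z \<rho> h k l \<sigma>. \<rho> > 0 ==> cball z \<rho> \<subseteq> \<Omega> ==> \<bar>\<sigma>\<bar> = 1 ==> l >= 0 ==>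
   pnorm 1 (%x. indicator (ball z \<rho>) x * indicator (ball z \<rho>) (x + h) *
    ((max (\<sigma> * v (x + h) - k) 0 - max (\<sigma> * v (x + h) - (k + l)) 0) - (max (\<sigma> * v x - k) 0 - max (\<sigma> * v x - (k + l)) 0))) <=
   ennreal (4 powr 1 * norm h powr 1) * pnorm 1 (%x. indicator (ball z \<rho>) x * norm ((if \<sigma> * v x > k & \<sigma> * v x <= k + l then \<sigma> else 0) *\<^sub>R G x))"
begin

text \<open>In view of the coarea formula this is the accumulated perimeter of the level sets
  between \<open>k\<close> and \<open>k + l\<close> inside the ball, the natural upper bound in
  isoperimetric inequalities.\<close>

definition grad_mass :: "real => real => real => 'a => real => ennreal" where
 "grad_mass \<sigma> k l z \<rho> = (NN x. ennreal (norm (G x)) * indicator {x \<in> ball z \<rho>. k < \<sigma> * v x & \<sigma> * v x <= k + l} x)"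

lemma level_set_borel[measurable]:
 "{x \<in> ball z \<rho>. k < \<sigma> * v x} \<in> sets borel" "{x \<in> ball z \<rho>. k < \<sigma> * v x & \<sigma> * v x <= l} \<in> sets borel"
 "{x \<in> ball z \<rho>. \<sigma> * v x <= l} \<in> sets borel" "{x \<in> ball z \<rho>. l <= \<sigma> * v x} \<in> sets borel"
proof -
 have m: "{x \<in> space borel. k < \<sigma> * v x} \<in> sets borel" "{x \<in> space borel. k < \<sigma> * v x & \<sigma> * v x <= l} \<in> sets borel"
   "{x \<in> space borel. \<sigma> * v x <= l} \<in> sets borel" "{x \<in> space borel. l <= \<sigma> * v x} \<in> sets borel" by measurable
 have e: "{x \<in> ball z \<rho>. k < \<sigma> * v x} = ball z \<rho> \<inter> {x \<in> space borel. k < \<sigma> * v x}"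
  "{x \<in> ball z \<rho>. k < \<sigma> * v x & \<sigma> * v x <= l} = ball z \<rho> \<inter> {x \<in> space borel. k < \<sigma> * v x & \<sigma> * v x <= l}"
  "{x \<in> ball z \<rho>. \<sigma> * v x <= l} = ball z \<rho> \<inter> {x \<in> space borel. \<sigma> * v x <= l}"
  "{x \<in> ball z \<rho>. l <= \<sigma> * v x} = ball z \<rho> \<inter> {x \<in> space borel. l <= \<sigma> * v x}" by auto
 show "{x \<in> ball z \<rho>. k < \<sigma> * v x} \<in> sets borel" "{x \<in> ball z \<rho>. k < \<sigma> * v x & \<sigma> * v x <= l} \<in> sets borel"
  "{x \<in> ball z \<rho>. \<sigma> * v x <= l} \<in> sets borel" "{x \<in> ball z \<rho>. l <= \<sigma> * v x} \<in> sets borel"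
  unfolding e by (intro sets.Int m; simp)+
qed

lemma emeasure_ball_subset:
 assumes "S \<subseteq> ball z \<rho>"
 shows "emeasure lborel S = ennreal (measure lborel S)"
proof (rule emeasure_eq_ennreal_measure)
 have "bounded S" using assms bounded_ball bounded_subset by blast
 then show "emeasure lborel S \<noteq> \<top>" using emeasure_bounded_finite[of S] by (simp add: less_top)
qed

text \<open>Substituting \<open>y = x + h\<close> turns the double integral into an integral of L^1
  translation estimates over \<open>norm h < r\<close>. The radius is left free:
  \<open>r = 2 * \<rho>\<close> sees all pairs of the ball, a small \<open>r\<close>
  localises.\<close>

lemma pair_estimate:
 fixes k :: real
 assumes \<rho>: "\<rho> > 0" "cball z \<rho> \<subseteq> \<Omega>" and \<sigma>: "\<bar>\<sigma>\<bar> = 1" and l: "l >= 0" and r: "r > 0"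
 defines "f \<equiv> (%x. max (\<sigma> * v x - k) 0 - max (\<sigma> * v x - (k + l)) 0)"
 shows "(NN x. NN y. ennreal (indicator (ball z \<rho>) x * indicator (ball z \<rho>) y * (indicator (ball x r) y * \<bar>f x - f y\<bar>)))
  <= ennreal (4 * r * (r ^ DIM('a) * measure lborel (ball (0::'a) 1))) * grad_mass \<sigma> k l z \<rho>"
proof -
 define Bz where "Bz = ball z \<rho>"
 have [measurable]: "Bz \<in> sets borel" by (simp add: Bz_def)
 have [measurable]: "f \<in> borel_measurable borel" unfolding f_def by measurable
 define D where "D = (%h x. indicator Bz x * indicator Bz (x + h) * (f (x + h) - f x))"
 have [measurable]: "D h \<in> borel_measurable borel" for h unfolding D_def by measurable
 have est: "pnorm 1 (D h) <= ennreal (4 * norm h) * grad_mass \<sigma> k l z \<rho>" for h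
 proof -
  have "pnorm 1 (%x. indicator (ball z \<rho>) x * norm ((if \<sigma> * v x > k & \<sigma> * v x <= k + l then \<sigma> else 0) *\<^sub>R G x)) = grad_mass \<sigma> k l z \<rho>"
   unfolding pnorm_def grad_mass_def using \<sigma> by (intro nn_integral_cong) (auto simp: indicator_def)
  then show ?thesis using transl[OF \<rho> \<sigma> l, of h k] unfolding D_def f_def Bz_def by simp
 qed
 define b where "b = (%h::'a. if norm h < r then 1 else 0::real)"
 have [measurable]: "b \<in> borel_measurable borel" unfolding b_def by measurable
 have "(NN x. NN y. ennreal (indicator Bz x * indicator Bz y * (indicator (ball x r) y * \<bar>f x - f y\<bar>)))
   = (NN x. NN h. ennreal \<bar>D h x\<bar> * ennreal (b h))"
 proof (rule nn_integral_cong)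
  fix x
  have "(NN y. ennreal (indicator Bz x * indicator Bz y * (indicator (ball x r) y * \<bar>f x - f y\<bar>)))
   = (NN y. ennreal (indicator Bz x * indicator Bz y * (b (y - x) * \<bar>f x - f y\<bar>)))"
   by (intro nn_integral_cong) (auto simp: b_def indicator_def dist_norm norm_minus_commute)
  also have "... = (NN h. ennreal (indicator Bz x * indicator Bz (h + x) * (b (h + x - x) * \<bar>f x - f (h + x)\<bar>)))"
   by (rule nn_integral_lborel_translate[symmetric]) measurable
  also have "... = (NN h. ennreal \<bar>D h x\<bar> * ennreal (b h))"
   by (intro nn_integral_cong) (auto simp: D_def b_def indicator_def abs_minus_commute add.commute)
  finally show "(NN y. ennreal (indicator Bz x * indicator Bz y * (indicator (ball x r) y * \<bar>f x - f y\<bar>)))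
   = (NN h. ennreal \<bar>D h x\<bar> * ennreal (b h))" .
 qed
 also have "... = (NN h. NN x. ennreal \<bar>D h x\<bar> * ennreal (b h))"
  unfolding D_def by (rule lborel_pair.Fubini') measurable
 also have "... = (NN h. pnorm 1 (D h) * ennreal (b h))"
  unfolding pnorm_def by (intro nn_integral_cong, subst nn_integral_multc) auto
 also have "... <= (NN h. (ennreal (4 * r) * grad_mass \<sigma> k l z \<rho>) * indicator (ball (0::'a) r) h)"
 proof (rule nn_integral_mono)
  fix h :: 'a
  show "pnorm 1 (D h) * ennreal (b h) <= (ennreal (4 * r) * grad_mass \<sigma> k l z \<rho>) * indicator (ball (0::'a) r) h"
  proof (cases "norm h < r")
   case True
   have "pnorm 1 (D h) <= ennreal (4 * norm h) * grad_mass \<sigma> k l z \<rho>" by (rule est)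
   also have "... <= ennreal (4 * r) * grad_mass \<sigma> k l z \<rho>" using True by (intro mult_right_mono ennreal_leI) auto
   finally show ?thesis using True by (simp add: b_def)
  qed (simp add: b_def)
 qed
 also have "... = (ennreal (4 * r) * grad_mass \<sigma> k l z \<rho>) * emeasure lborel (ball (0::'a) r)"
  by (rule nn_integral_cmult_indicator) simp
 also have "... = ennreal (4 * r * (r ^ DIM('a) * measure lborel (ball (0::'a) 1))) * grad_mass \<sigma> k l z \<rho>"
  using r by (simp add: measure_ball_eq ennreal_mult mult_ac)
 finally show ?thesis unfolding Bz_def .
qed

text \<open>On the lower set \<open>f\<close> is 0, on the upper set it is \<open>l\<close>, and any
  two points of the ball are closer than \<open>2 * \<rho>\<close>. So every pair from the two sets
  contributes \<open>l\<close> to the double integral of \<open>pair_estimate\<close>.\<close>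

lemma isoperimetric:
 assumes \<rho>: "\<rho> > 0" "cball z \<rho> \<subseteq> \<Omega>" and \<sigma>: "\<bar>\<sigma>\<bar> = 1" and l: "l > 0"
 shows "ennreal (l * measure lborel {x \<in> ball z \<rho>. \<sigma> * v x <= k} * measure lborel {x \<in> ball z \<rho>. k + l <= \<sigma> * v x}) <=
  ennreal (8 * \<rho> * ((2 * \<rho>) ^ DIM('a) * measure lborel (ball (0::'a) 1))) * grad_mass \<sigma> k l z \<rho>"
proof -
 define f where "f = (%x. max (\<sigma> * v x - k) 0 - max (\<sigma> * v x - (k + l)) 0)"
 define A where "A = {x \<in> ball z \<rho>. \<sigma> * v x <= k}"
 define E where "E = {x \<in> ball z \<rho>. k + l <= \<sigma> * v x}"
 have [measurable]: "A \<in> sets borel" "E \<in> sets borel" unfolding A_def E_def by auto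
 have eA: "emeasure lborel A = ennreal (measure lborel A)" and eE: "emeasure lborel E = ennreal (measure lborel E)"
  by (rule emeasure_ball_subset[of _ z \<rho>]; auto simp: A_def E_def)+
 have "ennreal (l * measure lborel A * measure lborel E) = (NN x. (ennreal l * emeasure lborel E) * indicator A x)"
  using l by (subst nn_integral_cmult_indicator) (auto simp: eA eE ennreal_mult mult_ac)
 also have "... <= (NN x. NN y. ennreal (indicator (ball z \<rho>) x * indicator (ball z \<rho>) y * (indicator (ball x (2 * \<rho>)) y * \<bar>f x - f y\<bar>)))"
 proof (rule nn_integral_mono)
  fix x
  show "(ennreal l * emeasure lborel E) * indicator A x <= (NN y. ennreal (indicator (ball z \<rho>) x * indicator (ball z \<rho>) y * (indicator (ball x (2 * \<rho>)) y * \<bar>f x - f y\<bar>)))"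
  proof (cases "x \<in> A")
   case True
   have "ennreal l * emeasure lborel E = (NN y. ennreal l * indicator E y)" by (rule nn_integral_cmult_indicator[symmetric]) simp
   also have "... <= (NN y. ennreal (indicator (ball z \<rho>) x * indicator (ball z \<rho>) y * (indicator (ball x (2 * \<rho>)) y * \<bar>f x - f y\<bar>)))"
   proof (rule nn_integral_mono)
    fix y
    show "ennreal l * indicator E y <= ennreal (indicator (ball z \<rho>) x * indicator (ball z \<rho>) y * (indicator (ball x (2 * \<rho>)) y * \<bar>f x - f y\<bar>))"
    proof (cases "y \<in> E")
     case yE: True
     have "f x = 0" using True l by (simp add: f_def A_def max_def)
     moreover have "f y = l" using yE l by (simp add: f_def E_def max_def)
     moreover have "dist x y < 2 * \<rho>" using True yE dist_triangle[of x y z] by (simp add: A_def E_def dist_commute)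
     ultimately show ?thesis using True yE l by (simp add: A_def E_def)
    qed simp
   qed
   finally show ?thesis using True by simp
  qed simp
 qed
 also have "... <= ennreal (4 * (2 * \<rho>) * ((2 * \<rho>) ^ DIM('a) * measure lborel (ball (0::'a) 1))) * grad_mass \<sigma> k l z \<rho>"
  unfolding f_def by (rule pair_estimate) (use assms in auto)
 finally show ?thesis by (simp add: A_def E_def)
qed

text \<open>The superlevel set is too small to fill more than half of a ball of radius
  \<open>e\<close>. A point where \<open>f = l\<close> therefore sees \<open>f = 0\<close> on at
  least half of its \<open>e\<close>-ball, which makes \<open>pair_estimate\<close> effective at the
  scale \<open>e\<close>. The factor \<open>e\<close> on the right is the gain of the iteration; it
  may be taken of the order of the \<open>N\<close>-th root of the measure.\<close>

lemma smoothing: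
 assumes \<rho>: "0 < \<rho>'" "\<rho>' < \<rho>" "cball z \<rho> \<subseteq> \<Omega>" and \<sigma>: "\<bar>\<sigma>\<bar> = 1" and l: "l > 0"
  and e: "0 < e" "e <= \<rho> - \<rho>'"
  and small: "2 * measure lborel {x \<in> ball z \<rho>. k < \<sigma> * v x} <= e ^ DIM('a) * measure lborel (ball (0::'a) 1)"
 shows "ennreal (l * measure lborel {x \<in> ball z \<rho>'. k + l <= \<sigma> * v x}) <= ennreal (8 * e) * grad_mass \<sigma> k l z \<rho>"
proof -
 define f where "f = (%x. max (\<sigma> * v x - k) 0 - max (\<sigma> * v x - (k + l)) 0)"
 define V where "V = e ^ DIM('a) * measure lborel (ball (0::'a) 1)"
 have V: "V > 0" using e content_ball_pos[of 1 "0::'a"] by (simp add: V_def)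
 define A where "A = {x \<in> ball z \<rho>. k < \<sigma> * v x}"
 define E where "E = {x \<in> ball z \<rho>'. k + l <= \<sigma> * v x}"
 have [measurable]: "A \<in> sets borel" "E \<in> sets borel" unfolding A_def E_def by auto
 have eA: "emeasure lborel A = ennreal (measure lborel A)" by (rule emeasure_ball_subset[of _ z \<rho>]) (auto simp: A_def)
 have eE: "emeasure lborel E = ennreal (measure lborel E)" by (rule emeasure_ball_subset[of _ z \<rho>']) (auto simp: E_def)
 have "ennreal (l * (V / 2) * measure lborel E) = (NN x. ennreal (l * (V / 2)) * indicator E x)"
 proof -
  have "ennreal (l * (V / 2) * measure lborel E) = ennreal (l * (V / 2)) * emeasure lborel E"
   unfolding eE using l V by (intro ennreal_mult) auto
  then show ?thesis by (simp add: nn_integral_cmult_indicator)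
 qed
 also have "... <= (NN x. NN y. ennreal (indicator (ball z \<rho>) x * indicator (ball z \<rho>) y * (indicator (ball x e) y * \<bar>f x - f y\<bar>)))"
 proof (rule nn_integral_mono)
  fix x
  show "ennreal (l * (V / 2)) * indicator E x <= (NN y. ennreal (indicator (ball z \<rho>) x * indicator (ball z \<rho>) y * (indicator (ball x e) y * \<bar>f x - f y\<bar>)))"
  proof (cases "x \<in> E")
   case True
   have sub: "ball x e \<subseteq> ball z \<rho>"
   proof
    fix y assume "y \<in> ball x e"
    then show "y \<in> ball z \<rho>" using True e dist_triangle[of z y x] by (simp add: E_def)
   qed
   have eb: "emeasure lborel (ball x e) = ennreal V" using e by (simp add: measure_ball_eq V_def)
   have "ennreal (V / 2) <= emeasure lborel (ball x e - A)"
   proof -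
    have "ennreal V <= emeasure lborel (ball x e - A) + emeasure lborel A"
    proof -
     have "emeasure lborel (ball x e) <= emeasure lborel ((ball x e - A) \<union> A)" by (rule emeasure_mono) auto
     also have "... <= emeasure lborel (ball x e - A) + emeasure lborel A" by (rule emeasure_subadditive) auto
     finally show ?thesis unfolding eb .
    qed
    also have "... <= emeasure lborel (ball x e - A) + ennreal (V / 2)"
     unfolding eA using small by (intro add_left_mono ennreal_leI) (simp add: A_def V_def)
    finally have "ennreal V <= emeasure lborel (ball x e - A) + ennreal (V / 2)" .
    moreover have "ennreal V = ennreal (V / 2) + ennreal (V / 2)" using V by (subst ennreal_plus[symmetric]) auto
    ultimately show ?thesis by (simp add: ennreal_add_left_cancel_le add.commute)
   qed
   then have "ennreal (l * (V / 2)) <= ennreal l * emeasure lborel (ball x e - A)"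
    using l V by (subst ennreal_mult) (auto intro: mult_left_mono)
   also have "... = (NN y. ennreal l * indicator (ball x e - A) y)" by (rule nn_integral_cmult_indicator[symmetric]) simp
   also have "... <= (NN y. ennreal (indicator (ball z \<rho>) x * indicator (ball z \<rho>) y * (indicator (ball x e) y * \<bar>f x - f y\<bar>)))"
   proof (rule nn_integral_mono)
    fix y
    show "ennreal l * indicator (ball x e - A) y <= ennreal (indicator (ball z \<rho>) x * indicator (ball z \<rho>) y * (indicator (ball x e) y * \<bar>f x - f y\<bar>))"
    proof (cases "y \<in> ball x e - A")
     case yE: True
     then have yz: "y \<in> ball z \<rho>" using sub by blast
     have "f x = l" using True l by (simp add: f_def E_def max_def)
     moreover have "f y = 0" using yE yz l by (simp add: f_def A_def max_def)
     moreover have "x \<in> ball z \<rho>" using True \<rho> by (simp add: E_def)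
     ultimately show ?thesis using yE yz l by simp
    qed simp
   qed
   finally show ?thesis using True by simp
  qed simp
 qed
 also have "... <= ennreal (4 * e * V) * grad_mass \<sigma> k l z \<rho>"
  unfolding f_def V_def by (rule pair_estimate) (use assms in auto)
 finally have "ennreal (l * (V / 2) * measure lborel E) <= ennreal (4 * e * V) * grad_mass \<sigma> k l z \<rho>" .
 then have "ennreal (2 / V) * ennreal (l * (V / 2) * measure lborel E) <= ennreal (2 / V) * (ennreal (4 * e * V) * grad_mass \<sigma> k l z \<rho>)"
  by (rule mult_left_mono) simp
 also have "ennreal (2 / V) * ennreal (l * (V / 2) * measure lborel E) = ennreal (l * measure lborel E)"
  using V l by (subst ennreal_mult[symmetric]) auto
 also have "ennreal (2 / V) * (ennreal (4 * e * V) * grad_mass \<sigma> k l z \<rho>) = ennreal (8 * e) * grad_mass \<sigma> k l z \<rho>"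
  using V e by (subst mult.assoc[symmetric], subst ennreal_mult[symmetric]) auto
 finally show ?thesis by (simp add: E_def)
qed

text \<open>As in \<open>pnorm1_le\<close>, a threshold \<open>\<mu>\<close> splits the gradient:
  below it the gradient is charged to the measure of the slice, above it to the energy.\<close>

lemma grad_mass_le:
 assumes \<mu>: "\<mu> > 0"
 shows "grad_mass \<sigma> k l z \<rho> <= ennreal (\<mu> * measure lborel {x \<in> ball z \<rho>. k < \<sigma> * v x & \<sigma> * v x <= k + l}) +
  ennreal (\<mu> powr (1 - p)) * (NN x. ennreal (if \<sigma> * v x > k then norm (G x) powr p else 0) * indicator (ball z \<rho>) x)"
proof -
 define D where "D = {x \<in> ball z \<rho>. k < \<sigma> * v x & \<sigma> * v x <= k + l}"
 have [measurable]: "D \<in> sets borel" unfolding D_def by auto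
 have [measurable]: "ball z \<rho> \<in> sets borel" by simp
 have eD: "emeasure lborel D = ennreal (measure lborel D)" by (rule emeasure_ball_subset[of _ z \<rho>]) (auto simp: D_def)
 have "grad_mass \<sigma> k l z \<rho> <= (NN x. ennreal \<mu> * indicator D x + ennreal (\<mu> powr (1 - p)) * (ennreal (if \<sigma> * v x > k then norm (G x) powr p else 0) * indicator (ball z \<rho>) x))"
  unfolding grad_mass_def D_def[symmetric]
 proof (rule nn_integral_mono)
  fix x
  show "ennreal (norm (G x)) * indicator D x <= ennreal \<mu> * indicator D x + ennreal (\<mu> powr (1 - p)) * (ennreal (if \<sigma> * v x > k then norm (G x) powr p else 0) * indicator (ball z \<rho>) x)"
  proof (cases "x \<in> D")
   case True
   have "norm (G x) <= \<mu> + \<mu> powr (1 - p) * norm (G x) powr p"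
   proof (cases "norm (G x) <= \<mu>")
    case False
    then have pos: "norm (G x) > 0" using \<mu> by linarith
    have "norm (G x) powr (1 - p) <= \<mu> powr (1 - p)" using False \<mu> p by (intro powr_mono2') auto
    then have "norm (G x) powr (1 - p) * norm (G x) powr p <= \<mu> powr (1 - p) * norm (G x) powr p" by (intro mult_right_mono) auto
    moreover have "norm (G x) powr (1 - p) * norm (G x) powr p = norm (G x)" using pos by (simp add: powr_add[symmetric])
    ultimately show ?thesis using \<mu> by linarith
   qed (simp add: add_increasing2)
   then have "ennreal (norm (G x)) <= ennreal (\<mu> + \<mu> powr (1 - p) * norm (G x) powr p)" by (rule ennreal_leI)
   also have "... = ennreal \<mu> + ennreal (\<mu> powr (1 - p)) * ennreal (norm (G x) powr p)" using \<mu> by (simp add: ennreal_mult)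
   finally show ?thesis using True by (simp add: D_def)
  qed simp
 qed
 also have "... = ennreal \<mu> * emeasure lborel D + ennreal (\<mu> powr (1 - p)) * (NN x. ennreal (if \<sigma> * v x > k then norm (G x) powr p else 0) * indicator (ball z \<rho>) x)"
  by (subst nn_integral_add) (auto simp: nn_integral_cmult nn_integral_cmult_indicator)
 also have "ennreal \<mu> * emeasure lborel D = ennreal (\<mu> * measure lborel D)" unfolding eD using \<mu> by (simp add: ennreal_mult)
 finally show ?thesis by (simp add: D_def)
qed

end

text \<open>Radii shrink to \<open>\<rho> / 2\<close> while levels rise to
  \<open>k + a * Mm\<close>. The smoothing scale \<open>e\<close> decreases geometrically in such a
  way that the measure bound \<open>\<nu> * q^j * \<rho>^N\<close> is exactly what
  \<open>smoothing\<close> tolerates. This makes the recursion linear,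
  \<open>A (Suc j) <= q * A j\<close>, in place of the usual superlinear one.\<close>

lemma de_giorgi_lemma:
 fixes Cd p s a H :: real
 assumes par: "Cd > 0" "p > 1" "0 < a" "a <= 1" "H >= 0"
 shows "\<exists>\<nu>>0. \<forall>(\<Omega>::'a::euclidean_space set) v G M. de_giorgi Cd p s \<Omega> v G M -->
  (\<forall>\<sigma> z \<rho> k Mm. \<bar>\<sigma>\<bar> = 1 & 0 < \<rho> & \<rho> <= 1 & cball z \<rho> \<subseteq> \<Omega> & Mm > 0 &
   (AE x in lborel. x \<in> ball z \<rho> --> \<sigma> * v x <= k + Mm) &
   (NN y. ennreal (max (\<sigma> * v y - k) 0 powr (p - 1) * riesz (p * s) z y) * indicator (- ball z (\<rho> / 2)) y) <= ennreal (H * Mm powr (p - 1) * \<rho> powr (- p)) &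
   measure lborel {x \<in> ball z \<rho>. k < \<sigma> * v x} <= \<nu> * \<rho> ^ DIM('a) -->
   (AE x in lborel. x \<in> ball z (\<rho> / 2) --> \<sigma> * v x <= k + a * Mm))"
proof -
 define N where "N = DIM('a)"
 define V where "V = measure lborel (ball (0::'a) 1)"
 have V: "V > 0" unfolding V_def by (intro content_ball_pos) auto
 \<comment> \<open>Bookkeeping of step \<open>j\<close>: halving the level gap costs 2 and shrinking
   the radii costs \<open>b1\<close>, hence \<open>e\<close> must decrease by
   \<open>cc = 2 * b1\<close> and the measure bound by \<open>q = cc^(-N)\<close>. The two entries
   of the minimum in \<open>c0\<close> ensure that \<open>e\<close> fits into the gap of radii and
   that the recursion factor is at most \<open>q\<close>.\<close>
 define b1 where "b1 = (2::real) powr (real N + p)"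
 define cc where "cc = 2 * b1"
 define E0 where "E0 = Cd * (1 + H) * 8 powr (real N + p) * 2 powr p"
 define q where "q = (1 / cc) ^ N"
 define c0 where "c0 = min (1/8) (a / (16 * (1 + E0))) * q"
 define \<nu> where "\<nu> = V * c0 ^ N / 2"
 have b1: "b1 >= 1" unfolding b1_def using par by (intro ge_one_powr_ge_zero) auto
 have cc: "cc >= 2" using b1 by (simp add: cc_def)
 have E0: "E0 >= 0" using par by (simp add: E0_def)
 have N0: "N > 0" by (simp add: N_def)
 have q: "0 < q" "q < 1" unfolding q_def using cc N0 by (auto intro!: power_less_one_iff[THEN iffD2] simp: power_less_one_iff)
 have c0: "c0 > 0" unfolding c0_def using par E0 q by auto
 have c0le: "c0 <= 1/8" "16 * (1 + E0) * c0 / a <= q"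
 proof -
  have "c0 <= (1/8) * 1" unfolding c0_def using q par E0 by (intro mult_mono) auto
  then show "c0 <= 1/8" by simp
  have "c0 <= (a / (16 * (1 + E0))) * q" unfolding c0_def using q by (intro mult_right_mono) auto
  then show "16 * (1 + E0) * c0 / a <= q" using par E0 by (simp add: field_simps)
 qed
 have \<nu>: "\<nu> > 0" using V c0 by (simp add: \<nu>_def)
 show ?thesis
 proof (intro exI[of _ \<nu>] conjI \<nu> allI impI, elim conjE)
  fix \<Omega> :: "'a set" and v G M \<sigma> z \<rho> k Mm
  assume dg: "de_giorgi Cd p s \<Omega> v G M" and \<sigma>: "\<bar>\<sigma>\<bar> = (1::real)" and \<rho>: "0 < \<rho>" "\<rho> <= 1" "cball z \<rho> \<subseteq> \<Omega>" and Mm: "Mm > 0"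
   and ub: "AE x in lborel. x \<in> ball z \<rho> --> \<sigma> * v x <= k + Mm"
   and tail: "(NN y. ennreal (max (\<sigma> * v y - k) 0 powr (p - 1) * riesz (p * s) z y) * indicator (- ball z (\<rho> / 2)) y) <= ennreal (H * Mm powr (p - 1) * \<rho> powr (- p))"
   and small: "measure lborel {x \<in> ball z \<rho>. k < \<sigma> * v x} <= \<nu> * \<rho> ^ DIM('a)"
  interpret de_giorgi Cd p s \<Omega> v G M by (rule dg)
  define rj where "rj = (%j::nat. \<rho> / 2 * (1 + (1/2) ^ j))"
  define kj where "kj = (%j::nat. k + a * Mm * (1 - (1/2) ^ j))"
  define A where "A = (%j. measure lborel {x \<in> ball z (rj j). kj j < \<sigma> * v x})"
  have rj: "\<rho> / 2 <= rj j" "rj j <= \<rho>" "rj j > 0" for j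
  proof -
   have "0 <= (1/2::real) ^ j" "(1/2::real) ^ j <= 1" by (auto simp: power_le_one)
   then have "\<rho> / 2 * 1 <= \<rho> / 2 * (1 + (1/2) ^ j)" "\<rho> / 2 * (1 + (1/2) ^ j) <= \<rho> / 2 * 2"
    using \<rho> by (intro mult_left_mono; simp)+
   then show "\<rho> / 2 <= rj j" "rj j <= \<rho>" by (simp_all add: rj_def)
   then show "rj j > 0" using \<rho> by simp
  qed
  have kjk: "k <= kj j" for j
  proof -
   have "(1/2::real) ^ j <= 1" by (simp add: power_le_one)
   then show ?thesis using par Mm by (simp add: kj_def)
  qed
  have mono: "measure lborel S <= measure lborel T" if "S \<subseteq> T" "T \<subseteq> ball z \<rho>" "S \<in> sets borel" "T \<in> sets borel" for S T
  proof (rule measure_mono_fmeasurable[OF that(1)])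
   have "emeasure lborel T = ennreal (measure lborel T)" by (rule emeasure_ball_subset[OF that(2)])
   then show "T \<in> fmeasurable lborel" using that by (auto simp: fmeasurable_def)
  qed (use that in auto)
  have step: "A j <= \<nu> * q ^ j * \<rho> ^ N" for j
  proof (induction j)
   case 0
   then show ?case using small by (simp add: A_def rj_def kj_def N_def)
  next
   case (Suc j)
   define t where "t = (1/2::real) ^ j"
   have t: "0 < t" "t <= 1" by (auto simp: t_def power_le_one)
   \<comment> \<open>The middle radius: the energy is estimated from \<open>rj j\<close> to
     \<open>rs\<close>, and smoothing acts from \<open>rs\<close> to
     \<open>rj (Suc j)\<close>.\<close>
   define rs where "rs = (rj j + rj (Suc j)) / 2"
   have d1: "rj j - rs = \<rho> * t / 8" "rs - rj (Suc j) = \<rho> * t / 8" by (auto simp: rs_def rj_def t_def field_simps)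
   have \<rho>t: "\<rho> * t > 0" using \<rho> t by simp
   have rs: "0 < rs" "rs < rj j" "rj (Suc j) < rs" "rs <= \<rho>" using d1 \<rho>t rj(2,3)[of j] rj(3)[of "Suc j"] by linarith+
   define l where "l = a * Mm * t / 2"
   have l: "l > 0" using par Mm t by (simp add: l_def)
   have kl: "kj (Suc j) = kj j + l" by (simp add: kj_def l_def t_def field_simps)
   have A0: "A j >= 0" by (simp add: A_def)
   define EE where "EE = (NN x. ennreal (if \<sigma> * v x > kj j then norm (G x) powr p else 0) * indicator (ball z rs) x)"
   have cb: "cball z (rj j) \<subseteq> \<Omega>" "cball z rs \<subseteq> \<Omega>" using \<rho>(3) rj(2)[of j] rs(4) subset_cball by blast+
   have EEb: "EE <= ennreal (E0 * b1 ^ j * \<rho> powr (- p) * Mm powr p * A j)"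
   proof -
    have "EE <= ennreal (Cd * (1 + H) * (rj j / (rj j - rs)) powr (real DIM('a) + p) * rj j powr (- p) * Mm powr p * measure lborel {x \<in> ball z (rj j). \<sigma> * v x > kj j})"
     unfolding EE_def
    proof (rule order_trans[OF _ energy[of rs "rj j" z \<sigma> Mm H "kj j"]])
     show "AE x in lborel. x \<in> ball z (rj j) --> \<sigma> * v x <= kj j + Mm"
      using ub
     proof eventually_elim
      case (elim x)
      then show ?case using rj(2)[of j] kjk[of j] by auto
     qed
     have "(NN y. ennreal (max (\<sigma> * v y - kj j) 0 powr (p - 1) * riesz (p * s) z y) * indicator (- ball z (rj j)) y) <=
      (NN y. ennreal (max (\<sigma> * v y - k) 0 powr (p - 1) * riesz (p * s) z y) * indicator (- ball z (\<rho> / 2)) y)"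
     proof (rule nn_integral_mono)
      fix y
      have "max (\<sigma> * v y - kj j) 0 powr (p - 1) <= max (\<sigma> * v y - k) 0 powr (p - 1)" using kjk[of j] par by (intro powr_mono2) auto
      then have "max (\<sigma> * v y - kj j) 0 powr (p - 1) * riesz (p * s) z y <= max (\<sigma> * v y - k) 0 powr (p - 1) * riesz (p * s) z y"
       by (intro mult_right_mono riesz_nonneg)
      then show "ennreal (max (\<sigma> * v y - kj j) 0 powr (p - 1) * riesz (p * s) z y) * indicator (- ball z (rj j)) y <= ennreal (max (\<sigma> * v y - k) 0 powr (p - 1) * riesz (p * s) z y) * indicator (- ball z (\<rho> / 2)) y"
       using rj(1)[of j] by (auto simp: indicator_def ennreal_leI)
     qed
     also have "... <= ennreal (H * Mm powr (p - 1) * \<rho> powr (- p))" by (rule tail)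
     also have "... <= ennreal (H * Mm powr (p - 1) * rj j powr (- p))"
      using par rj[of j] by (intro ennreal_leI mult_left_mono powr_mono2') auto
     finally show "(NN y. ennreal (max (\<sigma> * v y - kj j) 0 powr (p - 1) * riesz (p * s) z y) * indicator (- ball z (rj j)) y) <= ennreal (H * Mm powr (p - 1) * rj j powr (- p))" .
    qed (use rs rj[of j] \<rho> cb \<sigma> Mm par in auto)
    also have "... <= ennreal (E0 * b1 ^ j * \<rho> powr (- p) * Mm powr p * A j)"
    proof (rule ennreal_leI)
     have "rj j / (rj j - rs) <= 8 * (1 / t)"
      unfolding d1 using rj(2)[of j] \<rho> t by (simp add: field_simps)
     then have "(rj j / (rj j - rs)) powr (real N + p) <= (8 * (1 / t)) powr (real N + p)"
      using rs rj(3)[of j] par by (intro powr_mono2) auto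
     also have "... = 8 powr (real N + p) * b1 ^ j"
     proof -
      have "1 / t = 2 ^ j" by (simp add: t_def power_divide)
      then have "(1 / t) powr (real N + p) = b1 ^ j"
       by (simp add: b1_def powr_realpow[symmetric] powr_powr mult.commute)
      then show ?thesis using t by (simp only: powr_mult)
     qed
     finally have 1: "(rj j / (rj j - rs)) powr (real N + p) <= 8 powr (real N + p) * b1 ^ j" .
     have 2: "rj j powr (- p) <= 2 powr p * \<rho> powr (- p)"
     proof -
      have "rj j powr (- p) <= (\<rho> / 2) powr (- p)" using rj[of j] \<rho> par by (intro powr_mono2') auto
      also have "... = 2 powr p * \<rho> powr (- p)" using \<rho> by (simp add: powr_divide powr_minus field_simps)
      finally show ?thesis .
     qed
     have "Cd * (1 + H) * (rj j / (rj j - rs)) powr (real N + p) * rj j powr (- p) * Mm powr p * A j <=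
       Cd * (1 + H) * (8 powr (real N + p) * b1 ^ j) * (2 powr p * \<rho> powr (- p)) * Mm powr p * A j"
      using 1 2 par A0 b1 by (intro mult_right_mono mult_mono mult_left_mono) auto
     also have "... = E0 * b1 ^ j * \<rho> powr (- p) * Mm powr p * A j" by (simp add: E0_def mult_ac)
     finally show "Cd * (1 + H) * (rj j / (rj j - rs)) powr (real DIM('a) + p) * rj j powr (- p) * Mm powr p * measure lborel {x \<in> ball z (rj j). \<sigma> * v x > kj j} <= E0 * b1 ^ j * \<rho> powr (- p) * Mm powr p * A j"
      by (simp add: A_def N_def)
    qed
    finally show ?thesis .
   qed
   \<comment> \<open>With this threshold
     \<open>\<mu> powr (1 - p) * \<rho> powr (- p) * Mm powr p\<close> is again
     \<open>\<mu>\<close>, so both parts of \<open>grad_mass_le\<close> have the same size.\<close>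
   define \<mu> where "\<mu> = Mm / \<rho>"
   have \<mu>: "\<mu> > 0" using Mm \<rho> by (simp add: \<mu>_def)
   have inA: "measure lborel {x \<in> ball z rs. kj j < \<sigma> * v x} <= A j"
    unfolding A_def by (rule mono) (use rs rj(2)[of j] in auto)
   have gm: "grad_mass \<sigma> (kj j) l z rs <= ennreal (\<mu> * A j * ((1 + E0) * b1 ^ j))"
   proof -
    have "grad_mass \<sigma> (kj j) l z rs <= ennreal (\<mu> * measure lborel {x \<in> ball z rs. kj j < \<sigma> * v x & \<sigma> * v x <= kj j + l}) + ennreal (\<mu> powr (1 - p)) * EE"
     unfolding EE_def by (rule grad_mass_le[OF \<mu>])
    also have "... <= ennreal (\<mu> * A j) + ennreal (\<mu> powr (1 - p)) * ennreal (E0 * b1 ^ j * \<rho> powr (- p) * Mm powr p * A j)"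
    proof (intro add_mono mult_left_mono EEb ennreal_leI)
     have "measure lborel {x \<in> ball z rs. kj j < \<sigma> * v x & \<sigma> * v x <= kj j + l} <= measure lborel {x \<in> ball z rs. kj j < \<sigma> * v x}"
      by (rule mono) (use rs(4) in auto)
     then show "measure lborel {x \<in> ball z rs. kj j < \<sigma> * v x & \<sigma> * v x <= kj j + l} <= A j" using inA by linarith
    qed (use \<mu> in auto)
    also have "... = ennreal (\<mu> * A j + \<mu> powr (1 - p) * (E0 * b1 ^ j * \<rho> powr (- p) * Mm powr p * A j))"
     using \<mu> A0 E0 b1 by (simp add: ennreal_mult[symmetric] ennreal_plus[symmetric] del: ennreal_plus)
    also have "... <= ennreal (\<mu> * A j * ((1 + E0) * b1 ^ j))"
    proof (rule ennreal_leI)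
     have "\<mu> powr (1 - p) * (\<rho> powr (- p) * Mm powr p) = \<mu>"
     proof -
      have "\<rho> powr (- p) * Mm powr p = \<mu> powr p" using \<rho> Mm by (simp add: \<mu>_def powr_divide powr_minus field_simps)
      then show ?thesis using \<mu> by (simp add: powr_add[symmetric])
     qed
     then have "\<mu> powr (1 - p) * (E0 * b1 ^ j * \<rho> powr (- p) * Mm powr p * A j) = E0 * b1 ^ j * A j * \<mu>" by (simp add: mult_ac)
     moreover have "\<mu> * A j <= \<mu> * A j * b1 ^ j"
      using mult_left_mono[OF one_le_power[OF b1, of j], of "\<mu> * A j"] \<mu> A0 by simp
     moreover have "\<mu> * A j * ((1 + E0) * b1 ^ j) = \<mu> * A j * b1 ^ j + E0 * b1 ^ j * A j * \<mu>" by (simp add: algebra_simps)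
     ultimately show "\<mu> * A j + \<mu> powr (1 - p) * (E0 * b1 ^ j * \<rho> powr (- p) * Mm powr p * A j) <= \<mu> * A j * ((1 + E0) * b1 ^ j)"
      by linarith
    qed
    finally show ?thesis .
   qed
   define e where "e = \<rho> * (c0 / cc ^ j)"
   have e: "0 < e" using \<rho> c0 cc by (simp add: e_def)
   have ele: "e <= rs - rj (Suc j)"
   proof -
    have "c0 / cc ^ j <= (1/8) / 2 ^ j" using c0le(1) c0 cc by (intro frac_le power_mono) auto
    then have "\<rho> * (c0 / cc ^ j) <= \<rho> * ((1/8) / 2 ^ j)" using \<rho> by (intro mult_left_mono) auto
    then show ?thesis unfolding d1 e_def by (simp add: t_def power_divide)
   qed
   have "ennreal (l * measure lborel {x \<in> ball z (rj (Suc j)). kj j + l <= \<sigma> * v x}) <= ennreal (8 * e) * grad_mass \<sigma> (kj j) l z rs"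
   proof (rule smoothing[OF rj(3) rs(3) cb(2) \<sigma> l e ele])
    have "2 * measure lborel {x \<in> ball z rs. kj j < \<sigma> * v x} <= 2 * (\<nu> * q ^ j * \<rho> ^ N)" using inA Suc by linarith
    also have "... = e ^ N * V"
     by (simp add: \<nu>_def q_def e_def power_mult_distrib power_divide power_mult[symmetric] mult.commute)
    finally show "2 * measure lborel {x \<in> ball z rs. kj j < \<sigma> * v x} <= e ^ DIM('a) * measure lborel (ball (0::'a) 1)" by (simp add: N_def V_def)
   qed
   also have "... <= ennreal (8 * e) * ennreal (\<mu> * A j * ((1 + E0) * b1 ^ j))" by (rule mult_left_mono[OF gm]) simp
   also have "... = ennreal (8 * e * (\<mu> * A j * ((1 + E0) * b1 ^ j)))" using e \<mu> A0 E0 b1 by (intro ennreal_mult[symmetric]) auto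
   finally have "l * measure lborel {x \<in> ball z (rj (Suc j)). kj j + l <= \<sigma> * v x} <= 8 * e * (\<mu> * A j * ((1 + E0) * b1 ^ j))"
    using e \<mu> A0 E0 b1 by (subst (asm) ennreal_le_iff) auto
   moreover have "A (Suc j) <= measure lborel {x \<in> ball z (rj (Suc j)). kj j + l <= \<sigma> * v x}"
    unfolding A_def kl by (rule mono) (use rj(2)[of "Suc j"] in auto)
   ultimately have "l * A (Suc j) <= 8 * e * (\<mu> * A j * ((1 + E0) * b1 ^ j))"
    using l by (smt (verit) mult_left_mono)
   also have "... = l * (16 * (1 + E0) * c0 / a * A j)"
   proof -
    have tt: "t * 2 ^ j = 1" by (simp add: t_def power_divide)
    have "cc ^ j = 2 ^ j * b1 ^ j" by (simp add: cc_def power_mult_distrib)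
    then have "8 * e * (\<mu> * A j * ((1 + E0) * b1 ^ j)) = 8 * Mm * c0 * A j * (1 + E0) / 2 ^ j"
     using \<rho> b1 by (simp add: e_def \<mu>_def field_simps)
    also have "... = 8 * Mm * c0 * A j * (1 + E0) * t" by (simp add: t_def power_divide)
    also have "... = l * (16 * (1 + E0) * c0 / a * A j)" using par by (simp add: l_def field_simps)
    finally show ?thesis .
   qed
   finally have "A (Suc j) <= 16 * (1 + E0) * c0 / a * A j" using l by (rule mult_left_le_imp_le)
   also have "... <= q * A j" using c0le(2) A0 by (intro mult_right_mono) auto
   also have "... <= q * (\<nu> * q ^ j * \<rho> ^ N)" using Suc q by (intro mult_left_mono) auto
   finally show ?case by (simp add: mult_ac)
  qed
  define Z where "Z = {x \<in> ball z (\<rho> / 2). k + a * Mm < \<sigma> * v x}"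
  have Zm: "Z \<in> sets borel" unfolding Z_def by (rule level_set_borel)
  have Zle: "measure lborel Z <= (\<nu> * \<rho> ^ N) * q ^ j" for j
  proof -
   have "measure lborel Z <= A j"
    unfolding A_def
   proof (rule mono)
    have "kj j <= k + a * Mm" using par Mm by (simp add: kj_def mult_left_le)
    then show "Z \<subseteq> {x \<in> ball z (rj j). kj j < \<sigma> * v x}" using rj(1)[of j] by (auto simp: Z_def)
   qed (use rj(2)[of j] Zm in auto)
   then show ?thesis using step[of j] by (simp add: mult_ac)
  qed
  have "(%j. (\<nu> * \<rho> ^ N) * q ^ j) \<longlonglongrightarrow> (\<nu> * \<rho> ^ N) * 0" by (intro tendsto_intros LIMSEQ_power_zero) (use q in auto)
  then have "measure lborel Z <= 0" using Zle by (intro LIMSEQ_le_const[of "%j. (\<nu> * \<rho> ^ N) * q ^ j"]) auto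
  moreover have "emeasure lborel Z = ennreal (measure lborel Z)" by (rule emeasure_ball_subset[of _ z "\<rho> / 2"]) (auto simp: Z_def)
  ultimately have "Z \<in> null_sets lborel" using Zm by (auto simp: null_sets_def ennreal_eq_0_iff)
  then have "AE x in lborel. x \<notin> Z" by (rule AE_not_in)
  then show "AE x in lborel. x \<in> ball z (\<rho> / 2) --> \<sigma> * v x <= k + a * Mm"
   by eventually_elim (auto simp: Z_def)
 qed
qed

section \<open>Expansion of positivity\<close>

text \<open>The function \<open>v\<close> stands for \<open>u + \<tau>\<close>. The last assumption,
  uniform in the centre \<open>z\<close>, says that the tail of the negative part is at most that of
  a constant \<open>\<tau>\<close> at scale \<open>r\<close>, up to \<open>Ct\<close>. Hence levels
  \<open>l >= \<tau>\<close> absorb it, whereas for levels below \<open>\<tau>\<close> positivity is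
  immediate.\<close>

locale harnack_setup = de_giorgi Cd p s \<Omega> v G M
 for Cd p s :: real and \<Omega> :: "'a::euclidean_space set" and v :: "'a => real" and G :: "'a => 'a" and M :: real +
 fixes x0 :: 'a and r \<tau> Ct :: real
 assumes r: "0 < r" "r <= 1" and ball_subset: "ball x0 (2 * r) \<subseteq> \<Omega>" and \<tau>: "\<tau> >= 0" and Ct: "Ct >= 0"
  and above: "AE x in lborel. x \<in> ball x0 (2 * r) --> \<tau> <= v x"
  and neg: "\<And>z. z \<in> ball x0 r ==> (NN y. ennreal (max (- v y) 0 powr (p - 1) * riesz (p * s) z y)) <= ennreal (Ct * \<tau> powr (p - 1) * r powr (- p))"
begin

lemma cball_in:
 assumes "z \<in> ball x0 r" "\<rho> <= r" shows "cball z \<rho> \<subseteq> ball x0 (2 * r)"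
proof
 fix y assume "y \<in> cball z \<rho>"
 then show "y \<in> ball x0 (2 * r)" using assms dist_triangle[of x0 y z] by simp
qed

lemma cball_in_Omega: "z \<in> ball x0 r ==> \<rho> <= r ==> cball z \<rho> \<subseteq> \<Omega>"
 using cball_in ball_subset by blast

lemma above_ball:
 assumes "z \<in> ball x0 r" "\<rho> <= r" shows "AE x in lborel. x \<in> ball z \<rho> --> \<tau> <= v x"
 using above
proof eventually_elim
 case (elim x)
 then show ?case using cball_in[OF assms] ball_subset_cball by blast
qed

end

text \<open>The power \<open>(c + g) powr (p - 1)\<close> is split and the kernel integrated over
  the exterior of the ball, where \<open>\<rho> <= 1\<close> turns
  \<open>\<rho> powr (- p * s)\<close> into \<open>\<rho> powr (- p)\<close>. It is applied to
  \<open>l - v\<close> with \<open>g\<close> the negative part, and to \<open>v - m / 4\<close> with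
  \<open>g\<close> the excess of \<open>v\<close> over \<open>2 * S\<close>.\<close>

lemma tail_shift_le:
 fixes p s :: real
 assumes par: "p > 1" "0 < s" "s < 1"
 shows "\<exists>C>0. \<forall>(z::'a::euclidean_space) \<rho> c f g. 0 < \<rho> & \<rho> <= 1 & 0 <= c & f \<in> borel_measurable borel & g \<in> borel_measurable borel &
   (\<forall>y. 0 <= g y & f y <= c + g y) -->
  (NN y. ennreal (max (f y) 0 powr (p - 1) * riesz (p * s) z y) * indicator (- ball z (\<rho> / 2)) y) <=
  ennreal (2 powr (p - 1)) * (ennreal (C * c powr (p - 1) * \<rho> powr (- p)) +
   (NN y. ennreal (g y powr (p - 1) * riesz (p * s) z y) * indicator (- ball z (\<rho> / 2)) y))"
proof -
 have ps: "p * s > 0" "p * s <= p" using par by auto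
 obtain Cf where Cf: "Cf > 0" "\<And>r x. r > 0 ==> (NN y. ennreal (dist x y powr (- (real DIM('a) + p * s))) * indicator (- ball (x::'a) r) y) <= ennreal (Cf * r powr (- (p * s)))"
  using radial_far_at[OF ps(1), where 'a='a] by blast
 define C where "C = Cf * 2 powr p"
 have C: "C > 0" using Cf by (simp add: C_def)
 show ?thesis
 proof (intro exI[of _ C] conjI C allI impI, elim conjE)
  fix z :: 'a and \<rho> c :: real and f g :: "'a => real"
  assume \<rho>: "0 < \<rho>" "\<rho> <= 1" and c: "0 <= c" and [measurable]: "f \<in> borel_measurable borel" "g \<in> borel_measurable borel"
   and fg: "\<forall>y. 0 <= g y & f y <= c + g y"
  define I where "I = (indicator (- ball z (\<rho> / 2)) :: 'a => ennreal)"
  have [measurable]: "I \<in> borel_measurable borel" unfolding I_def by simp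
  have pt: "ennreal (max (f y) 0 powr (p - 1) * riesz (p * s) z y) * I y <=
    ennreal (2 powr (p - 1)) * (ennreal (c powr (p - 1)) * (ennreal (riesz (p * s) z y) * I y) + ennreal (g y powr (p - 1) * riesz (p * s) z y) * I y)" for y
  proof -
   have fgy: "0 <= g y" "f y <= c + g y" using fg by auto
   have "max (f y) 0 powr (p - 1) <= (c + g y) powr (p - 1)" using c par fgy by (intro powr_mono2) auto
   also have "... <= 2 powr (p - 1) * (c powr (p - 1) + g y powr (p - 1))" using c par fgy by (intro powr_add_le) auto
   finally have "max (f y) 0 powr (p - 1) * riesz (p * s) z y <= 2 powr (p - 1) * (c powr (p - 1) + g y powr (p - 1)) * riesz (p * s) z y"
    by (intro mult_right_mono riesz_nonneg)
   also have "... = 2 powr (p - 1) * (c powr (p - 1) * riesz (p * s) z y + g y powr (p - 1) * riesz (p * s) z y)" by (simp add: algebra_simps)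
   finally have "ennreal (max (f y) 0 powr (p - 1) * riesz (p * s) z y) <= ennreal (2 powr (p - 1) * (c powr (p - 1) * riesz (p * s) z y + g y powr (p - 1) * riesz (p * s) z y))" by (rule ennreal_leI)
   also have "... = ennreal (2 powr (p - 1)) * (ennreal (c powr (p - 1)) * ennreal (riesz (p * s) z y) + ennreal (g y powr (p - 1) * riesz (p * s) z y))"
    using riesz_nonneg[of "p * s" z y] by (simp add: ennreal_mult)
   finally have "ennreal (max (f y) 0 powr (p - 1) * riesz (p * s) z y) * I y <= (ennreal (2 powr (p - 1)) * (ennreal (c powr (p - 1)) * ennreal (riesz (p * s) z y) + ennreal (g y powr (p - 1) * riesz (p * s) z y))) * I y"
    by (rule mult_right_mono) simp
   then show ?thesis by (simp add: distrib_right mult.assoc)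
  qed
  have "(NN y. ennreal (max (f y) 0 powr (p - 1) * riesz (p * s) z y) * I y) <=
   (NN y. ennreal (2 powr (p - 1)) * (ennreal (c powr (p - 1)) * (ennreal (riesz (p * s) z y) * I y) + ennreal (g y powr (p - 1) * riesz (p * s) z y) * I y))"
   by (rule nn_integral_mono) (rule pt)
  also have "... = ennreal (2 powr (p - 1)) * (ennreal (c powr (p - 1)) * (NN y. ennreal (riesz (p * s) z y) * I y) + (NN y. ennreal (g y powr (p - 1) * riesz (p * s) z y) * I y))"
   by (subst nn_integral_cmult, measurable, subst nn_integral_add, measurable, subst nn_integral_cmult, measurable)
  also have "... <= ennreal (2 powr (p - 1)) * (ennreal (C * c powr (p - 1) * \<rho> powr (- p)) + (NN y. ennreal (g y powr (p - 1) * riesz (p * s) z y) * I y))"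
  proof (intro mult_left_mono add_right_mono)
   have "(\<rho> / 2) powr (- (p * s)) <= (\<rho> / 2) powr (- p)" using \<rho> ps par by (intro powr_mono') auto
   also have "... = 2 powr p * \<rho> powr (- p)" using \<rho> by (simp add: powr_divide powr_minus field_simps)
   finally have 1: "c powr (p - 1) * (Cf * (\<rho> / 2) powr (- (p * s))) <= c powr (p - 1) * (Cf * (2 powr p * \<rho> powr (- p)))"
    using Cf by (intro mult_left_mono) auto
   have "ennreal (c powr (p - 1)) * (NN y. ennreal (riesz (p * s) z y) * I y) <= ennreal (c powr (p - 1)) * ennreal (Cf * (\<rho> / 2) powr (- (p * s)))"
    using Cf(2)[of "\<rho> / 2" z] \<rho> by (intro mult_left_mono) (auto simp: riesz_def I_def)
   also have "... = ennreal (c powr (p - 1) * (Cf * (\<rho> / 2) powr (- (p * s))))" using Cf by (intro ennreal_mult[symmetric]) auto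
   also have "... <= ennreal (c powr (p - 1) * (Cf * (2 powr p * \<rho> powr (- p))))" using 1 by (rule ennreal_leI)
   finally show "ennreal (c powr (p - 1)) * (NN y. ennreal (riesz (p * s) z y) * I y) <= ennreal (C * c powr (p - 1) * \<rho> powr (- p))"
    by (simp add: C_def mult_ac)
  qed auto
  finally show "(NN y. ennreal (max (f y) 0 powr (p - 1) * riesz (p * s) z y) * indicator (- ball z (\<rho> / 2)) y) <=
   ennreal (2 powr (p - 1)) * (ennreal (C * c powr (p - 1) * \<rho> powr (- p)) +
   (NN y. ennreal (g y powr (p - 1) * riesz (p * s) z y) * indicator (- ball z (\<rho> / 2)) y))" by (simp add: I_def)
 qed
qed

text \<open>In \<open>tail_shift_le\<close> take \<open>c = l\<close> and the negative part of
  \<open>v\<close>; \<open>\<tau> <= l\<close> and \<open>\<rho> <= r\<close> bring both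
  contributions into the form expected by the energy inequality, with an \<open>H\<close> that does
  not depend on the level.\<close>

lemma neg_tail:
 fixes Cd p s Ct :: real
 assumes par: "p > 1" "0 < s" "s < 1" "Ct >= 0"
 shows "\<exists>H\<ge>0. \<forall>(\<Omega>::'a::euclidean_space set) v G M x0 r \<tau>. harnack_setup Cd p s \<Omega> v G M x0 r \<tau> Ct -->
  (\<forall>z \<rho> l. z \<in> ball x0 r & 0 < \<rho> & \<rho> <= r & 0 < l & \<tau> <= l -->
   (NN y. ennreal (max (l - v y) 0 powr (p - 1) * riesz (p * s) z y) * indicator (- ball z (\<rho> / 2)) y) <= ennreal (H * l powr (p - 1) * \<rho> powr (- p)))"
proof -
 obtain Cf where Cf: "Cf > 0" and sh: "\<And>(z::'a) \<rho> c f g. 0 < \<rho> & \<rho> <= 1 & 0 <= c & f \<in> borel_measurable borel & g \<in> borel_measurable borel &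
   (\<forall>y. 0 <= g y & f y <= c + g y) ==>
  (NN y. ennreal (max (f y) 0 powr (p - 1) * riesz (p * s) z y) * indicator (- ball z (\<rho> / 2)) y) <=
  ennreal (2 powr (p - 1)) * (ennreal (Cf * c powr (p - 1) * \<rho> powr (- p)) +
   (NN y. ennreal (g y powr (p - 1) * riesz (p * s) z y) * indicator (- ball z (\<rho> / 2)) y))"
  using tail_shift_le[OF par(1-3), where 'a='a] by auto
 define H where "H = 2 powr (p - 1) * (Cf + Ct)"
 have H: "H >= 0" using Cf par by (simp add: H_def)
 show ?thesis
 proof (intro exI[of _ H] conjI H allI impI, elim conjE)
  fix \<Omega> :: "'a set" and v G M x0 r \<tau> z \<rho> l
  assume hs: "harnack_setup Cd p s \<Omega> v G M x0 r \<tau> Ct" and z: "z \<in> ball x0 r" and \<rho>: "0 < \<rho>" "\<rho> <= r" and l: "0 < l" "\<tau> <= l"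
  interpret harnack_setup Cd p s \<Omega> v G M x0 r \<tau> Ct by (rule hs)
  have "(NN y. ennreal (max (l - v y) 0 powr (p - 1) * riesz (p * s) z y) * indicator (- ball z (\<rho> / 2)) y) <=
   ennreal (2 powr (p - 1)) * (ennreal (Cf * l powr (p - 1) * \<rho> powr (- p)) +
   (NN y. ennreal (max (- v y) 0 powr (p - 1) * riesz (p * s) z y) * indicator (- ball z (\<rho> / 2)) y))"
   by (rule sh) (use \<rho> r l in auto)
  also have "... <= ennreal (2 powr (p - 1)) * (ennreal (Cf * l powr (p - 1) * \<rho> powr (- p)) + ennreal (Ct * l powr (p - 1) * \<rho> powr (- p)))"
  proof (intro mult_left_mono add_left_mono)
   have "(NN y. ennreal (max (- v y) 0 powr (p - 1) * riesz (p * s) z y) * indicator (- ball z (\<rho> / 2)) y) <= (NN y. ennreal (max (- v y) 0 powr (p - 1) * riesz (p * s) z y))"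
    by (intro nn_integral_mono) (simp split: split_indicator)
   also have "... <= ennreal (Ct * \<tau> powr (p - 1) * r powr (- p))" by (rule neg[OF z])
   also have "... <= ennreal (Ct * l powr (p - 1) * \<rho> powr (- p))"
    using l \<tau> par \<rho> by (intro ennreal_leI mult_mono powr_mono2 powr_mono2') auto
   finally show "(NN y. ennreal (max (- v y) 0 powr (p - 1) * riesz (p * s) z y) * indicator (- ball z (\<rho> / 2)) y) <= ennreal (Ct * l powr (p - 1) * \<rho> powr (- p))" .
  qed auto
  also have "... = ennreal (H * l powr (p - 1) * \<rho> powr (- p))"
   using Cf Ct by (simp add: ennreal_mult[symmetric] ennreal_plus[symmetric] H_def algebra_simps del: ennreal_plus)
  finally show "(NN y. ennreal (max (l - v y) 0 powr (p - 1) * riesz (p * s) z y) * indicator (- ball z (\<rho> / 2)) y) <= ennreal (H * l powr (p - 1) * \<rho> powr (- p))" .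
 qed
qed

text \<open>Descend through the levels \<open>l / 2^j\<close>. The set below level
  \<open>j + 1\<close> and the dense set where \<open>v >= l\<close> are separated by the slice
  between levels \<open>j\<close> and \<open>j + 1\<close>, so the isoperimetric inequality bounds
  the former by the slice. The slices are disjoint, so one of the first \<open>n\<close> is thin;
  then the lower set has small measure and the De Giorgi lemma for \<open>- v\<close> empties it in
  the half ball.\<close>

lemma expansion_of_positivity:
 fixes Cd p s Ct \<nu> :: real
 assumes par: "Cd > 0" "p > 1" "0 < s" "s < 1" "Ct >= 0" "\<nu> > 0"
 shows "\<exists>\<delta>>0. \<forall>(\<Omega>::'a::euclidean_space set) v G M x0 r \<tau>. harnack_setup Cd p s \<Omega> v G M x0 r \<tau> Ct -->
  (\<forall>z \<rho> l. z \<in> ball x0 r & 0 < \<rho> & \<rho> <= r / 4 & 0 < l & \<nu> * \<rho> ^ DIM('a) <= measure lborel {x \<in> ball z \<rho>. l <= v x} -->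
   (AE x in lborel. x \<in> ball z (\<rho> / 2) --> \<delta> * l <= v x))"
proof -
 define N where "N = DIM('a)"
 define V where "V = measure lborel (ball (0::'a) 1)"
 have V: "V > 0" unfolding V_def by (intro content_ball_pos) auto
 obtain H where H: "H >= 0" and Htail: "\<And>(\<Omega>::'a set) v G M x0 r \<tau> z \<rho> l. harnack_setup Cd p s \<Omega> v G M x0 r \<tau> Ct ==> z \<in> ball x0 r ==> 0 < \<rho> ==> \<rho> <= r ==> 0 < l ==> \<tau> <= l ==>
   (NN y. ennreal (max (l - v y) 0 powr (p - 1) * riesz (p * s) z y) * indicator (- ball z (\<rho> / 2)) y) <= ennreal (H * l powr (p - 1) * \<rho> powr (- p))"
  using neg_tail[OF par(2-5), where 'a='a and Cd=Cd] by - (elim exE conjE, rule that, assumption, simp)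
 have half: "(0::real) < 1/2" "(1/2::real) <= 1" by auto
 obtain \<nu>0 where \<nu>0: "\<nu>0 > 0" and DGL: "\<And>(\<Omega>::'a set) v G M \<sigma> z \<rho> k Mm. de_giorgi Cd p s \<Omega> v G M ==>
   \<bar>\<sigma>\<bar> = 1 & 0 < \<rho> & \<rho> <= 1 & cball z \<rho> \<subseteq> \<Omega> & Mm > 0 &
   (AE x in lborel. x \<in> ball z \<rho> --> \<sigma> * v x <= k + Mm) &
   (NN y. ennreal (max (\<sigma> * v y - k) 0 powr (p - 1) * riesz (p * s) z y) * indicator (- ball z (\<rho> / 2)) y) <= ennreal (H * Mm powr (p - 1) * \<rho> powr (- p)) &
   measure lborel {x \<in> ball z \<rho>. k < \<sigma> * v x} <= \<nu>0 * \<rho> ^ DIM('a) ==>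
   (AE x in lborel. x \<in> ball z (\<rho> / 2) --> \<sigma> * v x <= k + 1/2 * Mm)"
  using de_giorgi_lemma[OF par(1,2) half H, where 'a='a and s=s] by blast
 define E1 where "E1 = Cd * (1 + H) * 2 powr (real N + p) * (V * 2 ^ N)"
 define C5 where "C5 = 16 * 2 ^ N * V"
 have E1: "E1 > 0" and C5: "C5 > 0" using par H V by (auto simp: E1_def C5_def)
 \<comment> \<open>\<open>\<kappa>\<close> is taken so large that the energy part of the
   isoperimetric bound uses at most half of \<open>\<nu>0\<close>; the slice must then account for
   the other half.\<close>
 define Y where "Y = 2 * C5 * E1 / (\<nu> * \<nu>0) + 1"
 have Y: "Y > 0" using C5 E1 par \<nu>0 by (auto simp: Y_def intro!: add_nonneg_pos divide_nonneg_nonneg)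
 define \<kappa> where "\<kappa> = Y powr (1 / (p - 1))"
 have \<kappa>: "\<kappa> > 0" using Y by (simp add: \<kappa>_def)
 have \<kappa>p: "C5 / \<nu> * (\<kappa> powr (1 - p) * E1) <= \<nu>0 / 2"
 proof -
  have "1 / (p - 1) * (1 - p) = - 1" using par by (simp add: field_simps)
  then have eq: "\<kappa> powr (1 - p) = 1 / Y" using Y unfolding \<kappa>_def powr_powr by (simp add: powr_minus_divide)
  have "C5 * E1 / \<nu> <= \<nu>0 / 2 * Y"
  proof -
   have "\<nu>0 / 2 * Y = C5 * E1 / \<nu> + \<nu>0 / 2" using \<nu>0 par by (simp add: Y_def field_simps)
   then show ?thesis using \<nu>0 by simp
  qed
  then have "C5 * E1 / \<nu> / Y <= \<nu>0 / 2" using Y by (simp only: pos_divide_le_eq)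
  then show ?thesis unfolding eq by (simp add: mult_ac)
 qed
 \<comment> \<open>The pigeonhole number: \<open>n\<close> disjoint slices, each of measure at least
   a fixed multiple of \<open>\<rho>^N\<close>, would exceed the volume of the ball.\<close>
 obtain n :: nat where n: "real n * (\<nu>0 * \<nu>) > 2 * V * C5 * \<kappa>"
  using reals_Archimedean3[of "\<nu>0 * \<nu>"] \<nu>0 par by (meson mult_pos_pos)
 define \<delta> where "\<delta> = (1/2::real) ^ (n + 1)"
 have \<delta>: "\<delta> > 0" by (simp add: \<delta>_def)
 show ?thesis
 proof (intro exI[of _ \<delta>] conjI \<delta> allI impI, elim conjE)
  fix \<Omega> :: "'a set" and v G M x0 r \<tau> z \<rho> l
  assume hs: "harnack_setup Cd p s \<Omega> v G M x0 r \<tau> Ct" and z: "z \<in> ball x0 r" and \<rho>: "0 < \<rho>" "\<rho> <= r / 4" and l: "0 < l"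
   and dens: "\<nu> * \<rho> ^ DIM('a) <= measure lborel {x \<in> ball z \<rho>. l <= v x}"
  interpret harnack_setup Cd p s \<Omega> v G M x0 r \<tau> Ct by (rule hs)
  have dg: "de_giorgi Cd p s \<Omega> v G M" by unfold_locales
  define lj where "lj = (%j::nat. l * (1/2) ^ j)"
  have lj: "lj j > 0" "lj (Suc j) = lj j / 2" for j using l by (auto simp: lj_def)
  have ljmono: "lj j <= lj i" if "i <= j" for i j
   unfolding lj_def using l that by (intro mult_left_mono power_decreasing) auto
  have \<rho>r: "\<rho> <= r" "2 * \<rho> <= r" "4 * \<rho> <= r" using \<rho> r by auto
  have fm: "S \<in> fmeasurable lborel" if "S \<subseteq> ball z (2 * \<rho>)" "S \<in> sets borel" for S
   using that emeasure_ball_subset[OF that(1)] by (auto simp: fmeasurable_def)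
  have sb[measurable]: "{x \<in> ball z \<rho>'. c <= v x} \<in> sets borel" "{x \<in> ball z \<rho>'. v x <= c} \<in> sets borel" "{x \<in> ball z \<rho>'. c <= v x & v x < d} \<in> sets borel" for \<rho>' c d
   using level_set_borel(4)[of z \<rho>' c 1] level_set_borel(3)[of z \<rho>' 1 c] level_set_borel(2)[of z \<rho>' "- d" "-1" "- c"]
   by (auto simp: conj_commute)
  show "AE x in lborel. x \<in> ball z (\<rho> / 2) --> \<delta> * l <= v x"
  proof (cases "lj n < \<tau>")
   case True
   \<comment> \<open>The final level has already dropped below \<open>\<tau>\<close>, so the bound
     follows from \<open>v >= \<tau>\<close>.\<close>
   have "\<delta> * l <= lj n" using l by (simp add: \<delta>_def lj_def)
   then show ?thesis using above_ball[OF z, of "\<rho> / 2"] True \<rho>r \<rho> by (auto elim!: eventually_mono)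
  next
   case False
   then have lt: "\<tau> <= lj j" if "j <= n" for j using ljmono[OF that] by linarith
   define Z where "Z = (%j. measure lborel {x \<in> ball z \<rho>. v x <= lj j})"
   define D where "D = (%j. measure lborel {x \<in> ball z \<rho>. lj (Suc j) <= v x & v x < lj j})"
   have ZD0: "Z j >= 0" "D j >= 0" for j by (auto simp: Z_def D_def)
   have stepj: "Z (Suc j) <= C5 / \<nu> * (\<kappa> * D j + \<kappa> powr (1 - p) * E1 * \<rho> ^ N)" if j: "j < n" for j
   proof -
    define m where "m = lj j"
    have m: "m > 0" "\<tau> <= m" using lj lt[of j] j by (auto simp: m_def)
    define EE where "EE = (NN x. ennreal (if (-1) * v x > - m then norm (G x) powr p else 0) * indicator (ball z \<rho>) x)"
    have EEb: "EE <= ennreal (E1 * (m powr p * \<rho> powr (- p)) * \<rho> ^ N)"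
    proof -
     have "EE <= ennreal (Cd * (1 + H) * (2 * \<rho> / (2 * \<rho> - \<rho>)) powr (real DIM('a) + p) * (2 * \<rho>) powr (- p) * m powr p * measure lborel {x \<in> ball z (2 * \<rho>). (-1) * v x > - m})"
      unfolding EE_def
     proof (rule order_trans[OF _ energy[of \<rho> "2 * \<rho>" z "-1" m H "- m"]])
      show "AE x in lborel. x \<in> ball z (2 * \<rho>) --> (-1) * v x <= - m + m"
       using above_ball[OF z \<rho>r(2)] by eventually_elim (use \<tau> in auto)
      \<comment> \<open>\<open>neg_tail\<close> excludes a ball of half its radius, so the tail
        outside \<open>ball z (2 * \<rho>)\<close> is taken from radius \<open>4 * \<rho>\<close>;
        this explains \<open>\<rho> <= r / 4\<close>.\<close>
      have "(NN y. ennreal (max ((-1) * v y - - m) 0 powr (p - 1) * riesz (p * s) z y) * indicator (- ball z (2 * \<rho>)) y) <= ennreal (H * m powr (p - 1) * (4 * \<rho>) powr (- p))"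
       using Htail[OF hs z, of "4 * \<rho>" m] \<rho> \<rho>r m by simp
      also have "... <= ennreal (H * m powr (p - 1) * (2 * \<rho>) powr (- p))"
       using H \<rho> par by (intro ennreal_leI mult_left_mono powr_mono2') auto
      finally show "(NN y. ennreal (max ((-1) * v y - - m) 0 powr (p - 1) * riesz (p * s) z y) * indicator (- ball z (2 * \<rho>)) y) <= ennreal (H * m powr (p - 1) * (2 * \<rho>) powr (- p))" .
     qed (use \<rho> \<rho>r r m H cball_in_Omega[OF z \<rho>r(2)] in auto)
     also have "... <= ennreal (E1 * (m powr p * \<rho> powr (- p)) * \<rho> ^ N)"
     proof (rule ennreal_leI)
      have "measure lborel {x \<in> ball z (2 * \<rho>). (-1) * v x > - m} <= measure lborel (ball z (2 * \<rho>))"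
       by (intro measure_mono_fmeasurable fm) auto
      also have "... = V * 2 ^ N * \<rho> ^ N"
       using content_ball_conv_unit_ball[of "2 * \<rho>" z] \<rho> by (simp add: V_def N_def power_mult_distrib mult_ac)
      finally have 1: "measure lborel {x \<in> ball z (2 * \<rho>). (-1) * v x > - m} <= V * 2 ^ N * \<rho> ^ N" .
      have 2: "(2 * \<rho>) powr (- p) <= \<rho> powr (- p)" using \<rho> par by (intro powr_mono2') auto
      have 3: "2 * \<rho> / (2 * \<rho> - \<rho>) = 2" using \<rho> by simp
      have "Cd * (1 + H) * 2 powr (real N + p) * (2 * \<rho>) powr (- p) * m powr p * measure lborel {x \<in> ball z (2 * \<rho>). (-1) * v x > - m} <=
       Cd * (1 + H) * 2 powr (real N + p) * \<rho> powr (- p) * m powr p * (V * 2 ^ N * \<rho> ^ N)"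
       using 1 2 par H by (intro mult_mono mult_left_mono mult_right_mono) auto
      also have "... = E1 * (m powr p * \<rho> powr (- p)) * \<rho> ^ N" by (simp add: E1_def mult_ac)
      finally show "Cd * (1 + H) * (2 * \<rho> / (2 * \<rho> - \<rho>)) powr (real DIM('a) + p) * (2 * \<rho>) powr (- p) * m powr p * measure lborel {x \<in> ball z (2 * \<rho>). (-1) * v x > - m} <= E1 * (m powr p * \<rho> powr (- p)) * \<rho> ^ N"
       unfolding 3 by (simp add: N_def)
     qed
     finally show ?thesis .
    qed
    \<comment> \<open>Raising the natural threshold \<open>m / \<rho>\<close> by
      \<open>\<kappa>\<close> multiplies the slice part by \<open>\<kappa>\<close> and the energy
      part by the small factor \<open>\<kappa> powr (1 - p)\<close>.\<close>
    define \<mu> where "\<mu> = \<kappa> * (m / \<rho>)"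
    have \<mu>: "\<mu> > 0" using \<kappa> m \<rho> by (simp add: \<mu>_def)
    have gm: "grad_mass (-1) (- m) (m / 2) z \<rho> <= ennreal (m / \<rho> * (\<kappa> * D j + \<kappa> powr (1 - p) * E1 * \<rho> ^ N))"
    proof -
     have De: "{x \<in> ball z \<rho>. - m < (-1) * v x & (-1) * v x <= - m + m / 2} = {x \<in> ball z \<rho>. lj (Suc j) <= v x & v x < lj j}"
      by (auto simp: m_def lj)
     have "grad_mass (-1) (- m) (m / 2) z \<rho> <= ennreal (\<mu> * measure lborel {x \<in> ball z \<rho>. - m < (-1) * v x & (-1) * v x <= - m + m / 2}) + ennreal (\<mu> powr (1 - p)) * EE"
      unfolding EE_def by (rule grad_mass_le[OF \<mu>])
     also have "... <= ennreal (\<mu> * D j) + ennreal (\<mu> powr (1 - p)) * ennreal (E1 * (m powr p * \<rho> powr (- p)) * \<rho> ^ N)"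
      unfolding De D_def by (intro add_left_mono mult_left_mono EEb) auto
     also have "... = ennreal (\<mu> * D j + \<mu> powr (1 - p) * (E1 * (m powr p * \<rho> powr (- p)) * \<rho> ^ N))"
      using \<mu> ZD0[of j] E1 \<rho> by (simp add: ennreal_mult[symmetric] ennreal_plus[symmetric] del: ennreal_plus)
     also have "\<mu> * D j + \<mu> powr (1 - p) * (E1 * (m powr p * \<rho> powr (- p)) * \<rho> ^ N) = m / \<rho> * (\<kappa> * D j + \<kappa> powr (1 - p) * E1 * \<rho> ^ N)"
     proof -
      have a: "m powr p * \<rho> powr (- p) = (m / \<rho>) powr p" using m \<rho> by (simp add: powr_divide powr_minus field_simps)
      have b: "\<mu> powr (1 - p) = \<kappa> powr (1 - p) * (m / \<rho>) powr (1 - p)" using \<kappa> m \<rho> unfolding \<mu>_def by (intro powr_mult)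
      have c: "(m / \<rho>) powr (1 - p) * (m / \<rho>) powr p = m / \<rho>" using m \<rho> by (simp add: powr_add[symmetric])
      have "\<mu> powr (1 - p) * (E1 * (m powr p * \<rho> powr (- p)) * \<rho> ^ N) = \<kappa> powr (1 - p) * E1 * \<rho> ^ N * ((m / \<rho>) powr (1 - p) * (m / \<rho>) powr p)"
       unfolding a b by (simp only: mult_ac)
      then show ?thesis unfolding c by (simp add: \<mu>_def algebra_simps)
     qed
     finally show ?thesis .
    qed
    have "ennreal (m / 2 * measure lborel {x \<in> ball z \<rho>. (-1) * v x <= - m} * measure lborel {x \<in> ball z \<rho>. - m + m / 2 <= (-1) * v x}) <=
      ennreal (8 * \<rho> * ((2 * \<rho>) ^ DIM('a) * measure lborel (ball (0::'a) 1))) * grad_mass (-1) (- m) (m / 2) z \<rho>"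
     by (rule isoperimetric) (use \<rho> m cball_in_Omega[OF z \<rho>r(1)] in auto)
    also have "... <= ennreal (8 * \<rho> * ((2 * \<rho>) ^ N * V)) * ennreal (m / \<rho> * (\<kappa> * D j + \<kappa> powr (1 - p) * E1 * \<rho> ^ N))"
     unfolding N_def V_def by (rule mult_left_mono[OF gm[unfolded N_def]]) simp
    also have "... = ennreal (8 * \<rho> * ((2 * \<rho>) ^ N * V) * (m / \<rho> * (\<kappa> * D j + \<kappa> powr (1 - p) * E1 * \<rho> ^ N)))"
     using \<rho> V m \<kappa> ZD0[of j] E1 by (intro ennreal_mult[symmetric]) auto
    finally have "m / 2 * measure lborel {x \<in> ball z \<rho>. (-1) * v x <= - m} * measure lborel {x \<in> ball z \<rho>. - m + m / 2 <= (-1) * v x} <= 8 * \<rho> * ((2 * \<rho>) ^ N * V) * (m / \<rho> * (\<kappa> * D j + \<kappa> powr (1 - p) * E1 * \<rho> ^ N))"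
     using \<rho> V m \<kappa> ZD0[of j] E1 by (subst (asm) ennreal_le_iff) auto
    moreover have "{x \<in> ball z \<rho>. - m + m / 2 <= (-1) * v x} = {x \<in> ball z \<rho>. v x <= lj (Suc j)}" by (auto simp: m_def lj)
    moreover have "\<nu> * \<rho> ^ N <= measure lborel {x \<in> ball z \<rho>. (-1) * v x <= - m}"
    proof -
     have "measure lborel {x \<in> ball z \<rho>. l <= v x} <= measure lborel {x \<in> ball z \<rho>. (-1) * v x <= - m}"
     proof (intro measure_mono_fmeasurable fm)
      have "m <= l" using ljmono[of 0 j] by (simp add: m_def lj_def)
      then show "{x \<in> ball z \<rho>. l <= v x} \<subseteq> {x \<in> ball z \<rho>. (-1) * v x <= - m}" by auto
      show "{x \<in> ball z \<rho>. (-1) * v x <= - m} \<subseteq> ball z (2 * \<rho>)" using \<rho> by auto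
     qed auto
     then show ?thesis using dens by (simp add: N_def)
    qed
    then have "m / 2 * (\<nu> * \<rho> ^ N) * Z (Suc j) <= m / 2 * measure lborel {x \<in> ball z \<rho>. (-1) * v x <= - m} * Z (Suc j)"
     using m ZD0 by (intro mult_right_mono mult_left_mono) auto
    ultimately have "m / 2 * (\<nu> * \<rho> ^ N) * Z (Suc j) <= 8 * \<rho> * ((2 * \<rho>) ^ N * V) * (m / \<rho> * (\<kappa> * D j + \<kappa> powr (1 - p) * E1 * \<rho> ^ N))"
     by (simp add: Z_def)
    also have "... = m / 2 * (\<nu> * \<rho> ^ N) * (C5 / \<nu> * (\<kappa> * D j + \<kappa> powr (1 - p) * E1 * \<rho> ^ N))"
    proof -
     define W where "W = \<kappa> * D j + \<kappa> powr (1 - p) * E1 * \<rho> ^ N"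
     show ?thesis unfolding W_def[symmetric] using \<rho> par by (simp add: C5_def power_mult_distrib field_simps)
    qed
    finally show ?thesis using m par \<rho> by (subst (asm) mult_le_cancel_left_pos) auto
   qed
   have Zn: "Z n <= \<nu>0 * \<rho> ^ N"
   proof (rule ccontr)
    assume big: "\<not> Z n <= \<nu>0 * \<rho> ^ N"
    have Dj: "\<nu>0 * \<nu> / (2 * C5 * \<kappa>) * \<rho> ^ N <= D j" if j: "j < n" for j
    proof -
     have "Z n <= Z (Suc j)"
      unfolding Z_def
     proof (intro measure_mono_fmeasurable fm)
      show "{x \<in> ball z \<rho>. v x <= lj n} \<subseteq> {x \<in> ball z \<rho>. v x <= lj (Suc j)}" using ljmono[of "Suc j" n] j by auto
      show "{x \<in> ball z \<rho>. v x <= lj (Suc j)} \<subseteq> ball z (2 * \<rho>)" using \<rho> by auto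
     qed auto
     then have "\<nu>0 * \<rho> ^ N < C5 / \<nu> * (\<kappa> * D j + \<kappa> powr (1 - p) * E1 * \<rho> ^ N)" using stepj[OF j] big by linarith
     also have "... = C5 / \<nu> * \<kappa> * D j + (C5 / \<nu> * (\<kappa> powr (1 - p) * E1)) * \<rho> ^ N" by (simp add: algebra_simps)
     also have "... <= C5 / \<nu> * \<kappa> * D j + \<nu>0 / 2 * \<rho> ^ N" using \<kappa>p \<rho> by (intro add_left_mono mult_right_mono) auto
     finally have "\<nu>0 / 2 * \<rho> ^ N <= C5 / \<nu> * \<kappa> * D j" by linarith
     then show ?thesis using C5 par \<kappa> by (simp add: field_simps)
    qed
    define Dset where "Dset = (%j. {x \<in> ball z \<rho>. lj (Suc j) <= v x & v x < lj j})"
    have "real n * (\<nu>0 * \<nu> / (2 * C5 * \<kappa>) * \<rho> ^ N) = (\<Sum>j<n. \<nu>0 * \<nu> / (2 * C5 * \<kappa>) * \<rho> ^ N)" by simp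
    also have "... <= (\<Sum>j<n. D j)" by (rule sum_mono) (use Dj in auto)
    also have "... = (\<Sum>j<n. measure lborel (Dset j))" by (simp add: D_def Dset_def)
    also have "... = measure lborel (\<Union>j\<in>{..<n}. Dset j)"
    proof (rule measure_finite_Union[symmetric])
     show "disjoint_family_on Dset {..<n}"
     unfolding disjoint_family_on_def
     proof (intro ballI impI)
      fix i j :: nat assume ij: "i \<noteq> j"
      have *: "Dset i \<inter> Dset j = {}" if "i < j" for i j
       using ljmono[of "Suc i" j] that by (force simp: Dset_def)
      show "Dset i \<inter> Dset j = {}" using *[of i j] *[of j i] ij by (cases "i < j") auto
     qed
     show "emeasure lborel (Dset i) \<noteq> \<infinity>" for i
      by (subst emeasure_ball_subset[of _ z \<rho>]) (auto simp: Dset_def)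
    qed (auto simp: Dset_def)
    also have "... <= measure lborel (ball z \<rho>)"
     by (intro measure_mono_fmeasurable fm) (use \<rho> in \<open>auto simp: Dset_def\<close>)
    also have "... = V * \<rho> ^ N" using content_ball_conv_unit_ball[of \<rho> z] \<rho> by (simp add: V_def N_def mult.commute)
    finally have "real n * (\<nu>0 * \<nu> / (2 * C5 * \<kappa>)) * \<rho> ^ N <= V * \<rho> ^ N" by (simp add: mult.assoc)
    then have "real n * (\<nu>0 * \<nu> / (2 * C5 * \<kappa>)) <= V" by (rule mult_right_le_imp_le) (use \<rho> in simp)
    then have "real n * (\<nu>0 * \<nu>) <= 2 * V * C5 * \<kappa>" using C5 \<kappa> by (simp add: field_simps)
    then show False using n by simp
   qed
   have ln: "lj n > 0" "\<tau> <= lj n" using lj lt by auto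
   have "AE x in lborel. x \<in> ball z (\<rho> / 2) --> (-1) * v x <= - lj n + 1/2 * lj n"
   proof (rule DGL[OF dg], intro conjI)
    show "AE x in lborel. x \<in> ball z \<rho> --> (-1) * v x <= - lj n + lj n"
     using above_ball[OF z \<rho>r(1)] by eventually_elim (use \<tau> in auto)
    show "(NN y. ennreal (max ((-1) * v y - - lj n) 0 powr (p - 1) * riesz (p * s) z y) * indicator (- ball z (\<rho> / 2)) y) <= ennreal (H * lj n powr (p - 1) * \<rho> powr (- p))"
     using Htail[OF hs z, of \<rho> "lj n"] \<rho> \<rho>r ln by simp
    have "measure lborel {x \<in> ball z \<rho>. - lj n < (-1) * v x} <= Z n"
     unfolding Z_def by (intro measure_mono_fmeasurable fm) (use \<rho> in auto)
    then show "measure lborel {x \<in> ball z \<rho>. - lj n < (-1) * v x} <= \<nu>0 * \<rho> ^ DIM('a)" using Zn by (simp add: N_def)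
   qed (use \<rho> \<rho>r r ln cball_in_Omega[OF z \<rho>r(1)] in auto)
   then show ?thesis by eventually_elim (auto simp: \<delta>_def lj_def mult.commute)
  qed
 qed
qed

section \<open>The Harnack inequality above the tail level\<close>

lemma AE_if_locally_AE:
 fixes S :: "'a::euclidean_space set"
 assumes "\<sigma> > 0" and "\<And>z. z \<in> S ==> AE x in lborel. x \<in> ball z \<sigma> --> P x"
 shows "AE x in lborel. x \<in> S --> P x"
proof -
 obtain F where F: "F \<subseteq> (%z. ball z \<sigma>) ` S" "countable F" "\<Union>F = \<Union>((%z. ball z \<sigma>) ` S)"
  using Lindelof[of "(%z. ball z \<sigma>) ` S"] by auto
 have "AE x in lborel. \<forall>A\<in>F. x \<in> A --> P x"
  using F(1) assms(2) by (subst AE_ball_countable[OF F(2)]) blast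
 then show ?thesis
 proof eventually_elim
  case (elim x)
  show ?case
  proof
   assume "x \<in> S"
   then have "x \<in> \<Union>((%z. ball z \<sigma>) ` S)" using assms(1) by (intro UN_I) auto
   then show "P x" using elim F(3) by blast
  qed
 qed
qed

text \<open>A lower bound on \<open>ball z \<rho>\<close> is a density \<open>4^(-N)\<close> in the
  ball of radius \<open>4 * \<rho>\<close>, whose half ball has radius \<open>2 * \<rho>\<close>.
  The cap \<open>1/2\<close> on \<open>\<delta>\<close> makes the growth factor
  \<open>1 / \<delta>\<close> larger than 1.\<close>

lemma doubling:
 fixes Cd p s Ct :: real
 assumes par: "Cd > 0" "p > 1" "0 < s" "s < 1" "Ct >= 0"
 shows "\<exists>\<delta>>0. \<delta> < 1 & (\<forall>(\<Omega>::'a::euclidean_space set) v G M x0 r \<tau>. harnack_setup Cd p s \<Omega> v G M x0 r \<tau> Ct -->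
  (\<forall>z \<rho> l. z \<in> ball x0 r & 0 < \<rho> & \<rho> <= r / 16 & 0 < l & (AE x in lborel. x \<in> ball z \<rho> --> l <= v x) -->
   (AE x in lborel. x \<in> ball z (2 * \<rho>) --> \<delta> * l <= v x)))"
proof -
 define N where "N = DIM('a)"
 define V where "V = measure lborel (ball (0::'a) 1)"
 have V: "V > 0" unfolding V_def by (intro content_ball_pos) auto
 define \<nu> where "\<nu> = V / 4 ^ N"
 have \<nu>: "\<nu> > 0" using V by (simp add: \<nu>_def)
 obtain \<delta>0 where \<delta>0: "\<delta>0 > 0" and ex: "\<And>(\<Omega>::'a set) v G M x0 r \<tau> z \<rho> l. harnack_setup Cd p s \<Omega> v G M x0 r \<tau> Ct ==>
   z \<in> ball x0 r & 0 < \<rho> & \<rho> <= r / 4 & 0 < l & \<nu> * \<rho> ^ DIM('a) <= measure lborel {x \<in> ball z \<rho>. l <= v x} ==>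
   (AE x in lborel. x \<in> ball z (\<rho> / 2) --> \<delta>0 * l <= v x)"
  using expansion_of_positivity[OF par \<nu>, where 'a='a] by - (elim exE conjE, rule that, assumption, blast)
 define \<delta> where "\<delta> = min \<delta>0 (1/2)"
 have \<delta>: "\<delta> > 0" "\<delta> < 1" using \<delta>0 by (auto simp: \<delta>_def)
 show ?thesis
 proof (intro exI[of _ \<delta>] conjI \<delta> allI impI, elim conjE)
  fix \<Omega> :: "'a set" and v G M x0 r \<tau> z \<rho> l
  assume hs: "harnack_setup Cd p s \<Omega> v G M x0 r \<tau> Ct" and z: "z \<in> ball x0 r" and \<rho>: "0 < \<rho>" "\<rho> <= r / 16" and l: "0 < l"
   and ae: "AE x in lborel. x \<in> ball z \<rho> --> l <= v x"
  interpret harnack_setup Cd p s \<Omega> v G M x0 r \<tau> Ct by (rule hs)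
  have sb: "{x \<in> ball z (4 * \<rho>). l <= v x} \<in> sets borel" using level_set_borel(4)[of z "4 * \<rho>" l 1] by simp
  have "emeasure lborel (ball z \<rho>) <= emeasure lborel {x \<in> ball z (4 * \<rho>). l <= v x}"
   using ae by (intro emeasure_mono_AE) (use sb \<rho> in \<open>auto elim!: eventually_mono\<close>)
  then have "measure lborel (ball z \<rho>) <= measure lborel {x \<in> ball z (4 * \<rho>). l <= v x}"
   by (subst (asm) (1 2) emeasure_ball_subset[of _ z "4 * \<rho>"]) (use \<rho> in auto)
  moreover have "measure lborel (ball z \<rho>) = \<nu> * (4 * \<rho>) ^ N"
   using content_ball_conv_unit_ball[of \<rho> z] \<rho> by (simp add: V_def \<nu>_def N_def power_mult_distrib)
  ultimately have "AE x in lborel. x \<in> ball z (4 * \<rho> / 2) --> \<delta>0 * l <= v x"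
   by (intro ex[OF hs]) (use z \<rho> l in \<open>auto simp: N_def\<close>)
  moreover have "\<delta> * l <= \<delta>0 * l" using l by (intro mult_right_mono) (auto simp: \<delta>_def)
  ultimately show "AE x in lborel. x \<in> ball z (2 * \<rho>) --> \<delta> * l <= v x" by (auto elim!: eventually_mono)
 qed
qed

text \<open>\<open>j + 1\<close> doublings enlarge the radius \<open>r / (32 * 2^j)\<close> to
  \<open>r / 16\<close>; 32 further applications along the segment from \<open>z\<close> to an
  arbitrary \<open>z'\<close> cover all of \<open>ball x0 r\<close>. The second number does not
  depend on \<open>j\<close>, which is decisive for the cancellation in
  \<open>harnack_shifted\<close>.\<close>

lemma (in harnack_setup) positivity_spreads:
 assumes \<delta>: "0 < \<delta>"
  and D: "\<And>z \<rho> l. z \<in> ball x0 r ==> 0 < \<rho> ==> \<rho> <= r / 16 ==> 0 < l ==> (AE x in lborel. x \<in> ball z \<rho> --> l <= v x) ==>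
   (AE x in lborel. x \<in> ball z (2 * \<rho>) --> \<delta> * l <= v x)"
  and z: "z \<in> ball x0 r" and l: "0 < l" and ae: "AE x in lborel. x \<in> ball z (r * (1/2) ^ j / 32) --> l <= v x"
 shows "AE x in lborel. x \<in> ball x0 r --> \<delta> ^ (j + 33) * l <= v x"
proof -
 have 1: "AE x in lborel. x \<in> ball z (r / 16) --> \<delta> ^ (j + 1) * l <= v x"
  using l ae
 proof (induction j arbitrary: l)
  case 0
  then show ?case using D[OF z, of "r / 32" l] r by auto
 next
  case (Suc j)
  have "r * (1/2) ^ Suc j / 32 <= r / 16"
   using r power_le_one[of "1/2::real" "Suc j"] mult_left_le[of "(1/2) ^ Suc j" r] by linarith
  then have "AE x in lborel. x \<in> ball z (2 * (r * (1/2) ^ Suc j / 32)) --> \<delta> * l <= v x"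
   using Suc.prems r by (intro D[OF z]) auto
  then have "AE x in lborel. x \<in> ball z (r / 16) --> \<delta> ^ (j + 1) * (\<delta> * l) <= v x"
   using Suc.prems \<delta> by (intro Suc.IH) auto
  then show ?case by (simp add: mult_ac)
 qed
 define L where "L = \<delta> ^ (j + 1) * l"
 have L: "L > 0" using \<delta> l by (simp add: L_def)
 have 2: "AE x in lborel. x \<in> ball z' (r / 16) --> \<delta> ^ 32 * L <= v x" if z': "z' \<in> ball x0 r" for z'
 proof -
  \<comment> \<open>Points of the ball are less than \<open>2 * r\<close> apart, so 32 equal steps
    are shorter than \<open>r / 16\<close>, and each small ball lies in the doubled preceding
    one.\<close>
  define w where "w = (%i::nat. z + (real i / 32) *\<^sub>R (z' - z))"
  have w: "w i \<in> ball x0 r" if "i <= 32" for i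
  proof -
   have "w i = (1 - real i / 32) *\<^sub>R z + (real i / 32) *\<^sub>R z'" by (simp add: w_def algebra_simps)
   then show ?thesis using convexD_alt[OF convex_ball z z', of "real i / 32"] that by simp
  qed
  have d: "dist (w i) (w (Suc i)) < r / 16" for i
  proof -
   have "w (Suc i) - w i = (real (Suc i) / 32 - real i / 32) *\<^sub>R (z' - z)" by (simp add: w_def scaleR_diff_left)
   also have "real (Suc i) / 32 - real i / 32 = 1/32" by (simp add: field_simps)
   finally have "w (Suc i) - w i = (1/32) *\<^sub>R (z' - z)" .
   then have "norm (w (Suc i) - w i) = norm (z' - z) / 32" by simp
   then have "dist (w i) (w (Suc i)) = dist z z' / 32" by (simp add: dist_norm norm_minus_commute)
   moreover have "dist z z' < 2 * r" using z z' dist_triangle2[of z z' x0] by (simp add: dist_commute)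
   ultimately show ?thesis by simp
  qed
  have "i <= 32 ==> AE x in lborel. x \<in> ball (w i) (r / 16) --> \<delta> ^ i * L <= v x" for i
  proof (induction i)
   case 0
   then show ?case using 1 by (simp add: w_def L_def)
  next
   case (Suc i)
   have "AE x in lborel. x \<in> ball (w i) (2 * (r / 16)) --> \<delta> * (\<delta> ^ i * L) <= v x"
    by (rule D) (use Suc w r \<delta> L in auto)
   then show ?case
   proof eventually_elim
    case (elim x)
    have "x \<in> ball (w i) (2 * (r / 16))" if "x \<in> ball (w (Suc i)) (r / 16)"
     using that d[of i] dist_triangle[of "w i" x "w (Suc i)"] by simp
    then show ?case using elim by (simp add: mult.assoc)
   qed
  qed
  from this[of 32] show ?thesis by (simp add: w_def)
 qed
 have "AE x in lborel. x \<in> ball x0 r --> \<delta> ^ 32 * L <= v x"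
  by (rule AE_if_locally_AE[of "r / 16"]) (use r 2 in auto)
 moreover have "\<delta> ^ 32 * L = \<delta> ^ (j + 33) * l" by (simp add: L_def power_add eval_nat_numeral)
 ultimately show ?thesis by simp
qed

lemma ennreal_le_divideI:
 assumes "a > 0" "b >= 0" "ennreal a * T <= ennreal b"
 shows "T <= ennreal (b / a)"
proof -
 have "T = ennreal (1 / a) * (ennreal a * T)" using assms(1) by (simp add: mult.assoc[symmetric] ennreal_mult[symmetric])
 also have "... <= ennreal (1 / a) * ennreal b" using assms(3) by (rule mult_left_mono) simp
 also have "... = ennreal (b / a)" using assms by (simp add: ennreal_mult[symmetric])
 finally show ?thesis .
qed

text \<open>The energy inequality for \<open>- v\<close> at height \<open>2 * S\<close> retains a
  mixed term. On the ball \<open>2 * S - v >= S\<close>, so this term is at least \<open>S\<close>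
  times the volume times the tail of the excess over \<open>2 * S\<close>, up to recentring the
  kernel. Its upper bound is of order \<open>S powr p * \<rho> powr (N - p)\<close>, and division
  gives the claim: values far away are controlled by the upper bound nearby.\<close>

lemma positive_tail:
 fixes Cd p s Ct :: real
 assumes par: "Cd > 0" "p > 1" "0 < s" "s < 1" "Ct >= 0"
 shows "\<exists>C\<ge>0. \<forall>(\<Omega>::'a::euclidean_space set) v G M x0 r \<tau>. harnack_setup Cd p s \<Omega> v G M x0 r \<tau> Ct -->
  (\<forall>z \<rho> S. z \<in> ball x0 r & 0 < \<rho> & \<rho> <= r / 4 & 0 < S & \<tau> <= S & (AE x in lborel. x \<in> ball z (2 * \<rho>) --> v x <= S) -->
   (NN y. ennreal (max (v y - 2 * S) 0 powr (p - 1) * riesz (p * s) z y) * indicator (- ball z \<rho>) y) <= ennreal (C * S powr (p - 1) * \<rho> powr (- p)))"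
proof -
 define N where "N = DIM('a)"
 define V where "V = measure lborel (ball (0::'a) 1)"
 have V: "V > 0" unfolding V_def by (intro content_ball_pos) auto
 obtain H where H: "H >= 0" and Htail: "\<And>(\<Omega>::'a set) v G M x0 r \<tau> z \<rho> l. harnack_setup Cd p s \<Omega> v G M x0 r \<tau> Ct ==> z \<in> ball x0 r ==> 0 < \<rho> ==> \<rho> <= r ==> 0 < l ==> \<tau> <= l ==>
   (NN y. ennreal (max (l - v y) 0 powr (p - 1) * riesz (p * s) z y) * indicator (- ball z (\<rho> / 2)) y) <= ennreal (H * l powr (p - 1) * \<rho> powr (- p))"
  using neg_tail[OF par(2-5), where 'a='a and Cd=Cd] by - (elim exE conjE, rule that, assumption, simp)
 \<comment> \<open>The recentring factor: \<open>dist x y <= 2 * dist z y\<close> for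
   \<open>x\<close> inside and \<open>y\<close> outside the ball, raised to the exponent of the
   kernel.\<close>
 define c2 where "c2 = 2 powr (- (real N + p * s))"
 have c2: "c2 > 0" by (simp add: c2_def)
 define E where "E = Cd * (1 + H) * 2 powr (real N + p) * 2 powr p * (V * 2 ^ N)"
 have E: "E > 0" using par H V by (simp add: E_def)
 define C where "C = E / (c2 * V)"
 have C: "C >= 0" using E c2 V by (simp add: C_def)
 show ?thesis
 proof (intro exI[of _ C] conjI C allI impI, elim conjE)
  fix \<Omega> :: "'a set" and v G M x0 r \<tau> z \<rho> S
  assume hs: "harnack_setup Cd p s \<Omega> v G M x0 r \<tau> Ct" and z: "z \<in> ball x0 r" and \<rho>: "0 < \<rho>" "\<rho> <= r / 4" and S: "0 < S" "\<tau> <= S"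
   and ae: "AE x in lborel. x \<in> ball z (2 * \<rho>) --> v x <= S"
  interpret harnack_setup Cd p s \<Omega> v G M x0 r \<tau> Ct by (rule hs)
  have \<rho>r: "\<rho> <= r" "2 * \<rho> <= r" "4 * \<rho> <= r" using \<rho> r by auto
  define T where "T = (NN y. ennreal (max (v y - 2 * S) 0 powr (p - 1) * riesz (p * s) z y) * indicator (- ball z \<rho>) y)"
  define J where "J = (NN x. NN y. ennreal (indicator (ball z \<rho>) x * (max ((-1) * v x - (- 2 * S)) 0 * max ((- 2 * S) - (-1) * v y) 0 powr (p - 1) * riesz (p * s) x y)))"
  have "J <= ennreal (Cd * (1 + H) * (2 * \<rho> / (2 * \<rho> - \<rho>)) powr (real DIM('a) + p) * (2 * \<rho>) powr (- p) * (2 * S) powr p * measure lborel {x \<in> ball z (2 * \<rho>). (-1) * v x > - 2 * S})"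
   unfolding J_def
  proof (rule order_trans[OF _ energy[of \<rho> "2 * \<rho>" z "-1" "2 * S" H "- 2 * S"]])
   show "AE x in lborel. x \<in> ball z (2 * \<rho>) --> (-1) * v x <= - 2 * S + 2 * S"
    using above_ball[OF z \<rho>r(2)] by eventually_elim (use \<tau> in auto)
   have "(NN y. ennreal (max ((-1) * v y - - 2 * S) 0 powr (p - 1) * riesz (p * s) z y) * indicator (- ball z (2 * \<rho>)) y) <= ennreal (H * (2 * S) powr (p - 1) * (4 * \<rho>) powr (- p))"
    using Htail[OF hs z, of "4 * \<rho>" "2 * S"] \<rho> \<rho>r S by simp
   also have "... <= ennreal (H * (2 * S) powr (p - 1) * (2 * \<rho>) powr (- p))"
    using H \<rho> par by (intro ennreal_leI mult_left_mono powr_mono2') auto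
   finally show "(NN y. ennreal (max ((-1) * v y - - 2 * S) 0 powr (p - 1) * riesz (p * s) z y) * indicator (- ball z (2 * \<rho>)) y) <= ennreal (H * (2 * S) powr (p - 1) * (2 * \<rho>) powr (- p))" .
  qed (use \<rho> \<rho>r r S H cball_in_Omega[OF z \<rho>r(2)] in auto)
  also have "... <= ennreal (E * S powr p * \<rho> powr (- p) * \<rho> ^ N)"
  proof (rule ennreal_leI)
   have m: "{x \<in> ball z (2 * \<rho>). (-1) * v x > - 2 * S} \<in> sets borel" by (rule level_set_borel)
   have "measure lborel {x \<in> ball z (2 * \<rho>). (-1) * v x > - 2 * S} <= measure lborel (ball z (2 * \<rho>))"
    by (rule measure_mono_fmeasurable) (use m emeasure_ball_subset[of "ball z (2 * \<rho>)" z "2 * \<rho>"] in \<open>auto simp: fmeasurable_def\<close>)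
   also have "... = V * 2 ^ N * \<rho> ^ N"
    using content_ball_conv_unit_ball[of "2 * \<rho>" z] \<rho> by (simp add: V_def N_def power_mult_distrib mult_ac)
   finally have 1: "measure lborel {x \<in> ball z (2 * \<rho>). (-1) * v x > - 2 * S} <= V * 2 ^ N * \<rho> ^ N" .
   have 2: "(2 * \<rho>) powr (- p) <= \<rho> powr (- p)" using \<rho> par by (intro powr_mono2') auto
   have 3: "2 * \<rho> / (2 * \<rho> - \<rho>) = 2" using \<rho> by simp
   have "Cd * (1 + H) * 2 powr (real N + p) * (2 * \<rho>) powr (- p) * (2 * S) powr p * measure lborel {x \<in> ball z (2 * \<rho>). (-1) * v x > - 2 * S} <=
    Cd * (1 + H) * 2 powr (real N + p) * \<rho> powr (- p) * (2 * S) powr p * (V * 2 ^ N * \<rho> ^ N)"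
    using 1 2 par H by (intro mult_mono mult_left_mono mult_right_mono) auto
   also have "... = E * S powr p * \<rho> powr (- p) * \<rho> ^ N" using S by (simp add: E_def powr_mult mult_ac)
   finally show "Cd * (1 + H) * (2 * \<rho> / (2 * \<rho> - \<rho>)) powr (real DIM('a) + p) * (2 * \<rho>) powr (- p) * (2 * S) powr p * measure lborel {x \<in> ball z (2 * \<rho>). (-1) * v x > - 2 * S} <= E * S powr p * \<rho> powr (- p) * \<rho> ^ N"
    unfolding 3 by (simp add: N_def)
  qed
  finally have up: "J <= ennreal (E * S powr p * \<rho> powr (- p) * \<rho> ^ N)" .
  have "ennreal (S * c2 * (V * \<rho> ^ N)) * T = (NN x. (ennreal (S * c2) * T) * indicator (ball z \<rho>) x)"
  proof -
   have "(NN x. (ennreal (S * c2) * T) * indicator (ball z \<rho>) x) = (ennreal (S * c2) * T) * emeasure lborel (ball z \<rho>)"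
    by (rule nn_integral_cmult_indicator) simp
   also have "emeasure lborel (ball z \<rho>) = ennreal (V * \<rho> ^ N)"
    using content_ball_conv_unit_ball[of \<rho> z] \<rho> by (subst emeasure_ball_subset[of _ z \<rho>]) (auto simp: V_def N_def mult.commute)
   finally show ?thesis using S c2 V \<rho> by (simp add: ennreal_mult mult_ac)
  qed
  also have "... <= J"
   unfolding J_def
  proof (rule nn_integral_mono_AE)
   show "AE x in lborel. (ennreal (S * c2) * T) * indicator (ball z \<rho>) x <= (NN y. ennreal (indicator (ball z \<rho>) x * (max ((-1) * v x - (- 2 * S)) 0 * max ((- 2 * S) - (-1) * v y) 0 powr (p - 1) * riesz (p * s) x y)))"
    using ae
   proof eventually_elim
    case (elim x)
    show ?case
    proof (cases "x \<in> ball z \<rho>")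
     case True
     then have vx: "S <= max ((-1) * v x - (- 2 * S)) 0" using elim \<rho> by auto
     have "ennreal (S * c2) * T = (NN y. ennreal (S * c2) * (ennreal (max (v y - 2 * S) 0 powr (p - 1) * riesz (p * s) z y) * indicator (- ball z \<rho>) y))"
      unfolding T_def by (rule nn_integral_cmult[symmetric]) measurable
     also have "... <= (NN y. ennreal (indicator (ball z \<rho>) x * (max ((-1) * v x - (- 2 * S)) 0 * max ((- 2 * S) - (-1) * v y) 0 powr (p - 1) * riesz (p * s) x y)))"
     proof (rule nn_integral_mono)
      fix y
      show "ennreal (S * c2) * (ennreal (max (v y - 2 * S) 0 powr (p - 1) * riesz (p * s) z y) * indicator (- ball z \<rho>) y) <= ennreal (indicator (ball z \<rho>) x * (max ((-1) * v x - (- 2 * S)) 0 * max ((- 2 * S) - (-1) * v y) 0 powr (p - 1) * riesz (p * s) x y))"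
      proof (cases "y \<in> ball z \<rho>")
       case False
       have "dist x y > 0" "dist x y <= 2 * dist z y" using True False dist_triangle[of x y z] by (auto simp: dist_commute)
       moreover have "0 <= real DIM('a) + p * s" using par by (intro add_nonneg_nonneg) auto
       ultimately have "c2 * riesz (p * s) z y <= riesz (p * s) x y"
        unfolding c2_def riesz_def N_def
        by (subst powr_mult[symmetric]) (auto intro!: powr_mono2')
       then have "S * (c2 * riesz (p * s) z y) <= max ((-1) * v x - (- 2 * S)) 0 * riesz (p * s) x y"
        using vx S c2 riesz_nonneg[of "p * s" z y] by (intro mult_mono) auto
       then have "(S * (c2 * riesz (p * s) z y)) * max (v y - 2 * S) 0 powr (p - 1) <= (max ((-1) * v x - (- 2 * S)) 0 * riesz (p * s) x y) * max (v y - 2 * S) 0 powr (p - 1)"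
        by (rule mult_right_mono) simp
       then have "ennreal (S * c2 * (max (v y - 2 * S) 0 powr (p - 1) * riesz (p * s) z y)) <= ennreal (max ((-1) * v x - (- 2 * S)) 0 * max ((- 2 * S) - (-1) * v y) 0 powr (p - 1) * riesz (p * s) x y)"
        by (intro ennreal_leI) (simp add: mult_ac)
       then show ?thesis using True False S c2 riesz_nonneg[of "p * s" z y] by (simp add: ennreal_mult)
      qed simp
     qed
     finally show ?thesis using True by simp
    qed simp
   qed
  qed
  finally have "ennreal (S * c2 * (V * \<rho> ^ N)) * T <= ennreal (E * S powr p * \<rho> powr (- p) * \<rho> ^ N)" using up by simp
  then have "T <= ennreal (E * S powr p * \<rho> powr (- p) * \<rho> ^ N / (S * c2 * (V * \<rho> ^ N)))"
   using S c2 V \<rho> E by (intro ennreal_le_divideI) auto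
  also have "E * S powr p * \<rho> powr (- p) * \<rho> ^ N / (S * c2 * (V * \<rho> ^ N)) = C * S powr (p - 1) * \<rho> powr (- p)"
   using S \<rho> by (simp add: C_def powr_diff field_simps)
  finally show "(NN y. ennreal (max (v y - 2 * S) 0 powr (p - 1) * riesz (p * s) z y) * indicator (- ball z \<rho>) y) <= ennreal (C * S powr (p - 1) * \<rho> powr (- p))"
   by (simp add: T_def)
 qed
qed

text \<open>The contrapositive of the De Giorgi lemma at level \<open>k = m / 4\<close> and height
  \<open>S = b * m\<close>: with \<open>a = 1 / (4 * b)\<close> its conclusion would be
  \<open>v <= m / 4 + m / 4\<close> in the half ball. The tail it requires comes from
  \<open>positive_tail\<close>, which is why an upper bound on a larger ball is assumed.\<close>

lemma sup_density:
 fixes Cd p s Ct b :: real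
 assumes par: "Cd > 0" "p > 1" "0 < s" "s < 1" "Ct >= 0" and b: "b >= 1"
 shows "\<exists>\<nu>>0. \<forall>(\<Omega>::'a::euclidean_space set) v G M x0 r \<tau>. harnack_setup Cd p s \<Omega> v G M x0 r \<tau> Ct -->
  (\<forall>z \<rho> m. z \<in> ball x0 r & 0 < \<rho> & \<rho> <= r / 4 & 0 < m & \<tau> <= m & (AE x in lborel. x \<in> ball z (2 * \<rho>) --> v x <= b * m) &
    \<not> (AE x in lborel. x \<in> ball z (\<rho> / 2) --> v x <= m / 2) -->
   \<nu> * \<rho> ^ DIM('a) <= measure lborel {x \<in> ball z \<rho>. m / 4 <= v x})"
proof -
 obtain C where C: "C >= 0" and PT: "\<And>(\<Omega>::'a set) v G M x0 r \<tau> z \<rho> S. harnack_setup Cd p s \<Omega> v G M x0 r \<tau> Ct ==>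
   z \<in> ball x0 r & 0 < \<rho> & \<rho> <= r / 4 & 0 < S & \<tau> <= S & (AE x in lborel. x \<in> ball z (2 * \<rho>) --> v x <= S) ==>
   (NN y. ennreal (max (v y - 2 * S) 0 powr (p - 1) * riesz (p * s) z y) * indicator (- ball z \<rho>) y) <= ennreal (C * S powr (p - 1) * \<rho> powr (- p))"
  using positive_tail[OF par, where 'a='a] by - (elim exE conjE, rule that, assumption, simp)
 obtain Cf where Cf: "Cf > 0" and sh: "\<And>(z::'a) \<rho> c f g. 0 < \<rho> & \<rho> <= 1 & 0 <= c & f \<in> borel_measurable borel & g \<in> borel_measurable borel &
   (\<forall>y. 0 <= g y & f y <= c + g y) ==>
  (NN y. ennreal (max (f y) 0 powr (p - 1) * riesz (p * s) z y) * indicator (- ball z (\<rho> / 2)) y) <=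
  ennreal (2 powr (p - 1)) * (ennreal (Cf * c powr (p - 1) * \<rho> powr (- p)) +
   (NN y. ennreal (g y powr (p - 1) * riesz (p * s) z y) * indicator (- ball z (\<rho> / 2)) y))"
  using tail_shift_le[OF par(2-4), where 'a='a] by auto
 \<comment> \<open>The constant \<open>2 * S\<close> and the excess over it are the two
   contributions in \<open>tail_shift_le\<close>; \<open>positive_tail\<close> is used at radius
   \<open>\<rho> / 2\<close>, whence \<open>2 powr p\<close>.\<close>
 define H where "H = 2 powr (p - 1) * (Cf * 2 powr (p - 1) + C * 2 powr p)"
 have H: "H >= 0" using Cf C by (simp add: H_def)
 have a: "0 < 1 / (4 * b)" "1 / (4 * b) <= 1" using b by auto
 obtain \<nu> where \<nu>: "\<nu> > 0" and DGL: "\<And>(\<Omega>::'a set) v G M \<sigma> z \<rho> k Mm. de_giorgi Cd p s \<Omega> v G M ==>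
   \<bar>\<sigma>\<bar> = 1 & 0 < \<rho> & \<rho> <= 1 & cball z \<rho> \<subseteq> \<Omega> & Mm > 0 &
   (AE x in lborel. x \<in> ball z \<rho> --> \<sigma> * v x <= k + Mm) &
   (NN y. ennreal (max (\<sigma> * v y - k) 0 powr (p - 1) * riesz (p * s) z y) * indicator (- ball z (\<rho> / 2)) y) <= ennreal (H * Mm powr (p - 1) * \<rho> powr (- p)) &
   measure lborel {x \<in> ball z \<rho>. k < \<sigma> * v x} <= \<nu> * \<rho> ^ DIM('a) ==>
   (AE x in lborel. x \<in> ball z (\<rho> / 2) --> \<sigma> * v x <= k + 1 / (4 * b) * Mm)"
  using de_giorgi_lemma[OF par(1,2) a H, where 'a='a and s=s] by blast
 show ?thesis
 proof (intro exI[of _ \<nu>] conjI \<nu> allI impI, elim conjE)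
  fix \<Omega> :: "'a set" and v G M x0 r \<tau> z \<rho> m
  assume hs: "harnack_setup Cd p s \<Omega> v G M x0 r \<tau> Ct" and z: "z \<in> ball x0 r" and \<rho>: "0 < \<rho>" "\<rho> <= r / 4" and m: "0 < m" "\<tau> <= m"
   and ae: "AE x in lborel. x \<in> ball z (2 * \<rho>) --> v x <= b * m" and nae: "\<not> (AE x in lborel. x \<in> ball z (\<rho> / 2) --> v x <= m / 2)"
  interpret harnack_setup Cd p s \<Omega> v G M x0 r \<tau> Ct by (rule hs)
  have dg: "de_giorgi Cd p s \<Omega> v G M" by unfold_locales
  define S where "S = b * m"
  have "1 * m <= b * m" using b m by (intro mult_right_mono) auto
  then have S: "S > 0" "m <= S" "\<tau> <= S" using m unfolding S_def by linarith+
  have aS: "AE x in lborel. x \<in> ball z \<rho> --> v x <= S" using ae by eventually_elim (use \<rho> in \<open>auto simp: S_def\<close>)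
  have tl: "(NN y. ennreal (max (v y - m / 4) 0 powr (p - 1) * riesz (p * s) z y) * indicator (- ball z (\<rho> / 2)) y) <= ennreal (H * S powr (p - 1) * \<rho> powr (- p))"
  proof -
   have "(NN y. ennreal (max (v y - m / 4) 0 powr (p - 1) * riesz (p * s) z y) * indicator (- ball z (\<rho> / 2)) y) <=
    ennreal (2 powr (p - 1)) * (ennreal (Cf * (2 * S) powr (p - 1) * \<rho> powr (- p)) +
    (NN y. ennreal (max (v y - 2 * S) 0 powr (p - 1) * riesz (p * s) z y) * indicator (- ball z (\<rho> / 2)) y))"
    by (rule sh) (use \<rho> r S m in auto)
   also have "... <= ennreal (2 powr (p - 1)) * (ennreal (Cf * (2 * S) powr (p - 1) * \<rho> powr (- p)) + ennreal (C * S powr (p - 1) * (\<rho> / 2) powr (- p)))"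
    by (intro mult_left_mono add_left_mono PT[OF hs]) (use z \<rho> r S aS in auto)
   also have "... = ennreal (2 powr (p - 1) * (Cf * (2 * S) powr (p - 1) * \<rho> powr (- p) + C * S powr (p - 1) * (\<rho> / 2) powr (- p)))"
    using Cf C by (simp add: ennreal_mult[symmetric] ennreal_plus[symmetric] del: ennreal_plus)
   also have "2 powr (p - 1) * (Cf * (2 * S) powr (p - 1) * \<rho> powr (- p) + C * S powr (p - 1) * (\<rho> / 2) powr (- p)) = H * S powr (p - 1) * \<rho> powr (- p)"
   proof -
    have "(\<rho> / 2) powr (- p) = 2 powr p * \<rho> powr (- p)" using \<rho> by (simp add: powr_divide powr_minus field_simps)
    moreover have "(2 * S) powr (p - 1) = 2 powr (p - 1) * S powr (p - 1)" using S by (intro powr_mult)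
    ultimately show ?thesis by (simp add: H_def algebra_simps)
   qed
   finally show ?thesis .
  qed
  have big: "\<not> measure lborel {x \<in> ball z \<rho>. m / 4 < 1 * v x} <= \<nu> * \<rho> ^ DIM('a)"
  proof
   assume le: "measure lborel {x \<in> ball z \<rho>. m / 4 < 1 * v x} <= \<nu> * \<rho> ^ DIM('a)"
   have "AE x in lborel. x \<in> ball z (\<rho> / 2) --> 1 * v x <= m / 4 + 1 / (4 * b) * S"
   proof (rule DGL[OF dg], intro conjI)
    show "AE x in lborel. x \<in> ball z \<rho> --> 1 * v x <= m / 4 + S" using aS by eventually_elim (use m in auto)
   qed (use \<rho> r S le tl cball_in_Omega[OF z, of \<rho>] in auto)
   moreover have e: "m / 4 + 1 / (4 * b) * S = m / 2" using b by (simp add: S_def)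
   ultimately have "AE x in lborel. x \<in> ball z (\<rho> / 2) --> v x <= m / 2" unfolding e mult_1 by -
   then show False using nae by simp
  qed
  have "measure lborel {x \<in> ball z \<rho>. m / 4 < 1 * v x} <= measure lborel {x \<in> ball z \<rho>. m / 4 <= 1 * v x}"
  proof (rule measure_mono_fmeasurable)
   show "{x \<in> ball z \<rho>. m / 4 <= 1 * v x} \<in> fmeasurable lborel"
    unfolding fmeasurable_def by (subst mem_Collect_eq, subst emeasure_ball_subset[of _ z \<rho>]) (use level_set_borel(4)[of z \<rho> "m / 4" 1] in auto)
  qed (use level_set_borel(1)[of z \<rho> "m / 4" 1] in auto)
  then show "\<nu> * \<rho> ^ DIM('a) <= measure lborel {x \<in> ball z \<rho>. m / 4 <= v x}" using big by simp
 qed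
qed

text \<open>The dichotomy at one level \<open>m\<close> keeps essential suprema and infima out of
  the argument. For \<open>m <= \<tau>\<close> it follows from \<open>v >= \<tau>\<close>; otherwise
  all levels \<open>m * b^j\<close> exceed \<open>\<tau>\<close>, so the tail estimates apply to
  them.\<close>

lemma harnack_shifted:
 fixes Cd p s Ct :: real
 assumes par: "Cd > 0" "p > 1" "0 < s" "s < 1" "Ct >= 0"
 shows "\<exists>c\<ge>1. \<forall>(\<Omega>::'a::euclidean_space set) v G M x0 r \<tau> m. harnack_setup Cd p s \<Omega> v G M x0 r \<tau> Ct & 0 < m &
  \<not> (AE x in lborel. x \<in> ball x0 (r / 2) --> v x <= m) --> (AE x in lborel. x \<in> ball x0 r --> m <= c * v x)"
proof -
 obtain \<delta> where \<delta>: "0 < \<delta>" "\<delta> < 1" and DB: "\<And>(\<Omega>::'a set) v G M x0 r \<tau> z \<rho> l. harnack_setup Cd p s \<Omega> v G M x0 r \<tau> Ct ==>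
   z \<in> ball x0 r & 0 < \<rho> & \<rho> <= r / 16 & 0 < l & (AE x in lborel. x \<in> ball z \<rho> --> l <= v x) ==>
   (AE x in lborel. x \<in> ball z (2 * \<rho>) --> \<delta> * l <= v x)"
  using doubling[OF par, where 'a='a] by - (elim exE conjE, rule that, assumption, assumption, blast)
 \<comment> \<open>The growth factor is reciprocal to the loss per doubling, so that
   \<open>b^j * \<delta>^j = 1\<close> for whatever \<open>j\<close> the stopping argument
   returns.\<close>
 define b where "b = 1 / \<delta>"
 have b: "b >= 1" "b > 1" "b > 0" "b * \<delta> = 1" using \<delta> by (auto simp: b_def)
 obtain \<nu> where \<nu>: "\<nu> > 0" and SD: "\<And>(\<Omega>::'a set) v G M x0 r \<tau> z \<rho> m. harnack_setup Cd p s \<Omega> v G M x0 r \<tau> Ct ==>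
   z \<in> ball x0 r & 0 < \<rho> & \<rho> <= r / 4 & 0 < m & \<tau> <= m & (AE x in lborel. x \<in> ball z (2 * \<rho>) --> v x <= 2 * b * m) &
    \<not> (AE x in lborel. x \<in> ball z (\<rho> / 2) --> v x <= m / 2) ==>
   \<nu> * \<rho> ^ DIM('a) <= measure lborel {x \<in> ball z \<rho>. m / 4 <= v x}"
  using sup_density[OF par, of "2 * b", where 'a='a] b by auto
 obtain \<delta>1 where \<delta>1: "\<delta>1 > 0" and ex: "\<And>(\<Omega>::'a set) v G M x0 r \<tau> z \<rho> l. harnack_setup Cd p s \<Omega> v G M x0 r \<tau> Ct ==>
   z \<in> ball x0 r & 0 < \<rho> & \<rho> <= r / 4 & 0 < l & \<nu> * \<rho> ^ DIM('a) <= measure lborel {x \<in> ball z \<rho>. l <= v x} ==>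
   (AE x in lborel. x \<in> ball z (\<rho> / 2) --> \<delta>1 * l <= v x)"
  using expansion_of_positivity[OF par \<nu>, where 'a='a] by - (elim exE conjE, rule that, assumption, blast)
 \<comment> \<open>What is left after the cancellation: 33 spreading losses, the loss
   \<open>\<delta>1\<close> of the expansion, and the 4 from the level \<open>mj / 4\<close> at
   which the density is known.\<close>
 define c where "c = max 1 (4 / (\<delta> ^ 33 * \<delta>1))"
 have c: "c >= 1" by (simp add: c_def)
 show ?thesis
 proof (intro exI[of _ c] conjI c allI impI, elim conjE)
  fix \<Omega> :: "'a set" and v G M x0 r \<tau> m
  assume hs: "harnack_setup Cd p s \<Omega> v G M x0 r \<tau> Ct" and m: "0 < m" and nae: "\<not> (AE x in lborel. x \<in> ball x0 (r / 2) --> v x <= m)"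
  interpret harnack_setup Cd p s \<Omega> v G M x0 r \<tau> Ct by (rule hs)
  have ab: "AE x in lborel. x \<in> ball x0 r --> \<tau> <= v x" using above by eventually_elim (use r in auto)
  show "AE x in lborel. x \<in> ball x0 r --> m <= c * v x"
  proof (cases "m <= \<tau>")
   case True
   show ?thesis using ab
   proof eventually_elim
    case (elim x)
    show ?case
    proof
     assume "x \<in> ball x0 r"
     then have "m <= v x" "0 <= v x" using elim True \<tau> by auto
     then show "m <= c * v x" using mult_right_mono[OF c, of "v x"] by simp
    qed
   qed
  next
   case False
   \<comment> \<open>The increments are \<open>r / 2^j / 8\<close>, so the radii stay below
     \<open>3/4 * r\<close> and all centres remain in \<open>ball x0 r\<close>.\<close>
   define rj where "rj = (%j::nat. r / 2 + (r / 4) * (1 - (1/2) ^ j))"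
   define Q where "Q = (%j::nat. \<not> (AE x in lborel. x \<in> ball x0 (rj j) --> v x <= m * b ^ j))"
   \<comment> \<open>Boundedness of \<open>v\<close> guarantees that the growth stops; the index at
     which it stops leaves no trace in the constant.\<close>
   obtain n where n: "M < m * b ^ n"
   proof -
    obtain n where "M / m < b ^ n" using real_arch_pow[OF b(2), of "M / m"] by blast
    then have "M < m * b ^ n" using m by (simp add: field_simps)
    then show ?thesis by (rule that)
   qed
   have "v x <= m * b ^ n" for x using vM[of x] n by linarith
   then have "\<not> Q n" by (simp add: Q_def)
   moreover have "Q 0" using nae by (simp add: Q_def rj_def)
   ultimately obtain j where j: "Q j" "\<not> Q (Suc j)" using ex_least_nat_less[of "%j. \<not> Q j" n] by auto
   define t where "t = (1/2::real) ^ j"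
   have t: "0 < t" "t <= 1" by (auto simp: t_def power_le_one)
   \<comment> \<open>\<open>2 * \<rho>\<close> is exactly the gap \<open>rj (Suc j) - rj j\<close>,
     so around a point of the \<open>j\<close>-th ball the upper bound on the next ball is
     available. \<open>\<rho> / 2\<close> is the starting radius in
     \<open>positivity_spreads\<close>.\<close>
   define \<rho> where "\<rho> = r * t / 16"
   have rt: "r * t <= r" using t r by (simp add: mult_left_le)
   have \<rho>: "0 < \<rho>" "\<rho> <= r / 4" "2 * \<rho> = r * t / 8" using r t rt by (auto simp: \<rho>_def)
   have rj1: "rj (Suc j) = rj j + r * t / 8" by (simp add: rj_def t_def algebra_simps)
   have "rj j = 3 / 4 * r - r * t / 4" by (simp add: rj_def t_def algebra_simps)
   then have rjr: "rj j <= r" using r(1) mult_pos_pos[OF r(1) t(1)] by linarith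
   define mj where "mj = m * b ^ j"
   have "m * 1 <= m * b ^ j" using m b by (intro mult_left_mono one_le_power) auto
   then have mj: "mj > 0" "\<tau> <= mj" using m False unfolding mj_def by linarith+
   obtain z where z: "z \<in> ball x0 (rj j)" and nz: "\<not> (AE x in lborel. x \<in> ball z (\<rho> / 2) --> v x <= mj)"
   proof -
    have "\<exists>z\<in>ball x0 (rj j). \<not> (AE x in lborel. x \<in> ball z (\<rho> / 2) --> v x <= mj)"
    proof (rule ccontr)
     assume *: "\<not> ?thesis"
     then have loc: "AE x in lborel. x \<in> ball z (\<rho> / 2) --> v x <= mj" if "z \<in> ball x0 (rj j)" for z using that by blast
     have "\<rho> / 2 > 0" using \<rho> by simp
     then have "AE x in lborel. x \<in> ball x0 (rj j) --> v x <= mj" by (rule AE_if_locally_AE) (rule loc)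
     then show False using j(1) by (simp add: Q_def mj_def)
    qed
    then show ?thesis using that by blast
   qed
   have zr: "z \<in> ball x0 r" using z rjr by simp
   have up: "AE x in lborel. x \<in> ball z (2 * \<rho>) --> v x <= b * mj"
   proof -
    have "AE x in lborel. x \<in> ball x0 (rj (Suc j)) --> v x <= m * b ^ Suc j" using j(2) by (simp add: Q_def)
    then show ?thesis
    proof eventually_elim
     case (elim x)
     have "x \<in> ball x0 (rj (Suc j))" if "x \<in> ball z (2 * \<rho>)"
      using that z dist_triangle[of x0 x z] unfolding rj1 \<rho>(3) by simp
     then show ?case using elim by (simp add: mj_def mult_ac)
    qed
   qed
   have "\<nu> * \<rho> ^ DIM('a) <= measure lborel {x \<in> ball z \<rho>. mj / 4 <= v x}"
   proof (rule SD[OF hs], intro conjI)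
    have "b * mj <= 2 * b * mj" using b mj by simp
    then show "AE x in lborel. x \<in> ball z (2 * \<rho>) --> v x <= 2 * b * mj" using up by (auto elim!: eventually_mono)
    show "\<not> (AE x in lborel. x \<in> ball z (\<rho> / 2) --> v x <= mj / 2)"
    proof
     assume "AE x in lborel. x \<in> ball z (\<rho> / 2) --> v x <= mj / 2"
     then have "AE x in lborel. x \<in> ball z (\<rho> / 2) --> v x <= mj" by eventually_elim (use mj in auto)
     then show False using nz by simp
    qed
   qed (use zr \<rho> mj in auto)
   then have e: "AE x in lborel. x \<in> ball z (\<rho> / 2) --> \<delta>1 * (mj / 4) <= v x"
    by (intro ex[OF hs]) (use zr \<rho> mj in auto)
   have "AE x in lborel. x \<in> ball x0 r --> \<delta> ^ (j + 33) * (\<delta>1 * (mj / 4)) <= v x"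
   proof (rule positivity_spreads[OF \<delta>(1) _ zr])
    show "AE x in lborel. x \<in> ball z (r * (1/2) ^ j / 32) --> \<delta>1 * (mj / 4) <= v x" using e by (simp add: \<rho>_def t_def)
   qed (use DB[OF hs] \<delta>1 mj in auto)
   moreover have eq: "\<delta> ^ (j + 33) * (\<delta>1 * (mj / 4)) = \<delta> ^ 33 * \<delta>1 / 4 * m"
   proof -
    have "\<delta> ^ j * b ^ j = 1" using b by (simp add: power_mult_distrib[symmetric] mult.commute)
    have "\<delta> ^ (j + 33) * (\<delta>1 * (mj / 4)) = \<delta> ^ 33 * \<delta>1 / 4 * m * (\<delta> ^ j * b ^ j)" by (simp add: mj_def power_add)
    then show ?thesis using \<open>\<delta> ^ j * b ^ j = 1\<close> by simp
   qed
   ultimately have "AE x in lborel. x \<in> ball x0 r --> \<delta> ^ 33 * \<delta>1 / 4 * m <= v x" unfolding eq by -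
   then show ?thesis
   proof eventually_elim
    case (elim x)
    define d where "d = \<delta> ^ 33 * \<delta>1 / 4"
    have d: "d > 0" "1 / d <= c" using \<delta> \<delta>1 by (auto simp: d_def c_def)
    show ?case
    proof
     assume "x \<in> ball x0 r"
     then have dm: "d * m <= v x" using elim by (simp add: d_def)
     have "d * m > 0" using d m by simp
     then have v0: "v x >= 0" using dm by linarith
     have "m = 1 / d * (d * m)" using d by simp
     also have "... <= 1 / d * v x" using dm d by (intro mult_left_mono) auto
     also have "... <= c * v x" using d v0 by (intro mult_right_mono) auto
     finally show "m <= c * v x" .
    qed
   qed
  qed
 qed
qed

section \<open>Representatives of weak solutions\<close>

lemma lebesgue_measurable_AE_cong:
 fixes f g :: "'a::euclidean_space => 'b::topological_space"
 assumes ae: "AE x in lebesgue. f x = g x" and g: "g \<in> borel_measurable lebesgue"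
 shows "f \<in> borel_measurable lebesgue"
proof (rule measurableI)
 fix A :: "'b set" assume A: "A \<in> sets borel"
 obtain N where N: "N \<in> null_sets lebesgue" "{x \<in> space lebesgue. f x \<noteq> g x} \<subseteq> N"
  using ae unfolding eventually_ae_filter by blast
 have "g -` A \<inter> space lebesgue \<in> sets lebesgue" using g A by (rule measurable_sets)
 moreover have "f -` A \<inter> N \<in> sets lebesgue" by (rule completion.complete[OF _ N(1)]) auto
 moreover have "f -` A \<inter> space lebesgue = (g -` A \<inter> space lebesgue - N) \<union> (f -` A \<inter> N)" using N(2) by auto
 ultimately show "f -` A \<inter> space lebesgue \<in> sets lebesgue" using N(1) by (metis null_setsD2 sets.Diff sets.Un)
qed simp

text \<open>The exceptional set is enlarged to a Borel null set, so that its two cylinders are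
  measurable in the product; the completion is entered at the end.\<close>

lemma AE_lebesgue_pair:
 fixes P :: "'a::euclidean_space => bool"
 assumes "AE x in lebesgue. P x"
 shows "AE z in lebesgue. P (fst z) & P (snd z)"
proof -
 have psf: "pair_sigma_finite (lborel :: 'a measure) (lborel :: 'a measure)" by (intro pair_sigma_finite.intro sigma_finite_lborel)
 have "AE x in lborel. P x" using assms by (simp add: AE_completion_iff)
 then obtain N where N: "{x \<in> space lborel. \<not> P x} \<subseteq> N" "N \<in> null_sets lborel" unfolding eventually_ae_filter by auto
 have [measurable]: "N \<in> sets borel" using N(2) by auto
 have nN: "AE x in lborel. x \<notin> N" using N(2) by (rule AE_not_in)
 have "AE z in lborel \<Otimes>\<^sub>M lborel. fst z \<notin> N & snd z \<notin> N"
 proof (rule pair_sigma_finite.AE_pair_measure[OF psf])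
  show "{z \<in> space (lborel \<Otimes>\<^sub>M lborel). fst z \<notin> N & snd z \<notin> N} \<in> sets (lborel \<Otimes>\<^sub>M lborel)" by measurable
  show "AE x in lborel. AE y in lborel. fst (x, y) \<notin> N & snd (x, y) \<notin> N"
   using nN by eventually_elim (use nN in auto)
 qed
 then have "AE z in (lborel :: ('a \<times> 'a) measure). fst z \<notin> N & snd z \<notin> N" unfolding lborel_prod by -
 then show ?thesis unfolding AE_completion_iff by eventually_elim (use N(1) in auto)
qed

lemma borel_representative:
 fixes f :: "'a::euclidean_space => 'b::euclidean_space"
 assumes "f \<in> borel_measurable lebesgue"
 obtains g where "g \<in> borel_measurable borel" "AE x in lebesgue. f x = g x"
proof -
 have "\<forall>i\<in>Basis. \<exists>h\<in>borel_measurable lborel. AE x in lborel. f x \<bullet> i = h x"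
  using assms by (intro ballI completion_ex_borel_measurable_real) simp
 then obtain h where h: "\<And>i. i \<in> Basis ==> h i \<in> borel_measurable lborel" "\<And>i. i \<in> Basis ==> AE x in lborel. f x \<bullet> i = h i x" by metis
 define g where "g = (%x. \<Sum>i\<in>Basis. h i x *\<^sub>R i)"
 have "AE x in lborel. \<forall>i\<in>Basis. f x \<bullet> i = h i x" using h(2) by (intro AE_finite_allI) auto
 then have "AE x in lborel. f x = g x"
 proof eventually_elim
  case (elim x)
  have "f x = (\<Sum>i\<in>Basis. (f x \<bullet> i) *\<^sub>R i)" by (rule euclidean_representation[symmetric])
  also have "... = g x" unfolding g_def using elim by (intro sum.cong) auto
  finally show ?case .
 qed
 moreover have "g \<in> borel_measurable borel"
  unfolding g_def using h(1) by (intro borel_measurable_sum borel_measurable_scaleR) auto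
 ultimately show ?thesis by (intro that) (auto intro: AE_completion)
qed

text \<open>Approximating \<open>(u, G)\<close> by simple functions reduces the composite to
  finitely many measurable sections \<open>B x v \<zeta>\<close> glued along measurable sets;
  continuity in the last two arguments passes to the limit.\<close>

lemma caratheodory_measurable:
 fixes B :: "'a::euclidean_space => real => 'a => 'a"
 assumes \<Omega>: "open \<Omega>" and B: "\<And>v \<zeta>. (%x. B x v \<zeta>) \<in> borel_measurable (lebesgue_on \<Omega>)"
  and cont: "\<And>x. x \<in> \<Omega> ==> continuous_on UNIV (%(v, \<zeta>). B x v \<zeta>)"
  and u: "u \<in> borel_measurable lebesgue" and G: "G \<in> borel_measurable lebesgue"
 shows "(%x. indicator \<Omega> x *\<^sub>R B x (u x) (G x)) \<in> borel_measurable lebesgue"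
proof -
 have "(%x. (u x, G x)) \<in> borel_measurable lebesgue" using u G by (rule borel_measurable_Pair)
 from borel_measurable_implies_sequence_metric[OF this, of 0]
 obtain F where F: "\<And>i. simple_function lebesgue (F i)" and lim: "\<And>x. (%i. F i x) \<longlonglongrightarrow> (u x, G x)" by auto
 define b where "b = (%c x. indicator \<Omega> x *\<^sub>R B x (fst c) (snd c))"
 have b: "b c \<in> borel_measurable lebesgue" for c
  unfolding b_def using B \<Omega> by (subst borel_measurable_restrict_space_iff[symmetric]) auto
 have "(%x. b (F i x) x) \<in> borel_measurable lebesgue" for i
 proof (rule measurable_compose_countable'[where I="F i ` space lebesgue"])
  have fin: "finite (F i ` space lebesgue)" using F[of i] by (simp add: simple_function_def)
  then show "countable (F i ` space lebesgue)" by (rule countable_finite)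
  show "F i \<in> lebesgue \<rightarrow>\<^sub>M count_space (F i ` space lebesgue)"
   using F[of i] unfolding measurable_count_space_eq2[OF fin] simple_function_def by auto
 qed (rule b)
 then have "(%x. b (u x, G x) x) \<in> borel_measurable lebesgue"
 proof (rule borel_measurable_LIMSEQ_metric)
  fix x
  show "(%i. b (F i x) x) \<longlonglongrightarrow> b (u x, G x) x"
  proof (cases "x \<in> \<Omega>")
   case True
   have "(%i. (%(v, \<zeta>). B x v \<zeta>) (F i x)) \<longlonglongrightarrow> (%(v, \<zeta>). B x v \<zeta>) (u x, G x)"
    by (rule continuous_on_tendsto_compose[OF cont[OF True] lim]) auto
   then show ?thesis using True by (simp add: b_def case_prod_unfold)
  qed (simp add: b_def)
 qed
 then show ?thesis by (simp add: b_def)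
qed

lemma W1p_loc_AE_cong:
 assumes W: "W1p_loc \<Omega> p u G" and u': "u' \<in> borel_measurable lebesgue" and G': "G' \<in> borel_measurable lebesgue"
  and ae: "AE x in lebesgue. u x = u' x & G x = G' x"
 shows "W1p_loc \<Omega> p u' G'"
proof -
 have u: "u \<in> borel_measurable lebesgue" and G: "G \<in> borel_measurable lebesgue" using W by (auto simp: W1p_loc_def)
 note [measurable] = u G u' G'
 have gr: "grad \<phi> \<in> borel_measurable lebesgue" "\<phi> \<in> borel_measurable lebesgue" if "test_fun \<Omega> \<phi>" for \<phi>
  using that smooth_measurable smooth_grad_measurable by (auto simp: test_fun_def intro!: measurable_completion)
 show ?thesis
  unfolding W1p_loc_def
 proof (intro conjI allI impI ballI u' G')
  fix K assume K: "compact K & K \<subseteq> \<Omega>"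
  then have [measurable]: "K \<in> sets lebesgue" using lmeasurable_compact fmeasurableD by blast
  have si: "set_integrable lebesgue K (%x. \<bar>u x\<bar> powr p)" "set_integrable lebesgue K (%x. norm (G x) powr p)"
   using W K by (auto simp: W1p_loc_def)
  have "AE x in lebesgue. indicator K x *\<^sub>R \<bar>u x\<bar> powr p = indicator K x *\<^sub>R \<bar>u' x\<bar> powr p" using ae by eventually_elim simp
  with si(1) show "set_integrable lebesgue K (%x. \<bar>u' x\<bar> powr p)"
   unfolding set_integrable_def by (elim integrable_cong_AE_imp) measurable
  have "AE x in lebesgue. indicator K x *\<^sub>R norm (G x) powr p = indicator K x *\<^sub>R norm (G' x) powr p" using ae by eventually_elim simp
  with si(2) show "set_integrable lebesgue K (%x. norm (G' x) powr p)"
   unfolding set_integrable_def by (elim integrable_cong_AE_imp) measurable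
 next
  fix \<phi> i assume \<phi>: "test_fun \<Omega> \<phi>" and i: "i \<in> (Basis :: 'a set)"
  note [measurable] = gr[OF \<phi>]
  have "(\<integral>x. u' x * (grad \<phi> x \<bullet> i) \<partial>lebesgue) = (\<integral>x. u x * (grad \<phi> x \<bullet> i) \<partial>lebesgue)"
   by (rule integral_cong_AE) (use ae in \<open>auto elim!: eventually_mono\<close>)
  also have "... = - (\<integral>x. (G x \<bullet> i) * \<phi> x \<partial>lebesgue)" using W \<phi> i by (auto simp: W1p_loc_def)
  also have "(\<integral>x. (G x \<bullet> i) * \<phi> x \<partial>lebesgue) = (\<integral>x. (G' x \<bullet> i) * \<phi> x \<partial>lebesgue)"
  proof (rule integral_cong_AE)
   show "AE x in lebesgue. G x \<bullet> i * \<phi> x = G' x \<bullet> i * \<phi> x" using ae by eventually_elim simp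
  qed auto
  finally show "(\<integral>x. u' x * (grad \<phi> x \<bullet> i) \<partial>lebesgue) = - (\<integral>x. (G' x \<bullet> i) * \<phi> x \<partial>lebesgue)" .
 qed
qed

text \<open>The Borel representative is clipped to the interval from \<open>- M\<close> to
  \<open>M\<close>, so that the bound holds everywhere while \<open>u\<close> changes on a null set
  only. It remains to see that neither integral of the weak equation notices the change.\<close>

lemma weak_solution_representative:
 fixes B :: "'a::euclidean_space => real => 'a => 'a"
 assumes par: "1 < p" "0 < s" "s < 1" "\<Lambda> >= 1" "C1 > 0" "C2 > 0" and \<Omega>: "open \<Omega>"
  and B: "\<And>v \<zeta>. (%x. B x v \<zeta>) \<in> borel_measurable (lebesgue_on \<Omega>)"
  and cont: "\<And>x. x \<in> \<Omega> ==> continuous_on UNIV (%(v, \<zeta>). B x v \<zeta>)"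
  and struct: "AE x in lebesgue. x \<in> \<Omega> --> (\<forall>v \<zeta>. B x v \<zeta> \<bullet> \<zeta> >= C1 * norm \<zeta> powr p & norm (B x v \<zeta>) <= C2 * norm \<zeta> powr (p - 1))"
  and Km: "(%(x, y). K x y) \<in> borel_measurable lebesgue"
  and Kb: "\<And>x y. x \<noteq> y ==> inverse \<Lambda> / dist x y powr (real DIM('a) + p * s) <= K x y & K x y <= \<Lambda> / dist x y powr (real DIM('a) + p * s)"
  and ws: "weak_solution \<Omega> p B K u"
 obtains M u' G where "mixed_solution \<Omega> p s \<Lambda> C1 C2 M B K u' G" "AE x in lebesgue. u x = u' x"
proof -
 obtain M0 G0 where u: "u \<in> borel_measurable lebesgue" and M0: "AE x in lebesgue. \<bar>u x\<bar> <= M0" and W: "W1p_loc \<Omega> p u G0"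
  and weq: "\<And>\<Omega>' \<phi> \<Phi>. cc_subset \<Omega>' \<Omega> ==> W01p \<Omega>' p \<phi> \<Phi> ==>
      (LINT x:\<Omega>'|lebesgue. B x (u x) (G0 x) \<bullet> \<Phi> x) +
      (\<integral>z. (case z of (x, y) => \<bar>u x - u y\<bar> powr (p - 2) * (u x - u y) * (\<phi> x - \<phi> y) * K x y) \<partial>lebesgue) = 0"
  using ws unfolding weak_solution_def by blast
 have G0: "G0 \<in> borel_measurable lebesgue" using W by (simp add: W1p_loc_def)
 obtain w where w[measurable]: "w \<in> borel_measurable borel" and uw: "AE x in lebesgue. u x = w x" using borel_representative[OF u] .
 obtain G where G[measurable]: "G \<in> borel_measurable borel" and GG: "AE x in lebesgue. G0 x = G x" using borel_representative[OF G0] .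
 define M where "M = \<bar>M0\<bar>"
 define u' where "u' = (%x. max (- M) (min M (w x)))"
 have u'm: "u' \<in> borel_measurable borel" unfolding u'_def by measurable
 have u'l: "u' \<in> borel_measurable lebesgue" and Gl: "G \<in> borel_measurable lebesgue" using u'm G by (auto intro!: measurable_completion)
 have uu': "AE x in lebesgue. u x = u' x" using uw M0 by eventually_elim (auto simp: u'_def M_def)
 have ae: "AE x in lebesgue. u x = u' x & G0 x = G x" using uu' GG by eventually_elim simp
 have "mixed_solution \<Omega> p s \<Lambda> C1 C2 M B K u' G"
 proof
  show "\<bar>u' x\<bar> <= M" for x by (auto simp: u'_def M_def)
  show "W1p_loc \<Omega> p u' G" by (rule W1p_loc_AE_cong[OF W u'l Gl ae])
  show "(%x. indicator \<Omega> x *\<^sub>R B x (u' x) (G x)) \<in> borel_measurable lebesgue" by (rule caratheodory_measurable[OF \<Omega> B cont u'l Gl])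
  show "AE x in lebesgue. x \<in> \<Omega> --> C1 * norm (G x) powr p <= B x (u' x) (G x) \<bullet> G x & norm (B x (u' x) (G x)) <= C2 * norm (G x) powr (p - 1)"
   using struct by eventually_elim auto
  show "inverse \<Lambda> * riesz (p * s) x y <= K x y & K x y <= \<Lambda> * riesz (p * s) x y" if "x \<noteq> y" for x y
   using Kb[OF that] by (simp only: riesz_def powr_minus_divide) simp
  fix \<Omega>' \<phi> \<Phi> assume cc: "cc_subset \<Omega>' \<Omega>" and ph: "W01p \<Omega>' p \<phi> \<Phi>"
  have \<phi>: "\<phi> \<in> borel_measurable lebesgue" and \<Phi>: "\<Phi> \<in> borel_measurable lebesgue" using ph by (auto simp: W01p_def)
  have \<Omega>': "\<Omega>' \<subseteq> \<Omega>" "\<Omega>' \<in> sets lebesgue" using cc closure_subset by (auto simp: cc_subset_def)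
  have e: "indicator \<Omega>' x *\<^sub>R (B x (f x) (g x) \<bullet> \<Phi> x) = indicator \<Omega>' x * ((indicator \<Omega> x *\<^sub>R B x (f x) (g x)) \<bullet> \<Phi> x)" for f g x
   using \<Omega>'(1) by (auto split: split_indicator)
  have "(LINT x:\<Omega>'|lebesgue. B x (u' x) (G x) \<bullet> \<Phi> x) = (LINT x:\<Omega>'|lebesgue. B x (u x) (G0 x) \<bullet> \<Phi> x)"
   unfolding set_lebesgue_integral_def e
  proof (rule integral_cong_AE)
   note [measurable] = caratheodory_measurable[OF \<Omega> B cont u'l Gl] caratheodory_measurable[OF \<Omega> B cont u G0] \<Omega>'(2) \<Phi>
   show "(%x. indicator \<Omega>' x * (indicator \<Omega> x *\<^sub>R B x (u' x) (G x) \<bullet> \<Phi> x)) \<in> borel_measurable lebesgue" by measurable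
   show "(%x. indicator \<Omega>' x * (indicator \<Omega> x *\<^sub>R B x (u x) (G0 x) \<bullet> \<Phi> x)) \<in> borel_measurable lebesgue" by measurable
   show "AE x in lebesgue. indicator \<Omega>' x * (indicator \<Omega> x *\<^sub>R B x (u' x) (G x) \<bullet> \<Phi> x) = indicator \<Omega>' x * (indicator \<Omega> x *\<^sub>R B x (u x) (G0 x) \<bullet> \<Phi> x)"
    using ae by eventually_elim simp
  qed
  moreover have "(\<integral>z. (case z of (x, y) => \<bar>u' x - u' y\<bar> powr (p - 2) * (u' x - u' y) * (\<phi> x - \<phi> y) * K x y) \<partial>lebesgue) =
   (\<integral>z. (case z of (x, y) => \<bar>u x - u y\<bar> powr (p - 2) * (u x - u y) * (\<phi> x - \<phi> y) * K x y) \<partial>lebesgue)"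
  proof (rule integral_cong_AE)
   \<comment> \<open>A test function is merely Lebesgue measurable, which does not directly give
     joint measurability of \<open>\<phi> x - \<phi> y\<close>. A Borel representative
     \<open>\<psi>\<close> does, and the two integrands agree off a null set of pairs.\<close>
   obtain \<psi> where \<psi>[measurable]: "\<psi> \<in> borel_measurable borel" and \<phi>\<psi>: "AE x in lebesgue. \<phi> x = \<psi> x" using borel_representative[OF \<phi>] .
   note [measurable] = u'm
   have "(%(x, y). \<bar>u' x - u' y\<bar> powr (p - 2) * (u' x - u' y) * (\<psi> x - \<psi> y)) \<in> borel_measurable (borel \<Otimes>\<^sub>M borel)" by measurable
   then have "(%(x, y). \<bar>u' x - u' y\<bar> powr (p - 2) * (u' x - u' y) * (\<psi> x - \<psi> y)) \<in> borel_measurable lebesgue"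
    by (intro measurable_completion) (simp add: borel_prod)
   from borel_measurable_times[OF this Km]
   have base: "(%z. case z of (x, y) => \<bar>u' x - u' y\<bar> powr (p - 2) * (u' x - u' y) * (\<psi> x - \<psi> y) * K x y) \<in> borel_measurable lebesgue"
    by (simp add: case_prod_unfold)
   show m1: "(%z. case z of (x, y) => \<bar>u' x - u' y\<bar> powr (p - 2) * (u' x - u' y) * (\<phi> x - \<phi> y) * K x y) \<in> borel_measurable lebesgue"
   proof (rule lebesgue_measurable_AE_cong[OF _ base])
    show "AE z in lebesgue. (case z of (x, y) => \<bar>u' x - u' y\<bar> powr (p - 2) * (u' x - u' y) * (\<phi> x - \<phi> y) * K x y) =
     (case z of (x, y) => \<bar>u' x - u' y\<bar> powr (p - 2) * (u' x - u' y) * (\<psi> x - \<psi> y) * K x y)"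
     using AE_lebesgue_pair[OF \<phi>\<psi>] by eventually_elim (simp add: case_prod_unfold)
   qed
   show ae2: "AE z in lebesgue. (case z of (x, y) => \<bar>u' x - u' y\<bar> powr (p - 2) * (u' x - u' y) * (\<phi> x - \<phi> y) * K x y) =
     (case z of (x, y) => \<bar>u x - u y\<bar> powr (p - 2) * (u x - u y) * (\<phi> x - \<phi> y) * K x y)"
    using AE_lebesgue_pair[OF uu'] by eventually_elim (simp add: case_prod_unfold)
   show "(%z. case z of (x, y) => \<bar>u x - u y\<bar> powr (p - 2) * (u x - u y) * (\<phi> x - \<phi> y) * K x y) \<in> borel_measurable lebesgue"
    by (rule lebesgue_measurable_AE_cong[OF _ m1]) (use ae2 in \<open>simp add: eq_commute\<close>)
  qed
  ultimately show "(LINT x:\<Omega>'|lebesgue. B x (u' x) (G x) \<bullet> \<Phi> x) +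
      (\<integral>z. (case z of (x, y) => \<bar>u' x - u' y\<bar> powr (p - 2) * (u' x - u' y) * (\<phi> x - \<phi> y) * K x y) \<partial>lebesgue) = 0"
   using weq[OF cc ph] by simp
 qed (use par \<Omega> u'm G Km in auto)
 then show ?thesis using uu' by (rule that)
qed

text \<open>Adding \<open>\<tau>\<close> to \<open>u\<close> moves every level from \<open>k\<close>
  to \<open>k - \<sigma> * \<tau>\<close> and leaves the gradient unchanged, so the Caccioppoli and
  translation estimates carry over with the same constant.\<close>

lemma mixed_solution_de_giorgi:
 fixes p s \<Lambda> C1 C2 :: real
 assumes par: "1 < p" "0 < s" "s < 1" "\<Lambda> >= 1" "C1 > 0" "C2 > 0"
 shows "\<exists>C>0. \<forall>(\<Omega>::'a::euclidean_space set) M B K u G \<tau>. mixed_solution \<Omega> p s \<Lambda> C1 C2 M B K u G --> de_giorgi C p s \<Omega> (%x. u x + \<tau>) G (M + \<bar>\<tau>\<bar>)"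
proof -
 obtain C where C: "C > 0" and cacc: "\<And>(\<Omega>::'a set) M B K u G z \<rho> \<rho>' k \<sigma> Mm H. mixed_solution \<Omega> p s \<Lambda> C1 C2 M B K u G ==>
   0 < \<rho>' & \<rho>' < \<rho> & \<rho> <= 1 & cball z \<rho> \<subseteq> \<Omega> & \<bar>\<sigma>\<bar> = 1 & Mm > 0 & H >= 0 &
   (AE x in lborel. x \<in> ball z \<rho> --> \<sigma> * u x <= k + Mm) &
   (NN y. ennreal (max (\<sigma> * u y - k) 0 powr (p - 1) * riesz (p * s) z y) * indicator (- ball z \<rho>) y) <= ennreal (H * Mm powr (p - 1) * \<rho> powr (- p)) ==>
   (NN x. ennreal (if \<sigma> * u x > k then norm (G x) powr p else 0) * indicator (ball z \<rho>') x) +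
   (NN x. NN y. ennreal (indicator (ball z \<rho>') x * (max (\<sigma> * u x - k) 0 * max (k - \<sigma> * u y) 0 powr (p - 1) * riesz (p * s) x y)))
   <= ennreal (C * (1 + H) * (\<rho> / (\<rho> - \<rho>')) powr (real DIM('a) + p) * \<rho> powr (- p) * Mm powr p * measure lborel {x \<in> ball z \<rho>. \<sigma> * u x > k})"
  using caccioppoli[OF par, where 'a='a] by - (elim exE conjE, rule that, assumption, blast)
 show ?thesis
 proof (intro exI[of _ C] conjI C allI impI)
  fix \<Omega> :: "'a set" and M B K u G \<tau>
  assume ms: "mixed_solution \<Omega> p s \<Lambda> C1 C2 M B K u G"
  interpret mixed_solution \<Omega> p s \<Lambda> C1 C2 M B K u G by (rule ms)
  have e1: "\<sigma> * (u x + \<tau>) - k = \<sigma> * u x - (k - \<sigma> * \<tau>)" "k - \<sigma> * (u x + \<tau>) = (k - \<sigma> * \<tau>) - \<sigma> * u x"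
   "(k < \<sigma> * (u x + \<tau>)) = (k - \<sigma> * \<tau> < \<sigma> * u x)" "(\<sigma> * (u x + \<tau>) <= k + l) = (\<sigma> * u x <= k - \<sigma> * \<tau> + l)"
   "\<sigma> * (u x + \<tau>) - (k + l) = \<sigma> * u x - (k - \<sigma> * \<tau> + l)" for \<sigma> x k l
   by (auto simp: algebra_simps)
  show "de_giorgi C p s \<Omega> (%x. u x + \<tau>) G (M + \<bar>\<tau>\<bar>)"
  proof
   show "\<bar>u x + \<tau>\<bar> <= M + \<bar>\<tau>\<bar>" for x using uM[of x] by linarith
   show "pnorm 1 (%x. indicator (ball z \<rho>) x * indicator (ball z \<rho>) (x + h) *
    ((max (\<sigma> * (u (x + h) + \<tau>) - k) 0 - max (\<sigma> * (u (x + h) + \<tau>) - (k + l)) 0) - (max (\<sigma> * (u x + \<tau>) - k) 0 - max (\<sigma> * (u x + \<tau>) - (k + l)) 0))) <=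
    ennreal (4 powr 1 * norm h powr 1) * pnorm 1 (%x. indicator (ball z \<rho>) x * norm ((if \<sigma> * (u x + \<tau>) > k & \<sigma> * (u x + \<tau>) <= k + l then \<sigma> else 0) *\<^sub>R G x))"
    if "\<rho> > 0" "cball z \<rho> \<subseteq> \<Omega>" "\<bar>\<sigma>\<bar> = 1" "l >= 0" for z \<rho> h k l \<sigma>
    unfolding e1(5) unfolding e1(1,3,4) by (rule truncation_translation(2)[OF p um Gm W \<Omega> that(3,1,2,4)])
  next
   fix z \<rho> \<rho>' k \<sigma> Mm H
   assume a: "0 < \<rho>'" "\<rho>' < \<rho>" "\<rho> <= 1" "cball z \<rho> \<subseteq> \<Omega>" "\<bar>\<sigma>\<bar> = 1" "Mm > 0" "H >= 0"
    "AE x in lborel. x \<in> ball z \<rho> --> \<sigma> * (u x + \<tau>) <= k + Mm"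
    "(NN y. ennreal (max (\<sigma> * (u y + \<tau>) - k) 0 powr (p - 1) * riesz (p * s) z y) * indicator (- ball z \<rho>) y) <= ennreal (H * Mm powr (p - 1) * \<rho> powr (- p))"
   show "(NN x. ennreal (if \<sigma> * (u x + \<tau>) > k then norm (G x) powr p else 0) * indicator (ball z \<rho>') x) +
    (NN x. NN y. ennreal (indicator (ball z \<rho>') x * (max (\<sigma> * (u x + \<tau>) - k) 0 * max (k - \<sigma> * (u y + \<tau>)) 0 powr (p - 1) * riesz (p * s) x y)))
    <= ennreal (C * (1 + H) * (\<rho> / (\<rho> - \<rho>')) powr (real DIM('a) + p) * \<rho> powr (- p) * Mm powr p * measure lborel {x \<in> ball z \<rho>. \<sigma> * (u x + \<tau>) > k})"
    unfolding e1(1,2,3) by (rule cacc[OF ms]) (use a[unfolded e1(1,4)] in blast)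
  qed (use par C um Gm in auto)
 qed
qed

lemma ess_sup_on_le:
 assumes S: "S \<in> sets lebesgue" and u: "u \<in> borel_measurable lebesgue" and ae: "AE x in lebesgue. x \<in> S --> u x <= t"
 shows "ess_sup_on S u <= ereal t"
 unfolding ess_sup_on_def
proof (rule esssup_I)
 show "(%x. ereal (u x)) \<in> borel_measurable (restrict_space lebesgue S)"
  using u by (intro measurable_restrict_space1 borel_measurable_ereal)
 show "AE x in restrict_space lebesgue S. ereal (u x) <= ereal t"
  using ae S by (subst AE_restrict_space_iff) auto
qed

lemma ess_inf_on_ge:
 assumes S: "S \<in> sets lebesgue" and u: "u \<in> borel_measurable lebesgue" and ae: "AE x in lebesgue. x \<in> S --> t <= u x"
 shows "ereal t <= ess_inf_on S u"
proof -
 have "ess_sup_on S (%x. - u x) <= ereal (- t)" by (rule ess_sup_on_le) (use assms in auto)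
 then have "- ereal (- t) <= - ess_sup_on S (%x. - u x)" by (subst ereal_minus_le_minus)
 then show ?thesis by (simp add: ess_sup_on_def ess_inf_on_def)
qed

text \<open>The powers are arranged to cancel: raising to \<open>p - 1\<close> turns
  \<open>(r / R) powr (p / (p - 1))\<close> into \<open>(r / R) powr p\<close> and the tail into
  \<open>R powr p\<close> times the integral, so \<open>R\<close> survives only in the domain of
  integration. Boundedness of \<open>u'\<close> makes the integral finite, hence the Bochner
  integral in \<open>tail\<close> agrees with the nonnegative one.\<close>

lemma tail_eq_nn_integral:
 fixes u u' :: "'a::euclidean_space => real" and x0 :: 'a
 assumes par: "1 < p" "0 < s" and R: "R > 0" and u'm[measurable]: "u' \<in> borel_measurable borel" and u'M: "\<And>x. \<bar>u' x\<bar> <= M"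
  and uu': "AE x in lebesgue. u x = u' x" and r: "r > 0"
 defines "\<tau> \<equiv> (r / R) powr (p / (p - 1)) * tail p s (%y. neg_part (u y)) x0 R"
 shows "ennreal (\<tau> powr (p - 1) * r powr (- p)) =
  (NN y. ennreal (max (- u' y) 0 powr (p - 1) * riesz (p * s) x0 y) * indicator (- ball x0 R) y)"
proof -
 define f where "f = (%y. indicator (- ball x0 R) y * (max (- u' y) 0 powr (p - 1) * riesz (p * s) x0 y))"
 have f0: "f y >= 0" for y by (simp add: f_def riesz_nonneg)
 have [measurable]: "f \<in> borel_measurable borel" unfolding f_def by measurable
 have fe: "ennreal (f y) = ennreal (max (- u' y) 0 powr (p - 1) * riesz (p * s) x0 y) * indicator (- ball x0 R) y" for y
  by (simp add: f_def split: split_indicator)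
 obtain Cf where Cf: "Cf > 0" "\<And>r x. r > 0 ==> (NN y. ennreal (dist x y powr (- (real DIM('a) + p * s))) * indicator (- ball (x::'a) r) y) <= ennreal (Cf * r powr (- (p * s)))"
  using radial_far_at[of "p * s", where 'a='a] par by auto
 have M: "M >= 0" using u'M[of undefined] by linarith
 have "(NN y. ennreal (f y)) <= (NN y. ennreal (M powr (p - 1)) * (ennreal (riesz (p * s) x0 y) * indicator (- ball x0 R) y))"
 proof (rule nn_integral_mono)
  fix y
  have "max (- u' y) 0 powr (p - 1) <= M powr (p - 1)" using u'M[of y] par by (intro powr_mono2) auto
  then have "max (- u' y) 0 powr (p - 1) * riesz (p * s) x0 y <= M powr (p - 1) * riesz (p * s) x0 y" by (intro mult_right_mono riesz_nonneg)
  then show "ennreal (f y) <= ennreal (M powr (p - 1)) * (ennreal (riesz (p * s) x0 y) * indicator (- ball x0 R) y)"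
   unfolding fe using riesz_nonneg[of "p * s" x0 y] by (auto split: split_indicator simp: ennreal_mult[symmetric] intro: ennreal_leI)
 qed
 also have "... = ennreal (M powr (p - 1)) * (NN y. ennreal (riesz (p * s) x0 y) * indicator (- ball x0 R) y)"
  by (rule nn_integral_cmult) measurable
 also have "... <= ennreal (M powr (p - 1)) * ennreal (Cf * R powr (- (p * s)))"
  using Cf(2)[OF R, of x0] by (intro mult_left_mono) (auto simp: riesz_def)
 also have "... < \<infinity>" by (simp add: ennreal_mult_less_top)
 finally have fin: "(NN y. ennreal (f y)) < \<infinity>" .
 have int: "integrable lborel f" by (rule integrableI_nonneg) (use f0 fin in auto)
 define I where "I = (\<integral>y. f y \<partial>lborel)"
 have I0: "I >= 0" unfolding I_def using f0 by (intro integral_nonneg_AE) auto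
 have "(LINT y:(UNIV - ball x0 R)|lebesgue. \<bar>neg_part (u y)\<bar> powr (p - 1) / dist y x0 powr (real DIM('a) + p * s)) = (\<integral>y. f y \<partial>lebesgue)"
  unfolding set_lebesgue_integral_def
 proof (rule integral_cong_AE)
  show m: "f \<in> borel_measurable lebesgue" by (intro measurable_completion) simp
  show ae: "AE y in lebesgue. indicator (UNIV - ball x0 R) y *\<^sub>R (\<bar>neg_part (u y)\<bar> powr (p - 1) / dist y x0 powr (real DIM('a) + p * s)) = f y"
   using uu'
  proof eventually_elim
   case (elim y)
   have "riesz (p * s) x0 y = 1 / dist y x0 powr (real DIM('a) + p * s)" unfolding riesz_def powr_minus_divide by (simp add: dist_commute)
   then show ?case using elim by (simp add: f_def neg_part_def Compl_eq_Diff_UNIV)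
  qed
  show "(%y. indicator (UNIV - ball x0 R) y *\<^sub>R (\<bar>neg_part (u y)\<bar> powr (p - 1) / dist y x0 powr (real DIM('a) + p * s))) \<in> borel_measurable lebesgue"
   by (rule lebesgue_measurable_AE_cong[OF ae m])
 qed
 also have "... = I" unfolding I_def by (rule integral_completion) simp
 finally have tl: "tail p s (%y. neg_part (u y)) x0 R = (R powr p * I) powr (1 / (p - 1))" by (simp add: tail_def)
 have "\<tau> powr (p - 1) * r powr (- p) = I"
 proof -
  have "\<tau> powr (p - 1) = ((r / R) powr (p / (p - 1))) powr (p - 1) * ((R powr p * I) powr (1 / (p - 1))) powr (p - 1)"
   unfolding \<tau>_def tl by (rule powr_mult)
  also have "... = (r / R) powr p * (R powr p * I)" using par I0 by (simp add: powr_powr)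
  also have "... = r powr p * I" using r R by (simp add: powr_divide)
  finally show ?thesis using r by (simp add: powr_minus)
 qed
 then have "ennreal (\<tau> powr (p - 1) * r powr (- p)) = ennreal I" by simp
 also have "... = (NN y. ennreal (f y))" unfolding I_def using int f0 by (intro nn_integral_eq_integral[symmetric]) auto
 finally show ?thesis by (simp add: fe)
qed

text \<open>If the inequality failed, a real \<open>m\<close> would lie strictly between its sides,
  and \<open>m > 0\<close> because the infimum is nonnegative by \<open>pos\<close>. The dichotomy
  at this \<open>m\<close> bounds the infimum from below by \<open>m / c - \<tau>\<close>, which
  contradicts the choice of \<open>m\<close>.\<close>

lemma ess_harnack_of_dichotomy:
 fixes u u' :: "'a::euclidean_space => real"
 assumes c: "c >= 1" and \<tau>: "\<tau> >= 0" and r: "r > 0" and u: "u \<in> borel_measurable lebesgue"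
  and uu': "AE x in lebesgue. u x = u' x" and pos: "AE x in lebesgue. x \<in> ball x0 r --> u x >= 0"
  and dich: "\<And>m. 0 < m ==> \<not> (AE x in lborel. x \<in> ball x0 (r / 2) --> u' x + \<tau> <= m) ==> (AE x in lborel. x \<in> ball x0 r --> m <= c * (u' x + \<tau>))"
 shows "ess_sup_on (ball x0 (r / 2)) u <= ereal c * ess_inf_on (ball x0 r) u + ereal (c * \<tau>)"
proof (rule ccontr)
 define I where "I = ess_inf_on (ball x0 r) u"
 assume "\<not> ?thesis"
 then have less: "ereal c * I + ereal (c * \<tau>) < ess_sup_on (ball x0 (r / 2)) u" by (simp add: I_def)
 have I0: "0 <= I" unfolding I_def using ess_inf_on_ge[OF _ u, of "ball x0 r" 0] pos by (simp add: zero_ereal_def)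
 from less obtain m where m: "ereal c * I + ereal (c * \<tau>) < ereal m" "ereal m < ess_sup_on (ball x0 (r / 2)) u"
  using ereal_dense2 by blast
 have "0 <= ereal c * I" using c I0 by (intro ereal_0_le_mult) auto
 then have "0 <= ereal c * I + ereal (c * \<tau>)" using c \<tau> by (intro add_nonneg_nonneg) auto
 then have "0 < ereal m" using m(1) by (rule le_less_trans)
 then have m0: "0 < m" by simp
 have "\<not> (AE x in lborel. x \<in> ball x0 (r / 2) --> u' x + \<tau> <= m)"
 proof
  assume "AE x in lborel. x \<in> ball x0 (r / 2) --> u' x + \<tau> <= m"
  then have "AE x in lebesgue. x \<in> ball x0 (r / 2) --> u' x + \<tau> <= m" by (rule AE_completion)
  then have "AE x in lebesgue. x \<in> ball x0 (r / 2) --> u x <= m" using uu' by eventually_elim (use \<tau> in auto)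
  then have "ess_sup_on (ball x0 (r / 2)) u <= ereal m" by (intro ess_sup_on_le u) auto
  then show False using m(2) by simp
 qed
 from AE_completion[OF dich[OF m0 this]] uu'
 have "AE x in lebesgue. x \<in> ball x0 r --> m / c - \<tau> <= u x"
 proof eventually_elim
  case (elim x)
  show ?case
  proof
   assume "x \<in> ball x0 r"
   then have "m <= c * (u x + \<tau>)" using elim by simp
   then show "m / c - \<tau> <= u x" using c by (simp add: field_simps)
  qed
 qed
 then have "ereal (m / c - \<tau>) <= I" unfolding I_def by (intro ess_inf_on_ge u) auto
 then have "ereal c * ereal (m / c - \<tau>) <= ereal c * I" using c by (intro ereal_mult_left_mono) auto
 then have "ereal c * ereal (m / c - \<tau>) + ereal (c * \<tau>) <= ereal c * I + ereal (c * \<tau>)" by (rule add_right_mono)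
 moreover have "ereal c * ereal (m / c - \<tau>) + ereal (c * \<tau>) = ereal m" using c by (simp add: right_diff_distrib)
 ultimately show False using m(1) by simp
qed

theorem mainTheorem7:
  fixes p s \<Lambda> C1 C2 :: real
  assumes "DIM('a::euclidean_space) \<ge> 2"
    and "1 < p" and "0 < s" and "s < 1" and "\<Lambda> \<ge> 1" and "C1 > 0" and "C2 > 0"
  shows "\<exists>c::real. \<forall>(\<Omega>::'a set) (B::'a \<Rightarrow> real \<Rightarrow> 'a \<Rightarrow> 'a) (K::'a \<Rightarrow> 'a \<Rightarrow> real) u x0 R r.
     smooth_bounded_domain \<Omega> \<and>
     (\<forall>v \<zeta>. (\<lambda>x. B x v \<zeta>) \<in> borel_measurable (lebesgue_on \<Omega>)) \<and>
     (\<forall>x\<in>\<Omega>. continuous_on UNIV (\<lambda>(v, \<zeta>). B x v \<zeta>)) \<and>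
     (AE x in lebesgue. x \<in> \<Omega> \<longrightarrow> (\<forall>v \<zeta>. B x v \<zeta> \<bullet> \<zeta> \<ge> C1 * norm \<zeta> powr p \<and>
                                           norm (B x v \<zeta>) \<le> C2 * norm \<zeta> powr (p - 1))) \<and>
     (\<lambda>(x, y). K x y) \<in> borel_measurable lebesgue \<and>
     (\<forall>x y. K x y = K y x) \<and>
     (\<forall>x y. x \<noteq> y \<longrightarrow> inverse \<Lambda> / dist x y powr (real DIM('a) + p * s) \<le> K x y \<and>
                         K x y \<le> \<Lambda> / dist x y powr (real DIM('a) + p * s)) \<and>
     weak_solution \<Omega> p B K u \<and>
     ball x0 R \<subseteq> \<Omega> \<and> (AE x in lebesgue. x \<in> ball x0 R \<longrightarrow> u x \<ge> 0) \<and>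
     ball x0 r \<subseteq> ball x0 (R / 2) \<and> 0 < r \<and> r \<le> 1
     \<longrightarrow> ess_sup_on (ball x0 (r / 2)) u \<le>
           ereal c * ess_inf_on (ball x0 r) u +
           ereal (c * (r / R) powr (p / (p - 1)) * tail p s (\<lambda>y. neg_part (u y)) x0 R)"
proof -
 note par = assms(2-7)
 obtain Cd where Cd: "Cd > 0" and dg: "\<And>(\<Omega>::'a set) M B K u G \<tau>. mixed_solution \<Omega> p s \<Lambda> C1 C2 M B K u G ==> de_giorgi Cd p s \<Omega> (%x. u x + \<tau>) G (M + \<bar>\<tau>\<bar>)"
  using mixed_solution_de_giorgi[OF par, where 'a='a] by blast
 \<comment> \<open>The recentring factor from \<open>x0\<close> to \<open>z\<close>:
   \<open>dist x0 z < r\<close> and \<open>dist x0 y >= R >= 2 * r\<close> give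
   \<open>dist x0 y <= 2 * dist z y\<close>.\<close>
 define Ct where "Ct = 2 powr (real DIM('a) + p * s)"
 have Ct: "Ct >= 0" by (simp add: Ct_def)
 obtain c where c: "c >= 1" and har: "\<And>(\<Omega>::'a set) v G M x0 r \<tau> m. harnack_setup Cd p s \<Omega> v G M x0 r \<tau> Ct ==> 0 < m ==>
  \<not> (AE x in lborel. x \<in> ball x0 (r / 2) --> v x <= m) ==> (AE x in lborel. x \<in> ball x0 r --> m <= c * v x)"
  using harnack_shifted[OF Cd par(1-3) Ct, where 'a='a] by - (elim exE conjE, rule that, assumption, blast)
 show ?thesis
 proof (intro exI[of _ c] allI impI, elim conjE)
  fix \<Omega> :: "'a set" and B :: "'a => real => 'a => 'a" and K :: "'a => 'a => real" and u x0 R r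
  assume dom: "smooth_bounded_domain \<Omega>" and B: "\<forall>v \<zeta>. (%x. B x v \<zeta>) \<in> borel_measurable (lebesgue_on \<Omega>)"
   and cont: "\<forall>x\<in>\<Omega>. continuous_on UNIV (%(v, \<zeta>). B x v \<zeta>)"
   and struct: "AE x in lebesgue. x \<in> \<Omega> --> (\<forall>v \<zeta>. B x v \<zeta> \<bullet> \<zeta> >= C1 * norm \<zeta> powr p & norm (B x v \<zeta>) <= C2 * norm \<zeta> powr (p - 1))"
   and Km: "(%(x, y). K x y) \<in> borel_measurable lebesgue"
   and Kb: "\<forall>x y. x \<noteq> y --> inverse \<Lambda> / dist x y powr (real DIM('a) + p * s) <= K x y & K x y <= \<Lambda> / dist x y powr (real DIM('a) + p * s)"
   and ws: "weak_solution \<Omega> p B K u" and bR: "ball x0 R \<subseteq> \<Omega>" and pos: "AE x in lebesgue. x \<in> ball x0 R --> u x >= 0"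
   and br: "ball x0 r \<subseteq> ball x0 (R / 2)" and r: "0 < r" "r <= 1"
  \<comment> \<open>For concentric balls the inclusion says \<open>2 * r <= R\<close>; this puts
    \<open>ball x0 (2 * r)\<close> into \<open>\<Omega>\<close> and into the region where
    \<open>u >= 0\<close>.\<close>
  have R: "2 * r <= R" "R > 0" using br r by (auto simp: ball_subset_ball_iff)
  have \<Omega>: "open \<Omega>" using dom by (simp add: smooth_bounded_domain_def)
  have um: "u \<in> borel_measurable lebesgue" using ws by (simp add: weak_solution_def)
  obtain M u' G where ms: "mixed_solution \<Omega> p s \<Lambda> C1 C2 M B K u' G" and uu': "AE x in lebesgue. u x = u' x"
   by (rule weak_solution_representative[OF par \<Omega> _ _ struct Km _ ws]) (use B cont Kb in auto)
  interpret ms: mixed_solution \<Omega> p s \<Lambda> C1 C2 M B K u' G by (rule ms)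
  define \<tau> where "\<tau> = (r / R) powr (p / (p - 1)) * tail p s (%y. neg_part (u y)) x0 R"
  have \<tau>: "\<tau> >= 0" by (simp add: \<tau>_def tail_def)
  have tl: "ennreal (\<tau> powr (p - 1) * r powr (- p)) = (NN y. ennreal (max (- u' y) 0 powr (p - 1) * riesz (p * s) x0 y) * indicator (- ball x0 R) y)"
   unfolding \<tau>_def by (rule tail_eq_nn_integral[OF par(1,2) R(2) ms.um ms.uM uu' r(1)])
  have posB: "AE x in lborel. x \<in> ball x0 R --> 0 <= u' x"
  proof -
   have "AE x in lebesgue. x \<in> ball x0 R --> 0 <= u' x" using pos uu' by eventually_elim auto
   then show ?thesis by (simp only: AE_completion_iff)
  qed
  have hs: "harnack_setup Cd p s \<Omega> (%x. u' x + \<tau>) G (M + \<bar>\<tau>\<bar>) x0 r \<tau> Ct"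
  proof (rule harnack_setup.intro[OF dg[OF ms]], unfold_locales)
   show "ball x0 (2 * r) \<subseteq> \<Omega>" using bR R subset_ball[of "2 * r" R x0] by blast
   show "AE x in lborel. x \<in> ball x0 (2 * r) --> \<tau> <= u' x + \<tau>" using posB by eventually_elim (use R in auto)
   fix z assume z: "z \<in> ball x0 r"
   have "(NN y. ennreal (max (- (u' y + \<tau>)) 0 powr (p - 1) * riesz (p * s) z y)) <=
    (NN y. ennreal Ct * (ennreal (max (- u' y) 0 powr (p - 1) * riesz (p * s) x0 y) * indicator (- ball x0 R) y))"
   proof (rule nn_integral_mono_AE)
    show "AE y in lborel. ennreal (max (- (u' y + \<tau>)) 0 powr (p - 1) * riesz (p * s) z y) <=
     ennreal Ct * (ennreal (max (- u' y) 0 powr (p - 1) * riesz (p * s) x0 y) * indicator (- ball x0 R) y)"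
     using posB
    proof eventually_elim
     case (elim y)
     show ?case
     proof (cases "y \<in> ball x0 R")
      case True
      \<comment> \<open>Inside \<open>ball x0 R\<close> the shifted function is nonnegative, so its
        negative tail reduces to the exterior part, where the kernel can be recentred.\<close>
      then have "max (- (u' y + \<tau>)) 0 = 0" using elim \<tau> by auto
      then show ?thesis by simp
     next
      case False
      have far: "dist x0 y <= 2 * dist z y" "dist x0 y > 0" using False z R dist_triangle[of x0 y z] by auto
      have "0 <= real DIM('a) + p * s" using par by (intro add_nonneg_nonneg) auto
      then have ex: "- (real DIM('a) + p * s) <= 0" by linarith
      have "riesz (p * s) z y <= (dist x0 y / 2) powr (- (real DIM('a) + p * s))"
       unfolding riesz_def using far ex by (intro powr_mono2') auto
      also have "... = Ct * riesz (p * s) x0 y"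
      proof -
       have "(d / 2) powr (- q) = 2 powr q * d powr (- q)" if "d > 0" for d q :: real using that by (simp add: powr_divide powr_minus field_simps)
       from this[OF far(2)] show ?thesis unfolding riesz_def Ct_def .
      qed
      finally have "riesz (p * s) z y <= Ct * riesz (p * s) x0 y" .
      moreover have "max (- (u' y + \<tau>)) 0 powr (p - 1) <= max (- u' y) 0 powr (p - 1)"
       using \<tau> par by (intro powr_mono2) auto
      ultimately have "max (- (u' y + \<tau>)) 0 powr (p - 1) * riesz (p * s) z y <= max (- u' y) 0 powr (p - 1) * (Ct * riesz (p * s) x0 y)"
       by (intro mult_mono) (auto simp: riesz_nonneg)
      then have "ennreal (max (- (u' y + \<tau>)) 0 powr (p - 1) * riesz (p * s) z y) <= ennreal (Ct * (max (- u' y) 0 powr (p - 1) * riesz (p * s) x0 y))"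
       by (intro ennreal_leI) (simp add: mult_ac)
      then show ?thesis using False Ct riesz_nonneg[of "p * s" x0 y] by (simp add: ennreal_mult)
     qed
    qed
   qed
   also have "... = ennreal Ct * ennreal (\<tau> powr (p - 1) * r powr (- p))"
    unfolding tl by (rule nn_integral_cmult) measurable
   also have "... = ennreal (Ct * \<tau> powr (p - 1) * r powr (- p))"
    using Ct by (simp add: ennreal_mult[symmetric] mult.assoc)
   finally show "(NN y. ennreal (max (- (u' y + \<tau>)) 0 powr (p - 1) * riesz (p * s) z y)) <= ennreal (Ct * \<tau> powr (p - 1) * r powr (- p))" .
  qed (use r \<tau> Ct in auto)
  have "AE x in lebesgue. x \<in> ball x0 r --> u x >= 0" using pos by eventually_elim (use R r in auto)
  then have "ess_sup_on (ball x0 (r / 2)) u <= ereal c * ess_inf_on (ball x0 r) u + ereal (c * \<tau>)"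
   by (rule ess_harnack_of_dichotomy[OF c \<tau> r(1) um uu']) (rule har[OF hs])
  then show "ess_sup_on (ball x0 (r / 2)) u <= ereal c * ess_inf_on (ball x0 r) u +
      ereal (c * (r / R) powr (p / (p - 1)) * tail p s (%y. neg_part (u y)) x0 R)"
   by (simp add: \<tau>_def mult.assoc)
 qed
qed

end
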